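(* Let $p_1,p_2,q_1,q_2,p,q\in(0,\infty]$, $\tau\in[0,1]$. Suppose $m\in\mathscr{P}(\mathbb{R}^{2d})$ is submultiplicative and $\omega_i,\mu_i\in\mathscr{P}(\mathbb{R}^d)$, $i=1,2$. For $\tau\in(0,1)$ denote $\widetilde m(\zeta_1,\zeta_2)=m((1-\tau)\zeta_1,\tau\zeta_2)$, $\widetilde{\omega_2}(z_1)=\omega_2(\tfrac{1-\tau}{\tau}z_1)$, $\widetilde{\mu_2}(z_2)=\mu_2(\tfrac{\tau}{1-\tau}z_2)$. Write $m_\alpha(z_1)=m(z_1,0)$, $m_\beta(z_2)=m(0,z_2)$, $\widetilde m_\alpha(z_1)=\widetilde m(z_1,0)$, $\widetilde m_\beta(z_2)=\widetilde m(0,z_2)$ for $z_1,z_2\in\mathbb{R}^d$. Consider the boundedness $$(\ast)\qquad W_\tau:\mathcal{M}^{p_1,q_1}_{\omega_1\otimes\mu_1}(\mathbb{R}^d)\times\mathcal{M}^{p_2,q_2}_{\omega_2\otimes\mu_2}(\mathbb{R}^d)\longrightarrow W(\mathscr{F}L^p,L^q_m)(\mathbb{R}^{2d}).$$ (1) If $\tau\in(0,1)$ and $p<\infty$, then $(\ast)$ holds if and only if $$l^{p_1/p}_{\omega_1^p}(\mathbb{Z}^d)\ast l^{p_2/p}_{\widetilde{\omega_2}^p}(\mathbb{Z}^d)\subset l^{q/p}_{\widetilde m_\alpha^p}(\mathbb{Z}^d)\quad\text{and}\quad l^{q_1/p}_{\mu_1^p}(\mathbb{Z}^d)\ast l^{q_2/p}_{\widetilde{\mu_2}^p}(\mathbb{Z}^d)\subset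 l^{q/p}_{\widetilde m_\beta^p}(\mathbb{Z}^d).$$ (2) If $\tau\in(0,1)$ and $p\ge q$, then $(\ast)$ holds if and only if $$l^{p_1}_{\omega_1}(\mathbb{Z}^d),\ l^{p_2}_{\widetilde{\omega_2}}(\mathbb{Z}^d)\subset l^q_{\widetilde m_\alpha}(\mathbb{Z}^d)\quad\text{and}\quad l^{q_1}_{\mu_1}(\mathbb{Z}^d),\ l^{q_2}_{\widetilde{\mu_2}}(\mathbb{Z}^d)\subset l^q_{\widetilde m_\beta}(\mathbb{Z}^d).$$ (3) If $\tau=0$, then $(\ast)$ holds if and only if $$l^{p_1,q_1}_{\omega_1\otimes\mu_1}(\mathbb{Z}^{2d})\subset l^{(q,p)}_{m_\alpha\otimes1}(\mathbb{Z}^{2d}),\quad l^{p_2}_{\omega_2}(\mathbb{Z}^d)\subset l^p(\mathbb{Z}^d),\quad l^{q_2}_{\mu_2}(\mathbb{Z}^d)\subset l^q_{m_\beta}(\mathbb{Z}^d).$$ (4) If $\tau=1$, then $(\ast)$ holds if and only if $$l^{p_2,q_2}_{\omega_2\otimes\mu_2}(\mathbb{Z}^{2d})\subset l^{(q,p)}_{m_\alpha\otimes1}(\mathbb{Z}^{2d}),\quad l^{p_1}_{\omega_1}(\mathbb{Z}^d)\subset l^p(\mathbb{Z}^d),\quad l^{q_1}_{\mu_1}(\mathbb{Z}^d)\subset l^q_{m_\beta}(\mathbb{Z}^d).$$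
   Context: $\tau$-Wigner distribution: for $f_1,f_2\in L^2(\mathbb{R}^d)$, $W_\tau(f_1,f_2)(x,\xi)=\int_{\mathbb{R}^d}f_1(x+\tau t)\overline{f_2(x-(1-\tau)t)}e^{-2\pi i\xi\cdot t}\,dt$. Weights: $m$ is $v$-moderate if $m(z+w)\le Cv(z)m(w)$ for all $z,w$. $\mathscr{P}(\mathbb{R}^{n})$ is the set of non-negative (measurable) functions on $\mathbb{R}^n$ that are $v$-moderate for some $v$ of polynomial growth with $v(z+w)\le v(z)v(w)$. In the theorem, "$m$ submultiplicative" means $m(z+w)\le C\,m(z)m(w)$ for all $z,w\in\mathbb{R}^{2d}$, for some constant $C$. $(\omega\otimes\mu)(z_1,z_2)=\omega(z_1)\mu(z_2)$. Function spaces: for $f\in\mathcal{S}'(\mathbb{R}^n)$ and a fixed nonzero $\phi\in\mathcal{S}(\mathbb{R}^n)$, $V_\phi f(x,\xi)=\langle f,M_\xi T_x\phi\rangle$ with $T_xg(t)=g(t-x)$, $M_\xi g(t)=e^{2\pi it\cdot\xi}g(t)$. $M^{p,q}_m(\mathbb{R}^n)$ is the set of $f\in\mathcal{S}'(\mathbb{R}^n)$ with $\|f\|_{M^{p,q}_m}=\big(\int(\int|V_\phi f(x,\xi)|^pm(x,\xi)^pdx)^{q/p}d\xi\big)^{1/q}<\infty$ (usual modification if $p$ or $q$ is $\infty$; different $\phi$ give equivalent quasi-norms). $\mathcal{M}^{p,q}_m(\mathbb{R}^n)$ is the closure of $\mathcal{S}(\mathbb{R}^n)$ in $M^{p,q}_m(\mathbb{R}^n)$.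 The Wiener amalgam space $W(\mathscr{F}L^p,L^q_m)(\mathbb{R}^{2d})=\mathscr{F}M^{p,q}_{1\otimes m}(\mathbb{R}^{2d})$ is the set of $F\in\mathcal{S}'(\mathbb{R}^{2d})$ with $\|F\|=\|\mathscr{F}^{-1}F\|_{M^{p,q}_{1\otimes m}}$, i.e. (up to equivalence) $\big(\int_{\mathbb{R}^{2d}}(\int_{\mathbb{R}^{2d}}|V_\Phi F(\zeta,-z)|^pdz)^{q/p}m(\zeta)^qd\zeta\big)^{1/q}<\infty$ for a nonzero $\Phi\in\mathcal{S}(\mathbb{R}^{2d})$, where $(1\otimes m)(z,\zeta)=m(\zeta)$. Boundedness notation: $W_\tau:\mathcal{M}^{p_1,q_1}_{m_1}\times\mathcal{M}^{p_2,q_2}_{m_2}\to X$ means there is $C>0$ with $\|W_\tau(f_1,f_2)\|_X\le C\|f_1\|_{M^{p_1,q_1}_{m_1}}\|f_2\|_{M^{p_2,q_2}_{m_2}}$ for all $f_1,f_2\in\mathcal{S}(\mathbb{R}^d)$. Discrete spaces (usual modifications for infinite exponents): $\|\vec b\|_{l^p_\omega(\mathbb{Z}^d)}=(\sum_k|b_k|^p\omega(k)^p)^{1/p}$; $\|\vec a\|_{l^{p,q}_m(\mathbb{Z}^{2d})}=\big(\sum_{n\in\mathbb{Z}^d}(\sum_{k\in\mathbb{Z}^d}|a_{k,n}|^pm(k,n)^p)^{q/p}\big)^{1/q}$; $\|\vec a\|_{l^{(p,q)}_m(\mathbb{Z}^{2d})}=\big(\sum_{k\in\mathbb{Z}^d}(\sum_{n\in\mathbb{Z}^d}|a_{k,n}|^qm(k,n)^q)^{p/q}\big)^{1/p}$.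 $X\subset Z$ means $\|\vec a\|_Z\le C\|\vec a\|_X$ for all $\vec a\in X$; $X\ast Y\subset Z$ means $\|\vec a\ast\vec b\|_Z\le C\|\vec a\|_X\|\vec b\|_Y$ for all $\vec a\in X,\vec b\in Y$, with $(\vec a\ast\vec b)_n=\sum_ka_kb_{n-k}$ (the series converging absolutely). "$X,Y\subset Z$" means $X\subset Z$ and $Y\subset Z$.
   Formalization: The weight m is assumed not to be identically zero; for m = 0 the boundedness (∗) is trivial while, for example, the condition l^{p_2}_{ω_2} ⊂ l^p in part (3) can fail. *)

theory Defs
  imports "HOL-Analysis.Analysis" "HOL-Probability.Essential_Supremum"
begin

text \<open>
  Exponents in \<open>(0, \<infinity>]\<close> are elements of \<^typ>\<open>ennreal\<close>. All quasi-norms take values in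
  \<^typ>\<open>ennreal\<close>, and a space is the set of objects whose quasi-norm is finite.
  \<open>\<real>\<^sup>d\<close> is \<open>real^'d\<close>, \<open>\<real>\<^sup>2\<^sup>d\<close> is \<open>(real^'d) \<times> (real^'d)\<close>, \<open>\<int>\<^sup>d\<close> is \<open>int^'d\<close>.
\<close>


subsection \<open>Lebesgue and mixed quasi-norms\<close>

text \<open>Only used for exponents \<open>r > 0\<close>.\<close>

definition epowr :: "ennreal \<Rightarrow> real \<Rightarrow> ennreal" where
  "epowr x r = (if x = \<infinity> then \<infinity> else ennreal (enn2real x powr r))"

definition Lp_norm :: "ennreal \<Rightarrow> 'a measure \<Rightarrow> ('a \<Rightarrow> ennreal) \<Rightarrow> ennreal" where
  "Lp_norm p M f =
     (if p = \<infinity> then esssup M f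
      else epowr (\<integral>\<^sup>+ x. epowr (f x) (enn2real p) \<partial>M) (1 / enn2real p))"

text \<open>The inner exponent \<open>p\<close> belongs to the first variable, the outer exponent \<open>q\<close> to the second.\<close>

definition mixed_norm ::
  "ennreal \<Rightarrow> ennreal \<Rightarrow> 'a measure \<Rightarrow> 'b measure \<Rightarrow> ('a \<Rightarrow> 'b \<Rightarrow> ennreal) \<Rightarrow> ennreal" where
  "mixed_norm p q M N f = Lp_norm q N (\<lambda>y. Lp_norm p M (\<lambda>x. f x y))"


subsection \<open>Schwartz functions and tempered distributions\<close>

text \<open>Iterated partial derivatives along the basis vectors in a list.\<close>

primrec partials :: "'a::euclidean_space list \<Rightarrow> ('a \<Rightarrow> complex) \<Rightarrow> 'a \<Rightarrow> complex" where
  "partials [] f = f"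
| "partials (b # bs) f = (\<lambda>x. frechet_derivative (partials bs f) (at x) b)"

definition schwartz_seminorm :: "nat \<Rightarrow> ('a::euclidean_space \<Rightarrow> complex) \<Rightarrow> ennreal" where
  "schwartz_seminorm n f =
     (SUP bs\<in>{bs. set bs \<subseteq> Basis \<and> length bs \<le> n}.
        SUP x. ennreal ((1 + norm x) ^ n * norm (partials bs f x)))"

text \<open>A function is smooth iff all its iterated partial derivatives are differentiable.\<close>

definition schwartz :: "('a::euclidean_space \<Rightarrow> complex) set" where
  "schwartz = {f. (\<forall>bs x. set bs \<subseteq> Basis \<longrightarrow> partials bs f differentiable (at x)) \<and>
                  (\<forall>n. schwartz_seminorm n f < \<infinity>)}"

text \<open>
  A tempered distribution is a functional whose values off \<^const>\<open>schwartz\<close> are irrelevant;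
  it acts bilinearly, so that a function \<open>f\<close> acts by \<open>g \<mapsto> \<integral> f g\<close>.
\<close>

definition tempered :: "(('a::euclidean_space \<Rightarrow> complex) \<Rightarrow> complex) set" where
  "tempered = {u.
     (\<forall>g\<in>schwartz. \<forall>h\<in>schwartz. u (\<lambda>x. g x + h x) = u g + u h) \<and>
     (\<forall>c. \<forall>g\<in>schwartz. u (\<lambda>x. c * g x) = c * u g) \<and>
     (\<exists>n C. \<forall>g\<in>schwartz. ennreal (norm (u g)) \<le> ennreal C * schwartz_seminorm n g)}"

definition regular_distr :: "('a::euclidean_space \<Rightarrow> complex) \<Rightarrow> ('a \<Rightarrow> complex) \<Rightarrow> complex" where
  "regular_distr f g = (LINT x|lebesgue. f x * g x)"

text \<open>The sesquilinear pairing \<open>\<langle>u, g\<rangle>\<close>, which extends the \<open>L\<^sup>2\<close> inner product \<open>\<integral> f \<cdot> cnj g\<close>.\<close>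

definition pairing :: "(('a \<Rightarrow> complex) \<Rightarrow> complex) \<Rightarrow> ('a \<Rightarrow> complex) \<Rightarrow> complex" where
  "pairing u g = u (\<lambda>x. cnj (g x))"

definition inverse_fourier :: "('a::euclidean_space \<Rightarrow> complex) \<Rightarrow> 'a \<Rightarrow> complex" where
  "inverse_fourier g x = (LINT \<xi>|lebesgue. g \<xi> * cis (2 * pi * (x \<bullet> \<xi>)))"

definition inverse_fourier_distr ::
  "(('a::euclidean_space \<Rightarrow> complex) \<Rightarrow> complex) \<Rightarrow> ('a \<Rightarrow> complex) \<Rightarrow> complex" where
  "inverse_fourier_distr u g = u (inverse_fourier g)"


subsection \<open>Weights\<close>

text \<open>
  Measurability is Lebesgue measurability. The moderating weight \<open>v\<close> is only needed up to
  domination, so no measurability is demanded of it.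
\<close>

definition poly_weight :: "('a::euclidean_space \<Rightarrow> real) \<Rightarrow> bool" where
  "poly_weight m \<longleftrightarrow>
     m \<in> borel_measurable lebesgue \<and> (\<forall>z. 0 \<le> m z) \<and>
     (\<exists>v. (\<forall>z. 0 \<le> v z) \<and> (\<forall>z w. v (z + w) \<le> v z * v w) \<and>
          (\<exists>K N. \<forall>z. v z \<le> K * (1 + norm z) ^ (N::nat)) \<and>
          (\<exists>C. \<forall>z w. m (z + w) \<le> C * v z * m w))"

definition submultiplicative :: "('a::euclidean_space \<Rightarrow> real) \<Rightarrow> bool" where
  "submultiplicative m \<longleftrightarrow> (\<exists>C. \<forall>z w. m (z + w) \<le> C * m z * m w)"

definition tensor :: "('a \<Rightarrow> real) \<Rightarrow> ('b \<Rightarrow> real) \<Rightarrow> 'a \<times> 'b \<Rightarrow> real" where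
  "tensor \<omega> \<mu> = (\<lambda>(x, y). \<omega> x * \<mu> y)"


subsection \<open>Modulation and Wiener amalgam spaces\<close>

definition stft ::
  "('a::euclidean_space \<Rightarrow> complex) \<Rightarrow> (('a \<Rightarrow> complex) \<Rightarrow> complex) \<Rightarrow> 'a \<Rightarrow> 'a \<Rightarrow> complex" where
  "stft \<phi> u x \<xi> = pairing u (\<lambda>t. cis (2 * pi * (t \<bullet> \<xi>)) * \<phi> (t - x))"

text \<open>
  The quasi-norm of \<open>M\<^sup>p\<^sup>,\<^sup>q\<^sub>m\<close> with window \<open>\<phi>\<close>; it is \<open>\<infinity>\<close> outside \<open>M\<^sup>p\<^sup>,\<^sup>q\<^sub>m\<close>,
  in particular on functionals that are not tempered distributions.
\<close>

definition modulation_norm ::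
  "('a::euclidean_space \<Rightarrow> complex) \<Rightarrow> ennreal \<Rightarrow> ennreal \<Rightarrow> ('a \<times> 'a \<Rightarrow> real) \<Rightarrow>
   (('a \<Rightarrow> complex) \<Rightarrow> complex) \<Rightarrow> ennreal" where
  "modulation_norm \<phi> p q m u =
     (if u \<in> tempered
      then mixed_norm p q lebesgue lebesgue (\<lambda>x \<xi>. ennreal (norm (stft \<phi> u x \<xi>) * m (x, \<xi>)))
      else \<infinity>)"

text \<open>The quasi-norm of \<open>W(\<F>L\<^sup>p, L\<^sup>q\<^sub>m)\<close>, the image of \<open>M\<^sup>p\<^sup>,\<^sup>q\<close> with weight \<open>1 \<otimes> m\<close> under \<open>\<F>\<close>.\<close>

definition wiener_norm ::
  "('a::euclidean_space \<Rightarrow> complex) \<Rightarrow> ennreal \<Rightarrow> ennreal \<Rightarrow> ('a \<Rightarrow> real) \<Rightarrow>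
   (('a \<Rightarrow> complex) \<Rightarrow> complex) \<Rightarrow> ennreal" where
  "wiener_norm \<Phi> p q m u =
     modulation_norm \<Phi> p q (tensor (\<lambda>_. 1) m) (inverse_fourier_distr u)"


subsection \<open>The \<open>\<tau>\<close>-Wigner distribution\<close>

definition wigner ::
  "real \<Rightarrow> ('a::euclidean_space \<Rightarrow> complex) \<Rightarrow> ('a \<Rightarrow> complex) \<Rightarrow> 'a \<times> 'a \<Rightarrow> complex" where
  "wigner \<tau> f g = (\<lambda>(x, \<xi>).
     LINT t|lebesgue. f (x + \<tau> *\<^sub>R t) * cnj (g (x - (1 - \<tau>) *\<^sub>R t)) * cis (- 2 * pi * (\<xi> \<bullet> t)))"

text \<open>
  Boundedness of \<open>W\<^sub>\<tau>\<close> from the closures of the Schwartz space in \<open>M\<^sup>p\<^sup>1\<^sup>,\<^sup>q\<^sup>1\<close> and \<open>M\<^sup>p\<^sup>2\<^sup>,\<^sup>q\<^sup>2\<close> (with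
  weights \<open>m1\<close>, \<open>m2\<close>) to \<open>W(\<F>L\<^sup>p, L\<^sup>q\<^sub>m)\<close> is by convention an estimate on Schwartz functions.
\<close>

definition wigner_bounded ::
  "('a::euclidean_space \<Rightarrow> complex) \<Rightarrow> ('a \<times> 'a \<Rightarrow> complex) \<Rightarrow> real \<Rightarrow>
   ennreal \<Rightarrow> ennreal \<Rightarrow> ('a \<times> 'a \<Rightarrow> real) \<Rightarrow> ennreal \<Rightarrow> ennreal \<Rightarrow> ('a \<times> 'a \<Rightarrow> real) \<Rightarrow>
   ennreal \<Rightarrow> ennreal \<Rightarrow> ('a \<times> 'a \<Rightarrow> real) \<Rightarrow> bool" where
  "wigner_bounded \<phi> \<Phi> \<tau> p1 q1 m1 p2 q2 m2 p q m \<longleftrightarrow>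
     (\<exists>C::real. C > 0 \<and> (\<forall>f\<in>schwartz. \<forall>g\<in>schwartz.
        wiener_norm \<Phi> p q m (regular_distr (wigner \<tau> f g))
          \<le> ennreal C * modulation_norm \<phi> p1 q1 m1 (regular_distr f)
                       * modulation_norm \<phi> p2 q2 m2 (regular_distr g)))"


subsection \<open>Discrete spaces\<close>

definition lattice_pt :: "int^'d \<Rightarrow> real^'d" where
  "lattice_pt k = (\<chi> i. real_of_int (k $ i))"

definition lp_norm ::
  "ennreal \<Rightarrow> (real^'d \<Rightarrow> real) \<Rightarrow> (int^'d \<Rightarrow> complex) \<Rightarrow> ennreal" where
  "lp_norm p \<omega> b = Lp_norm p (count_space UNIV) (\<lambda>k. ennreal (norm (b k) * \<omega> (lattice_pt k)))"

text \<open>\<open>l\<^sup>p\<^sup>,\<^sup>q\<^sub>m\<close>: inner exponent \<open>p\<close> in the first variable, outer exponent \<open>q\<close> in the second.\<close>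

definition lpq_norm ::
  "ennreal \<Rightarrow> ennreal \<Rightarrow> ((real^'d) \<times> (real^'d) \<Rightarrow> real) \<Rightarrow>
   ((int^'d) \<times> (int^'d) \<Rightarrow> complex) \<Rightarrow> ennreal" where
  "lpq_norm p q m a = mixed_norm p q (count_space UNIV) (count_space UNIV)
     (\<lambda>k n. ennreal (norm (a (k, n)) * m (lattice_pt k, lattice_pt n)))"

text \<open>\<open>l\<^sup>(\<^sup>p\<^sup>,\<^sup>q\<^sup>)\<^sub>m\<close>: inner exponent \<open>q\<close> in the second variable, outer exponent \<open>p\<close> in the first.\<close>

definition lpq_norm_rev ::
  "ennreal \<Rightarrow> ennreal \<Rightarrow> ((real^'d) \<times> (real^'d) \<Rightarrow> real) \<Rightarrow>
   ((int^'d) \<times> (int^'d) \<Rightarrow> complex) \<Rightarrow> ennreal" where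
  "lpq_norm_rev p q m a = mixed_norm q p (count_space UNIV) (count_space UNIV)
     (\<lambda>n k. ennreal (norm (a (k, n)) * m (lattice_pt k, lattice_pt n)))"

text \<open>The inclusions \<open>X \<subset> Z\<close> and \<open>X * Y \<subset> Z\<close> for spaces given by their quasi-norms.\<close>

definition embeds ::
  "(('i \<Rightarrow> complex) \<Rightarrow> ennreal) \<Rightarrow> (('i \<Rightarrow> complex) \<Rightarrow> ennreal) \<Rightarrow> bool" where
  "embeds X Z \<longleftrightarrow> (\<exists>C::real. C > 0 \<and> (\<forall>a. X a < \<infinity> \<longrightarrow> Z a \<le> ennreal C * X a))"

definition convolution ::
  "('i::ab_group_add \<Rightarrow> complex) \<Rightarrow> ('i \<Rightarrow> complex) \<Rightarrow> 'i \<Rightarrow> complex" where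
  "convolution a b n = (\<Sum>\<^sub>\<infinity>k. a k * b (n - k))"

definition conv_embeds ::
  "(('i::ab_group_add \<Rightarrow> complex) \<Rightarrow> ennreal) \<Rightarrow> (('i \<Rightarrow> complex) \<Rightarrow> ennreal) \<Rightarrow>
   (('i \<Rightarrow> complex) \<Rightarrow> ennreal) \<Rightarrow> bool" where
  "conv_embeds X Y Z \<longleftrightarrow> (\<exists>C::real. C > 0 \<and> (\<forall>a b. X a < \<infinity> \<longrightarrow> Y b < \<infinity> \<longrightarrow>
     (\<forall>n. (\<lambda>k. norm (a k * b (n - k))) summable_on UNIV) \<and>
     Z (convolution a b) \<le> ennreal C * X a * Y b))"

text \<open>The weight \<open>\<omega>\<^sup>p\<close> for a finite exponent \<open>p\<close>.\<close>

definition weight_pow :: "('a \<Rightarrow> real) \<Rightarrow> ennreal \<Rightarrow> 'a \<Rightarrow> real" where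
  "weight_pow \<omega> p = (\<lambda>z. \<omega> z powr enn2real p)"

end

theory Submission
  imports Defs "HOL-Probability.Sinc_Integral" "HOL-Probability.Characteristic_Functions"
begin

text \<open>
 Let \<open>G\<close> be the Gaussian. The short-time Fourier transform of \<open>\<F>\<^sup>-\<^sup>1 W\<^sub>\<tau>(f, g)\<close>, with the window
 \<open>\<F>\<^sup>-\<^sup>1 W\<^sub>\<tau>(G, G)\<close>, factorizes up to a phase into \<open>V\<^sub>G f\<close> and \<open>V\<^sub>G g\<close> at two linearly transformed points
 of the time-frequency space. Replacing \<open>V\<^sub>G f\<close> by its Peetre maximal function, which has the same weighted
 \<open>L\<^sup>p\<^sup>,\<^sup>q\<close> quasi-norms for all exponents in \<open>(0, \<infinity>]\<close> but varies slowly, all integrals become sums over lattices.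
 Conversely every finitely supported sequence is dominated by a sampled maximal function of a linear
 combination of sparse Gabor atoms with comparable norm. So boundedness is equivalent to a bilinear inequality
 for sequences. For \<open>0 < \<tau> < 1\<close> it is a convolution inequality on \<open>\<int>\<^sup>2\<^sup>d\<close>, which separates into the two variables
 by submultiplicativity of \<open>m\<close>, and by Minkowski's inequality if \<open>p <= q\<close> or testing against a delta if \<open>q <= p\<close>;
 for \<open>\<tau> \<in> {0, 1}\<close> the bilinear form is a product of norms.
\<close>

subsection \<open>Quasi-norms\<close>

text \<open>For exponents below 1 there is neither duality nor a triangle inequality, and the
  quasi-norm of |V_G f| does not obviously control values at lattice points. The reproducing formula
  helps: it bounds |V_G f| by its own average against a rapidly decaying kernel, and this improves
  itself to every power r > 0, so that Minkowski's inequality can be used with all exponents divided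
  by r. The decay index of the maximal function must exceed a threshold depending on the exponents
  and weights; hence the equivalences hold for all large indices, and one index is fixed only in
  \<open>wigner_bounded_iff_bemb\<close>, where all norms meet. The lattices are not independent
  either: the transformed points must fall on lattices, and for 0 < \<tau> < 1 this rescales the
  weights to \<open>m'\<close>, \<open>\<omega>2'\<close> and \<open>\<mu>2'\<close>. At \<tau> = 0
  and \<tau> = 1 two of the four coordinates do not depend on z, so the sum over z factorizes and no
  convolution remains. Finally, the discrete spaces consist of complex sequences of finite norm,
  while the bilinear forms are treated on sequences in [0, top]; the passage rests on the positivity
  of \<open>m\<close>.\<close>

lemma epowr_top [simp]: "epowr top r = top"
 by (simp add: epowr_def)

lemma epowr_0 [simp]: "epowr 0 r = 0"
 by (simp add: epowr_def)

lemma epowr_ennreal: "0 <= x ==> epowr (ennreal x) r = ennreal (x powr r)"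
 by (simp add: epowr_def)

lemma epowr_one [simp]: "epowr 1 r = 1"
 using epowr_ennreal[of 1 r] by simp

lemma epowr_1 [simp]: "epowr x 1 = x"
 by (cases x) (auto simp: epowr_ennreal)

lemma epowr_mono: "0 < r ==> x <= y ==> epowr x r <= epowr y r"
 by (cases x; cases y) (auto simp: epowr_ennreal top_unique intro!: ennreal_leI powr_mono2)

lemma epowr_mult: "0 < r ==> epowr (x * y) r = epowr x r * epowr y r"
proof (cases "x = \<infinity> \<or> y = \<infinity>")
 case True
 assume "0 < r"
 \<comment> \<open>Since \<open>0 * top = 0\<close>, a product with an infinite factor depends on
   whether the other factor vanishes, before and after taking powers.\<close>
 have *: "epowr z r = 0 \<longleftrightarrow> z = 0" for z
  using \<open>0 < r\<close> by (cases z) (auto simp: epowr_ennreal ennreal_eq_0_iff)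
 show ?thesis using True *[of x] *[of y] by (auto simp: ennreal_top_mult ennreal_mult_top)
next
 case False
 then obtain a b where "x = ennreal a" "y = ennreal b" "0 <= a" "0 <= b"
  by (cases x; cases y) auto
 then show ?thesis by (simp add: epowr_ennreal powr_mult flip: ennreal_mult)
qed

lemma epowr_epowr: "epowr (epowr x r) s = epowr x (r * s)"
 by (cases x) (auto simp: epowr_ennreal powr_powr)


lemma epowr_inv: "r \<noteq> 0 ==> epowr (epowr x r) (1 / r) = x" "r \<noteq> 0 ==> epowr (epowr x (1 / r)) r = x"
 by (auto simp: epowr_epowr)

lemma epowr_le_iff: "0 < r ==> epowr x r <= epowr y r \<longleftrightarrow> x <= y"
 using epowr_mono[of r x y] epowr_mono[of "1/r" "epowr x r" "epowr y r"] by (auto simp: epowr_inv)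

lemma epowr_eq_0_iff: "epowr x r = 0 \<longleftrightarrow> x = 0"
 by (cases x) (auto simp: epowr_ennreal ennreal_eq_0_iff)

lemma epowr_eq_top_iff: "epowr x r = top \<longleftrightarrow> x = top"
 by (cases x) (auto simp: epowr_ennreal)

lemma epowr_le_swap: "0 < r ==> epowr x r <= y \<longleftrightarrow> x <= epowr y (1 / r)"
 using epowr_le_iff[of r x "epowr y (1 / r)"] by (simp add: epowr_inv)


lemma measurable_epowr [measurable (raw)]:
 "f \<in> borel_measurable M ==> (%x. epowr (f x) r) \<in> borel_measurable M"
proof -
 assume [measurable]: "f \<in> borel_measurable M"
 have eq: "(%x. epowr (f x) r) = (%x. if f x \<in> {\<infinity>} then \<infinity> else ennreal (exp (r * ln (enn2real (f x))) * indicator {0<..} (enn2real (f x))))"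
  by (auto simp: epowr_def powr_def fun_eq_iff indicator_def order.strict_iff_order)
 show ?thesis unfolding eq by measurable
qed

text \<open>For r > 0 the map has the monotone inverse \<open>epowr _ (1 / r)\<close>, so it is an
  order isomorphism and respects suprema of arbitrary families.\<close>

lemma epowr_SUP:
 assumes "0 < r" shows "epowr (SUP i\<in>I. f i) r = (SUP i\<in>I. epowr (f i) r)"
proof (rule antisym)
 show "(SUP i\<in>I. epowr (f i) r) <= epowr (SUP i\<in>I. f i) r"
  by (intro SUP_least epowr_mono assms SUP_upper)
 show "epowr (SUP i\<in>I. f i) r <= (SUP i\<in>I. epowr (f i) r)"
  unfolding epowr_le_swap[OF assms]
  by (intro SUP_least) (auto simp: epowr_le_swap[OF assms, symmetric] intro: SUP_upper)
qed

text \<open>By homogeneity the sum may be normalized to 1; a fraction t in [0, 1] satisfies t <= t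
  powr r, and the two fractions add up to 1.\<close>

lemma powr_add_le:
 fixes x y :: real
 assumes "0 <= x" "0 <= y" "0 < r" "r <= 1"
 shows "(x + y) powr r <= x powr r + y powr r"
proof (cases "x + y = 0")
 case True
 then show ?thesis using assms by auto
next
 case False
 then have pos: "x + y > 0" using assms by simp
 have le: "t <= t powr r" if "0 <= t" "t <= 1" for t :: real
  using that assms powr_mono'[of r 1 t] by (cases "t = 0") auto
 have "1 = x / (x + y) + y / (x + y)" using pos by (simp flip: add_divide_distrib)
 also have "... <= (x / (x + y)) powr r + (y / (x + y)) powr r"
  using assms pos by (intro add_mono le) (auto simp: field_simps)
 also have "... = (x powr r + y powr r) / (x + y) powr r"
  using assms pos by (simp add: powr_divide add_divide_distrib)
 finally show ?thesis using pos by (simp add: field_simps)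
qed

lemma epowr_add_le: "0 < r ==> r <= 1 ==> epowr (x + y) r <= epowr x r + epowr y r"
 by (cases x; cases y)
  (auto simp: epowr_ennreal powr_add_le simp flip: ennreal_plus intro!: ennreal_leI)

lemma epowr_sum_le: "finite I ==> 0 < r ==> r <= 1 ==> epowr (sum f I) r <= (\<Sum>i\<in>I. epowr (f i) r)"
 by (induction I rule: finite_induct) (auto intro: order_trans[OF epowr_add_le] add_left_mono)

section \<open>Sums over countable types as suprema of finite sums\<close>

definition exhaust :: "nat => 'i::countable set" where
 "exhaust n = {x. to_nat x < n}"

lemma finite_exhaust [simp]: "finite (exhaust n)"
 unfolding exhaust_def using finite_vimageI[of "{..<n}" to_nat] by (simp add: vimage_def)

lemma exhaust_mono: "m <= n ==> exhaust m \<subseteq> exhaust n"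
 by (auto simp: exhaust_def)

lemma in_exhaust: "\<exists>n. x \<in> exhaust n"
 by (auto simp: exhaust_def)

lemma SUP_exhaust:
 fixes c :: ennreal
 shows "(SUP n. c * indicator (exhaust n) x) = c"
proof (rule antisym)
 obtain n where "x \<in> exhaust n" using in_exhaust by blast
 then show "c <= (SUP n. c * indicator (exhaust n) x)"
  by (intro SUP_upper2[of n]) auto
qed (auto intro!: SUP_least simp: indicator_def)

lemma sums_exhaust:
 fixes f :: "'i::countable => ennreal"
 shows "(\<integral>\<^sup>+x. f x \<partial>count_space UNIV) = (SUP n. \<Sum>x\<in>exhaust n. f x)"
proof -
 have "(\<integral>\<^sup>+x. f x \<partial>count_space UNIV) = (\<integral>\<^sup>+x. (SUP n. f x * indicator (exhaust n) x) \<partial>count_space UNIV)"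
  by (simp add: SUP_exhaust)
 also have "... = (SUP n. \<integral>\<^sup>+x. f x * indicator (exhaust n) x \<partial>count_space UNIV)"
  by (intro nn_integral_monotone_convergence_SUP)
   (auto simp: incseq_def le_fun_def indicator_def dest: exhaust_mono)
 also have "... = (SUP n. \<Sum>x\<in>exhaust n. f x)"
 proof (intro SUP_cong refl)
  fix n
  have "(\<integral>\<^sup>+x. f x * indicator (exhaust n) x \<partial>count_space UNIV)
   = (\<integral>\<^sup>+x. f x \<partial>count_space (exhaust n))"
   by (simp add: nn_integral_count_space_indicator)
  also have "... = (\<Sum>x\<in>exhaust n. f x)"
   by (simp add: nn_integral_count_space_finite)
  finally show "(\<integral>\<^sup>+x. f x * indicator (exhaust n) x \<partial>count_space UNIV) = (\<Sum>x\<in>exhaust n. f x)" .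
 qed
 finally show ?thesis .
qed

text \<open>The substitute for the triangle inequality at small exponents. The finite case is
  \<open>epowr_sum_le\<close>, and both sides are suprema over finite sets.\<close>

lemma epowr_nn_integral_count_le:
 fixes f :: "'i::countable => ennreal"
 assumes "0 < r" "r <= 1"
 shows "epowr (\<integral>\<^sup>+x. f x \<partial>count_space UNIV) r <= (\<integral>\<^sup>+x. epowr (f x) r \<partial>count_space UNIV)"
 unfolding sums_exhaust epowr_SUP[OF assms(1)]
 by (intro SUP_mono) (use assms epowr_sum_le[OF finite_exhaust] in blast)

lemma nn_integral_count_ge:
 fixes f :: "'i => ennreal"
 shows "f k <= (\<integral>\<^sup>+x. f x \<partial>count_space UNIV)"
proof -
 have "f k = (\<integral>\<^sup>+x. f x * indicator {k} x \<partial>count_space UNIV)"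
  by simp
 also have "... <= (\<integral>\<^sup>+x. f x \<partial>count_space UNIV)"
  by (intro nn_integral_mono) (auto simp: indicator_def)
 finally show ?thesis .
qed

section \<open>Quasi-norms with exponents in (0, top]\<close>

lemma Lp_norm_ennreal: "0 < P ==> Lp_norm (ennreal P) M f = epowr (\<integral>\<^sup>+ x. epowr (f x) P \<partial>M) (1 / P)"
 by (simp add: Lp_norm_def)

lemma Lp_norm_top: "Lp_norm top M f = esssup M f"
 by (simp add: Lp_norm_def)

lemma exponent_cases:
 assumes "0 < (p::ennreal)"
 obtains P where "0 < P" "p = ennreal P" | "p = top"
 using assms by (cases p) auto

lemma epowr_Lp_norm: "0 < P ==> epowr (Lp_norm (ennreal P) M f) P = (\<integral>\<^sup>+ x. epowr (f x) P \<partial>M)"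
 by (simp add: Lp_norm_ennreal epowr_inv)

lemma Lp_norm_mono_AE:
 assumes "0 < p" "f \<in> borel_measurable M" "AE x in M. f x <= g x"
 shows "Lp_norm p M f <= Lp_norm p M g"
 using assms(1)
proof (cases rule: exponent_cases)
 case (1 P)
 have "AE x in M. epowr (f x) P <= epowr (g x) P"
  using assms(3) by eventually_elim (intro epowr_mono 1)
 then show ?thesis using 1 by (auto simp: Lp_norm_ennreal intro!: epowr_mono nn_integral_mono_AE)
next
 case 2
 then show ?thesis using assms by (simp add: Lp_norm_top esssup_AE_mono)
qed

lemma Lp_norm_mono:
 assumes "0 < p" "f \<in> borel_measurable M" "!!x. f x <= g x"
 shows "Lp_norm p M f <= Lp_norm p M g"
 using assms by (intro Lp_norm_mono_AE) auto

lemma Lp_norm_cong_AE: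
 assumes "0 < p" "f \<in> borel_measurable M" "g \<in> borel_measurable M" "AE x in M. f x = g x"
 shows "Lp_norm p M f = Lp_norm p M g"
 using assms by (intro antisym Lp_norm_mono_AE) auto

lemma Lp_norm_0 [simp]: "0 < p ==> Lp_norm p M (%_. 0) = 0"
 by (cases p rule: exponent_cases)
  (auto simp: Lp_norm_ennreal Lp_norm_top intro!: antisym[OF esssup_I])

lemma Lp_norm_eq_0_imp_AE:
 assumes "0 < p" "f \<in> borel_measurable M" "Lp_norm p M f = 0"
 shows "AE x in M. f x = 0"
 using assms(1)
proof (cases rule: exponent_cases)
 case (1 P)
 then have "AE x in M. epowr (f x) P = 0"
  using assms by (simp add: Lp_norm_ennreal epowr_eq_0_iff nn_integral_0_iff_AE)
 then show ?thesis by (simp add: epowr_eq_0_iff)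
next
 case 2
 then show ?thesis using esssup_AE[of f M] assms by (simp add: Lp_norm_top)
qed

lemma Lp_norm_cmult:
 assumes p: "0 < p" and [measurable]: "f \<in> borel_measurable M"
 shows "Lp_norm p M (%x. c * f x) = c * Lp_norm p M f"
 using assms(1)
proof (cases rule: exponent_cases)
 case (1 P)
 then show ?thesis
  by (simp add: Lp_norm_ennreal epowr_mult nn_integral_cmult epowr_inv)
next
 case 2
 have le: "esssup M (%x. c * f x) <= c * esssup M f"
  by (rule esssup_I) (use esssup_AE[of f M] in \<open>auto elim!: eventually_mono intro: mult_left_mono\<close>)
 have ge: "c * esssup M f <= esssup M (%x. c * f x)"
 proof -
  consider "c = 0" | "c = \<infinity>" | "c \<noteq> 0" "c < \<infinity>" by (auto simp: less_top[symmetric])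
  then show ?thesis
  proof cases
   case 2
   show ?thesis
   proof (cases "esssup M (%x. c * f x) = \<infinity>")
    case False
    \<comment> \<open>Since \<open>top * y = top\<close> for y > 0, a finite essential supremum of
      \<open>top * f x\<close> leaves only the value 0 for f.\<close>
    have "AE x in M. f x = 0"
     using esssup_AE[of "%x. c * f x" M]
    proof eventually_elim
     case (elim x)
     then show ?case using False 2 by (auto simp: ennreal_top_mult top_unique split: if_splits)
    qed
    then have "esssup M f <= 0" by (intro esssup_I) auto
    then show ?thesis by simp
   qed simp
  next
   case 3
   have "esssup M f <= inverse c * esssup M (%x. c * f x)"
   proof (rule esssup_I)
    show "AE x in M. f x <= inverse c * esssup M (%x. c * f x)"
     using esssup_AE[of "%x. c * f x" M]
    proof eventually_elim
     case (elim x)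
     then have "inverse c * (c * f x) <= inverse c * esssup M (%x. c * f x)"
      by (rule mult_left_mono) simp
     then show ?case using 3
      by (simp add: mult.assoc[symmetric] mult.commute[of "inverse c"] ennreal_mult_divide_eq flip: divide_ennreal_def)
    qed
   qed simp
   then have "c * esssup M f <= c * (inverse c * esssup M (%x. c * f x))"
    by (rule mult_left_mono) simp
   then show ?thesis using 3
    by (simp add: mult.assoc[symmetric] flip: divide_ennreal_def)
  qed simp
 qed
 show ?thesis using 2 le ge by (simp add: Lp_norm_top antisym)
qed

lemma Lp_norm_multc:
 assumes "0 < p" "f \<in> borel_measurable M"
 shows "Lp_norm p M (%x. f x * c) = Lp_norm p M f * c"
 using Lp_norm_cmult[OF assms, of c] by (simp add: mult.commute)

lemma esssup_epowr_le:
 assumes "0 < r" and [measurable]: "f \<in> borel_measurable M"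
 shows "esssup M (%x. epowr (f x) r) <= epowr (esssup M f) r"
 by (rule esssup_I) (use esssup_AE[of f M] assms in \<open>auto elim!: eventually_mono intro: epowr_mono\<close>)

text \<open>Taking r-th powers divides the exponent by r. With r small this moves every exponent
  above 1, where Minkowski's inequality holds; \<open>top / r = top\<close> keeps the supremum norm
  in the same pattern.\<close>

lemma Lp_norm_epowr:
 assumes "0 < p" "0 < r" and [measurable]: "f \<in> borel_measurable M"
 shows "Lp_norm (p / ennreal r) M (%x. epowr (f x) r) = epowr (Lp_norm p M f) r"
 using assms(1)
proof (cases rule: exponent_cases)
 case (1 P)
 have "p / ennreal r = ennreal (P / r)" using 1 assms by (simp add: divide_ennreal)
 then show ?thesis using 1 assms by (simp add: Lp_norm_ennreal epowr_epowr)
next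
 case 2
 have "esssup M f = esssup M (%x. epowr (epowr (f x) r) (1 / r))" using assms by (simp add: epowr_inv)
 also have "... <= epowr (esssup M (%x. epowr (f x) r)) (1 / r)"
  using assms by (intro esssup_epowr_le) auto
 finally have "epowr (esssup M f) r <= esssup M (%x. epowr (f x) r)"
  using assms by (simp add: epowr_le_swap)
 moreover have "p / ennreal r = \<infinity>" using 2 by (simp add: ennreal_top_divide)
 ultimately show ?thesis using esssup_epowr_le[of r f M] assms 2
  by (simp add: Lp_norm_top antisym)
qed

section \<open>The inequalities of Jensen and Minkowski\<close>

lemma powr_tangent:
 fixes x t P :: real
 assumes "0 <= x" "0 < t" "1 <= P"
 shows "P * t powr (P - 1) * x <= x powr P + (P - 1) * t powr P"
proof (cases "P = 1")
 case True
 then show ?thesis using assms by simp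
next
 case False
 then have P: "P > 1" using assms by simp
 define Q where "Q = P / (P - 1)"
 have Q: "Q > 1" "1 / P + 1 / Q = 1" using P by (auto simp: Q_def field_simps)
 \<comment> \<open>Young's inequality for the conjugate exponents P and Q turns t powr (P - 1) into
   t powr P; multiplied by P it says that the P-th power lies above its tangent at t.\<close>
 have "x * t powr (P - 1) <= x powr P / P + (t powr (P - 1)) powr Q / Q"
  using P Q assms by (intro Youngs_inequality) auto
 moreover have "(t powr (P - 1)) powr Q = t powr P"
  using P by (simp add: powr_powr Q_def)
 moreover have "P * (t powr P / Q) = (P - 1) * t powr P"
  using P by (simp add: Q_def field_simps)
 ultimately show ?thesis
  using mult_left_mono[of "x * t powr (P - 1)" "x powr P / P + t powr P / Q" P] P
  by (simp add: algebra_simps)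
qed

lemma Jensen_epowr:
 assumes prob: "emeasure N (space N) = 1" and P: "1 <= P" and [measurable]: "g \<in> borel_measurable N"
 shows "epowr (\<integral>\<^sup>+ x. g x \<partial>N) P <= (\<integral>\<^sup>+ x. epowr (g x) P \<partial>N)"
proof (cases "(\<integral>\<^sup>+ x. epowr (g x) P \<partial>N) = top")
 case False
 define T where "T = (\<integral>\<^sup>+ x. g x \<partial>N)"
 \<comment> \<open>This crude bound makes the mean finite once the P-th moment is, so that there is
   a real point at which to take the tangent.\<close>
 have le: "x <= 1 + epowr x P" for x
 proof (cases x)
  case (real a)
  have "a <= 1 + a powr P"
   using real P powr_mono[of 1 P a] by (cases "a <= 1") (auto simp: add_increasing2)
  then show ?thesis using real by (simp add: epowr_ennreal flip: ennreal_plus ennreal_1)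
 qed auto
 have "T <= (\<integral>\<^sup>+ x. 1 + epowr (g x) P \<partial>N)"
  unfolding T_def by (intro nn_integral_mono le)
 also have "... = 1 + (\<integral>\<^sup>+ x. epowr (g x) P \<partial>N)" by (simp add: nn_integral_add prob)
 also have "... < top" using False by (simp add: less_top[symmetric])
 finally obtain t where t: "T = ennreal t" "0 <= t" by (cases T) auto
 show ?thesis
 proof (cases "t = 0")
  case True
  then show ?thesis using t by (simp add: T_def)
 next
  case t0: False
  have tangent: "ennreal (P * t powr (P - 1)) * x <= epowr x P + ennreal ((P - 1) * t powr P)" for x
  proof (cases x)
   case (real a)
   then show ?thesis using powr_tangent[of a t P] t0 t P
    by (simp add: epowr_ennreal ennreal_leI flip: ennreal_plus ennreal_mult)
  qed auto
  have "ennreal (P * t powr (P - 1)) * T = (\<integral>\<^sup>+ x. ennreal (P * t powr (P - 1)) * g x \<partial>N)"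
   by (simp add: nn_integral_cmult T_def)
  also have "... <= (\<integral>\<^sup>+ x. epowr (g x) P + ennreal ((P - 1) * t powr P) \<partial>N)"
   by (intro nn_integral_mono tangent)
  also have "... = (\<integral>\<^sup>+ x. epowr (g x) P \<partial>N) + ennreal ((P - 1) * t powr P)"
   by (simp add: nn_integral_add prob)
  finally have A: "ennreal (P * t powr (P - 1)) * T <= (\<integral>\<^sup>+ x. epowr (g x) P \<partial>N) + ennreal ((P - 1) * t powr P)" .
  obtain I where I: "(\<integral>\<^sup>+ x. epowr (g x) P \<partial>N) = ennreal I" "0 <= I" using False by (cases "\<integral>\<^sup>+ x. epowr (g x) P \<partial>N") auto
  have "P * t powr (P - 1) * t <= I + (P - 1) * t powr P"
   using A I t t0 P by (simp flip: ennreal_mult ennreal_plus)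
  moreover have "t powr (P - 1) * t = t powr P" using t t0 by (simp add: powr_diff)
  ultimately have "t powr P <= I" by (simp add: algebra_simps)
  then show ?thesis using I t by (simp add: T_def[symmetric] epowr_ennreal ennreal_leI)
 qed
qed simp

lemma esssup_le_iff:
 assumes "f \<in> borel_measurable M"
 shows "esssup M f <= c \<longleftrightarrow> (AE x in M. f x <= c)"
 using esssup_I[OF assms, of c] esssup_AE[of f M] by (auto elim: eventually_mono)

lemma measurable_Lp_norm:
 fixes h :: "'a => 'b => ennreal"
 assumes "sigma_finite_measure M" "0 < p"
  and h[measurable]: "(%(x, y). h x y) \<in> borel_measurable (M \<Otimes>\<^sub>M N)"
 shows "(%y. Lp_norm p M (%x. h x y)) \<in> borel_measurable N"
 using assms(2)
proof (cases rule: exponent_cases)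
 case (1 P)
 interpret sigma_finite_measure M by fact
 show ?thesis unfolding 1(2) Lp_norm_ennreal[OF 1(1)] by measurable
next
 case 2
 interpret M: sigma_finite_measure M by fact
 \<comment> \<open>The essential supremum is not an integral. Its sublevel sets in y are described
   by the vanishing of the integral of an indicator, which depends measurably on y.\<close>
 have "{y \<in> space N. esssup M (%x. h x y) <= a} \<in> sets N" for a
 proof -
  have meas: "(%x. h x y) \<in> borel_measurable M" if "y \<in> space N" for y
   using measurable_Pair1[OF h that] by simp
  have "(\<integral>\<^sup>+x. indicator {a<..} (h x y) \<partial>M) = 0 \<longleftrightarrow> esssup M (%x. h x y) <= a" if "y \<in> space N" for y
  proof -
   have "(\<integral>\<^sup>+x. indicator {a<..} (h x y) \<partial>M) = 0 \<longleftrightarrow> (AE x in M. indicator {a<..} (h x y) = (0::ennreal))"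
    by (rule nn_integral_0_iff_AE) (use meas[OF that] in measurable)
   also have "... \<longleftrightarrow> (AE x in M. h x y <= a)"
    by (intro AE_cong) (auto simp: indicator_def)
   also have "... \<longleftrightarrow> esssup M (%x. h x y) <= a" using meas[OF that] by (rule esssup_le_iff[symmetric])
   finally show ?thesis .
  qed
  then have "{y \<in> space N. esssup M (%x. h x y) <= a} = {y \<in> space N. (\<integral>\<^sup>+x. indicator {a<..} (h x y) \<partial>M) = 0}"
   by auto
  also have "... \<in> sets N" by measurable
  finally show ?thesis .
 qed
 then show ?thesis unfolding 2 Lp_norm_top by (rule borel_measurableI_le)
qed


lemma ennreal_mult_divide_cancel:
 fixes x n :: ennreal
 assumes "n \<noteq> 0" "n \<noteq> top" shows "n * (x / n) = x"
 using assms by (simp add: ennreal_times_divide mult.commute[of n] ennreal_mult_divide_eq)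

text \<open>The sections are normalized: \<open>h / n\<close> has norm at most 1 in x, and
  \<open>n / T\<close> is a probability density in u. Jensen's inequality for this density, followed
  by an exchange of the integrals, gives the bound T.\<close>

lemma Minkowski_integral:
 fixes h :: "'a => 'b => ennreal"
 assumes "sigma_finite_measure M" "sigma_finite_measure U" "1 <= p"
  and h[measurable]: "(%(x, u). h x u) \<in> borel_measurable (M \<Otimes>\<^sub>M U)"
 shows "Lp_norm p M (%x. \<integral>\<^sup>+ u. h x u \<partial>U) <= (\<integral>\<^sup>+ u. Lp_norm p M (%x. h x u) \<partial>U)"
proof -
 interpret M: sigma_finite_measure M by fact
 interpret U: sigma_finite_measure U by fact
 interpret pair_sigma_finite M U ..
 have p0: "0 < p" using assms(3) by (auto intro: less_le_trans[of 0 1 p])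
 define n where "n = (%u. Lp_norm p M (%x. h x u))"
 have n_meas[measurable]: "n \<in> borel_measurable U"
  unfolding n_def by (rule measurable_Lp_norm[OF assms(1) p0 h])
 have hx: "(%x. h x u) \<in> borel_measurable M" if "u \<in> space U" for u
  using measurable_Pair1[OF h that] by simp
 define T where "T = (\<integral>\<^sup>+ u. n u \<partial>U)"
 show ?thesis unfolding n_def[symmetric] T_def[symmetric]
  using p0
 proof (cases rule: exponent_cases)
  case 2
  \<comment> \<open>For the supremum norm it suffices to exchange the two almost-everywhere
    quantifiers.\<close>
  have "AE u in U. AE x in M. h x u <= n u"
   unfolding n_def 2 Lp_norm_top by (intro always_eventually allI esssup_AE)
  then have "AE x in M. AE u in U. h x u <= n u"
   by (subst AE_commute) auto
  then have "AE x in M. (\<integral>\<^sup>+ u. h x u \<partial>U) <= T"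
   unfolding T_def by eventually_elim (rule nn_integral_mono_AE)
  then show "Lp_norm p M (%x. \<integral>\<^sup>+ u. h x u \<partial>U) <= T"
   unfolding 2 Lp_norm_top by (subst esssup_le_iff) auto
 next
  case (1 P)
  have P: "1 <= P" using assms(3) 1 by simp
  consider "T = top" | "T = 0" | "0 < T" "T < top" by (auto simp: less_top[symmetric] zero_less_iff_neq_zero)
  then show "Lp_norm p M (%x. \<integral>\<^sup>+ u. h x u \<partial>U) <= T"
  proof cases
   case 2
   have "AE u in U. n u = 0" using 2 unfolding T_def by (subst (asm) nn_integral_0_iff_AE) auto
   then have "AE u in U. AE x in M. h x u = 0"
    using AE_space
   proof eventually_elim
    case (elim u)
    then show ?case using Lp_norm_eq_0_imp_AE[OF p0 hx] by (auto simp: n_def)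
   qed
   then have "AE x in M. AE u in U. h x u = 0" by (subst AE_commute) auto
   then have "AE x in M. (\<integral>\<^sup>+ u. h x u \<partial>U) = 0"
    using AE_space
   proof eventually_elim
    case (elim x)
    then show ?case by (subst nn_integral_0_iff_AE) auto
   qed
   then have "Lp_norm p M (%x. \<integral>\<^sup>+ u. h x u \<partial>U) = Lp_norm p M (%x. 0)"
    by (intro Lp_norm_cong_AE p0) auto
   then show ?thesis using p0 by simp
  next
   case 3
   define g where "g = (%x u. h x u / n u)"
   have g_meas[measurable]: "(%(x, u). g x u) \<in> borel_measurable (M \<Otimes>\<^sub>M U)"
    unfolding g_def by measurable
   have fin: "AE u in U. n u \<noteq> top"
    using nn_integral_PInf_AE[of n U] 3 by (auto simp: T_def)
   \<comment> \<open>Where n u = 0 the section vanishes almost everywhere; n u = top, where the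
     quotient carries no information, occurs only on a null set because T is finite.\<close>
   have eq: "AE x in M. AE u in U. h x u = n u * g x u"
   proof (subst AE_commute)
    show "AE u in U. AE x in M. h x u = n u * g x u"
     using fin AE_space
    proof eventually_elim
     case (elim u)
     show ?case
     proof (cases "n u = 0")
      case True
      then have "AE x in M. h x u = 0" using elim Lp_norm_eq_0_imp_AE[OF p0 hx] by (auto simp: n_def)
      then show ?thesis by eventually_elim (simp add: True)
     next
      case False
      then show ?thesis using elim
       by (auto simp: g_def ennreal_mult_divide_cancel)
     qed
    qed
   qed auto
   define D where "D = density U (%u. n u / T)"
   have "(\<integral>\<^sup>+ u. n u / T \<partial>U) = 1"
    using 3 by (simp add: nn_integral_divide T_def[symmetric] ennreal_divide_self)
   then have prob: "emeasure D (space D) = 1"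
    by (simp add: D_def emeasure_density cong: nn_integral_cong)
   have int_D: "(\<integral>\<^sup>+ u. k u \<partial>D) = (\<integral>\<^sup>+ u. n u / T * k u \<partial>U)" if "k \<in> borel_measurable U" for k
    unfolding D_def using that by (intro nn_integral_density) auto
   have bound: "AE x in M. epowr (\<integral>\<^sup>+ u. h x u \<partial>U) P <= epowr T P * (\<integral>\<^sup>+ u. n u / T * epowr (g x u) P \<partial>U)"
    using eq AE_space
   proof eventually_elim
    case (elim x)
    have [measurable]: "g x \<in> borel_measurable U"
     using measurable_Pair2[OF g_meas] elim by auto
    have "(\<integral>\<^sup>+ u. h x u \<partial>U) = (\<integral>\<^sup>+ u. T * (n u / T * g x u) \<partial>U)"
     using elim(1) 3 by (intro nn_integral_cong_AE)
      (auto elim!: eventually_mono simp: mult.assoc[symmetric] ennreal_mult_divide_cancel)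
    also have "... = T * (\<integral>\<^sup>+ u. g x u \<partial>D)"
     by (subst nn_integral_cmult) (auto simp: int_D)
    finally have "epowr (\<integral>\<^sup>+ u. h x u \<partial>U) P = epowr T P * epowr (\<integral>\<^sup>+ u. g x u \<partial>D) P"
     using P by (simp add: epowr_mult)
    also have "... <= epowr T P * (\<integral>\<^sup>+ u. epowr (g x u) P \<partial>D)"
     by (intro mult_left_mono Jensen_epowr prob P) (auto simp: D_def)
    finally show ?case by (simp add: int_D)
   qed
   \<comment> \<open>In [0, top] the quotient 0 / 0 is 0, so sections of norm 0 satisfy the bound
     too.\<close>
   have one: "(\<integral>\<^sup>+ x. epowr (g x u) P \<partial>M) <= 1" if "u \<in> space U" "n u \<noteq> top" for u
   proof -
    have "(\<integral>\<^sup>+ x. epowr (g x u) P \<partial>M) = epowr (Lp_norm p M (%x. h x u * inverse (n u))) P"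
     unfolding 1 epowr_Lp_norm[OF 1(1)] by (simp add: g_def divide_ennreal_def)
    also have "... = epowr (n u / n u) P"
     by (subst Lp_norm_multc[OF p0 hx[OF that(1)]]) (simp add: n_def divide_ennreal_def)
    also have "... <= 1" using that by (cases "n u = 0") (auto simp: ennreal_divide_self less_top[symmetric])
    finally show ?thesis .
   qed
   have "(\<integral>\<^sup>+ x. epowr (\<integral>\<^sup>+ u. h x u \<partial>U) P \<partial>M)
     <= (\<integral>\<^sup>+ x. epowr T P * (\<integral>\<^sup>+ u. n u / T * epowr (g x u) P \<partial>U) \<partial>M)"
    by (intro nn_integral_mono_AE bound)
   also have "... = epowr T P * (\<integral>\<^sup>+ x. (\<integral>\<^sup>+ u. n u / T * epowr (g x u) P \<partial>U) \<partial>M)"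
    by (intro nn_integral_cmult) measurable
   also have "(\<integral>\<^sup>+ x. (\<integral>\<^sup>+ u. n u / T * epowr (g x u) P \<partial>U) \<partial>M)
     = (\<integral>\<^sup>+ u. (\<integral>\<^sup>+ x. n u / T * epowr (g x u) P \<partial>M) \<partial>U)"
    by (intro Fubini'[symmetric]) measurable
   also have "... <= (\<integral>\<^sup>+ u. n u / T \<partial>U)"
   proof (rule nn_integral_mono_AE)
    show "AE u in U. (\<integral>\<^sup>+ x. n u / T * epowr (g x u) P \<partial>M) <= n u / T"
     using fin AE_space
    proof eventually_elim
     case (elim u)
     have [measurable]: "(%x. g x u) \<in> borel_measurable M"
      using measurable_Pair1[OF g_meas] elim by auto
     have "(\<integral>\<^sup>+ x. n u / T * epowr (g x u) P \<partial>M) = n u / T * (\<integral>\<^sup>+ x. epowr (g x u) P \<partial>M)"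
      by (intro nn_integral_cmult) measurable
     also have "... <= n u / T * 1" by (intro mult_left_mono one) (use elim in auto)
     finally show ?case by simp
    qed
   qed
   also have "... = 1" by fact
   finally have "(\<integral>\<^sup>+ x. epowr (\<integral>\<^sup>+ u. h x u \<partial>U) P \<partial>M) <= epowr T P"
    by (simp add: mult_left_mono)
   then show ?thesis unfolding 1 Lp_norm_ennreal[OF 1(1)]
    using epowr_mono[of "1/P" _ "epowr T P"] 1 by (auto simp: epowr_inv)
  qed simp
 qed
qed

lemma sigma_finite_count [simp]: "sigma_finite_measure (count_space (UNIV :: 'i::countable set))"
 by (rule sigma_finite_measure_count_space)

lemma sigma_finite_lborel [simp]: "sigma_finite_measure lborel"
 by (rule lborel.sigma_finite_measure_axioms)

section \<open>Sequence spaces over countable index types\<close>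

lemma esssup_count: "esssup (count_space UNIV) f = (SUP x. f x :: ennreal)"
proof (rule antisym)
 show "esssup (count_space UNIV) f <= (SUP x. f x)"
  by (rule esssup_I) (auto intro: SUP_upper simp: AE_count_space)
 have "f x <= esssup (count_space UNIV) f" for x
  using esssup_AE[of f "count_space UNIV"] by (simp add: AE_count_space)
 then show "(SUP x. f x) <= esssup (count_space UNIV) f" by (rule SUP_least)
qed

abbreviation lp :: "ennreal => ('i => ennreal) => ennreal" where
 "lp p \<equiv> Lp_norm p (count_space UNIV)"

lemma lp_mono: "0 < p ==> (!!x. f x <= g x) ==> lp p f <= lp p g"
 by (rule Lp_norm_mono) auto

lemma lp_cmult: "0 < p ==> lp p (%x. c * f x) = c * lp p f"
 by (rule Lp_norm_cmult) auto

lemma lp_multc: "0 < p ==> lp p (%x. f x * c) = lp p f * c"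
 by (rule Lp_norm_multc) auto

lemma lp_SUP:
 fixes f :: "nat => 'i => ennreal"
 assumes "0 < p" "!!x. incseq (%n. f n x)"
 shows "lp p (%x. SUP n. f n x) = (SUP n. lp p (f n))"
 using assms(1)
proof (cases rule: exponent_cases)
 case (1 P)
 have "(\<integral>\<^sup>+ x. (SUP n. epowr (f n x) P) \<partial>count_space UNIV) = (SUP n. \<integral>\<^sup>+ x. epowr (f n x) P \<partial>count_space UNIV)"
  using assms 1 by (intro nn_integral_monotone_convergence_SUP)
   (auto simp: incseq_def le_fun_def intro: epowr_mono)
 then show ?thesis using 1 by (simp add: Lp_norm_ennreal epowr_SUP)
next
 case 2
 then show ?thesis by (simp add: Lp_norm_top esssup_count SUP_commute[of "%x n. f n x"])
qed

lemma lp_ge: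
 assumes "0 < p" shows "f k <= lp p f"
 using assms
proof (cases rule: exponent_cases)
 case (1 P)
 have "epowr (epowr (f k) P) (1 / P) <= epowr (\<integral>\<^sup>+ x. epowr (f x) P \<partial>count_space UNIV) (1 / P)"
  using 1 by (intro epowr_mono nn_integral_count_ge) auto
 then show ?thesis using 1 by (simp add: epowr_inv Lp_norm_ennreal)
next
 case 2
 then show ?thesis by (simp add: Lp_norm_top esssup_count SUP_upper)
qed

lemma lp_single:
 assumes "0 < p" and f: "!!x. x \<noteq> k ==> f x = 0" shows "lp p f = f k"
 using assms(1)
proof (cases rule: exponent_cases)
 case (1 P)
 have "(\<integral>\<^sup>+ x. epowr (f x) P \<partial>count_space UNIV) = (\<integral>\<^sup>+ x. epowr (f k) P * indicator {k} x \<partial>count_space UNIV)"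
  using f by (intro nn_integral_cong) (auto simp: indicator_def)
 then show ?thesis using 1 by (simp add: Lp_norm_ennreal epowr_inv)
next
 case 2
 have "(SUP x. f x) <= f k" using f by (intro SUP_least) (metis zero_le order_refl)
 then show ?thesis using 2 by (simp add: Lp_norm_top esssup_count antisym SUP_upper)
qed

lemma lp_top: "lp top f = (SUP x. f x)"
 by (simp add: Lp_norm_top esssup_count)

lemma lp_bij:
 assumes "bij \<pi>" "0 < p" shows "lp p (%x. f (\<pi> x)) = lp p f"
 using assms(2)
proof (cases rule: exponent_cases)
 case (1 P)
 show ?thesis unfolding 1 Lp_norm_ennreal[OF 1(1)]
  by (subst nn_integral_bij_count_space[OF assms(1), symmetric]) simp
next
 case 2
 have "range (%x. f (\<pi> x)) = range f" using assms(1) by (metis bij_is_surj image_image)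
 then show ?thesis by (simp add: 2 lp_top)
qed

text \<open>With s = P / Q <= 1, subadditivity of the s-th power applied to the terms
  \<open>epowr (f x) Q\<close> is the claim after taking P-th roots.\<close>

lemma lp_antimono:
 fixes f :: "'i::countable => ennreal"
 assumes "0 < p" "p <= q"
 shows "lp q f <= lp p f"
 using assms(1)
proof (cases rule: exponent_cases)
 case (1 P)
 have "0 < q" using assms by auto
 then show ?thesis
 proof (cases rule: exponent_cases)
  case (1 Q)
  note Q = this
  have PQ: "0 < P" "P <= Q" using \<open>0 < P\<close> \<open>p = ennreal P\<close> assms Q by auto
  have "epowr (\<integral>\<^sup>+ x. epowr (f x) Q \<partial>count_space UNIV) (P / Q)
   <= (\<integral>\<^sup>+ x. epowr (epowr (f x) Q) (P / Q) \<partial>count_space UNIV)"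
   using PQ by (intro epowr_nn_integral_count_le) auto
  also have "... = (\<integral>\<^sup>+ x. epowr (f x) P \<partial>count_space UNIV)"
   using PQ by (simp add: epowr_epowr)
  finally have "epowr (epowr (\<integral>\<^sup>+ x. epowr (f x) Q \<partial>count_space UNIV) (P / Q)) (1 / P)
   <= epowr (\<integral>\<^sup>+ x. epowr (f x) P \<partial>count_space UNIV) (1 / P)"
   using PQ by (intro epowr_mono) auto
  then show ?thesis using PQ Q \<open>p = ennreal P\<close> by (simp add: Lp_norm_ennreal epowr_epowr)
 next
  case 2
  show ?thesis unfolding 2 lp_top by (intro SUP_least lp_ge assms)
 qed
next
 case 2
 then show ?thesis using assms by (simp add: top_unique)
qed

lemma lp_pair:
 fixes f :: "'i::countable \<times> 'j::countable => ennreal"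
 assumes "0 < p"
 shows "lp p f = lp p (%y. lp p (%x. f (x, y)))"
 using assms
proof (cases rule: exponent_cases)
 case (1 P)
 interpret pair_sigma_finite "count_space (UNIV :: 'i set)" "count_space (UNIV :: 'j set)"
  by (simp add: pair_sigma_finite_def)
 have "(\<integral>\<^sup>+ z. epowr (f z) P \<partial>count_space UNIV) = (\<integral>\<^sup>+ y. \<integral>\<^sup>+ x. epowr (f (x, y)) P \<partial>count_space UNIV \<partial>count_space UNIV)"
  using nn_integral_snd[of "%z. epowr (f z) P"]
  by (simp add: pair_measure_countable split_beta')
 then show ?thesis using 1 by (simp add: Lp_norm_ennreal epowr_inv)
next
 case 2
 have "(SUP z. f z) = (SUP y. SUP x. f (x, y))"
  by (intro antisym SUP_least) (auto intro!: SUP_upper2 SUP_upper)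
 then show ?thesis by (simp add: 2 lp_top)
qed

lemma lp_pair_swap:
 fixes f :: "'i::countable \<times> 'j::countable => ennreal"
 assumes "0 < p"
 shows "lp p f = lp p (%x. lp p (%y. f (x, y)))"
proof -
 have "lp p f = lp p (%z. f (prod.swap z))" using assms by (intro lp_bij[symmetric]) auto
 also have "... = lp p (%x. lp p (%y. f (x, y)))" by (subst lp_pair[OF assms]) simp
 finally show ?thesis .
qed

subsection \<open>Mixed norms\<close>

lemma mixed_norm_mono:
 fixes f g :: "'a => 'b => ennreal"
 assumes "sigma_finite_measure M" "0 < p" "0 < q"
  and f[measurable]: "(%(x, y). f x y) \<in> borel_measurable (M \<Otimes>\<^sub>M N)"
  and le: "!!x y. f x y <= g x y"
 shows "mixed_norm p q M N f <= mixed_norm p q M N g"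
 unfolding mixed_norm_def
proof (rule Lp_norm_mono_AE[OF assms(3)])
 show "(%y. Lp_norm p M (%x. f x y)) \<in> borel_measurable N"
  by (rule measurable_Lp_norm) fact+
 show "AE y in N. Lp_norm p M (%x. f x y) <= Lp_norm p M (%x. g x y)"
  using AE_space
 proof eventually_elim
  case (elim y)
  then show ?case
   using measurable_Pair1[OF f elim] assms by (intro Lp_norm_mono) auto
 qed
qed

lemma mixed_norm_cmult:
 fixes f :: "'a => 'b => ennreal"
 assumes "sigma_finite_measure M" "0 < p" "0 < q"
  and f[measurable]: "(%(x, y). f x y) \<in> borel_measurable (M \<Otimes>\<^sub>M N)"
 shows "mixed_norm p q M N (%x y. c * f x y) = c * mixed_norm p q M N f"
proof -
 have [measurable]: "(%y. Lp_norm p M (%x. f x y)) \<in> borel_measurable N"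
  by (rule measurable_Lp_norm) fact+
 have [measurable]: "(%y. Lp_norm p M (%x. c * f x y)) \<in> borel_measurable N"
  by (rule measurable_Lp_norm) (auto simp: assms)
 have "mixed_norm p q M N (%x y. c * f x y) = Lp_norm q N (%y. c * Lp_norm p M (%x. f x y))"
  unfolding mixed_norm_def
 proof (rule Lp_norm_cong_AE[OF assms(3)])
  show "AE y in N. Lp_norm p M (%x. c * f x y) = c * Lp_norm p M (%x. f x y)"
   using AE_space
  proof eventually_elim
   case (elim y)
   then show ?case using measurable_Pair1[OF f elim] assms by (intro Lp_norm_cmult) auto
  qed
 qed measurable
 then show ?thesis by (simp add: mixed_norm_def Lp_norm_cmult assms)
qed

lemma mixed_norm_epowr:
 fixes f :: "'a => 'b => ennreal"
 assumes "sigma_finite_measure M" "0 < p" "0 < q" "0 < r"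
  and f[measurable]: "(%(x, y). f x y) \<in> borel_measurable (M \<Otimes>\<^sub>M N)"
 shows "mixed_norm (p / ennreal r) (q / ennreal r) M N (%x y. epowr (f x y) r) = epowr (mixed_norm p q M N f) r"
proof -
 have [measurable]: "(%y. Lp_norm p M (%x. f x y)) \<in> borel_measurable N"
  by (rule measurable_Lp_norm) fact+
 have pr: "0 < p / ennreal r" "0 < q / ennreal r"
  using assms by (auto simp: ennreal_zero_less_divide)
 have [measurable]: "(%y. Lp_norm (p / ennreal r) M (%x. epowr (f x y) r)) \<in> borel_measurable N"
  using pr by (intro measurable_Lp_norm) (auto simp: assms)
 have "mixed_norm (p / ennreal r) (q / ennreal r) M N (%x y. epowr (f x y) r)
   = Lp_norm (q / ennreal r) N (%y. epowr (Lp_norm p M (%x. f x y)) r)"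
  unfolding mixed_norm_def
 proof (rule Lp_norm_cong_AE[OF pr(2)])
  show "AE y in N. Lp_norm (p / ennreal r) M (%x. epowr (f x y) r) = epowr (Lp_norm p M (%x. f x y)) r"
   using AE_space
  proof eventually_elim
   case (elim y)
   then show ?case using measurable_Pair1[OF f elim] assms by (intro Lp_norm_epowr) auto
  qed
 qed measurable
 then show ?thesis by (simp add: mixed_norm_def Lp_norm_epowr assms)
qed

text \<open>Minkowski's inequality is used for the inner norm at each fixed y and then for the outer
  norm of the resulting integral over u.\<close>

lemma mixed_Minkowski:
 fixes h :: "'a => 'b => 'c => ennreal"
 assumes M: "sigma_finite_measure M" and N: "sigma_finite_measure N" and U: "sigma_finite_measure U"
  and p: "1 <= p" and q: "1 <= q"
  and h[measurable]: "(%(x, y, u). h x y u) \<in> borel_measurable (M \<Otimes>\<^sub>M N \<Otimes>\<^sub>M U)"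
 shows "mixed_norm p q M N (%x y. \<integral>\<^sup>+ u. h x y u \<partial>U) <= (\<integral>\<^sup>+ u. mixed_norm p q M N (%x y. h x y u) \<partial>U)"
proof -
 interpret U: sigma_finite_measure U by fact
 have p0: "0 < p" "0 < q" using p q by (auto intro: less_le_trans[of 0 1])
 have m1[measurable]: "(%(y, u). Lp_norm p M (%x. h x y u)) \<in> borel_measurable (N \<Otimes>\<^sub>M U)"
  using measurable_Lp_norm[OF M p0(1), of "%x (y, u). h x y u" "N \<Otimes>\<^sub>M U"] h
  by (simp add: split_beta')
 have [measurable]: "(%z. h (fst (fst z)) (snd (fst z)) (snd z)) \<in> borel_measurable ((M \<Otimes>\<^sub>M N) \<Otimes>\<^sub>M U)"
  using measurable_compose[OF _ h, of "%z. (fst (fst z), snd (fst z), snd z)" "(M \<Otimes>\<^sub>M N) \<Otimes>\<^sub>M U"]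
  by simp
 have [measurable]: "(%y. Lp_norm p M (%x. \<integral>\<^sup>+ u. h x y u \<partial>U)) \<in> borel_measurable N"
  by (rule measurable_Lp_norm[OF M p0(1)]) measurable
 have "mixed_norm p q M N (%x y. \<integral>\<^sup>+ u. h x y u \<partial>U)
   <= Lp_norm q N (%y. \<integral>\<^sup>+ u. Lp_norm p M (%x. h x y u) \<partial>U)"
  unfolding mixed_norm_def
 proof (rule Lp_norm_mono_AE[OF p0(2)])
  show "AE y in N. Lp_norm p M (%x. \<integral>\<^sup>+ u. h x y u \<partial>U) <= (\<integral>\<^sup>+ u. Lp_norm p M (%x. h x y u) \<partial>U)"
   using AE_space
  proof eventually_elim
   case (elim y)
   have [measurable]: "(%(x, u). h x y u) \<in> borel_measurable (M \<Otimes>\<^sub>M U)"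
    using measurable_compose[OF _ h, of "%z. (fst z, y, snd z)" "M \<Otimes>\<^sub>M U"] elim
    by (simp add: split_beta')
   show ?case by (intro Minkowski_integral M U p) measurable
  qed
 qed measurable
 also have "... <= (\<integral>\<^sup>+ u. mixed_norm p q M N (%x y. h x y u) \<partial>U)"
  unfolding mixed_norm_def by (intro Minkowski_integral N U q) measurable
 finally show ?thesis .
qed

text \<open>The form of Minkowski's inequality that is available for all exponents: if r is at most
  p and q, the r-th power of the mixed quasi-norm behaves like a norm with exponents p / r and q /
  r. The hypothesis \<open>le\<close>, an r-th power bounded by an average of r-th powers, is what
  the maximal inequality and discrete convolutions provide.\<close>

lemma mixed_Minkowski_epowr:
 fixes h :: "'a => 'b => 'c => ennreal"
 assumes M: "sigma_finite_measure M" and N: "sigma_finite_measure N" and U: "sigma_finite_measure U"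
  and r: "0 < r" "ennreal r <= p" "ennreal r <= q"
  and h[measurable]: "(%(x, y, u). h x y u) \<in> borel_measurable (M \<Otimes>\<^sub>M N \<Otimes>\<^sub>M U)"
  and f[measurable]: "(%(x, y). f x y) \<in> borel_measurable (M \<Otimes>\<^sub>M N)"
  and le: "!!x y. epowr (f x y) r <= (\<integral>\<^sup>+ u. epowr (h x y u) r * k u \<partial>U)"
  and k[measurable]: "k \<in> borel_measurable U"
 shows "epowr (mixed_norm p q M N f) r <= (\<integral>\<^sup>+ u. epowr (mixed_norm p q M N (%x y. h x y u)) r * k u \<partial>U)"
proof -
 interpret U: sigma_finite_measure U by fact
 have p0: "0 < p" "0 < q" using r by (auto intro: less_le_trans[of 0 "ennreal r"])
 have pr: "1 <= p / ennreal r" "1 <= q / ennreal r"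
  using r divide_right_mono_ennreal[of "ennreal r" p "ennreal r"] divide_right_mono_ennreal[of "ennreal r" q "ennreal r"]
  by (auto simp: ennreal_divide_self)
 have pr0: "0 < p / ennreal r" "0 < q / ennreal r"
  using pr by (auto intro: less_le_trans[of 0 1])
 have [measurable]: "(%z. h (fst (fst z)) (snd (fst z)) (snd z)) \<in> borel_measurable ((M \<Otimes>\<^sub>M N) \<Otimes>\<^sub>M U)"
  using measurable_compose[OF _ h, of "%z. (fst (fst z), snd (fst z), snd z)" "(M \<Otimes>\<^sub>M N) \<Otimes>\<^sub>M U"]
  by simp
 have "epowr (mixed_norm p q M N f) r = mixed_norm (p / ennreal r) (q / ennreal r) M N (%x y. epowr (f x y) r)"
  by (rule mixed_norm_epowr[symmetric]) (use M p0 r in auto)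
 also have "... <= mixed_norm (p / ennreal r) (q / ennreal r) M N (%x y. \<integral>\<^sup>+ u. epowr (h x y u) r * k u \<partial>U)"
  by (rule mixed_norm_mono[OF M pr0 _ le]) measurable
 also have "... <= (\<integral>\<^sup>+ u. mixed_norm (p / ennreal r) (q / ennreal r) M N (%x y. epowr (h x y u) r * k u) \<partial>U)"
 proof (rule mixed_Minkowski[OF M N U pr])
  have [measurable]: "(%z. h (fst z) (fst (snd z)) (snd (snd z))) \<in> borel_measurable (M \<Otimes>\<^sub>M N \<Otimes>\<^sub>M U)"
   using h by (simp add: split_beta')
  show "(%(x, y, u). epowr (h x y u) r * k u) \<in> borel_measurable (M \<Otimes>\<^sub>M N \<Otimes>\<^sub>M U)"
   by measurable
 qed
 also have "... = (\<integral>\<^sup>+ u. epowr (mixed_norm p q M N (%x y. h x y u)) r * k u \<partial>U)"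
 proof (intro nn_integral_cong)
  fix u assume u: "u \<in> space U"
  have [measurable]: "(%(x, y). h x y u) \<in> borel_measurable (M \<Otimes>\<^sub>M N)"
   using measurable_compose[OF _ h, of "%z. (fst z, snd z, u)" "M \<Otimes>\<^sub>M N"] u
   by (simp add: split_beta')
  show "mixed_norm (p / ennreal r) (q / ennreal r) M N (%x y. epowr (h x y u) r * k u)
    = epowr (mixed_norm p q M N (%x y. h x y u)) r * k u"
   using mixed_norm_cmult[OF M pr0, of "%x y. epowr (h x y u) r" N "k u"]
    mixed_norm_epowr[OF M p0 r(1), of "%x y. h x y u" N]
   by (simp add: mult.commute)
 qed
 finally show ?thesis .
qed

subsection \<open>Sampling of slowly varying functions\<close>

text \<open>A tiling into cells of equal volume with one node for each cell. Nodes need not lie in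
  their cells, and the cells need not be translates of each other, so the notion is stable under
  shifts, reindexing and products.\<close>

definition sampling :: "real => real => ('i => 'a::euclidean_space) => bool" where
 "sampling v D \<nu> \<longleftrightarrow> 0 < v \<and> 0 <= D \<and> (\<exists>cell. (\<forall>k. {x. cell x = k} \<in> sets borel \<and>
  emeasure lborel {x. cell x = k} = ennreal v) \<and> (\<forall>x. norm (x - \<nu> (cell x)) <= D))"

text \<open>Tonelli's theorem for Lebesgue measure and the counting measure on the indices of the
  cells.\<close>

lemma nn_integral_cells:
 fixes cell :: "'a::euclidean_space => 'i::countable" and f :: "'a => ennreal"
 assumes cell: "!!k. {x. cell x = k} \<in> sets borel" and [measurable]: "f \<in> borel_measurable borel"
 shows "(\<integral>\<^sup>+ x. f x \<partial>lborel) = (\<integral>\<^sup>+ k. (\<integral>\<^sup>+ x. f x * indicator {x. cell x = k} x \<partial>lborel) \<partial>count_space UNIV)"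
proof -
 interpret pair_sigma_finite "lborel :: 'a measure" "count_space (UNIV :: 'i set)"
  by (simp add: pair_sigma_finite_def)
 have [measurable]: "cell \<in> borel \<rightarrow>\<^sub>M count_space UNIV"
 proof (rule measurableI)
  fix A :: "'i set"
  have "cell -` A = (\<Union>k\<in>A. {x. cell x = k})" by auto
  also have "... \<in> sets borel" using cell by (intro sets.countable_UN') auto
  finally show "cell -` A \<inter> space borel \<in> sets borel" by simp
 qed simp
 have "(\<integral>\<^sup>+ k. f x * indicator {cell x} k \<partial>count_space UNIV) = f x" for x by simp
 then have "(\<integral>\<^sup>+ x. f x \<partial>lborel) = (\<integral>\<^sup>+ x. (\<integral>\<^sup>+ k. f x * (if cell x = k then 1 else 0) \<partial>count_space UNIV) \<partial>lborel)"
  by (simp add: indicator_def of_bool_def eq_commute)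
 also have "... = (\<integral>\<^sup>+ k. (\<integral>\<^sup>+ x. f x * (if cell x = k then 1 else 0) \<partial>lborel) \<partial>count_space UNIV)"
  by (intro Fubini'[symmetric]) measurable
 also have "... = (\<integral>\<^sup>+ k. (\<integral>\<^sup>+ x. f x * indicator {x. cell x = k} x \<partial>lborel) \<partial>count_space UNIV)"
  by (simp add: indicator_def of_bool_def)
 finally show ?thesis .
qed

text \<open>The ratio v^(1/p) between the L^p norm of a function that is constant on cells of volume
  v and the l^p norm of its values.\<close>

definition cell_const :: "ennreal => real => ennreal" where
 "cell_const p v = (if p = top then 1 else ennreal (v powr (1 / enn2real p)))"

lemma cell_const_finite: "cell_const p v < top"
 by (simp add: cell_const_def)

lemma cell_const_pos: "0 < v ==> 0 < cell_const p v"
 by (simp add: cell_const_def)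

text \<open>On each cell F is comparable to its value at the node, with factor c in both directions;
  the step function of the node values is integrated exactly.\<close>

lemma sampling_Lp_norm:
 fixes \<nu> :: "'i::countable => 'a::euclidean_space"
 assumes \<nu>: "sampling v D \<nu>" and p: "0 < p"
  and [measurable]: "F \<in> borel_measurable borel"
  and osc: "!!x y. norm (x - y) <= D ==> F x <= c * F y"
 shows sampling_Lp_norm_le: "Lp_norm p lborel F <= cell_const p v * c * lp p (%k. F (\<nu> k))"
  and sampling_Lp_norm_ge: "cell_const p v * lp p (%k. F (\<nu> k)) <= c * Lp_norm p lborel F"
proof -
 obtain cell where v: "0 < v" and cell: "!!k. {x. cell x = k} \<in> sets borel"
  and vol: "!!k. emeasure lborel {x. cell x = k} = ennreal v" and D: "!!x. norm (x - \<nu> (cell x)) <= D"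
  using \<nu> by (auto simp: sampling_def)
 note [measurable] = cell
 have ub: "F x <= c * F (\<nu> (cell x))" and lb: "F (\<nu> (cell x)) <= c * F x" for x
  using D[of x] osc by (auto simp: norm_minus_commute)
 from p have "Lp_norm p lborel F <= cell_const p v * c * lp p (%k. F (\<nu> k)) \<and>
  cell_const p v * lp p (%k. F (\<nu> k)) <= c * Lp_norm p lborel F"
 proof (cases rule: exponent_cases)
  case (1 P)
  have cc: "cell_const p v = epowr (ennreal v) (1 / P)" using 1 v by (simp add: cell_const_def epowr_ennreal)
  have int: "(\<integral>\<^sup>+ x. a * indicator {x. cell x = k} x \<partial>lborel) = ennreal v * a" for a k
   by (simp add: nn_integral_cmult_indicator vol mult.commute)
  have "(\<integral>\<^sup>+ x. epowr (F x) P \<partial>lborel)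
    = (\<integral>\<^sup>+ k. (\<integral>\<^sup>+ x. epowr (F x) P * indicator {x. cell x = k} x \<partial>lborel) \<partial>count_space UNIV)"
   by (intro nn_integral_cells cell) measurable
  also have "... <= (\<integral>\<^sup>+ k. (\<integral>\<^sup>+ x. epowr (c * F (\<nu> k)) P * indicator {x. cell x = k} x \<partial>lborel) \<partial>count_space UNIV)"
   using 1 ub by (intro nn_integral_mono) (auto simp: indicator_def intro!: epowr_mono)
  also have "... = ennreal v * (epowr c P * (\<integral>\<^sup>+ k. epowr (F (\<nu> k)) P \<partial>count_space UNIV))"
   using 1 by (simp add: int nn_integral_cmult epowr_mult)
  finally have A: "(\<integral>\<^sup>+ x. epowr (F x) P \<partial>lborel) <= ennreal v * (epowr c P * (\<integral>\<^sup>+ k. epowr (F (\<nu> k)) P \<partial>count_space UNIV))" .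
  have "ennreal v * (\<integral>\<^sup>+ k. epowr (F (\<nu> k)) P \<partial>count_space UNIV)
   = (\<integral>\<^sup>+ k. (\<integral>\<^sup>+ x. epowr (F (\<nu> k)) P * indicator {x. cell x = k} x \<partial>lborel) \<partial>count_space UNIV)"
   by (simp add: int nn_integral_cmult)
  also have "... <= (\<integral>\<^sup>+ k. (\<integral>\<^sup>+ x. epowr (c * F x) P * indicator {x. cell x = k} x \<partial>lborel) \<partial>count_space UNIV)"
   using 1 lb by (intro nn_integral_mono) (auto simp: indicator_def intro!: epowr_mono)
  also have "... = (\<integral>\<^sup>+ x. epowr (c * F x) P \<partial>lborel)"
   by (intro nn_integral_cells[symmetric] cell) measurable
  also have "... = epowr c P * (\<integral>\<^sup>+ x. epowr (F x) P \<partial>lborel)"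
   using 1 by (simp add: nn_integral_cmult epowr_mult)
  finally have B: "ennreal v * (\<integral>\<^sup>+ k. epowr (F (\<nu> k)) P \<partial>count_space UNIV) <= epowr c P * (\<integral>\<^sup>+ x. epowr (F x) P \<partial>lborel)" .
  show ?thesis
   using epowr_mono[OF _ A, of "1/P"] epowr_mono[OF _ B, of "1/P"] 1
   by (simp add: cc[unfolded 1(2)] Lp_norm_ennreal epowr_mult epowr_inv mult.assoc)
 next
  case 2
  have "esssup lborel F <= c * (SUP k. F (\<nu> k))"
   by (intro esssup_I AE_I2 order_trans[OF ub] mult_left_mono SUP_upper) auto
  \<comment> \<open>A node value above the bound would exclude almost every point of its cell, but
    cells have positive volume.\<close>
  moreover have "F (\<nu> k) <= c * esssup lborel F" for k
  proof (rule ccontr)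
   assume neg: "\<not> F (\<nu> k) <= c * esssup lborel F"
   have "AE x in lborel. x \<notin> {x. cell x = k}"
    using esssup_AE[of F lborel]
   proof eventually_elim
    case (elim x)
    show ?case
    proof
     assume "x \<in> {x. cell x = k}"
     then have "F (\<nu> k) <= c * F x" using lb[of x] by simp
     also have "... <= c * esssup lborel F" using elim by (rule mult_left_mono) simp
     finally show False using neg by simp
    qed
   qed
   then have "emeasure lborel {x. cell x = k} = 0"
    by (subst (asm) AE_iff_measurable[OF _ refl]) auto
   then show False using vol[of k] v by simp
  qed
  ultimately show ?thesis using 2
   by (auto simp: Lp_norm_top esssup_count cell_const_def SUP_least)
 qed
 then show "Lp_norm p lborel F <= cell_const p v * c * lp p (%k. F (\<nu> k))"
  "cell_const p v * lp p (%k. F (\<nu> k)) <= c * Lp_norm p lborel F" by auto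
qed

text \<open>The inner nodes \<open>\<nu>1 j\<close> may depend on the outer index: later the points
  at which z is sampled are shifted according to the sample of \<zeta>. One factor c is lost in each
  variable.\<close>

lemma sampling_mixed_norm:
 fixes \<nu>1 :: "'j::countable => 'i::countable => 'a::euclidean_space" and \<nu>2 :: "'j => 'b::euclidean_space"
 assumes \<nu>: "!!j. sampling v1 D1 (\<nu>1 j)" "sampling v2 D2 \<nu>2" and p: "0 < p" and q: "0 < q"
  and F[measurable]: "(%(x, y). F x y) \<in> borel_measurable (borel \<Otimes>\<^sub>M borel)"
  and osc: "!!x x' y y'. norm (x - x') <= D1 ==> norm (y - y') <= D2 ==> F x y <= c * F x' y'"
 shows "mixed_norm p q lborel lborel F
   <= cell_const p v1 * cell_const q v2 * c ^ 2 * lp q (%j. lp p (%i. F (\<nu>1 j i) (\<nu>2 j)))" (is ?A)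
  and "cell_const p v1 * cell_const q v2 * lp q (%j. lp p (%i. F (\<nu>1 j i) (\<nu>2 j)))
   <= c ^ 2 * mixed_norm p q lborel lborel F" (is ?B)
proof -
 define H where "H = (%y. Lp_norm p lborel (%x. F x y))"
 have D: "0 <= D1" "0 <= D2" using \<nu> by (auto simp: sampling_def)
 have sec[measurable]: "(%x. F x y) \<in> borel_measurable borel" for y by measurable
 have [measurable]: "H \<in> borel_measurable borel"
  using measurable_Lp_norm[of lborel p F borel] p by (simp add: H_def)
 have Hosc: "H y <= c * H y'" if "norm (y - y') <= D2" for y y'
 proof -
  have "H y <= Lp_norm p lborel (%x. c * F x y')"
   unfolding H_def using p D osc that by (intro Lp_norm_mono) auto
  then show ?thesis using p by (simp add: H_def Lp_norm_cmult)
 qed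
 have oscx: "F x y <= c * F x' y" if "norm (x - x') <= D1" for x x' y
  using osc[OF that, of y y] D by simp
 have "Lp_norm q lborel H <= cell_const q v2 * c * lp q (%j. H (\<nu>2 j))"
  by (rule sampling_Lp_norm_le[OF \<nu>(2) q _ Hosc]) auto
 also have "... <= cell_const q v2 * c * lp q (%j. cell_const p v1 * c * lp p (%i. F (\<nu>1 j i) (\<nu>2 j)))"
  unfolding H_def by (intro mult_left_mono lp_mono q sampling_Lp_norm_le[OF \<nu>(1) p _ oscx]) auto
 finally show ?A
  by (simp add: lp_cmult q mixed_norm_def H_def power2_eq_square mult_ac)
 have "cell_const p v1 * cell_const q v2 * lp q (%j. lp p (%i. F (\<nu>1 j i) (\<nu>2 j)))
  = cell_const q v2 * lp q (%j. cell_const p v1 * lp p (%i. F (\<nu>1 j i) (\<nu>2 j)))"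
  by (simp add: lp_cmult q mult_ac)
 also have "... <= cell_const q v2 * lp q (%j. c * H (\<nu>2 j))"
  unfolding H_def by (intro mult_left_mono lp_mono q sampling_Lp_norm_ge[OF \<nu>(1) p _ oscx]) auto
 also have "... = c * (cell_const q v2 * lp q (%j. H (\<nu>2 j)))"
  by (simp add: lp_cmult q mult_ac)
 also have "... <= c * (c * Lp_norm q lborel H)"
  by (intro mult_left_mono sampling_Lp_norm_ge[OF \<nu>(2) q _ Hosc]) auto
 finally show ?B
  by (simp add: mixed_norm_def H_def power2_eq_square mult_ac)
qed

lemma sampling_shift: "sampling v D \<nu> ==> sampling v D (%k. \<nu> k + s)"
proof -
 assume "sampling v D \<nu>"
 then obtain cell where v: "0 < v" "0 <= D" and cell: "!!k. {x. cell x = k} \<in> sets borel"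
  and vol: "!!k. emeasure lborel {x. cell x = k} = ennreal v" and D: "!!x. norm (x - \<nu> (cell x)) <= D"
  by (auto simp: sampling_def)
 show ?thesis
  unfolding sampling_def
 proof (intro conjI v exI[of _ "%x. cell (x - s)"] allI)
  fix k
  have eq: "{x. cell (x - s) = k} = (%x. x - s) -` {x. cell x = k} \<inter> space borel" by auto
  show "{x. cell (x - s) = k} \<in> sets borel" unfolding eq by (rule measurable_sets[OF _ cell]) measurable
  have "emeasure lborel {x. cell x = k} = emeasure (distr lborel borel ((+) (- s))) {x. cell x = k}"
   by (simp add: lborel_distr_plus)
  also have "... = emeasure lborel {x. cell (x - s) = k}"
   using cell by (subst emeasure_distr) (auto intro!: arg_cong[where f="emeasure lborel"] simp: add.commute)
  finally show "emeasure lborel {x. cell (x - s) = k} = ennreal v" using vol by simp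
 next
  fix x show "norm (x - (\<nu> (cell (x - s)) + s)) <= D" using D[of "x - s"] by (simp add: algebra_simps)
 qed
qed

lemma sampling_bij: "sampling v D \<nu> ==> bij \<pi> ==> sampling v D (%k. \<nu> (\<pi> k))"
proof -
 assume "sampling v D \<nu>" and \<pi>: "bij \<pi>"
 then obtain cell where v: "0 < v" "0 <= D" and cell: "!!k. {x. cell x = k} \<in> sets borel"
  and vol: "!!k. emeasure lborel {x. cell x = k} = ennreal v" and D: "!!x. norm (x - \<nu> (cell x)) <= D"
  by (auto simp: sampling_def)
 have eq: "{x. inv \<pi> (cell x) = k} = {x. cell x = \<pi> k}" for k
  using \<pi> by (auto simp: bij_inv_eq_iff eq_commute)
 show ?thesis
  unfolding sampling_def
  by (intro conjI v exI[of _ "%x. inv \<pi> (cell x)"] allI)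
   (use \<pi> cell vol D in \<open>auto simp: eq bij_is_surj surj_f_inv_f\<close>)
qed

lemma sampling_pair:
 fixes \<nu>1 :: "'i => 'a::euclidean_space" and \<nu>2 :: "'j => 'b::euclidean_space"
 assumes "sampling v1 D1 \<nu>1" "sampling v2 D2 \<nu>2"
 shows "sampling (v1 * v2) (D1 + D2) (%(k, n). (\<nu>1 k, \<nu>2 n))"
proof -
 obtain cell1 where v1: "0 < v1" "0 <= D1" and cell1: "!!k. {x. cell1 x = k} \<in> sets borel"
  and vol1: "!!k. emeasure lborel {x. cell1 x = k} = ennreal v1" and D1: "!!x. norm (x - \<nu>1 (cell1 x)) <= D1"
  using assms(1) by (auto simp: sampling_def)
 obtain cell2 where v2: "0 < v2" "0 <= D2" and cell2: "!!k. {x. cell2 x = k} \<in> sets borel"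
  and vol2: "!!k. emeasure lborel {x. cell2 x = k} = ennreal v2" and D2: "!!x. norm (x - \<nu>2 (cell2 x)) <= D2"
  using assms(2) by (auto simp: sampling_def)
 show ?thesis
  unfolding sampling_def
 proof (intro conjI exI[of _ "%(x, y). (cell1 x, cell2 y)"] allI)
  fix k :: "'i \<times> 'j"
  have eq: "{x. (case x of (x, y) => (cell1 x, cell2 y)) = k} = {x. cell1 x = fst k} \<times> {y. cell2 y = snd k}"
   by auto
  show "{x. (case x of (x, y) => (cell1 x, cell2 y)) = k} \<in> sets borel"
   unfolding eq borel_prod[symmetric] by (intro pair_measureI cell1 cell2)
  show "emeasure lborel {x. (case x of (x, y) => (cell1 x, cell2 y)) = k} = ennreal (v1 * v2)"
   unfolding eq lborel_prod[symmetric]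
   using v1 v2 cell1 cell2 by (subst lborel.emeasure_pair_measure_Times) (auto simp: vol1 vol2 ennreal_mult)
 next
  fix z :: "'a \<times> 'b"
  show "norm (z - (case case z of (x, y) => (cell1 x, cell2 y) of (k, n) => (\<nu>1 k, \<nu>2 n))) <= D1 + D2"
   using D1[of "fst z"] D2[of "snd z"]
   by (cases z) (auto intro: order_trans[OF norm_Pair_le])
 qed (use v1 v2 in auto)
qed

text \<open>The cells are half-open cubes of side c with the lattice point as lower corner, and the
  distance is estimated in the l^1 norm.\<close>

lemma sampling_lattice:
 assumes "0 < c"
 shows "sampling (c ^ CARD('d)) (c * CARD('d)) (%k :: int^'d. c *\<^sub>R lattice_pt k)"
 unfolding sampling_def
proof (intro conjI exI[of _ "%x :: real^'d. \<chi> i. \<lfloor>x $ i / c\<rfloor>"] allI)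
 fix k :: "int^'d"
 let ?S = "{x :: real^'d. (\<chi> i. \<lfloor>x $ i / c\<rfloor>) = k}"
 let ?a = "c *\<^sub>R lattice_pt k" and ?b = "c *\<^sub>R (lattice_pt k + (\<chi> i. 1)) :: real^'d"
 have S: "?S = {x. \<forall>i. c * real_of_int (k $ i) <= x $ i \<and> x $ i < c * real_of_int (k $ i) + c}"
  using assms by (auto simp: vec_eq_iff floor_eq_iff field_simps)
 have [measurable]: "?S \<in> sets borel"
 proof -
  have "?S = (\<Inter>i. {x. c * real_of_int (k $ i) <= x $ i} \<inter> {x. x $ i < c * real_of_int (k $ i) + c})"
   unfolding S by auto
  also have "... \<in> sets borel"
   by (intro sets.finite_INT sets.Int) (auto intro!: borel_closed borel_open closed_Collect_le open_Collect_less continuous_intros)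
  finally show ?thesis .
 qed
 then show "?S \<in> sets borel" .
 \<comment> \<open>The cell lies between an open and a closed box of the same volume.\<close>
 have sub: "box ?a ?b \<subseteq> ?S" "?S \<subseteq> cbox ?a ?b"
  unfolding S by (auto simp: mem_box_cart lattice_pt_def algebra_simps less_imp_le)
 have "measure lborel (cbox ?a ?b) = (\<Prod>i\<in>UNIV. ?b $ i - ?a $ i)"
  using assms by (intro content_cbox_cart) (auto simp: interval_eq_empty_cart not_less algebra_simps)
 also have "... = c ^ CARD('d)" by (simp add: algebra_simps)
 finally have vol: "measure lborel (cbox ?a ?b) = c ^ CARD('d)" .
 have e1: "emeasure lborel (cbox ?a ?b) = ennreal (c ^ CARD('d))"
  using vol by (metis emeasure_eq_ennreal_measure emeasure_lborel_cbox_finite less_irrefl infinity_ennreal_def)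
 have e2: "emeasure lborel (box ?a ?b) = emeasure lborel (cbox ?a ?b)"
  by (simp add: emeasure_lborel_box_eq emeasure_lborel_cbox_eq)
 show "emeasure lborel ?S = ennreal (c ^ CARD('d))"
  using emeasure_mono[OF sub(1), of lborel] emeasure_mono[OF sub(2), of lborel] e1 e2 by auto
next
 fix x :: "real^'d"
 have "norm (x - c *\<^sub>R lattice_pt (\<chi> i. \<lfloor>x $ i / c\<rfloor>)) <= (\<Sum>i\<in>UNIV. \<bar>(x - c *\<^sub>R lattice_pt (\<chi> i. \<lfloor>x $ i / c\<rfloor>)) $ i\<bar>)"
  by (rule norm_le_l1_cart)
 also have "... <= (\<Sum>i\<in>(UNIV::'d set). c)"
 proof (intro sum_mono)
  fix i :: 'd
  have "real_of_int \<lfloor>x $ i / c\<rfloor> <= x $ i / c" "x $ i / c < real_of_int \<lfloor>x $ i / c\<rfloor> + 1" by linarith+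
  then have "c * real_of_int \<lfloor>x $ i / c\<rfloor> <= x $ i" "x $ i < c * real_of_int \<lfloor>x $ i / c\<rfloor> + c"
   using assms mult_left_mono[of "real_of_int \<lfloor>x $ i / c\<rfloor>" "x $ i / c" c]
    mult_strict_left_mono[of "x $ i / c" "real_of_int \<lfloor>x $ i / c\<rfloor> + 1" c] by (auto simp: distrib_left)
  then show "\<bar>(x - c *\<^sub>R lattice_pt (\<chi> i. \<lfloor>x $ i / c\<rfloor>)) $ i\<bar> <= c" by (simp add: lattice_pt_def)
 qed
 finally show "norm (x - c *\<^sub>R lattice_pt (\<chi> i. \<lfloor>x $ i / c\<rfloor>)) <= c * CARD('d)" by (simp add: mult.commute)
qed (use assms in auto)

subsection \<open>Moderate weights\<close>

definition moderate :: "nat => ('a::real_normed_vector => real) => bool" where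
 "moderate L F \<longleftrightarrow> (\<forall>x. 0 <= F x) \<and> (\<forall>x y. F y <= (1 + norm (x - y)) ^ L * F x)"

lemma moderateD: "moderate L F ==> 0 <= F x" "moderate L F ==> F y <= (1 + norm (x - y)) ^ L * F x"
 by (auto simp: moderate_def)

lemma moderate_add_le: "moderate L F ==> F (x + y) <= (1 + norm x) ^ L * F y"
 using moderateD(2)[of L F "x + y" y] by simp

text \<open>The defining inequality has no multiplicative constant, so its factor tends to 1 as y
  approaches x and squeezes F y towards F x from both sides.\<close>

lemma moderate_continuous:
 assumes "moderate L F" shows "continuous_on UNIV F"
proof -
 have "isCont F x" for x
  unfolding isCont_def
 proof (rule tendsto_sandwich)
  let ?w = "%y. (1 + norm (x - y)) ^ L"
  have pos: "0 < ?w y" for y by (simp add: add_pos_nonneg)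
  show "\<forall>\<^sub>F y in at x. F y <= ?w y * F x"
   using assms by (auto simp: moderateD)
  show "\<forall>\<^sub>F y in at x. F x / ?w y <= F y"
   using moderateD(2)[OF assms, of x] pos by (auto simp: divide_le_eq norm_minus_commute mult.commute)
  have w: "(?w \<longlongrightarrow> 1) (at x)"
   by (rule tendsto_eq_intros refl | simp)+
  show "((%y. ?w y * F x) \<longlongrightarrow> F x) (at x)"
   by (rule tendsto_eq_intros w | simp)+
  show "((%y. F x / ?w y) \<longlongrightarrow> F x) (at x)"
   by (rule tendsto_eq_intros w | simp)+
 qed
 then show ?thesis by (simp add: continuous_at_imp_continuous_on)
qed

lemma moderate_measurable: "moderate L (F :: 'a::euclidean_space => real) ==> F \<in> borel_measurable borel"
 by (intro borel_measurable_continuous_onI moderate_continuous)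

lemma one_add_norm_mult: "1 + norm (x + y) <= (1 + norm x) * (1 + norm y)"
 by (auto simp: algebra_simps intro: order_trans[OF norm_triangle_ineq])

lemma one_add_norm_diff: "1 + norm (x - y) <= (1 + norm (x - z)) * (1 + norm (z - y))"
 using one_add_norm_mult[of "x - z" "z - y"] by simp

text \<open>The supremum of \<omega> y / (1 + norm (x - y))^N over y is comparable to \<omega>, and
  it satisfies the moderate inequality with constant 1 because 1 + norm is submultiplicative. This
  regularization removes the constant and makes the weight continuous.\<close>

lemma poly_weight_moderate:
 assumes "poly_weight \<omega>"
 obtains \<omega>' L C where "moderate L \<omega>'" "0 < C" "!!x. \<omega> x <= \<omega>' x" "!!x. \<omega>' x <= C * \<omega> x"
proof -
 obtain v K N C0 where nn: "!!z. 0 <= \<omega> z" and v: "!!z. 0 <= v z" "!!z. v z <= K * (1 + norm z) ^ (N::nat)"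
  and C0: "!!z w. \<omega> (z + w) <= C0 * v z * \<omega> w"
  using assms by (auto simp: poly_weight_def)
 define C where "C = max 1 (\<bar>C0\<bar> * \<bar>K\<bar>)"
 have le: "\<omega> y <= C * (1 + norm (x - y)) ^ N * \<omega> x" for x y
 proof -
  have "\<omega> y <= C0 * v (y - x) * \<omega> x" using C0[of "y - x" x] by simp
  also have "... <= \<bar>C0\<bar> * (\<bar>K\<bar> * (1 + norm (y - x)) ^ N) * \<omega> x"
  proof (intro mult_right_mono nn)
   have "v (y - x) <= \<bar>K\<bar> * (1 + norm (y - x)) ^ N"
    by (rule order_trans[OF v(2)]) (auto intro!: mult_right_mono)
   then show "C0 * v (y - x) <= \<bar>C0\<bar> * (\<bar>K\<bar> * (1 + norm (y - x)) ^ N)"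
    by (intro mult_mono v) auto
  qed
  also have "... = (\<bar>C0\<bar> * \<bar>K\<bar>) * ((1 + norm (y - x)) ^ N * \<omega> x)" by simp
  also have "... <= C * ((1 + norm (y - x)) ^ N * \<omega> x)"
   by (intro mult_right_mono) (auto simp: C_def nn)
  finally show ?thesis by (simp add: norm_minus_commute mult.assoc)
 qed
 define \<omega>' where "\<omega>' = (%x. SUP y. \<omega> y / (1 + norm (x - y)) ^ N)"
 have pos: "0 < 1 + norm x" for x :: 'a by (simp add: add_pos_nonneg)
 have bnd: "\<omega> y / (1 + norm (x - y)) ^ N <= C * \<omega> x" for x y
  using le[of y x] pos[of "x - y"] by (simp add: divide_le_eq mult_ac)
 have bdd: "bdd_above (range (%y. \<omega> y / (1 + norm (x - y)) ^ N))" for x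
  using bnd[of _ x] by (auto intro!: bdd_aboveI)
 show ?thesis
 proof
  show "0 < C" by (simp add: C_def)
  show up: "\<omega> x <= \<omega>' x" for x
   unfolding \<omega>'_def by (rule cSUP_upper2[OF bdd, of x]) auto
  show "\<omega>' x <= C * \<omega> x" for x unfolding \<omega>'_def by (intro cSUP_least bnd) auto
  show "moderate N \<omega>'"
   unfolding moderate_def
  proof (intro conjI allI)
   fix x y :: 'a
   show "0 <= \<omega>' x" using nn up order_trans by blast
   show "\<omega>' y <= (1 + norm (x - y)) ^ N * \<omega>' x"
   proof (subst (1) \<omega>'_def, rule cSUP_least)
    fix z
    have "(1 + norm (x - z)) ^ N <= ((1 + norm (x - y)) * (1 + norm (y - z))) ^ N"
     by (intro power_mono one_add_norm_diff) (simp add: add_nonneg_nonneg)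
    then have "(1 + norm (x - z)) ^ N * \<omega> z <= (1 + norm (x - y)) ^ N * (1 + norm (y - z)) ^ N * \<omega> z"
     using nn by (intro mult_right_mono) (auto simp: power_mult_distrib)
    then have "\<omega> z / (1 + norm (y - z)) ^ N <= (1 + norm (x - y)) ^ N * (\<omega> z / (1 + norm (x - z)) ^ N)"
     using pos[of "y - z"] pos[of "x - z"] by (simp add: field_simps)
    also have "... <= (1 + norm (x - y)) ^ N * \<omega>' x"
     unfolding \<omega>'_def by (intro mult_left_mono cSUP_upper bdd) (auto simp: add_nonneg_nonneg)
    finally show "\<omega> z / (1 + norm (y - z)) ^ N <= (1 + norm (x - y)) ^ N * \<omega>' x" .
   qed simp
  qed
 qed
qed

lemma Lp_norm_lebesgue:
 assumes "f \<in> borel_measurable borel"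
 shows "Lp_norm p lebesgue f = Lp_norm p lborel f"
 using assms by (simp add: Lp_norm_def nn_integral_completion esssup_eq_AE AE_completion_iff measurable_completion)

text \<open>The spaces are defined by Lebesgue measure and weights that are only Lebesgue
  measurable, while the arguments with product measures concern Borel functions. At fixed y the
  inner norm is a Borel function of y times \<mu> y, so the outer integrand is measurable for the
  original weights as well.\<close>

lemma mixed_norm_lebesgue:
 fixes v :: "'a::euclidean_space => 'b::euclidean_space => real"
 assumes v[measurable]: "(%(x, y). v x y) \<in> borel_measurable (borel \<Otimes>\<^sub>M borel)" and v0: "!!x y. 0 <= v x y"
  and meas: "\<omega> \<in> borel_measurable lebesgue" "\<mu> \<in> borel_measurable lebesgue"
  and nn: "!!x. 0 <= \<omega> x" "!!y. 0 <= \<mu> y"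
  and meas'[measurable]: "\<omega>' \<in> borel_measurable borel" "\<mu>' \<in> borel_measurable borel"
  and le: "!!x. \<omega> x <= \<omega>' x" "!!y. \<mu> y <= \<mu>' y"
  and ge: "!!x. \<omega>' x <= C * \<omega> x" "!!y. \<mu>' y <= D * \<mu> y" and CD: "0 < C" "0 < D"
  and p: "0 < p" and q: "0 < q"
 shows "mixed_norm p q lebesgue lebesgue (%x y. ennreal (v x y * (\<omega> x * \<mu> y)))
   <= mixed_norm p q lborel lborel (%x y. ennreal (v x y * (\<omega>' x * \<mu>' y)))" (is ?A)
  and "mixed_norm p q lborel lborel (%x y. ennreal (v x y * (\<omega>' x * \<mu>' y)))
   <= ennreal (C * D) * mixed_norm p q lebesgue lebesgue (%x y. ennreal (v x y * (\<omega> x * \<mu> y)))" (is ?B)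
proof -
 have [measurable]: "(%x. v x y) \<in> borel_measurable borel" for y by measurable
 have vl[measurable]: "(%x. v x y) \<in> borel_measurable lebesgue" for y
  by (rule measurable_completion) simp
 note meas[measurable]
 have nn': "0 <= \<omega>' x" "0 <= \<mu>' y" for x y using le nn order_trans by blast+
 \<comment> \<open>A Borel function equal to \<omega> almost everywhere does not change the inner
   norm and makes it a Borel function of y.\<close>
 obtain \<omega>0 where \<omega>0[measurable]: "\<omega>0 \<in> borel_measurable lborel" and AE: "AE x in lborel. ennreal (\<omega> x) = \<omega>0 x"
  using completion_ex_borel_measurable[of "%x. ennreal (\<omega> x)" lborel] by auto
 have \<omega>0l[measurable]: "\<omega>0 \<in> borel_measurable lebesgue" by (rule measurable_completion) simp
 define I where "I = (%y. Lp_norm p lborel (%x. ennreal (v x y) * \<omega>0 x))"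
 have "I \<in> borel_measurable borel"
  unfolding I_def by (intro measurable_Lp_norm p) (auto simp: split_beta')
 then have Il[measurable]: "I \<in> borel_measurable lebesgue"
  by (intro measurable_completion) simp
 have inner: "Lp_norm p lebesgue (%x. ennreal (v x y * (\<omega> x * \<mu> y))) = I y * ennreal (\<mu> y)" for y
 proof -
  have "Lp_norm p lebesgue (%x. ennreal (v x y * (\<omega> x * \<mu> y)))
    = Lp_norm p lebesgue (%x. (ennreal (v x y) * \<omega>0 x) * ennreal (\<mu> y))"
  proof (rule Lp_norm_cong_AE[OF p])
   have "AE x in lebesgue. ennreal (\<omega> x) = \<omega>0 x" using AE by (rule AE_completion)
   then show "AE x in lebesgue. ennreal (v x y * (\<omega> x * \<mu> y)) = ennreal (v x y) * \<omega>0 x * ennreal (\<mu> y)"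
    by eventually_elim (simp add: ennreal_mult v0 nn mult.assoc)
  qed measurable
  also have "... = Lp_norm p lebesgue (%x. ennreal (v x y) * \<omega>0 x) * ennreal (\<mu> y)"
   by (rule Lp_norm_multc[OF p]) measurable
  also have "Lp_norm p lebesgue (%x. ennreal (v x y) * \<omega>0 x) = I y"
   unfolding I_def by (rule Lp_norm_lebesgue) (use \<omega>0 in measurable)
  finally show ?thesis .
 qed
 define J where "J = (%y. Lp_norm p lborel (%x. ennreal (v x y * (\<omega>' x * \<mu>' y))))"
 have J_meas: "J \<in> borel_measurable borel"
  unfolding J_def by (intro measurable_Lp_norm p) (auto simp: split_beta')
 have J_leb: "J y = Lp_norm p lebesgue (%x. ennreal (v x y * (\<omega>' x * \<mu>' y)))" for y
  unfolding J_def by (rule Lp_norm_lebesgue[symmetric]) measurable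
 have wl[measurable]: "\<omega>' \<in> borel_measurable lebesgue" by (rule measurable_completion) simp
 have "Lp_norm p lebesgue (%x. ennreal (v x y * (\<omega> x * \<mu> y))) <= J y" for y
  unfolding J_leb
  by (rule Lp_norm_mono[OF p]) (auto intro!: ennreal_leI mult_left_mono mult_mono le v0 nn nn')
 then have "mixed_norm p q lebesgue lebesgue (%x y. ennreal (v x y * (\<omega> x * \<mu> y))) <= Lp_norm q lebesgue J"
  unfolding mixed_norm_def
  by (intro Lp_norm_mono[OF q]) (unfold inner, measurable)
 then show ?A using J_meas by (simp add: Lp_norm_lebesgue mixed_norm_def J_def)
 have JI: "J y <= ennreal (C * D) * (I y * ennreal (\<mu> y))" for y
 proof -
  have "J y <= Lp_norm p lebesgue (%x. ennreal (C * D) * ennreal (v x y * (\<omega> x * \<mu> y)))"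
   unfolding J_leb
  proof (rule Lp_norm_mono[OF p])
   fix x
   have "\<omega>' x * \<mu>' y <= (C * \<omega> x) * (D * \<mu> y)" using nn' nn CD by (intro mult_mono ge) auto
   then have "v x y * (\<omega>' x * \<mu>' y) <= v x y * ((C * \<omega> x) * (D * \<mu> y))" by (intro mult_left_mono v0)
   then show "ennreal (v x y * (\<omega>' x * \<mu>' y)) <= ennreal (C * D) * ennreal (v x y * (\<omega> x * \<mu> y))"
    using CD v0 nn by (simp add: ennreal_leI mult_ac flip: ennreal_mult)
  qed measurable
  also have "... = ennreal (C * D) * (I y * ennreal (\<mu> y))"
   by (subst Lp_norm_cmult[OF p]) (auto simp: inner)
  finally show ?thesis .
 qed
 have "mixed_norm p q lborel lborel (%x y. ennreal (v x y * (\<omega>' x * \<mu>' y))) = Lp_norm q lebesgue J"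
  using J_meas by (simp add: Lp_norm_lebesgue mixed_norm_def J_def)
 also have "... <= Lp_norm q lebesgue (%y. ennreal (C * D) * (I y * ennreal (\<mu> y)))"
  using J_meas JI by (intro Lp_norm_mono[OF q] measurable_completion) auto
 also have "... = ennreal (C * D) * Lp_norm q lebesgue (%y. I y * ennreal (\<mu> y))"
  by (rule Lp_norm_cmult[OF q]) measurable
 finally show ?B by (simp add: mixed_norm_def inner)
qed

subsection \<open>Fourier and short-time Fourier transforms\<close>

lemma measurable_cis [measurable (raw)]:
 assumes "f \<in> borel_measurable M" shows "(%x. cis (f x)) \<in> borel_measurable M"
 by (rule measurable_compose[OF assms]) (intro borel_measurable_continuous_onI continuous_intros)

lemma nn_integral_affine:
 fixes f :: "'a::euclidean_space => ennreal"
 assumes [measurable]: "f \<in> borel_measurable borel" and c: "c \<noteq> 0"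
 shows "(\<integral>\<^sup>+ x. f x \<partial>lborel) = ennreal (\<bar>c\<bar> ^ DIM('a)) * (\<integral>\<^sup>+ x. f (t + c *\<^sub>R x) \<partial>lborel)"
 by (subst lborel_affine[OF c, of t]) (simp add: nn_integral_density nn_integral_distr nn_integral_cmult)

lemma integral_affine:
 fixes f :: "'a::euclidean_space => 'b::{banach, second_countable_topology}"
 assumes [measurable]: "f \<in> borel_measurable borel" and c: "c \<noteq> 0"
 shows "integral\<^sup>L lborel f = \<bar>c\<bar> ^ DIM('a) *\<^sub>R (\<integral> x. f (t + c *\<^sub>R x) \<partial>lborel)"
 by (subst lborel_affine[OF c, of t]) (simp add: integral_density integral_distr)

lemma integrable_affine:
 fixes f :: "'a::euclidean_space => 'b::{banach, second_countable_topology}"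
 assumes "integrable lborel f" and c: "c \<noteq> 0"
 shows "integrable lborel (%x. f (t + c *\<^sub>R x))"
proof -
 have [measurable]: "f \<in> borel_measurable borel" using assms(1) by auto
 have "integrable (density (distr lborel borel (%x. t + c *\<^sub>R x)) (%_. \<bar>c\<bar> ^ DIM('a))) f"
  using assms(1) by (subst (asm) lborel_affine[OF c, of t])
 then show ?thesis
  using c integrable_scaleR_right[of "1 / \<bar>c\<bar> ^ DIM('a)" lborel "%x. \<bar>c\<bar> ^ DIM('a) *\<^sub>R f (t + c *\<^sub>R x)"]
  by (simp add: integrable_density integrable_distr_eq)
qed

lemma nn_integral_shift:
 fixes f :: "'a::euclidean_space => ennreal"
 assumes "f \<in> borel_measurable borel"
 shows "(\<integral>\<^sup>+ x. f (x + t) \<partial>lborel) = (\<integral>\<^sup>+ x. f x \<partial>lborel)" "(\<integral>\<^sup>+ x. f (x - t) \<partial>lborel) = (\<integral>\<^sup>+ x. f x \<partial>lborel)"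
  "(\<integral>\<^sup>+ x. f (t - x) \<partial>lborel) = (\<integral>\<^sup>+ x. f x \<partial>lborel)"
 using nn_integral_affine[OF assms, of 1 t] nn_integral_affine[OF assms, of 1 "- t"] nn_integral_affine[OF assms, of "- 1" t]
 by (simp_all add: add.commute)

lemma integral_shift:
 fixes f :: "'a::euclidean_space => 'b::{banach, second_countable_topology}"
 assumes "f \<in> borel_measurable borel"
 shows "(\<integral> x. f (x + t) \<partial>lborel) = (\<integral> x. f x \<partial>lborel)" "(\<integral> x. f (x - t) \<partial>lborel) = (\<integral> x. f x \<partial>lborel)"
  "(\<integral> x. f (t - x) \<partial>lborel) = (\<integral> x. f x \<partial>lborel)"
 using integral_affine[OF assms, of 1 t] integral_affine[OF assms, of 1 "- t"] integral_affine[OF assms, of "- 1" t]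
 by (simp_all add: add.commute)

lemma integrable_shift:
 fixes f :: "'a::euclidean_space => 'b::{banach, second_countable_topology}"
 assumes "integrable lborel f"
 shows "integrable lborel (%x. f (x + t))" "integrable lborel (%x. f (x - t))" "integrable lborel (%x. f (t - x))"
 using integrable_affine[OF assms, of 1 t] integrable_affine[OF assms, of 1 "- t"] integrable_affine[OF assms, of "- 1" t]
 by (simp_all add: add.commute)

section \<open>Polynomial decay\<close>

definition decay :: "nat => 'a::real_normed_vector => real" where
 "decay n x = inverse ((1 + norm x) ^ n)"

lemma one_add_norm_pos [simp]: "0 < 1 + norm x" "1 + norm x \<noteq> 0"
 by (auto simp: add_pos_nonneg)
  (metis add_pos_nonneg less_numeral_extra(1) less_numeral_extra(3) norm_ge_zero)

lemma decay_pos [simp]: "0 < decay n x"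
 by (simp add: decay_def)

lemma decay_nonneg [simp]: "0 <= decay n x"
 by (simp add: decay_def)

lemma decay_le_1 [simp]: "decay n x <= 1"
 by (simp add: decay_def inverse_le_1_iff one_le_power)

lemma decay_add: "decay (m + n) x = decay m x * decay n x"
 by (simp add: decay_def power_add)

lemma decay_antimono: "m <= n ==> decay n x <= decay m x"
 by (simp add: decay_def power_increasing le_imp_inverse_le)

lemma decay_minus [simp]: "decay n (- x) = decay n x"
 by (simp add: decay_def)

lemma decay_commute: "decay n (x - y) = decay n (y - x)"
 by (simp add: decay_def norm_minus_commute)

lemma decay_zero [simp]: "decay n 0 = 1" "decay 0 x = 1"
 by (simp_all add: decay_def)

lemma decay_mult_cancel [simp]: "(1 + norm x) ^ n * decay n x = 1" "decay n x * (1 + norm x) ^ n = 1"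
 by (simp_all add: decay_def)

lemma decay_mult_le: "decay n x * decay n y <= decay n (x + y)"
proof -
 have "(1 + norm (x + y)) ^ n <= (1 + norm x) ^ n * (1 + norm y) ^ n"
  using power_mono[OF one_add_norm_mult, of x y n] by (simp add: power_mult_distrib)
 then show ?thesis unfolding decay_def
  by (metis inverse_mult_distrib le_imp_inverse_le one_add_norm_pos(1) zero_less_power)
qed

text \<open>The inverse of the submultiplicativity of 1 + norm; in this form triangle inequalities
  enter the estimates of kernels below.\<close>

lemma decay_chain: "decay n (x - y) * decay n (y - z) <= decay n (x - z)"
 using decay_mult_le[of n "x - y" "y - z"] by simp

lemma moderate_decay: "moderate n (decay n)"
 unfolding moderate_def
proof (intro conjI allI)
 fix x y :: 'a
 have "decay n (x - y) * decay n y <= decay n x" using decay_mult_le[of n "x - y" y] by simp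
 then have "(1 + norm (x - y)) ^ n * (decay n (x - y) * decay n y) <= (1 + norm (x - y)) ^ n * decay n x"
  by (intro mult_left_mono) (simp_all add: add_nonneg_nonneg)
 then show "decay n y <= (1 + norm (x - y)) ^ n * decay n x"
  by (simp flip: mult.assoc)
qed simp

lemma decay_measurable [measurable]: "decay n \<in> borel_measurable (borel :: 'a::euclidean_space measure)"
 by (rule moderate_measurable[OF moderate_decay])

lemma nn_integral_cauchy: "(\<integral>\<^sup>+ x. ennreal (inverse (1 + x\<^sup>2)) \<partial>lborel) < (top::ennreal)"
proof -
 have "integrable lborel (%x::real. inverse (1 + x\<^sup>2))"
  using integrable_inverse_1_plus_square by (simp add: set_integrable_def)
 then show ?thesis by (simp add: integrable_iff_bounded less_top[symmetric])
qed

text \<open>Comparison with a product of one-dimensional Cauchy kernels: each of the DIM factors 1 +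
  (x . b)^2 is at most (1 + norm x)^2, which gives the exponent 2 * DIM.\<close>

lemma integrable_decay:
 assumes "2 * DIM('a) <= n"
 shows "integrable lborel (decay n :: 'a::euclidean_space => real)"
proof (rule integrableI_nonneg)
 have "decay n x <= (\<Prod>b\<in>Basis. inverse (1 + (x \<bullet> b)\<^sup>2))" for x :: 'a
 proof -
  have "(\<Prod>b\<in>(Basis::'a set). 1 + (x \<bullet> b)\<^sup>2) <= (\<Prod>b\<in>(Basis::'a set). (1 + norm x)\<^sup>2)"
  proof (intro prod_mono conjI)
   fix b :: 'a assume "b \<in> Basis"
   then have "\<bar>x \<bullet> b\<bar> <= norm x" by (rule Basis_le_norm)
   then have "(x \<bullet> b)\<^sup>2 <= (norm x)\<^sup>2" using abs_le_square_iff[of "x \<bullet> b" "norm x"] by simp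
   then show "1 + (x \<bullet> b)\<^sup>2 <= (1 + norm x)\<^sup>2" using norm_ge_zero[of x] by (simp add: power2_sum del: norm_ge_zero)
  qed simp
  also have "... = (1 + norm x) ^ (2 * DIM('a))" by (simp add: power_mult)
  also have "... <= (1 + norm x) ^ n" using assms by (intro power_increasing) auto
  finally have "(\<Prod>b\<in>(Basis::'a set). 1 + (x \<bullet> b)\<^sup>2) <= (1 + norm x) ^ n" .
  moreover have "0 < (\<Prod>b\<in>(Basis::'a set). 1 + (x \<bullet> b)\<^sup>2)"
   by (intro prod_pos) (auto intro: add_pos_nonneg)
  ultimately show ?thesis
   using prod_inversef[of "%b. 1 + (x \<bullet> b)\<^sup>2" Basis] by (simp add: decay_def comp_def le_imp_inverse_le)
 qed
 then have "(\<integral>\<^sup>+ x. ennreal (decay n (x::'a)) \<partial>lborel) <= (\<integral>\<^sup>+ x. (\<Prod>b\<in>Basis. ennreal (inverse (1 + ((x::'a) \<bullet> b)\<^sup>2))) \<partial>lborel)"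
  by (intro nn_integral_mono) (auto simp: prod_ennreal intro!: ennreal_leI)
 also have "... = (\<Prod>b\<in>(Basis::'a set). \<integral>\<^sup>+ x. ennreal (inverse (1 + x\<^sup>2)) \<partial>lborel)"
  by (rule nn_integral_lborel_prod) auto
 also have "... < \<infinity>"
 proof -
  obtain c where "(\<integral>\<^sup>+ x. ennreal (inverse (1 + x\<^sup>2)) \<partial>lborel) = ennreal c" "0 <= c"
   using nn_integral_cauchy by (cases "\<integral>\<^sup>+ x. ennreal (inverse (1 + x\<^sup>2)) \<partial>lborel") auto
  then show ?thesis by (simp add: ennreal_power)
 qed
 finally show "(\<integral>\<^sup>+ x. ennreal (decay n (x::'a)) \<partial>lborel) < \<infinity>" .
qed auto

lemma gaussian_fourier_real:
 fixes a \<xi> :: real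
 assumes a: "0 < a"
 shows "integrable lborel (%x. of_real (exp (- pi * a * x\<^sup>2)) * cis (2 * pi * (x * \<xi>)))" (is ?I)
  and "(\<integral> x. of_real (exp (- pi * a * x\<^sup>2)) * cis (2 * pi * (x * \<xi>)) \<partial>lborel)
  = of_real (exp (- pi * \<xi>\<^sup>2 / a) / sqrt a)" (is ?E)
proof -
 \<comment> \<open>With this scale - pi a (s x)^2 = - x^2 / 2, so the integral becomes the
   characteristic function of the standard normal distribution at \<open>t\<close>.\<close>
 define s where "s = 1 / sqrt (2 * pi * a)"
 define t where "t = 2 * pi * \<xi> * s"
 have s: "0 < s" using a by (simp add: s_def)
 have s2: "s\<^sup>2 = 1 / (2 * pi * a)" using a by (simp add: s_def power_divide)
 let ?f = "%x. of_real (exp (- pi * a * x\<^sup>2)) * cis (2 * pi * (x * \<xi>))"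
 have fs: "?f (0 + s * x) = of_real (sqrt (2 * pi)) * (of_real (std_normal_density x) * iexp (t * x))" for x
 proof -
  have "- pi * a * (s * x)\<^sup>2 = - x\<^sup>2 / 2" using a by (simp add: power_mult_distrib s2)
  then show ?thesis
   by (simp add: std_normal_density_def cis_conv_exp t_def mult_ac)
 qed
 have int: "integrable lborel (%x. std_normal_density x *\<^sub>R iexp (t * x))"
 proof (rule Bochner_Integration.integrable_bound)
  show "integrable lborel std_normal_density" by simp
 qed auto
 have int': "integrable lborel (%x. ?f (0 + s * x))"
  unfolding fs using int by (simp add: scaleR_conv_of_real)
 have eq: "?f = (%x. ?f (0 + s * ((x - 0) / s)))" using s by simp
 have "integrable lborel (%x. ?f (0 + s * (0 + (1/s) * x)))"
  using s by (intro lborel_integrable_real_affine[OF int']) auto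
 then show ?I using s by simp
 have "char std_normal_distribution t = (\<integral> x. std_normal_density x *\<^sub>R iexp (t * x) \<partial>lborel)"
  unfolding char_def by (subst integral_density) auto
 then have ch: "(\<integral> x. of_real (std_normal_density x) * iexp (t * x) \<partial>lborel) = of_real (exp (- t\<^sup>2 / 2))"
  by (simp add: char_std_normal_distribution scaleR_conv_of_real)
 have "(\<integral> x. ?f x \<partial>lborel) = \<bar>s\<bar> *\<^sub>R (\<integral> x. ?f (0 + s * x) \<partial>lborel)"
  using s by (intro lborel_integral_real_affine) auto
 also have "... = of_real (s * sqrt (2 * pi) * exp (- t\<^sup>2 / 2))"
  unfolding fs using s by (simp add: ch[unfolded of_real_mult] scaleR_conv_of_real)
 also have "s * sqrt (2 * pi) = 1 / sqrt a"
  using a by (simp add: s_def real_sqrt_mult)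
 also have "- t\<^sup>2 / 2 = - pi * \<xi>\<^sup>2 / a"
  using a by (simp add: t_def power_mult_distrib s2) (simp add: power2_eq_square field_simps)
 finally show ?E by simp
qed

text \<open>The Gaussian and the character are both products over the coordinates.\<close>

lemma gaussian_fourier:
 fixes \<xi> :: "'a::euclidean_space"
 assumes a: "0 < a"
 shows "integrable lborel (%x. of_real (exp (- pi * a * (norm x)\<^sup>2)) * cis (2 * pi * (x \<bullet> \<xi>)))"
  and "(\<integral> x. of_real (exp (- pi * a * (norm x)\<^sup>2)) * cis (2 * pi * (x \<bullet> \<xi>)) \<partial>lborel)
  = of_real (exp (- pi * (norm \<xi>)\<^sup>2 / a) / sqrt a ^ DIM('a))"
proof -
 interpret P: product_sigma_finite "%_::'a. lborel :: real measure" by standard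
 let ?h = "%b x. of_real (exp (- pi * a * x\<^sup>2)) * cis (2 * pi * (x * (\<xi> \<bullet> b)))"
 have fact: "of_real (exp (- pi * a * (norm x)\<^sup>2)) * cis (2 * pi * (x \<bullet> \<xi>)) = (\<Prod>b\<in>Basis. ?h b (x \<bullet> b))" for x
 proof -
  have n: "(norm x)\<^sup>2 = (\<Sum>b\<in>Basis. (x \<bullet> b)\<^sup>2)"
   by (simp only: power2_norm_eq_inner) (subst euclidean_inner, simp add: power2_eq_square)
  have i: "x \<bullet> \<xi> = (\<Sum>b\<in>Basis. (x \<bullet> b) * (\<xi> \<bullet> b))" by (rule euclidean_inner)
  show ?thesis unfolding n i prod.distrib
   by (simp add: sum_distrib_left exp_sum cis_conv_exp mult_ac)
 qed
 have [measurable]: "(%f. \<Sum>b\<in>Basis. f b *\<^sub>R b) \<in> (\<Pi>\<^sub>M b\<in>Basis. lborel) \<rightarrow>\<^sub>M (borel :: 'a measure)"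
  by measurable
 have proj: "(\<Prod>b\<in>Basis. ?h b ((\<Sum>b\<in>Basis. f b *\<^sub>R b) \<bullet> b)) = (\<Prod>b\<in>Basis. ?h b (f b))" for f :: "'a => real"
  by (intro prod.cong) (auto simp: inner_sum_left inner_Basis if_distrib cong: if_cong)
 have int: "integrable lborel (?h b)" for b
  by (rule gaussian_fourier_real[OF a])
 have "integrable (\<Pi>\<^sub>M b\<in>Basis. lborel) (%f. \<Prod>b\<in>Basis. ?h b (f b))"
  by (rule P.product_integrable_prod[OF finite_Basis int])
 then show "integrable lborel (%x. of_real (exp (- pi * a * (norm x)\<^sup>2)) * cis (2 * pi * (x \<bullet> \<xi>)))"
  unfolding fact by (subst lborel_eq, subst integrable_distr_eq) (auto simp only: proj, measurable)
 have "(\<integral> x. (\<Prod>b\<in>Basis. ?h b (x \<bullet> b)) \<partial>lborel) = (\<integral> f. (\<Prod>b\<in>Basis. ?h b (f b)) \<partial>(\<Pi>\<^sub>M b\<in>Basis. lborel))"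
  by (subst lborel_eq, subst integral_distr) (auto simp only: proj, measurable)
 also have "... = (\<Prod>b\<in>Basis. integral\<^sup>L lborel (?h b))"
  by (rule P.product_integral_prod[OF finite_Basis int])
 also have "... = (\<Prod>b\<in>(Basis::'a set). of_real (exp (- pi * (\<xi> \<bullet> b)\<^sup>2 / a) / sqrt a))"
  by (intro prod.cong refl gaussian_fourier_real[OF a])
 also have "... = of_real ((\<Prod>b\<in>(Basis::'a set). exp (- pi * (\<xi> \<bullet> b)\<^sup>2 / a)) / sqrt a ^ DIM('a))"
  by (simp add: prod_dividef)
 also have "(\<Prod>b\<in>(Basis::'a set). exp (- pi * (\<xi> \<bullet> b)\<^sup>2 / a)) = exp (- pi * (norm \<xi>)\<^sup>2 / a)"
 proof -
  have n: "(norm \<xi>)\<^sup>2 = (\<Sum>b\<in>Basis. (\<xi> \<bullet> b)\<^sup>2)"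
   by (simp only: power2_norm_eq_inner) (subst euclidean_inner, simp add: power2_eq_square)
  show ?thesis unfolding n by (simp add: exp_sum[symmetric] sum_distrib_left sum_divide_distrib sum_negf)
 qed
 finally show "(\<integral> x. of_real (exp (- pi * a * (norm x)\<^sup>2)) * cis (2 * pi * (x \<bullet> \<xi>)) \<partial>lborel)
  = of_real (exp (- pi * (norm \<xi>)\<^sup>2 / a) / sqrt a ^ DIM('a))" unfolding fact .
qed

lemma norm_integral_le_nn_integral:
 fixes f :: "'a => 'b::{banach, second_countable_topology}"
 shows "ennreal (norm (integral\<^sup>L M f)) <= (\<integral>\<^sup>+ x. ennreal (norm (f x)) \<partial>M)"
 by (cases "integrable M f") (auto intro: integral_norm_bound_ennreal simp: not_integrable_integral_eq)

lemma integrable_pair_dominated: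
 fixes F :: "'a::euclidean_space \<times> 'b::euclidean_space => complex"
 assumes F[measurable]: "F \<in> borel_measurable (lborel \<Otimes>\<^sub>M lborel)"
  and f: "integrable lborel f" and g: "integrable lborel g"
  and le: "!!x y. norm (F (x, y)) <= f x * g y"
 shows "integrable (lborel \<Otimes>\<^sub>M lborel) F"
proof (rule integrableI_bounded[OF F])
 have [measurable]: "f \<in> borel_measurable borel" "g \<in> borel_measurable borel" using f g by auto
 have "(\<integral>\<^sup>+ z. ennreal (norm (F z)) \<partial>(lborel \<Otimes>\<^sub>M lborel)) = (\<integral>\<^sup>+ x. \<integral>\<^sup>+ y. ennreal (norm (F (x, y))) \<partial>lborel \<partial>lborel)"
  by (rule lborel.nn_integral_fst[symmetric]) simp
 also have "... <= (\<integral>\<^sup>+ x. \<integral>\<^sup>+ y. ennreal (norm (f x)) * ennreal (norm (g y)) \<partial>lborel \<partial>lborel)"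
  using le by (intro nn_integral_mono)
   (auto simp flip: ennreal_mult abs_mult intro!: ennreal_leI order_trans[OF _ abs_ge_self])
 also have "... = (\<integral>\<^sup>+ x. ennreal (norm (f x)) \<partial>lborel) * (\<integral>\<^sup>+ y. ennreal (norm (g y)) \<partial>lborel)"
  by (simp add: nn_integral_cmult nn_integral_multc)
 also have "... < \<infinity>" using f g by (simp add: integrable_iff_bounded ennreal_mult_less_top)
 finally show "(\<integral>\<^sup>+ z. ennreal (norm (F z)) \<partial>(lborel \<Otimes>\<^sub>M lborel)) < \<infinity>" .
qed

lemma integral_swap_dominated:
 fixes F :: "'a::euclidean_space => 'b::euclidean_space => complex"
 assumes F: "(%(x, y). F x y) \<in> borel_measurable (lborel \<Otimes>\<^sub>M lborel)"
  and f: "integrable lborel f" and g: "integrable lborel g"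
  and le: "!!x y. norm (F x y) <= f x * g y"
 shows "(\<integral> x. (\<integral> y. F x y \<partial>lborel) \<partial>lborel) = (\<integral> y. (\<integral> x. F x y \<partial>lborel) \<partial>lborel)"
  and "integrable lborel (%x. \<integral> y. F x y \<partial>lborel)"
  and "integrable lborel (%y. \<integral> x. F x y \<partial>lborel)"
proof -
 have int: "integrable (lborel \<Otimes>\<^sub>M lborel) (%(x, y). F x y)"
  by (rule integrable_pair_dominated[OF F f g]) (simp add: le)
 show "(\<integral> x. (\<integral> y. F x y \<partial>lborel) \<partial>lborel) = (\<integral> y. (\<integral> x. F x y \<partial>lborel) \<partial>lborel)"
  using lborel_pair.Fubini_integral[OF int] by simp
 show "integrable lborel (%x. \<integral> y. F x y \<partial>lborel)" "integrable lborel (%y. \<integral> x. F x y \<partial>lborel)"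
  using lborel_pair.integrable_fst[OF int] lborel_pair.integrable_snd[OF int] by auto
qed

lemma measurable_cnj [measurable (raw)]:
 assumes "f \<in> borel_measurable M" shows "(%x. cnj (f x)) \<in> borel_measurable M"
 by (rule measurable_compose[OF assms]) (intro borel_measurable_continuous_onI continuous_intros)

definition fourier :: "('a::euclidean_space => complex) => 'a => complex" where
 "fourier f \<xi> = (\<integral> t. f t * cis (- 2 * pi * (t \<bullet> \<xi>)) \<partial>lborel)"

lemma fourier_measurable [measurable]:
 assumes [measurable]: "f \<in> borel_measurable borel"
 shows "fourier f \<in> borel_measurable (borel :: 'a::euclidean_space measure)"
 unfolding fourier_def by measurable

text \<open>Gauss summation: a Gaussian factor in the frequency turns the inversion integral into an
  average of f around x at scale \<open>e n\<close>. As the scale tends to 0 both sides converge by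
  dominated convergence, on the left because the transform is integrable, on the right because f is
  bounded and continuous.\<close>

lemma fourier_inversion:
 fixes f :: "'a::euclidean_space => complex"
 assumes f: "integrable lborel f" and cont: "continuous_on UNIV f" and B: "!!t. norm (f t) <= B"
  and ff: "integrable lborel (fourier f)"
 shows "(\<integral> \<xi>. fourier f \<xi> * cis (2 * pi * (x \<bullet> \<xi>)) \<partial>lborel) = f x"
proof -
 have [measurable]: "f \<in> borel_measurable borel" using f by auto
 define e where "e = (%n::nat. 1 / (real n + 1))"
 have e: "0 < e n" for n by (simp add: e_def)
 define k where "k = (%n \<xi>. complex_of_real (exp (- pi * (e n)\<^sup>2 * (norm (\<xi>::'a))\<^sup>2)))"
 have [measurable]: "k n \<in> borel_measurable borel" for n unfolding k_def by measurable
 have e0: "e \<longlonglongrightarrow> 0" unfolding e_def by real_asymp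
 have kint: "integrable lborel (%\<xi>. norm (k n \<xi>))" for n
  using gaussian_fourier(1)[of "(e n)\<^sup>2" "0::'a"] e[of n] by (intro integrable_norm) (simp add: k_def)
 have lim1: "(%n. \<integral> \<xi>. fourier f \<xi> * cis (2 * pi * (x \<bullet> \<xi>)) * k n \<xi> \<partial>lborel)
   \<longlonglongrightarrow> (\<integral> \<xi>. fourier f \<xi> * cis (2 * pi * (x \<bullet> \<xi>)) \<partial>lborel)"
 proof (rule integral_dominated_convergence[where w = "%\<xi>. norm (fourier f \<xi>)"])
  show "AE \<xi> in lborel. (%n. fourier f \<xi> * cis (2 * pi * (x \<bullet> \<xi>)) * k n \<xi>) \<longlonglongrightarrow> fourier f \<xi> * cis (2 * pi * (x \<bullet> \<xi>))"
  proof (rule AE_I2)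
   fix \<xi> :: 'a
   have "(%n. exp (- pi * (e n)\<^sup>2 * (norm \<xi>)\<^sup>2)) \<longlonglongrightarrow> exp (- pi * 0\<^sup>2 * (norm \<xi>)\<^sup>2)"
    by (intro tendsto_intros e0)
   then have "(%n. k n \<xi>) \<longlonglongrightarrow> 1" unfolding k_def using tendsto_of_real by fastforce
   from tendsto_mult_left[OF this, of "fourier f \<xi> * cis (2 * pi * (x \<bullet> \<xi>))"]
   show "(%n. fourier f \<xi> * cis (2 * pi * (x \<bullet> \<xi>)) * k n \<xi>) \<longlonglongrightarrow> fourier f \<xi> * cis (2 * pi * (x \<bullet> \<xi>))" by simp
  qed
  show "integrable lborel (%\<xi>. norm (fourier f \<xi>))" using ff by (rule integrable_norm)
  show "AE \<xi> in lborel. norm (fourier f \<xi> * cis (2 * pi * (x \<bullet> \<xi>)) * k n \<xi>) <= norm (fourier f \<xi>)" for n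
   by (intro AE_I2) (auto simp: norm_mult k_def intro!: mult_left_le)
 qed measurable
 \<comment> \<open>Exchange of the integrals, the transform of the Gaussian, and the substitution t
   = x - e n s.\<close>
 have eq: "(\<integral> \<xi>. fourier f \<xi> * cis (2 * pi * (x \<bullet> \<xi>)) * k n \<xi> \<partial>lborel)
   = (\<integral> s. f (x - e n *\<^sub>R s) * of_real (exp (- pi * (norm s)\<^sup>2)) \<partial>lborel)" for n
 proof -
  have "(\<integral> \<xi>. fourier f \<xi> * cis (2 * pi * (x \<bullet> \<xi>)) * k n \<xi> \<partial>lborel)
    = (\<integral> \<xi>. (\<integral> t. f t * (k n \<xi> * cis (2 * pi * (\<xi> \<bullet> (x - t)))) \<partial>lborel) \<partial>lborel)"
  proof (intro Bochner_Integration.integral_cong refl)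
   fix \<xi> :: 'a
   have c: "cis (2 * pi * (\<xi> \<bullet> (x - t))) = cis (- 2 * pi * (t \<bullet> \<xi>)) * cis (2 * pi * (x \<bullet> \<xi>))" for t
    unfolding cis_mult by (rule arg_cong[where f = cis]) (simp add: inner_commute inner_diff_right algebra_simps)
   have "f t * (k n \<xi> * cis (2 * pi * (\<xi> \<bullet> (x - t)))) = f t * cis (- 2 * pi * (t \<bullet> \<xi>)) * (cis (2 * pi * (x \<bullet> \<xi>)) * k n \<xi>)" for t
    unfolding c by (simp only: mult_ac)
   note eq = this
   show "fourier f \<xi> * cis (2 * pi * (x \<bullet> \<xi>)) * k n \<xi> = (\<integral> t. f t * (k n \<xi> * cis (2 * pi * (\<xi> \<bullet> (x - t)))) \<partial>lborel)"
    unfolding eq fourier_def integral_mult_left_zero by (rule mult.assoc)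
  qed
  also have "... = (\<integral> t. (\<integral> \<xi>. f t * (k n \<xi> * cis (2 * pi * (\<xi> \<bullet> (x - t)))) \<partial>lborel) \<partial>lborel)"
   by (rule integral_swap_dominated(1)[OF _ kint[of n] integrable_norm[OF f]]) (auto simp: norm_mult mult.commute)
  also have "... = (\<integral> t. f t * of_real (exp (- pi * (norm (x - t))\<^sup>2 / (e n)\<^sup>2) / (e n) ^ DIM('a)) \<partial>lborel)"
   unfolding k_def using gaussian_fourier(2)[of "(e n)\<^sup>2" "x - t" for t] e[of n]
   by (simp add: less_imp_le)
  also have "... = \<bar>- e n\<bar> ^ DIM('a) *\<^sub>R (\<integral> s. f (x + (- e n) *\<^sub>R s) * of_real (exp (- pi * (norm (x - (x + (- e n) *\<^sub>R s)))\<^sup>2 / (e n)\<^sup>2) / (e n) ^ DIM('a)) \<partial>lborel)"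
   using e[of n] by (intro integral_affine) auto
  also have "... = (\<integral> s. f (x - e n *\<^sub>R s) * of_real (exp (- pi * (norm s)\<^sup>2)) \<partial>lborel)"
  proof -
   have "- pi * (norm (x - (x + (- e n) *\<^sub>R s)))\<^sup>2 / (e n)\<^sup>2 = - pi * (norm s)\<^sup>2" for s
    using e[of n] by (simp add: power_mult_distrib)
   then show ?thesis using e[of n] by (simp add: scaleR_conv_of_real mult.assoc[symmetric])
  qed
  finally show ?thesis .
 qed
 have lim2: "(%n. \<integral> s. f (x - e n *\<^sub>R s) * of_real (exp (- pi * (norm s)\<^sup>2)) \<partial>lborel)
   \<longlonglongrightarrow> (\<integral> s. f x * of_real (exp (- pi * (norm (s::'a))\<^sup>2)) \<partial>lborel)"
 proof (rule integral_dominated_convergence[where w = "%s. B * exp (- pi * (norm (s::'a))\<^sup>2)"])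
  have "integrable lborel (%s::'a. norm (complex_of_real (exp (- pi * 1 * (norm s)\<^sup>2)) * cis (2 * pi * (s \<bullet> 0))))"
   by (intro integrable_norm gaussian_fourier) auto
  then show "integrable lborel (%s::'a. B * exp (- pi * (norm s)\<^sup>2))"
   by (intro integrable_mult_right) simp
  show "AE s in lborel. (%n. f (x - e n *\<^sub>R s) * of_real (exp (- pi * (norm s)\<^sup>2))) \<longlonglongrightarrow> f x * of_real (exp (- pi * (norm s)\<^sup>2))"
  proof (intro AE_I2 tendsto_mult_right)
   fix s :: 'a
   have "(%n. x - e n *\<^sub>R s) \<longlonglongrightarrow> x - 0 *\<^sub>R s" by (intro tendsto_intros e0)
   moreover have "isCont f x" using cont by (simp add: continuous_on_eq_continuous_at)
   ultimately show "(%n. f (x - e n *\<^sub>R s)) \<longlonglongrightarrow> f x"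
    using isCont_tendsto_compose[of x f] by auto
  qed
  show "AE s in lborel. norm (f (x - e n *\<^sub>R s) * of_real (exp (- pi * (norm s)\<^sup>2))) <= B * exp (- pi * (norm s)\<^sup>2)" for n
   by (intro AE_I2) (auto simp: norm_mult intro!: mult_right_mono B)
 qed measurable
 have "(\<integral> s. f x * of_real (exp (- pi * (norm (s::'a))\<^sup>2)) \<partial>lborel) = f x"
  using gaussian_fourier(2)[of 1 "0::'a"] by simp
 with lim2 lim1 eq show ?thesis by (auto intro: LIMSEQ_unique)
qed

text \<open>The inversion formula is applied to G under the integral sign; all regularity is
  therefore asked of G, and of F only integrability.\<close>

lemma parseval:
 fixes F G :: "'a::euclidean_space => complex"
 assumes F: "integrable lborel F" and G: "integrable lborel G" and cont: "continuous_on UNIV G" and B: "!!t. norm (G t) <= B"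
  and GG: "integrable lborel (fourier G)"
 shows "(\<integral> \<xi>. fourier F \<xi> * cnj (fourier G \<xi>) \<partial>lborel) = (\<integral> t. F t * cnj (G t) \<partial>lborel)"
proof -
 have [measurable]: "F \<in> borel_measurable borel" "G \<in> borel_measurable borel" using F G by auto
 have "(\<integral> \<xi>. fourier F \<xi> * cnj (fourier G \<xi>) \<partial>lborel)
   = (\<integral> \<xi>. (\<integral> t. F t * cnj (fourier G \<xi> * cis (2 * pi * (t \<bullet> \<xi>))) \<partial>lborel) \<partial>lborel)"
  by (simp add: fourier_def[of F] cis_cnj mult_ac flip: integral_mult_left_zero integral_mult_right_zero)
 also have "... = (\<integral> t. (\<integral> \<xi>. F t * cnj (fourier G \<xi> * cis (2 * pi * (t \<bullet> \<xi>))) \<partial>lborel) \<partial>lborel)"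
  by (rule integral_swap_dominated(1)[OF _ integrable_norm[OF GG] integrable_norm[OF F]]) (auto simp: norm_mult mult.commute)
 also have "... = (\<integral> t. F t * cnj (G t) \<partial>lborel)"
  using fourier_inversion[OF G cont B GG] by (simp add: integral_mult_right_zero del: complex_cnj_mult)
 finally show ?thesis .
qed

text \<open>What the integral identities require of a window or a Schwartz function: continuity and
  rapid decrease, without derivatives.\<close>

definition rapid :: "('a::real_normed_vector => complex) => bool" where
 "rapid \<phi> \<longleftrightarrow> continuous_on UNIV \<phi> \<and> (\<forall>n. \<exists>C. \<forall>t. norm (\<phi> t) <= C * decay n t)"

lemma rapidE:
 assumes "rapid \<phi>" obtains C where "0 <= C" "!!t. norm (\<phi> t) <= C * decay n t"
proof -
 obtain C where C: "!!t. norm (\<phi> t) <= C * decay n t" using assms by (auto simp: rapid_def)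
 have "0 <= norm (\<phi> 0)" by simp
 also have "... <= C" using C[of 0] by simp
 finally show ?thesis using C that by blast
qed

lemma rapid_continuous: "rapid \<phi> ==> continuous_on UNIV \<phi>"
 by (simp add: rapid_def)

lemma rapid_measurable [measurable_dest]: "rapid \<phi> ==> \<phi> \<in> borel_measurable borel"
 by (intro borel_measurable_continuous_onI rapid_continuous)

lemma rapid_integrable:
 fixes \<phi> :: "'a::euclidean_space => complex"
 assumes "rapid \<phi>" shows "integrable lborel \<phi>"
proof -
 obtain C where C: "0 <= C" "!!t. norm (\<phi> t) <= C * decay (2 * DIM('a)) t" using rapidE[OF assms, of "2 * DIM('a)"] by blast
 show ?thesis
  by (rule Bochner_Integration.integrable_bound[of _ "%t. C * decay (2 * DIM('a)) t"])
   (use C assms in \<open>auto intro!: integrable_mult_right integrable_decay rapid_measurable simp: abs_mult\<close>)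
qed

lemma rapid_bounded:
 assumes "rapid \<phi>" obtains B where "0 <= B" "!!t. norm (\<phi> t) <= B"
 using rapidE[OF assms, of 0] by (metis decay_zero(2) mult.right_neutral)

text \<open>The short-time Fourier transform of a function, as an integral with respect to
  Borel-Lebesgue measure; \<open>stft_regular_distr\<close> identifies it with
  \<open>stft\<close>.\<close>

definition stft0 :: "('a::euclidean_space => complex) => ('a => complex) => 'a => 'a => complex" where
 "stft0 \<phi> u x \<xi> = fourier (%t. u t * cnj (\<phi> (t - x))) \<xi>"

lemma stft0_measurable [measurable]:
 assumes [measurable]: "\<phi> \<in> borel_measurable borel" "u \<in> borel_measurable borel"
 shows "(%(x, \<xi>). stft0 \<phi> u x \<xi>) \<in> borel_measurable (borel \<Otimes>\<^sub>M (borel :: 'a::euclidean_space measure))"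
 unfolding stft0_def fourier_def by measurable

text \<open>Covariance: a time-frequency shift of the analysed function shifts its transform, up to
  a phase.\<close>

lemma norm_fourier_shift:
 fixes \<phi> \<psi> :: "'a::euclidean_space => complex"
 assumes [measurable]: "\<phi> \<in> borel_measurable borel" "\<psi> \<in> borel_measurable borel"
 shows "norm (fourier (%t. \<phi> (t - y) * cis (2 * pi * (t \<bullet> \<eta>)) * cnj (\<psi> (t - x))) \<xi>)
  = norm (stft0 \<psi> \<phi> (x - y) (\<xi> - \<eta>))" (is "norm (fourier ?G \<xi>) = _")
proof -
 have "fourier ?G \<xi> = (\<integral> s. ?G (s + y) * cis (- 2 * pi * ((s + y) \<bullet> \<xi>)) \<partial>lborel)"
  unfolding fourier_def by (rule integral_shift(1)[symmetric]) measurable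
 also have "... = (\<integral> s. cis (- 2 * pi * (y \<bullet> (\<xi> - \<eta>))) * (\<phi> s * cnj (\<psi> (s - (x - y))) * cis (- 2 * pi * (s \<bullet> (\<xi> - \<eta>)))) \<partial>lborel)"
 proof (intro Bochner_Integration.integral_cong refl)
  fix s
  have "cis (2 * pi * ((s + y) \<bullet> \<eta>)) * cis (- 2 * pi * ((s + y) \<bullet> \<xi>))
    = cis (- 2 * pi * (y \<bullet> (\<xi> - \<eta>))) * cis (- 2 * pi * (s \<bullet> (\<xi> - \<eta>)))"
   unfolding cis_mult by (rule arg_cong[where f = cis]) (simp add: inner_diff_right inner_add_left algebra_simps)
  moreover have "?G (s + y) * cis (- 2 * pi * ((s + y) \<bullet> \<xi>))
   = \<phi> s * cnj (\<psi> (s - (x - y))) * (cis (2 * pi * ((s + y) \<bullet> \<eta>)) * cis (- 2 * pi * ((s + y) \<bullet> \<xi>)))"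
   by (simp add: algebra_simps)
  ultimately show "?G (s + y) * cis (- 2 * pi * ((s + y) \<bullet> \<xi>))
   = cis (- 2 * pi * (y \<bullet> (\<xi> - \<eta>))) * (\<phi> s * cnj (\<psi> (s - (x - y))) * cis (- 2 * pi * (s \<bullet> (\<xi> - \<eta>))))"
   by (simp only: mult_ac)
 qed
 also have "... = cis (- 2 * pi * (y \<bullet> (\<xi> - \<eta>))) * stft0 \<psi> \<phi> (x - y) (\<xi> - \<eta>)"
  unfolding stft0_def fourier_def by (rule integral_mult_right_zero)
 finally show ?thesis by (simp add: norm_mult)
qed

text \<open>Parseval in \<xi> at fixed x yields the integral of u times the conjugate of g times
  |\<psi> (t - x)|^2, where g is the shifted and modulated \<phi>; integration over x then produces
  the squared norm of \<psi>. The decay hypothesis makes the transform of \<open>G x\<close>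
  integrable, as Parseval demands.\<close>

lemma stft0_reproducing:
 fixes u :: "'a::euclidean_space => complex"
 assumes u: "integrable lborel u" and \<phi>: "rapid \<phi>" and \<psi>: "rapid \<psi>" and n: "2 * DIM('a) <= n"
  and K: "!!x \<xi>. norm (stft0 \<psi> \<phi> x \<xi>) <= K * (decay n x * decay n \<xi>)"
 shows "ennreal ((\<integral> t. (norm (\<psi> t))\<^sup>2 \<partial>lborel) * norm (stft0 \<phi> u y \<eta>))
  <= (\<integral>\<^sup>+ x. \<integral>\<^sup>+ \<xi>. ennreal (norm (stft0 \<psi> u x \<xi>) * norm (stft0 \<psi> \<phi> (x - y) (\<xi> - \<eta>))) \<partial>lborel \<partial>lborel)"
proof -
 have [measurable]: "u \<in> borel_measurable borel" using u by auto
 note [measurable] = rapid_measurable[OF \<phi>] rapid_measurable[OF \<psi>]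
 define g where "g = (%t. \<phi> (t - y) * cis (2 * pi * (t \<bullet> \<eta>)))"
 have [measurable]: "g \<in> borel_measurable borel" unfolding g_def by measurable
 define G where "G = (%x t. g t * cnj (\<psi> (t - x)))"
 have [measurable]: "G x \<in> borel_measurable borel" for x unfolding G_def by measurable
 obtain C1 where C1: "0 <= C1" "!!t. norm (\<phi> t) <= C1 * decay n t" using rapidE[OF \<phi>, of n] by blast
 obtain B where B: "0 <= B" "!!t. norm (\<psi> t) <= B" using rapid_bounded[OF \<psi>] by blast
 obtain C2 where C2: "0 <= C2" "!!t. norm (\<psi> t) <= C2 * decay n t" using rapidE[OF \<psi>, of n] by blast
 have gb: "norm (g t) <= C1 * decay n (t - y)" for t using C1 by (simp add: g_def norm_mult)
 have G_norm: "norm (fourier (G x) \<xi>) = norm (stft0 \<psi> \<phi> (x - y) (\<xi> - \<eta>))" for x \<xi>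
  unfolding G_def g_def by (rule norm_fourier_shift) measurable
 have dec: "integrable lborel (%t::'a. C * decay n (t - y))" for C y
  by (intro integrable_mult_right integrable_shift(2) integrable_decay n)
 have Gint: "integrable lborel (G x)" for x
 proof (rule Bochner_Integration.integrable_bound[OF dec[of "C1 * B" y]])
  show "AE t in lborel. norm (G x t) <= norm (C1 * B * decay n (t - y))"
  proof (rule AE_I2)
   fix t
   have "norm (G x t) <= (C1 * decay n (t - y)) * B"
    unfolding G_def norm_mult using gb[of t] B C1 by (intro mult_mono) auto
   then show "norm (G x t) <= norm (C1 * B * decay n (t - y))" using B C1 by (simp add: abs_mult mult_ac)
  qed
 qed measurable
 have Gbound: "norm (G x t) <= C1 * B" for x t
 proof -
  have "norm (G x t) <= (C1 * 1) * B"
   unfolding G_def norm_mult using gb[of t] B C1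
   by (intro mult_mono order_trans[OF gb] mult_left_mono) auto
  then show ?thesis by simp
 qed
 have Gcont: "continuous_on UNIV (G x)" for x
  unfolding G_def g_def
  by (intro continuous_intros continuous_on_compose2[OF rapid_continuous[OF \<phi>]] continuous_on_compose2[OF rapid_continuous[OF \<psi>]]) auto
 have GF: "integrable lborel (fourier (G x))" for x
 proof (rule Bochner_Integration.integrable_bound[OF dec[of "K * decay n (x - y)" \<eta>]])
  show "AE \<xi> in lborel. norm (fourier (G x) \<xi>) <= norm (K * decay n (x - y) * decay n (\<xi> - \<eta>))"
   using K[of "x - y"] by (intro AE_I2) (auto simp: G_norm mult.assoc intro: order_trans[OF _ abs_ge_self])
 qed measurable
 have Fint: "integrable lborel (%t. u t * cnj (\<psi> (t - x)))" for x
 proof (rule Bochner_Integration.integrable_bound)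
  show "integrable lborel (%t. norm (u t) * B)" using u by auto
  show "AE t in lborel. norm (u t * cnj (\<psi> (t - x))) <= norm (norm (u t) * B)"
   using B by (intro AE_I2) (auto simp: norm_mult abs_mult intro!: mult_left_mono)
 qed measurable
 have "(\<integral> x. (\<integral> \<xi>. stft0 \<psi> u x \<xi> * cnj (fourier (G x) \<xi>) \<partial>lborel) \<partial>lborel)
   = (\<integral> x. (\<integral> t. u t * cnj (\<psi> (t - x)) * cnj (G x t) \<partial>lborel) \<partial>lborel)"
  unfolding stft0_def by (intro Bochner_Integration.integral_cong refl parseval[OF Fint Gint Gcont Gbound GF])
 \<comment> \<open>The factor that makes the x-integral converge, \<open>decay n (x - y)\<close>,
   results from chaining the decay of \<psi> (t - x) with that of g around y.\<close>
 also have "... = (\<integral> t. (\<integral> x. u t * cnj (\<psi> (t - x)) * cnj (G x t) \<partial>lborel) \<partial>lborel)"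
 proof (rule integral_swap_dominated(1)[OF _ dec[of "C1 * C2 * B" y] integrable_norm[OF u]])
  show "(%(x, t). u t * cnj (\<psi> (t - x)) * cnj (G x t)) \<in> borel_measurable (lborel \<Otimes>\<^sub>M lborel)"
   unfolding G_def by measurable
  fix x t
  have "norm (u t * cnj (\<psi> (t - x)) * cnj (G x t)) = norm (u t) * (norm (\<psi> (t - x)) * (norm (g t) * norm (\<psi> (t - x))))"
   by (simp add: norm_mult G_def mult.assoc)
  also have "... <= norm (u t) * ((C2 * decay n (t - x)) * ((C1 * decay n (t - y)) * B))"
   using gb B C1 C2 by (intro mult_left_mono mult_mono) auto
  also have "... = norm (u t) * (C1 * C2 * B * (decay n (x - t) * decay n (t - y)))"
   by (simp add: decay_commute[of n t x] mult_ac)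
  also have "... <= norm (u t) * (C1 * C2 * B * decay n (x - y))"
   using C1 C2 B by (intro mult_left_mono decay_chain) auto
  finally show "norm (u t * cnj (\<psi> (t - x)) * cnj (G x t)) <= C1 * C2 * B * decay n (x - y) * norm (u t)"
   by (simp add: mult_ac)
 qed
 also have "... = (\<integral> t. (\<integral> x. (u t * cnj (g t)) * of_real ((norm (\<psi> (t - x)))\<^sup>2) \<partial>lborel) \<partial>lborel)"
  by (intro Bochner_Integration.integral_cong refl)
   (simp add: G_def mult_ac complex_norm_square[symmetric] flip: of_real_power)
 also have "... = (\<integral> t. (u t * cnj (g t)) * of_real (\<integral> x. (norm (\<psi> (t - x)))\<^sup>2 \<partial>lborel) \<partial>lborel)"
  by (simp only: integral_mult_right_zero integral_complex_of_real)
 also have "... = (\<integral> t. (u t * cnj (g t)) * of_real (\<integral> x. (norm (\<psi> x))\<^sup>2 \<partial>lborel) \<partial>lborel)"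
 proof -
  have "(\<integral> x. (norm (\<psi> (t - x)))\<^sup>2 \<partial>lborel) = (\<integral> x. (norm (\<psi> x))\<^sup>2 \<partial>lborel)" for t
   by (rule integral_shift(3)) measurable
  then show ?thesis by simp
 qed
 also have "... = (\<integral> t. u t * cnj (g t) \<partial>lborel) * of_real (\<integral> x. (norm (\<psi> x))\<^sup>2 \<partial>lborel)"
  by (rule integral_mult_left_zero)
 also have "(\<integral> t. u t * cnj (g t) \<partial>lborel) = stft0 \<phi> u y \<eta>"
  unfolding stft0_def fourier_def g_def by (simp add: cis_cnj mult_ac)
 finally have eq: "stft0 \<phi> u y \<eta> * of_real (\<integral> x. (norm (\<psi> x))\<^sup>2 \<partial>lborel)
   = (\<integral> x. (\<integral> \<xi>. stft0 \<psi> u x \<xi> * cnj (fourier (G x) \<xi>) \<partial>lborel) \<partial>lborel)" ..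
 have "0 <= (\<integral> t. (norm (\<psi> t))\<^sup>2 \<partial>lborel)" by simp
 then have "(\<integral> t. (norm (\<psi> t))\<^sup>2 \<partial>lborel) * norm (stft0 \<phi> u y \<eta>)
   = norm (\<integral> x. (\<integral> \<xi>. stft0 \<psi> u x \<xi> * cnj (fourier (G x) \<xi>) \<partial>lborel) \<partial>lborel)"
  unfolding eq[symmetric] norm_mult by simp
 then have "ennreal ((\<integral> t. (norm (\<psi> t))\<^sup>2 \<partial>lborel) * norm (stft0 \<phi> u y \<eta>))
   <= (\<integral>\<^sup>+ x. ennreal (norm (\<integral> \<xi>. stft0 \<psi> u x \<xi> * cnj (fourier (G x) \<xi>) \<partial>lborel)) \<partial>lborel)"
  by (simp only: norm_integral_le_nn_integral)
 also have "... <= (\<integral>\<^sup>+ x. \<integral>\<^sup>+ \<xi>. ennreal (norm (stft0 \<psi> u x \<xi> * cnj (fourier (G x) \<xi>))) \<partial>lborel \<partial>lborel)"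
  by (intro nn_integral_mono norm_integral_le_nn_integral)
 finally show ?thesis by (simp add: norm_mult G_norm)
qed

lemma stft0_bounded:
 fixes u :: "'a::euclidean_space => complex"
 assumes u: "integrable lborel u" and B: "!!t. norm (\<phi> t) <= B"
 shows "norm (stft0 \<phi> u x \<xi>) <= (\<integral> t. norm (u t) \<partial>lborel) * B"
proof -
 have B0: "0 <= B" using B[of 0] norm_ge_zero order_trans by blast
 have "norm (stft0 \<phi> u x \<xi>) <= (\<integral> t. norm (u t) * B \<partial>lborel)"
  unfolding stft0_def fourier_def
 proof (rule order_trans[OF integral_norm_bound integral_mono'])
  show "integrable lborel (%t. norm (u t) * B)" using u by auto
 qed (use B B0 in \<open>auto simp: norm_mult intro!: mult_left_mono\<close>)
 then show ?thesis by simp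
qed

subsection \<open>Schwartz functions\<close>

lemma partials_append: "partials (as @ bs) f = partials as (partials bs f)"
 by (induction as) auto

lemma schwartz_differentiable:
 "f \<in> schwartz ==> set bs \<subseteq> Basis ==> partials bs f differentiable (at x)"
 by (simp add: schwartz_def)

lemma schwartz_has_derivative:
 "f \<in> schwartz ==> set bs \<subseteq> Basis ==>
  (partials bs f has_derivative frechet_derivative (partials bs f) (at x)) (at x)"
 using schwartz_differentiable frechet_derivative_works by blast

lemma schwartz_seminorm_ge:
 assumes "set bs \<subseteq> Basis" "length bs <= n"
 shows "ennreal ((1 + norm x) ^ n * norm (partials bs f x)) <= schwartz_seminorm n f"
 unfolding schwartz_seminorm_def using assms
 by (intro SUP_upper2[of bs] SUP_upper2[of x]) auto

lemma schwartz_bound: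
 assumes f: "f \<in> schwartz" and bs: "set bs \<subseteq> Basis"
 shows "\<exists>C. \<forall>x. norm (partials bs f x) <= C * decay n x"
proof -
 define m where "m = max n (length bs)"
 have "schwartz_seminorm m f < top" using f by (simp add: schwartz_def)
 then obtain C where C: "schwartz_seminorm m f = ennreal C" "0 <= C"
  by (cases "schwartz_seminorm m f") auto
 have "norm (partials bs f x) <= C * decay n x" for x
 proof -
  have "ennreal ((1 + norm x) ^ m * norm (partials bs f x)) <= ennreal C"
   using schwartz_seminorm_ge[OF bs, of m x f] C by (simp add: m_def)
  then have "(1 + norm x) ^ m * norm (partials bs f x) <= C" using C by simp
  then have "decay m x * ((1 + norm x) ^ m * norm (partials bs f x)) <= decay m x * C"
   by (intro mult_left_mono) auto
  then have "norm (partials bs f x) <= decay m x * C" by (simp flip: mult.assoc)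
  also have "... <= decay n x * C" using C by (intro mult_right_mono decay_antimono) (auto simp: m_def)
  finally show ?thesis by (simp add: mult.commute)
 qed
 then show ?thesis by blast
qed

text \<open>The bounds may depend on the list of directions: there are finitely many lists of length
  at most n over the basis, so their constants can be added.\<close>

lemma schwartzI:
 assumes diff: "!!bs x. set bs \<subseteq> Basis ==> partials bs f differentiable (at x)"
  and bound: "!!bs n. set bs \<subseteq> Basis ==> \<exists>C. \<forall>x. norm (partials bs f x) <= C * decay n x"
 shows "f \<in> schwartz"
 unfolding schwartz_def
proof (intro CollectI conjI allI impI diff)
 fix n
 let ?B = "{bs. set bs \<subseteq> (Basis :: 'a set) \<and> length bs <= n}"
 have "\<forall>bs\<in>?B. \<exists>C. \<forall>x. norm (partials bs f x) <= C * decay n x" using bound by blast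
 from bchoice[OF this] obtain C where C: "!!bs x. bs \<in> ?B ==> norm (partials bs f x) <= C bs * decay n x"
  by blast
 have fin: "finite ?B" by (rule finite_lists_length_le) simp
 have "schwartz_seminorm n f <= ennreal (\<Sum>bs\<in>?B. \<bar>C bs\<bar>)"
  unfolding schwartz_seminorm_def
 proof (intro SUP_least ennreal_leI)
  fix bs x assume bs: "bs \<in> ?B"
  have "(1 + norm x) ^ n * norm (partials bs f x) <= (1 + norm x) ^ n * (C bs * decay n x)"
   using C[OF bs] by (intro mult_left_mono) auto
  also have "... = C bs" by (simp add: mult.left_commute)
  also have "... <= \<bar>C bs\<bar>" by simp
  also have "... <= (\<Sum>bs\<in>?B. \<bar>C bs\<bar>)" by (rule member_le_sum[OF bs _ fin]) simp
  finally show "(1 + norm x) ^ n * norm (partials bs f x) <= (\<Sum>bs\<in>?B. \<bar>C bs\<bar>)" .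
 qed
 also have "... < \<infinity>" by simp
 finally show "schwartz_seminorm n f < \<infinity>" .
qed

lemma schwartz_partials:
 assumes "f \<in> schwartz" "set bs \<subseteq> Basis" shows "partials bs f \<in> schwartz"
proof (rule schwartzI)
 fix cs :: "'a list" and x n assume "set cs \<subseteq> Basis"
 then have "set (cs @ bs) \<subseteq> Basis" using assms by auto
 from schwartz_differentiable[OF assms(1) this] schwartz_bound[OF assms(1) this]
 show "partials cs (partials bs f) differentiable (at x)"
  "\<exists>C. \<forall>x. norm (partials cs (partials bs f) x) <= C * decay n x"
  unfolding partials_append by blast+
qed

lemma schwartz_rapid:
 assumes f: "f \<in> schwartz" shows "rapid f"
 unfolding rapid_def
proof (intro conjI allI)
 show "continuous_on UNIV f"
  using schwartz_differentiable[OF f, of "[]"]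
  by (intro continuous_at_imp_continuous_on ballI) (auto intro: differentiable_imp_continuous_within)
 show "\<exists>C. \<forall>t. norm (f t) <= C * decay n t" for n
  using schwartz_bound[OF f, of "[]"] by simp
qed

lemma partials_add:
 assumes "f \<in> schwartz" "g \<in> schwartz" "set bs \<subseteq> Basis"
 shows "partials bs (%x. f x + g x) = (%x. partials bs f x + partials bs g x)"
 using assms(3)
proof (induction bs)
 case (Cons b bs)
 have "frechet_derivative (%x. partials bs f x + partials bs g x) (at x)
   = (%h. frechet_derivative (partials bs f) (at x) h + frechet_derivative (partials bs g) (at x) h)" for x
  by (intro frechet_derivative_at[symmetric] has_derivative_add schwartz_has_derivative assms) (use Cons.prems in auto)
 then show ?case using Cons by simp
qed simp

lemma partials_cmult:
 assumes "f \<in> schwartz" "set bs \<subseteq> Basis"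
 shows "partials bs (%x. c * f x) = (%x. c * partials bs f x)"
 using assms(2)
proof (induction bs)
 case (Cons b bs)
 have "frechet_derivative (%x. c * partials bs f x) (at x)
   = (%h. c * frechet_derivative (partials bs f) (at x) h)" for x
  by (intro frechet_derivative_at[symmetric] has_derivative_mult_right schwartz_has_derivative assms) (use Cons.prems in auto)
 then show ?case using Cons by simp
qed simp

lemma schwartz_add:
 assumes "f \<in> schwartz" "g \<in> schwartz" shows "(%x. f x + g x) \<in> schwartz"
proof (rule schwartzI)
 fix bs :: "'a list" and x n assume bs: "set bs \<subseteq> Basis"
 show "partials bs (%x. f x + g x) differentiable (at x)"
  unfolding partials_add[OF assms bs] using bs assms by (intro differentiable_add schwartz_differentiable)
 obtain C D where "!!x. norm (partials bs f x) <= C * decay n x" "!!x. norm (partials bs g x) <= D * decay n x"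
  using schwartz_bound[OF assms(1) bs] schwartz_bound[OF assms(2) bs] by blast
 then have "norm (partials bs f x + partials bs g x) <= (C + D) * decay n x" for x
  unfolding distrib_right by (intro norm_triangle_le add_mono)
 then show "\<exists>C. \<forall>x. norm (partials bs (%x. f x + g x) x) <= C * decay n x"
  unfolding partials_add[OF assms bs] by blast
qed

lemma schwartz_cmult:
 assumes "f \<in> schwartz" shows "(%x. c * f x) \<in> schwartz"
proof (rule schwartzI)
 fix bs :: "'a list" and x n assume bs: "set bs \<subseteq> Basis"
 show "partials bs (%x. c * f x) differentiable (at x)"
  unfolding partials_cmult[OF assms bs] using bs assms
  by (intro differentiable_mult differentiable_const schwartz_differentiable)
 obtain C where "!!x. norm (partials bs f x) <= C * decay n x"
  using schwartz_bound[OF assms(1) bs] by blast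
 then have "norm (c * partials bs f x) <= (norm c * C) * decay n x" for x
  by (simp add: norm_mult mult.assoc mult_left_mono)
 then show "\<exists>C. \<forall>x. norm (partials bs (%x. c * f x) x) <= C * decay n x"
  unfolding partials_cmult[OF assms bs] by blast
qed

lemma schwartz_zero: "(%_. 0) \<in> schwartz"
proof (rule schwartzI)
 fix bs :: "'a list" and x n
 have "partials bs (%_. 0 :: complex) = (%_ :: 'a. 0)"
  by (induction bs) (auto simp: frechet_derivative_const)
 then show "partials bs (%_ :: 'a. 0 :: complex) differentiable (at x)"
  "\<exists>C. \<forall>x. norm (partials bs (%_ :: 'a. 0 :: complex) x) <= C * decay n x" by (auto intro: exI[of _ 0])
qed

lemma schwartz_sum:
 "finite I ==> (!!i. i \<in> I ==> f i \<in> schwartz) ==> (%x. \<Sum>i\<in>I. f i x) \<in> schwartz"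
 by (induction I rule: finite_induct) (auto intro: schwartz_zero schwartz_add)

text \<open>Integrating the derivative over the segment from t to t + b gives H (t + b) - H t, whose
  integral over t vanishes by translation invariance; after exchanging the integrals the same
  quantity is the integral of H'.\<close>

lemma integral_directional_derivative:
 fixes H H' :: "'a::euclidean_space => complex"
 assumes deriv: "!!t s. ((%s. H (t + s *\<^sub>R b)) has_vector_derivative H' (t + s *\<^sub>R b)) (at s)"
  and cont: "continuous_on UNIV H'" and H: "integrable lborel H" and H': "integrable lborel H'"
 shows "(\<integral> t. H' t \<partial>lborel) = 0"
proof -
 have [measurable]: "H \<in> borel_measurable borel" "H' \<in> borel_measurable borel" using H H' by auto
 define F where "F = (%s t. indicator {0..1::real} s *\<^sub>R H' (t + s *\<^sub>R b))"
 have F_int: "integrable (lborel \<Otimes>\<^sub>M lborel) (%(s, t). F s t)"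
 proof (rule integrableI_bounded)
  show "(%(s, t). F s t) \<in> borel_measurable (lborel \<Otimes>\<^sub>M lborel)" unfolding F_def by measurable
  have "(\<integral>\<^sup>+ z. ennreal (norm (case z of (s, t) => F s t)) \<partial>(lborel \<Otimes>\<^sub>M lborel))
    = (\<integral>\<^sup>+ s. \<integral>\<^sup>+ t. ennreal (norm (F s t)) \<partial>lborel \<partial>lborel)"
   unfolding F_def by (subst lborel.nn_integral_fst[symmetric]) (auto simp: split_beta')
  also have "... = (\<integral>\<^sup>+ s. indicator {0..1::real} s * (\<integral>\<^sup>+ t. ennreal (norm (H' (t + s *\<^sub>R b))) \<partial>lborel) \<partial>lborel)"
   by (intro nn_integral_cong) (auto simp: F_def indicator_def)
  also have "... = (\<integral>\<^sup>+ s. indicator {0..1::real} s * (\<integral>\<^sup>+ t. ennreal (norm (H' t)) \<partial>lborel) \<partial>lborel)"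
  proof -
   have "(\<integral>\<^sup>+ t. ennreal (norm (H' (t + s *\<^sub>R b))) \<partial>lborel) = (\<integral>\<^sup>+ t. ennreal (norm (H' t)) \<partial>lborel)" for s
    by (rule nn_integral_shift(1)) measurable
   then show ?thesis by simp
  qed
  also have "... = (\<integral>\<^sup>+ t. ennreal (norm (H' t)) \<partial>lborel)"
   by (simp add: nn_integral_multc)
  also have "... < \<infinity>" using H' by (simp add: integrable_iff_bounded)
  finally show "(\<integral>\<^sup>+ z. ennreal (norm (case z of (s, t) => F s t)) \<partial>(lborel \<Otimes>\<^sub>M lborel)) < \<infinity>" .
 qed
 have FTC: "(\<integral> s. F s t \<partial>lborel) = H (t + b) - H t" for t
 proof -
  have "(\<integral> s. F s t \<partial>lborel) = H (t + 1 *\<^sub>R b) - H (t + 0 *\<^sub>R b)"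
   unfolding F_def
   by (rule integral_FTC_Icc)
    (auto intro!: has_vector_derivative_at_within deriv continuous_intros continuous_on_compose2[OF cont])
  then show ?thesis by simp
 qed
 have "(\<integral> t. H (t + b) - H t \<partial>lborel) = (\<integral> t. H (t + b) \<partial>lborel) - (\<integral> t. H t \<partial>lborel)"
  using H by (intro Bochner_Integration.integral_diff integrable_shift)
 also have "... = 0" by (simp add: integral_shift)
 finally have "0 = (\<integral> t. (\<integral> s. F s t \<partial>lborel) \<partial>lborel)" by (simp add: FTC)
 also have "... = (\<integral> s. (\<integral> t. F s t \<partial>lborel) \<partial>lborel)"
  using lborel_pair.Fubini_integral[OF F_int] by simp
 also have "... = (\<integral> s. indicator {0..1::real} s *\<^sub>R (\<integral> t. H' t \<partial>lborel) \<partial>lborel)"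
  by (intro Bochner_Integration.integral_cong refl) (simp add: F_def integral_shift(1))
 also have "... = (\<integral> t. H' t \<partial>lborel)" by simp
 finally show ?thesis ..
qed

section \<open>Fourier transforms of products of two Schwartz functions along lines\<close>

lemma schwartz_line_derivative:
 assumes "f \<in> schwartz"
 shows "((%s. f (u + \<alpha> *\<^sub>R (t + s *\<^sub>R b))) has_vector_derivative \<alpha> *\<^sub>R partials [b] f (u + \<alpha> *\<^sub>R (t + s *\<^sub>R b))) (at s)"
proof -
 let ?x = "u + \<alpha> *\<^sub>R (t + s *\<^sub>R b)"
 have d: "(f has_derivative frechet_derivative f (at ?x)) (at ?x)"
  using schwartz_differentiable[OF assms, of "[]" ?x] by (simp add: frechet_derivative_works)
 have l: "((%s. u + \<alpha> *\<^sub>R (t + s *\<^sub>R b)) has_derivative (%h. \<alpha> *\<^sub>R h *\<^sub>R b)) (at s)"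
  by (auto intro!: derivative_eq_intros)
 have "((%s. f (u + \<alpha> *\<^sub>R (t + s *\<^sub>R b))) has_derivative (%h. frechet_derivative f (at ?x) (\<alpha> *\<^sub>R h *\<^sub>R b))) (at s)"
  using has_derivative_compose[OF l, of f] d by simp
 moreover have "frechet_derivative f (at ?x) (\<alpha> *\<^sub>R h *\<^sub>R b) = h *\<^sub>R \<alpha> *\<^sub>R partials [b] f ?x" for h
  using has_derivative_linear[OF d] by (simp add: linear_scale mult.commute)
 ultimately show ?thesis by (simp add: has_vector_derivative_def)
qed

text \<open>The integral covers short-time Fourier transforms, \<open>\<tau>\<close>-Wigner distributions and ambiguity functions.\<close>

definition two_point :: "real => real => 'a => 'a => ('a::euclidean_space => complex) => ('a => complex) => 'a => complex" where
 "two_point \<alpha> \<beta> a c f g t = f (a + \<alpha> *\<^sub>R t) * cnj (g (c + \<beta> *\<^sub>R t))"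

text \<open>The two arguments must jointly control the integration variable t and an external
  parameter y; then decay of the two factors becomes decay in t and in y, uniformly in a and
  c.\<close>

definition spread :: "real => real => 'a => 'a => 'a::euclidean_space => bool" where
 "spread \<alpha> \<beta> a c y \<longleftrightarrow> (\<forall>t. 1 + norm t <= (1 + norm (a + \<alpha> *\<^sub>R t)) * (1 + norm (c + \<beta> *\<^sub>R t)) \<and>
  1 + norm y <= (1 + norm (a + \<alpha> *\<^sub>R t)) * (1 + norm (c + \<beta> *\<^sub>R t)))"

text \<open>Decay of order N + M in each factor is divided: N is spent on y and M on t.\<close>

lemma two_point_bound:
 fixes f g :: "'a::euclidean_space => complex"
 assumes "rapid f" "rapid g"
 shows "\<exists>C. 0 <= C \<and> (\<forall>a c y t. spread \<alpha> \<beta> a c y \<longrightarrow> norm (two_point \<alpha> \<beta> a c f g t) <= C * decay N y * decay M t)"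
proof -
 obtain C where C: "0 <= C" "!!t. norm (f t) <= C * decay (N + M) t" using rapidE[OF assms(1)] by blast
 obtain D where D: "0 <= D" "!!t. norm (g t) <= D * decay (N + M) t" using rapidE[OF assms(2)] by blast
 have "norm (two_point \<alpha> \<beta> a c f g t) <= C * D * decay N y * decay M t" if "spread \<alpha> \<beta> a c y" for a c y t
 proof -
  let ?u = "a + \<alpha> *\<^sub>R t" and ?v = "c + \<beta> *\<^sub>R t"
  have *: "decay n ?u * decay n ?v <= decay n z" if "1 + norm z <= (1 + norm ?u) * (1 + norm ?v)" for n z
  proof -
   have "(1 + norm z) ^ n <= (1 + norm ?u) ^ n * (1 + norm ?v) ^ n"
    unfolding power_mult_distrib[symmetric] by (rule power_mono[OF that]) auto
   then show ?thesis unfolding decay_def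
    by (metis inverse_mult_distrib le_imp_inverse_le one_add_norm_pos(1) zero_less_power)
  qed
  have "norm (two_point \<alpha> \<beta> a c f g t) <= (C * decay (N + M) ?u) * (D * decay (N + M) ?v)"
   unfolding two_point_def norm_mult using C D by (intro mult_mono) auto
  also have "... = (C * D) * ((decay N ?u * decay N ?v) * (decay M ?u * decay M ?v))"
   by (simp add: decay_add mult_ac)
  also have "... <= (C * D) * (decay N y * decay M t)"
   using that C D by (intro mult_left_mono mult_mono *) (auto simp: spread_def)
  finally show ?thesis by (simp add: mult.assoc)
 qed
 then show ?thesis using C D by (intro exI[of _ "C * D"]) auto
qed

lemma two_point_measurable [measurable]:
 "rapid f ==> rapid g ==> two_point \<alpha> \<beta> a c f g \<in> borel_measurable borel"
proof -
 assume "rapid f" "rapid g"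
 note [measurable] = this[THEN rapid_measurable]
 show ?thesis unfolding two_point_def[abs_def] by measurable
qed

lemma two_point_integrable:
 fixes f g :: "'a::euclidean_space => complex"
 assumes fg: "rapid f" "rapid g" and sp: "spread \<alpha> \<beta> a c y"
 shows "integrable lborel (two_point \<alpha> \<beta> a c f g)"
proof -
 obtain C where C: "0 <= C" "!!t. norm (two_point \<alpha> \<beta> a c f g t) <= C * decay 0 y * decay (2 * DIM('a)) t"
  using two_point_bound[OF fg, of \<alpha> \<beta> 0 "2 * DIM('a)"] sp by blast
 show ?thesis
  by (rule Bochner_Integration.integrable_bound[of _ "%t. C * decay (2 * DIM('a)) t"])
   (use C fg in \<open>auto intro!: integrable_mult_right integrable_decay simp: abs_mult\<close>)
qed

text \<open>Integration by parts: the derivative in direction b of the two factors times the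
  character integrates to 0, and differentiating the character produces the left-hand side.\<close>

lemma fourier_two_point_parts:
 fixes f g :: "'a::euclidean_space => complex"
 assumes f: "f \<in> schwartz" and g: "g \<in> schwartz" and b: "b \<in> Basis" and sp: "spread \<alpha> \<beta> a c y"
 shows "2 * pi * \<i> * (\<xi> \<bullet> b) * fourier (two_point \<alpha> \<beta> a c f g) \<xi>
  = \<alpha> * fourier (two_point \<alpha> \<beta> a c (partials [b] f) g) \<xi> + \<beta> * fourier (two_point \<alpha> \<beta> a c f (partials [b] g)) \<xi>"
proof -
 define e where "e = (%t. cis (- 2 * pi * (t \<bullet> \<xi>)))"
 have [measurable]: "e \<in> borel_measurable borel" unfolding e_def by measurable
 have pf: "partials [b] f \<in> schwartz" and pg: "partials [b] g \<in> schwartz"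
  using f g b schwartz_partials[of _ "[b]"] by auto
 note r = schwartz_rapid[OF f] schwartz_rapid[OF g] schwartz_rapid[OF pf] schwartz_rapid[OF pg]
 have int: "integrable lborel (%t. two_point \<alpha> \<beta> a c F G t * e t)" if "rapid F" "rapid G" for F G
  by (rule Bochner_Integration.integrable_bound[OF two_point_integrable[OF that sp]])
   (use that in \<open>auto simp: norm_mult e_def\<close>)
 have cont: "continuous_on UNIV (two_point \<alpha> \<beta> a c F G)" if "rapid F" "rapid G" for F G
  unfolding two_point_def[abs_def]
  by (intro continuous_intros continuous_on_compose2[OF rapid_continuous[OF that(1)]]
    continuous_on_compose2[OF rapid_continuous[OF that(2)]]) auto
 define H' where "H' = (%t. \<alpha> * (two_point \<alpha> \<beta> a c (partials [b] f) g t * e t)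
  + \<beta> * (two_point \<alpha> \<beta> a c f (partials [b] g) t * e t) - 2 * pi * \<i> * (\<xi> \<bullet> b) * (two_point \<alpha> \<beta> a c f g t * e t))"
 have "(\<integral> t. H' t \<partial>lborel) = 0"
 proof (rule integral_directional_derivative)
  show "integrable lborel (%t. two_point \<alpha> \<beta> a c f g t * e t)" by (intro int r)
  show "integrable lborel H'" unfolding H'_def
   by (intro Bochner_Integration.integrable_diff Bochner_Integration.integrable_add integrable_mult_right int r)
  show "continuous_on UNIV H'" unfolding H'_def e_def by (intro continuous_intros cont r)
  fix t and s :: real
  have 1: "((%s. f (a + \<alpha> *\<^sub>R (t + s *\<^sub>R b))) has_vector_derivative \<alpha> *\<^sub>R partials [b] f (a + \<alpha> *\<^sub>R (t + s *\<^sub>R b))) (at s)"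
   by (rule schwartz_line_derivative[OF f])
  have 2: "((%s. cnj (g (c + \<beta> *\<^sub>R (t + s *\<^sub>R b)))) has_vector_derivative cnj (\<beta> *\<^sub>R partials [b] g (c + \<beta> *\<^sub>R (t + s *\<^sub>R b)))) (at s)"
   by (intro has_vector_derivative_cnj schwartz_line_derivative[OF g])
  have 3: "((%s. e (t + s *\<^sub>R b)) has_vector_derivative - 2 * pi * \<i> * (\<xi> \<bullet> b) * e (t + s *\<^sub>R b)) (at s)"
  proof -
   have l: "((%s. \<i> * of_real (- 2 * pi * ((t + s *\<^sub>R b) \<bullet> \<xi>))) has_vector_derivative \<i> * of_real (- 2 * pi * (b \<bullet> \<xi>))) (at s)"
    unfolding has_vector_derivative_def
    by (auto intro!: derivative_eq_intros simp: inner_add_left fun_eq_iff scaleR_conv_of_real algebra_simps)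
   have "((exp \<circ> (%s. \<i> * of_real (- 2 * pi * ((t + s *\<^sub>R b) \<bullet> \<xi>)))) has_vector_derivative
     \<i> * of_real (- 2 * pi * (b \<bullet> \<xi>)) * exp (\<i> * of_real (- 2 * pi * ((t + s *\<^sub>R b) \<bullet> \<xi>)))) (at s)"
    by (rule field_vector_diff_chain_at[OF l DERIV_exp])
   then show ?thesis
    unfolding e_def cis_conv_exp o_def by (simp add: inner_commute[of b] mult_ac)
  qed
  show "((%s. two_point \<alpha> \<beta> a c f g (t + s *\<^sub>R b) * e (t + s *\<^sub>R b)) has_vector_derivative H' (t + s *\<^sub>R b)) (at s)"
   unfolding two_point_def H'_def
   by (rule has_vector_derivative_eq_rhs[OF has_vector_derivative_mult[OF has_vector_derivative_mult[OF 1 2] 3]])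
    (simp add: algebra_simps scaleR_conv_of_real)
 qed
 moreover have "(\<integral> t. H' t \<partial>lborel) = \<alpha> * fourier (two_point \<alpha> \<beta> a c (partials [b] f) g) \<xi>
  + \<beta> * fourier (two_point \<alpha> \<beta> a c f (partials [b] g)) \<xi> - 2 * pi * \<i> * (\<xi> \<bullet> b) * fourier (two_point \<alpha> \<beta> a c f g) \<xi>"
  unfolding H'_def fourier_def
  by (subst Bochner_Integration.integral_diff Bochner_Integration.integral_add integral_mult_right_zero
    | intro Bochner_Integration.integrable_add integrable_mult_right int r)+ (simp add: e_def)
 ultimately show ?thesis by simp
qed

text \<open>Each power of a frequency coordinate costs one derivative. The derivative may fall on
  either factor, so the induction runs over all pairs of Schwartz functions; the bounds on \<alpha>
  and \<beta> together with 2 pi >= 1 let the constants simply add.\<close>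

lemma fourier_two_point_power:
 assumes b: "b \<in> Basis" and ab: "\<bar>\<alpha>\<bar> <= 1" "\<bar>\<beta>\<bar> <= 1"
  and "f \<in> schwartz" "g \<in> schwartz"
 shows "\<exists>C. 0 <= C \<and> (\<forall>a c y \<xi> :: 'a::euclidean_space. spread \<alpha> \<beta> a c y \<longrightarrow>
  \<bar>\<xi> \<bullet> b\<bar> ^ k * norm (fourier (two_point \<alpha> \<beta> a c f g) \<xi>) <= C * decay N y)"
 using assms(4,5)
proof (induction k arbitrary: f g)
 case 0
 note r = schwartz_rapid[OF 0(1)] schwartz_rapid[OF 0(2)]
 obtain C where C: "0 <= C" "!!a c y t. spread \<alpha> \<beta> a c y ==> norm (two_point \<alpha> \<beta> a c f g t) <= C * decay N y * decay (2 * DIM('a)) t"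
  using two_point_bound[OF r, of \<alpha> \<beta> N "2 * DIM('a)"] by blast
 let ?D = "\<integral> t. decay (2 * DIM('a)) (t :: 'a) \<partial>lborel"
 have "norm (fourier (two_point \<alpha> \<beta> a c f g) \<xi>) <= C * ?D * decay N y" if "spread \<alpha> \<beta> a c y" for a c y \<xi>
 proof -
  have "norm (fourier (two_point \<alpha> \<beta> a c f g) \<xi>) <= (\<integral> t. C * decay N y * decay (2 * DIM('a)) (t :: 'a) \<partial>lborel)"
   unfolding fourier_def
  proof (rule order_trans[OF integral_norm_bound integral_mono'])
   show "integrable lborel (%t :: 'a. C * decay N y * decay (2 * DIM('a)) t)"
    by (intro integrable_mult_right integrable_decay) simp
  qed (use C that in \<open>auto simp: norm_mult\<close>)
  then show ?thesis by (simp add: mult_ac)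
 qed
 then show ?case using C by (intro exI[of _ "C * ?D"]) (auto intro!: mult_nonneg_nonneg integral_nonneg_AE)
next
 case (Suc k)
 have pf: "partials [b] f \<in> schwartz" and pg: "partials [b] g \<in> schwartz"
  using Suc.prems b schwartz_partials[of _ "[b]"] by auto
 obtain C where C: "0 <= C" "!!a c y \<xi>. spread \<alpha> \<beta> a c y ==>
   \<bar>\<xi> \<bullet> b\<bar> ^ k * norm (fourier (two_point \<alpha> \<beta> a c (partials [b] f) g) \<xi>) <= C * decay N y"
  using Suc.IH[OF pf Suc.prems(2)] by blast
 obtain D where D: "0 <= D" "!!a c y \<xi>. spread \<alpha> \<beta> a c y ==>
   \<bar>\<xi> \<bullet> b\<bar> ^ k * norm (fourier (two_point \<alpha> \<beta> a c f (partials [b] g)) \<xi>) <= D * decay N y"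
  using Suc.IH[OF Suc.prems(1) pg] by blast
 have "\<bar>\<xi> \<bullet> b\<bar> ^ Suc k * norm (fourier (two_point \<alpha> \<beta> a c f g) \<xi>) <= (C + D) * decay N y"
  if sp: "spread \<alpha> \<beta> a c y" for a c y \<xi>
 proof -
  let ?F = "fourier (two_point \<alpha> \<beta> a c f g) \<xi>" and ?A = "fourier (two_point \<alpha> \<beta> a c (partials [b] f) g) \<xi>"
   and ?B = "fourier (two_point \<alpha> \<beta> a c f (partials [b] g)) \<xi>"
  have "1 * (\<bar>\<xi> \<bullet> b\<bar> * norm ?F) <= (2 * pi) * (\<bar>\<xi> \<bullet> b\<bar> * norm ?F)"
   using pi_gt3 by (intro mult_right_mono) auto
  also have "... = norm (2 * pi * \<i> * (\<xi> \<bullet> b) * ?F)" by (simp add: norm_mult)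
  also have "... = norm (\<alpha> * ?A + \<beta> * ?B)"
   using fourier_two_point_parts[OF Suc.prems b sp] by simp
  also have "... <= \<bar>\<alpha>\<bar> * norm ?A + \<bar>\<beta>\<bar> * norm ?B"
   by (rule norm_triangle_le) (simp add: norm_mult)
  also have "... <= norm ?A + norm ?B"
   using ab by (intro add_mono mult_left_le_one_le) auto
  finally have "\<bar>\<xi> \<bullet> b\<bar> * norm ?F <= norm ?A + norm ?B" by simp
  then have "\<bar>\<xi> \<bullet> b\<bar> ^ k * (\<bar>\<xi> \<bullet> b\<bar> * norm ?F) <= \<bar>\<xi> \<bullet> b\<bar> ^ k * (norm ?A + norm ?B)"
   by (intro mult_left_mono) auto
  also have "... <= C * decay N y + D * decay N y"
   unfolding distrib_left by (intro add_mono C(2) D(2) sp)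
  finally show ?thesis by (simp add: algebra_simps)
 qed
 then show ?case using C D by (intro exI[of _ "C + D"]) auto
qed

lemma fourier_two_point_decay:
 assumes ab: "\<bar>\<alpha>\<bar> <= 1" "\<bar>\<beta>\<bar> <= 1" and fg: "f \<in> schwartz" "g \<in> schwartz"
 shows "\<exists>C. 0 <= C \<and> (\<forall>a c y \<xi> :: 'a::euclidean_space. spread \<alpha> \<beta> a c y \<longrightarrow>
  norm (fourier (two_point \<alpha> \<beta> a c f g) \<xi>) <= C * (decay N y * decay n \<xi>))"
proof -
 have "\<forall>b\<in>(Basis :: 'a set). \<exists>C. 0 <= C \<and> (\<forall>a c y \<xi>. spread \<alpha> \<beta> a c y \<longrightarrow>
  \<bar>\<xi> \<bullet> b\<bar> ^ n * norm (fourier (two_point \<alpha> \<beta> a c f g) \<xi>) <= C * decay N y)"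
  using fourier_two_point_power[OF _ ab fg] by blast
 from bchoice[OF this] obtain C where C: "!!b. b \<in> (Basis :: 'a set) ==> 0 <= C b"
  "!!b a c y \<xi>. b \<in> Basis ==> spread \<alpha> \<beta> a c y ==> \<bar>\<xi> \<bullet> b\<bar> ^ n * norm (fourier (two_point \<alpha> \<beta> a c f g) \<xi>) <= C b * decay N y"
  by blast
 obtain b0 :: 'a where b0: "b0 \<in> Basis" using nonempty_Basis by blast
 \<comment> \<open>The power 0 takes care of the summand 1 in the estimate of (1 + norm
   \<xi>)^n.\<close>
 obtain C0 where C0: "0 <= C0" "!!a c y \<xi>. spread \<alpha> \<beta> a c y ==> norm (fourier (two_point \<alpha> \<beta> a c f g) \<xi>) <= C0 * decay N y"
  using fourier_two_point_power[OF b0 ab fg, of 0 N] by auto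
 define d where "d = real DIM('a)"
 define K where "K = 2 ^ n * (C0 + d ^ n * sum C Basis)"
 have "norm (fourier (two_point \<alpha> \<beta> a c f g) \<xi>) <= K * (decay N y * decay n \<xi>)" if sp: "spread \<alpha> \<beta> a c y" for a c y \<xi>
 proof -
  let ?F = "norm (fourier (two_point \<alpha> \<beta> a c f g) \<xi>)"
  \<comment> \<open>The largest coordinate controls the norm up to the factor DIM, so powers of a
    single coordinate suffice.\<close>
  obtain b where b: "b \<in> Basis" "!!b'. b' \<in> Basis ==> \<bar>\<xi> \<bullet> b'\<bar> <= \<bar>\<xi> \<bullet> b\<bar>"
  proof -
   have "Max ((%b. \<bar>\<xi> \<bullet> b\<bar>) ` Basis) \<in> (%b. \<bar>\<xi> \<bullet> b\<bar>) ` Basis" by (rule Max_in) auto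
   then obtain b where "b \<in> Basis" "Max ((%b. \<bar>\<xi> \<bullet> b\<bar>) ` Basis) = \<bar>\<xi> \<bullet> b\<bar>"
    by (rule imageE) simp
   moreover have "\<bar>\<xi> \<bullet> b'\<bar> <= Max ((%b. \<bar>\<xi> \<bullet> b\<bar>) ` Basis)" if "b' \<in> Basis" for b'
    by (rule Max_ge) (use that in auto)
   ultimately show thesis by (intro that[of b]) simp_all
  qed
  define t where "t = d * \<bar>\<xi> \<bullet> b\<bar>"
  have t0: "0 <= t" by (simp add: t_def d_def)
  have "norm \<xi> <= (\<Sum>b'\<in>Basis. \<bar>\<xi> \<bullet> b'\<bar>)" by (rule norm_le_l1)
  also have "... <= (\<Sum>b'\<in>(Basis :: 'a set). \<bar>\<xi> \<bullet> b\<bar>)" by (intro sum_mono b)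
  also have "... = t" by (simp add: t_def d_def)
  finally have "norm \<xi> <= t" .
  then have "(1 + norm \<xi>) ^ n <= (2 * max 1 t) ^ n" by (intro power_mono) auto
  also have "... = 2 ^ n * (max 1 t) ^ n" by (simp add: power_mult_distrib)
  also have "(max 1 t) ^ n <= 1 + t ^ n" using t0 by (auto simp: max_def)
  finally have p: "(1 + norm \<xi>) ^ n <= 2 ^ n * (1 + t ^ n)" by simp
  have "(1 + norm \<xi>) ^ n * ?F <= 2 ^ n * (1 + t ^ n) * ?F" by (intro mult_right_mono p) auto
  also have "... = 2 ^ n * (?F + d ^ n * (\<bar>\<xi> \<bullet> b\<bar> ^ n * ?F))"
   by (simp add: t_def power_mult_distrib algebra_simps)
  also have "... <= 2 ^ n * (C0 * decay N y + d ^ n * (C b * decay N y))"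
   using sp b C C0 by (intro mult_left_mono add_mono) (auto simp: d_def)
  also have "... <= 2 ^ n * (C0 * decay N y + d ^ n * (sum C Basis * decay N y))"
   using b C by (intro mult_left_mono add_mono mult_right_mono member_le_sum) (auto simp: d_def)
  also have "... = K * decay N y" by (simp add: K_def algebra_simps)
  finally have "decay n \<xi> * ((1 + norm \<xi>) ^ n * ?F) <= decay n \<xi> * (K * decay N y)"
   by (intro mult_left_mono) auto
  moreover have "decay n \<xi> * ((1 + norm \<xi>) ^ n * ?F) = ?F" by (simp flip: mult.assoc)
  ultimately show ?thesis by (simp add: mult_ac)
 qed
 moreover have "0 <= K" using C C0 by (auto simp: K_def d_def intro!: mult_nonneg_nonneg add_nonneg_nonneg sum_nonneg)
 ultimately show ?thesis by blast
qed

text \<open>The functions obtained from \<open>E\<close> by sums and multiplication by affine functions; for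
 \<open>E = exp \<circ> q\<close> with \<open>q\<close> quadratic this class is closed under partial derivatives.\<close>

inductive_set affine_span :: "('a::euclidean_space => complex) => ('a => complex) set" for E where
 base: "E \<in> affine_span E"
| add: "s \<in> affine_span E ==> t \<in> affine_span E ==> (%x. s x + t x) \<in> affine_span E"
| mult: "s \<in> affine_span E ==> bounded_linear l ==> (%x. (c + l x) * s x) \<in> affine_span E"

lemma affine_span_bound:
 assumes "s \<in> affine_span E"
 shows "\<exists>n C. 0 <= C \<and> (\<forall>x. norm (s x) <= C * (1 + norm x) ^ n * norm (E x))"
 using assms
proof induction
 case base
 show ?case by (intro exI[of _ 0] exI[of _ 1]) auto
next
 case (add s t)
 then obtain m C n D where C: "0 <= C" "!!x. norm (s x) <= C * (1 + norm x) ^ m * norm (E x)"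
  and D: "0 <= D" "!!x. norm (t x) <= D * (1 + norm x) ^ n * norm (E x)" by blast
 have "norm (s x + t x) <= (C + D) * (1 + norm x) ^ (m + n) * norm (E x)" for x
 proof -
  have "norm (s x) <= C * (1 + norm x) ^ (m + n) * norm (E x)"
   by (rule order_trans[OF C(2)]) (auto intro!: mult_right_mono mult_left_mono power_increasing C)
  moreover have "norm (t x) <= D * (1 + norm x) ^ (m + n) * norm (E x)"
   by (rule order_trans[OF D(2)]) (auto intro!: mult_right_mono mult_left_mono power_increasing D)
  ultimately show ?thesis by (simp add: distrib_right norm_triangle_le)
 qed
 then show ?case using C D by (intro exI[of _ "m + n"] exI[of _ "C + D"]) auto
next
 case (mult s l c)
 then obtain n C where C: "0 <= C" "!!x. norm (s x) <= C * (1 + norm x) ^ n * norm (E x)" by blast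
 obtain K where K: "0 < K" "!!x. norm (l x) <= norm x * K"
  using bounded_linear.pos_bounded[OF mult(2)] by blast
 have "norm ((c + l x) * s x) <= ((norm c + K) * C) * (1 + norm x) ^ Suc n * norm (E x)" for x
 proof -
  have "norm (c + l x) <= norm c * 1 + norm x * K" using K by (intro norm_triangle_le add_mono) auto
  also have "... <= norm c * (1 + norm x) + (1 + norm x) * K"
   using K by (intro add_mono mult_left_mono mult_right_mono) auto
  also have "... = (norm c + K) * (1 + norm x)" by (simp add: algebra_simps)
  finally have "norm ((c + l x) * s x) <= ((norm c + K) * (1 + norm x)) * (C * (1 + norm x) ^ n * norm (E x))"
   unfolding norm_mult using K C by (intro mult_mono) auto
  then show ?thesis by (simp add: mult_ac)
 qed
 then show ?case using C K by (intro exI[of _ "Suc n"] exI[of _ "(norm c + K) * C"]) auto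
qed

lemma affine_span_derivative:
 fixes q :: "'a::euclidean_space => complex"
 assumes q: "!!x. (q has_derivative L x) (at x)"
  and affine: "!!b. b \<in> Basis ==> \<exists>c l. bounded_linear l \<and> (\<forall>x. L x b = c + l x)"
  and s: "s \<in> affine_span (%x. exp (q x))"
 shows "\<exists>D. (\<forall>x. (s has_derivative D x) (at x)) \<and> (\<forall>b\<in>Basis. (%x. D x b) \<in> affine_span (%x. exp (q x)))"
 using s
proof induction
 case base
 show ?case
 proof (intro exI[of _ "%x h. L x h * exp (q x)"] conjI allI ballI)
  fix x show "((%x. exp (q x)) has_derivative (%h. L x h * exp (q x))) (at x)"
   by (rule has_derivative_eq_rhs[OF has_derivative_compose[OF q[of x]]]) (auto intro!: derivative_eq_intros)
 next
  fix b :: 'a assume "b \<in> Basis"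
  then obtain c l where l: "bounded_linear l" "!!x. L x b = c + l x" using affine by blast
  show "(%x. L x b * exp (q x)) \<in> affine_span (%x. exp (q x))"
   unfolding l(2) by (intro affine_span.intros l)
 qed
next
 case (add s t)
 then obtain D1 D2 where "!!x. (s has_derivative D1 x) (at x)" "!!b. b \<in> Basis ==> (%x. D1 x b) \<in> affine_span (%x. exp (q x))"
  "!!x. (t has_derivative D2 x) (at x)" "!!b. b \<in> Basis ==> (%x. D2 x b) \<in> affine_span (%x. exp (q x))" by blast
 then show ?case
  by (intro exI[of _ "%x h. D1 x h + D2 x h"] conjI allI ballI has_derivative_add affine_span.add)
next
 case (mult s l c)
 then obtain D where D: "!!x. (s has_derivative D x) (at x)" "!!b. b \<in> Basis ==> (%x. D x b) \<in> affine_span (%x. exp (q x))"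
  by blast
 show ?case
 proof (intro exI[of _ "%x h. (c + l x) * D x h + l h * s x"] conjI allI ballI)
  fix x
  have "((%x. c + l x) has_derivative l) (at x)"
   using bounded_linear.has_derivative[OF mult(2) has_derivative_ident] by (auto intro!: derivative_eq_intros)
  from has_derivative_mult[OF this D(1)]
  show "((%x. (c + l x) * s x) has_derivative (%h. (c + l x) * D x h + l h * s x)) (at x)" .
 next
  fix b :: 'a assume b: "b \<in> Basis"
  have "(%x. (l b + (%_. 0) x) * s x) \<in> affine_span (%x. exp (q x))"
   by (intro affine_span.mult mult(1) bounded_linear_zero)
  then show "(%x. (c + l x) * D x b + l b * s x) \<in> affine_span (%x. exp (q x))"
   using affine_span.mult[OF D(2)[OF b] mult(2)] by (intro affine_span.add) auto
 qed
qed

lemma power_exp_bounded: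
 fixes k A :: real
 assumes "0 < k" shows "\<exists>B. \<forall>r\<ge>0. (1 + r) ^ n * exp (A - k * r\<^sup>2) <= B"
proof -
 let ?f = "%r. (1 + r) ^ n * exp (A - k * r\<^sup>2)"
 have "(?f \<longlongrightarrow> 0) at_top" using assms by real_asymp
 then have "eventually (%r. ?f r < 1) at_top" by (rule order_tendstoD) simp
 then obtain R where R: "!!r. R <= r ==> ?f r < 1" by (auto simp: eventually_at_top_linorder)
 have "compact (?f ` {0..max 0 R})" by (intro compact_continuous_image continuous_intros) auto
 then have "bdd_above (?f ` {0..max 0 R})" by (intro bounded_imp_bdd_above compact_imp_bounded)
 then obtain B where B: "!!r. r \<in> {0..max 0 R} ==> ?f r <= B" unfolding bdd_above_def by blast
 show ?thesis
 proof (intro exI[of _ "max 1 B"] allI impI)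
  fix r :: real assume "0 <= r"
  then show "?f r <= max 1 B" using B[of r] R[of r] by (cases "R <= r") (auto simp: max_def)
 qed
qed

text \<open>Every partial derivative lies in the span of exp(q), hence is exp(q) up to polynomial
  growth, and the bound on Re q absorbs the growth. The imaginary part may be quadratic as well, as
  for the chirp in \<open>amb_gauss\<close>.\<close>

lemma exp_quadratic_schwartz:
 fixes q :: "'a::euclidean_space => complex"
 assumes q: "!!x. (q has_derivative L x) (at x)"
  and affine: "!!b. b \<in> Basis ==> \<exists>c l. bounded_linear l \<and> (\<forall>x. L x b = c + l x)"
  and k: "0 < k" and re: "!!x. Re (q x) <= A - k * (norm x)\<^sup>2"
 shows "(%x. exp (q x)) \<in> schwartz"
proof -
 let ?E = "%x. exp (q x)"
 have span: "partials bs ?E \<in> affine_span ?E" if "set bs \<subseteq> Basis" for bs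
  using that
 proof (induction bs)
  case Nil
  show ?case by (simp add: affine_span.base)
 next
  case (Cons b bs)
  obtain D where D: "!!x. (partials bs ?E has_derivative D x) (at x)" "!!b. b \<in> Basis ==> (%x. D x b) \<in> affine_span ?E"
   using affine_span_derivative[OF q affine Cons.IH] Cons.prems by auto
  have "frechet_derivative (partials bs ?E) (at x) = D x" for x
   using frechet_derivative_at[OF D(1)] by simp
  then show ?case using D(2) Cons.prems by simp
 qed
 show ?thesis
 proof (rule schwartzI)
  fix bs :: "'a list" and x n assume bs: "set bs \<subseteq> Basis"
  show "partials bs ?E differentiable (at x)"
   using affine_span_derivative[OF q affine span[OF bs]] by (auto simp: differentiable_def)
  obtain m C where C: "0 <= C" "!!x. norm (partials bs ?E x) <= C * (1 + norm x) ^ m * norm (?E x)"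
   using affine_span_bound[OF span[OF bs]] by blast
  obtain B where B: "!!r. 0 <= r ==> (1 + r) ^ (n + m) * exp (A - k * r\<^sup>2) <= B"
   using power_exp_bounded[OF k] by blast
  have "norm (partials bs ?E x) <= (C * B) * decay n x" for x
  proof -
   have "norm (partials bs ?E x) <= C * (1 + norm x) ^ m * exp (A - k * (norm x)\<^sup>2)"
    using re by (intro order_trans[OF C(2)] mult_left_mono) (auto intro!: mult_nonneg_nonneg C)
   also have "... = C * ((1 + norm x) ^ (n + m) * exp (A - k * (norm x)\<^sup>2)) * decay n x"
    by (simp add: power_add mult_ac)
   also have "... <= (C * B) * decay n x"
    using B[of "norm x"] C by (intro mult_right_mono mult_left_mono) auto
   finally show ?thesis .
  qed
  then show "\<exists>C. \<forall>x. norm (partials bs ?E x) <= C * decay n x" by blast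
 qed
qed

definition gauss :: "'a::euclidean_space => 'a => 'a => complex" where
 "gauss k n t = of_real (exp (- pi * (norm (t - k))\<^sup>2)) * cis (2 * pi * (t \<bullet> n))"

lemma gauss_schwartz: "gauss k n \<in> schwartz"
proof -
 define q where "q = (%t. complex_of_real (- pi * ((t - k) \<bullet> (t - k))) + \<i> * complex_of_real (2 * pi * (t \<bullet> n)))"
 have "gauss k n = (%t. exp (q t))"
  by (simp only: gauss_def[abs_def] q_def exp_add cis_conv_exp power2_norm_eq_inner exp_of_real)
 also have "... \<in> schwartz"
 proof (rule exp_quadratic_schwartz)
  fix x
  show "(q has_derivative (%h. complex_of_real (- pi * (2 * ((x - k) \<bullet> h))) + \<i> * complex_of_real (2 * pi * (h \<bullet> n)))) (at x)"
   unfolding q_def by (auto intro!: derivative_eq_intros simp: fun_eq_iff inner_commute algebra_simps)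
  show "Re (q x) <= pi * (norm k)\<^sup>2 - (pi / 2) * (norm x)\<^sup>2"
  proof -
   \<comment> \<open>Half of this square is the difference of the two sides of the next
     inequality.\<close>
   have "0 <= (norm (x - 2 *\<^sub>R k))\<^sup>2" by simp
   then have "(norm x)\<^sup>2 / 2 - (norm k)\<^sup>2 <= (norm (x - k))\<^sup>2"
    unfolding power2_norm_eq_inner by (simp add: inner_diff_left inner_diff_right inner_commute algebra_simps)
   then have "pi * ((norm x)\<^sup>2 / 2 - (norm k)\<^sup>2) <= pi * (norm (x - k))\<^sup>2" by (intro mult_left_mono) auto
   then show ?thesis by (simp add: q_def power2_norm_eq_inner algebra_simps)
  qed
 next
  fix b :: 'a assume "b \<in> Basis"
  have l: "bounded_linear (%x. complex_of_real (- pi * (2 * (x \<bullet> b))))"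
   by (intro bounded_linear_compose[OF bounded_linear_of_real] bounded_linear_const_mult bounded_linear_inner_left)
  show "\<exists>c l. bounded_linear l \<and> (\<forall>x. complex_of_real (- pi * (2 * ((x - k) \<bullet> b))) + \<i> * complex_of_real (2 * pi * (b \<bullet> n)) = c + l x)"
   by (rule exI[of _ "complex_of_real (pi * (2 * (k \<bullet> b))) + \<i> * complex_of_real (2 * pi * (b \<bullet> n))"])
    (rule exI[of _ "%x. complex_of_real (- pi * (2 * (x \<bullet> b)))"], simp add: l[simplified] inner_diff_left algebra_simps)
 qed auto
 finally show ?thesis .
qed

lemma stft0_two_point: "stft0 \<phi> u x \<xi> = fourier (two_point 1 1 0 (- x) u \<phi>) \<xi>"
 by (simp add: stft0_def two_point_def[abs_def])

lemma spread_stft: "spread 1 1 0 (- x) x"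
 unfolding spread_def
proof (intro allI conjI)
 fix t :: 'a
 show "1 + norm t <= (1 + norm (0 + 1 *\<^sub>R t)) * (1 + norm (- x + 1 *\<^sub>R t))"
  using mult_left_mono[of 1 "1 + norm (t - x)" "1 + norm t"] by simp
 show "1 + norm x <= (1 + norm (0 + 1 *\<^sub>R t)) * (1 + norm (- x + 1 *\<^sub>R t))"
  using one_add_norm_mult[of t "x - t"] by (simp add: norm_minus_commute)
qed

lemma stft0_decay:
 assumes "f \<in> schwartz" "\<phi> \<in> schwartz"
 shows "\<exists>C. 0 <= C \<and> (\<forall>x \<xi>. norm (stft0 \<phi> f x \<xi>) <= C * (decay n x * decay n \<xi>))"
 using fourier_two_point_decay[of 1 1 f \<phi> n n] assms spread_stft
 unfolding stft0_two_point by fastforce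

lemma norm_stft0_gauss:
 "norm (stft0 (gauss 0 0) (gauss k n) x \<xi>) = norm (stft0 (gauss 0 0) (gauss 0 0) (x - k) (\<xi> - n))"
proof -
 have [measurable]: "gauss 0 0 \<in> borel_measurable (borel :: 'a measure)"
  by (intro rapid_measurable schwartz_rapid gauss_schwartz)
 have eq: "gauss k n t = gauss 0 0 (t - k) * cis (2 * pi * (t \<bullet> n))" for t by (simp add: gauss_def)
 show ?thesis
  unfolding stft0_def[of _ "gauss k n"] eq by (rule norm_fourier_shift) measurable
qed

text \<open>This positive number is the diagonal term in \<open>gabor_sum\<close>.\<close>

lemma stft0_gauss_0: "stft0 (gauss 0 0) (gauss 0 0) 0 (0::'a::euclidean_space) = of_real (1 / sqrt 2 ^ DIM('a))"
proof -
 have "gauss 0 0 t * cnj (gauss 0 0 (t - 0)) * cis (- 2 * pi * (t \<bullet> 0)) = of_real (exp (- pi * 2 * (norm t)\<^sup>2)) * cis (2 * pi * (t \<bullet> 0))" for t :: 'a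
  by (simp add: gauss_def flip: exp_add of_real_mult)
 then show ?thesis
  unfolding stft0_def fourier_def by (simp only: gaussian_fourier(2)[of 2 "0::'a"]) simp
qed

section \<open>Tempered distributions given by functions\<close>

lemma integral_lebesgue:
 fixes f :: "'a::euclidean_space => 'b::{banach, second_countable_topology}"
 shows "f \<in> borel_measurable borel ==> integral\<^sup>L lebesgue f = integral\<^sup>L lborel f"
 by (rule integral_completion) simp

lemma schwartz_measurable [measurable_dest]: "f \<in> schwartz ==> f \<in> borel_measurable borel"
 by (intro rapid_measurable schwartz_rapid)

lemma integrable_mult_rapid:
 fixes u :: "'a::euclidean_space => complex"
 assumes u: "integrable lborel u" and g: "rapid g"
 shows "integrable lborel (%x. u x * g x)"
proof -
 obtain B where B: "0 <= B" "!!t. norm (g t) <= B" using rapid_bounded[OF g] by blast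
 show ?thesis
 proof (rule Bochner_Integration.integrable_bound)
  show "integrable lborel (%x. norm (u x) * B)" using u by auto
  show "AE x in lborel. norm (u x * g x) <= norm (norm (u x) * B)"
   using B by (intro AE_I2) (auto simp: norm_mult abs_mult intro!: mult_left_mono)
  show "(%x. u x * g x) \<in> borel_measurable lborel" using u rapid_measurable[OF g] by auto
 qed
qed

lemma schwartz_seminorm_bound:
 assumes "g \<in> schwartz"
 obtains S where "0 <= S" "schwartz_seminorm n g = ennreal S" "!!x. norm (g x) <= S * decay n x"
proof -
 have "schwartz_seminorm n g < top" using assms by (simp add: schwartz_def)
 then obtain S where S: "schwartz_seminorm n g = ennreal S" "0 <= S"
  by (cases "schwartz_seminorm n g") auto
 have "norm (g x) <= S * decay n x" for x
 proof -
  have "(1 + norm x) ^ n * norm (g x) <= S"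
   using schwartz_seminorm_ge[of "[]" n x g] S by simp
  then have "decay n x * ((1 + norm x) ^ n * norm (g x)) <= decay n x * S"
   by (intro mult_left_mono) auto
  then show ?thesis unfolding mult.assoc[symmetric] by (simp add: mult.commute)
 qed
 with S that show thesis by blast
qed

lemma regular_distr_tempered:
 fixes u :: "'a::euclidean_space => complex"
 assumes u: "integrable lborel u"
 shows "regular_distr u \<in> tempered"
proof -
 have [measurable]: "u \<in> borel_measurable borel" using u by auto
 have eq: "regular_distr u g = (\<integral> x. u x * g x \<partial>lborel)" if "g \<in> borel_measurable borel" for g
  unfolding regular_distr_def using that by (intro integral_lebesgue) measurable
 note int = integrable_mult_rapid[OF u schwartz_rapid]
 show ?thesis
  unfolding tempered_def
 proof (intro CollectI conjI ballI allI)
  fix g h :: "'a => complex" assume gh: "g \<in> schwartz" "h \<in> schwartz"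
  note [measurable] = gh[THEN schwartz_measurable]
  show "regular_distr u (%x. g x + h x) = regular_distr u g + regular_distr u h"
   using int[OF gh(1)] int[OF gh(2)] by (simp add: eq distrib_left)
 next
  fix c and g :: "'a => complex" assume g: "g \<in> schwartz"
  note [measurable] = g[THEN schwartz_measurable]
  show "regular_distr u (%x. c * g x) = c * regular_distr u g"
   by (simp add: eq mult.left_commute[of _ c])
 next
  show "\<exists>n C. \<forall>g\<in>schwartz. ennreal (norm (regular_distr u g)) <= ennreal C * schwartz_seminorm n g"
  proof (intro exI ballI)
   fix g :: "'a => complex" assume g: "g \<in> schwartz"
   obtain S where S: "0 <= S" "schwartz_seminorm 0 g = ennreal S" "!!x. norm (g x) <= S * decay 0 x"
    using schwartz_seminorm_bound[OF g, of 0] by blast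
   have "norm (regular_distr u g) <= (\<integral> x. norm (u x) * S \<partial>lborel)"
    unfolding eq[OF schwartz_measurable[OF g]]
    by (rule order_trans[OF integral_norm_bound integral_mono'])
     (use u S in \<open>auto simp: norm_mult intro!: mult_left_mono\<close>)
   then show "ennreal (norm (regular_distr u g)) <= ennreal (\<integral> x. norm (u x) \<partial>lborel) * schwartz_seminorm 0 g"
    using S by (simp add: ennreal_leI flip: ennreal_mult)
  qed
 qed
qed

lemma stft_regular_distr:
 assumes [measurable]: "u \<in> borel_measurable borel" "\<phi> \<in> borel_measurable borel"
 shows "stft \<phi> (regular_distr u) x \<xi> = stft0 \<phi> u x \<xi>"
 unfolding stft_def pairing_def regular_distr_def stft0_def fourier_def
 by (subst integral_lebesgue) (auto simp: cis_cnj mult_ac)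

lemma inverse_fourier_lborel:
 assumes [measurable]: "g \<in> borel_measurable borel"
 shows "inverse_fourier g x = (\<integral> \<xi>. g \<xi> * cis (2 * pi * (x \<bullet> \<xi>)) \<partial>lborel)"
 unfolding inverse_fourier_def by (subst integral_lebesgue) auto

lemma inverse_fourier_distr_eq:
 fixes W :: "'a::euclidean_space => complex"
 assumes W: "integrable lborel W" and g: "integrable lborel g"
 shows "inverse_fourier_distr (regular_distr W) g = (\<integral> t. g t * (\<integral> y. W y * cis (2 * pi * (y \<bullet> t)) \<partial>lborel) \<partial>lborel)"
proof -
 have [measurable]: "W \<in> borel_measurable borel" "g \<in> borel_measurable borel" using W g by auto
 have [measurable]: "inverse_fourier g \<in> borel_measurable borel"
  unfolding inverse_fourier_lborel[OF \<open>g \<in> borel_measurable borel\<close>, abs_def] by measurable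
 have "inverse_fourier_distr (regular_distr W) g = (\<integral> y. W y * inverse_fourier g y \<partial>lborel)"
  unfolding inverse_fourier_distr_def regular_distr_def by (rule integral_lebesgue) measurable
 also have "... = (\<integral> y. (\<integral> t. W y * (g t * cis (2 * pi * (y \<bullet> t))) \<partial>lborel) \<partial>lborel)"
  by (simp add: inverse_fourier_lborel)
 also have "... = (\<integral> t. (\<integral> y. W y * (g t * cis (2 * pi * (y \<bullet> t))) \<partial>lborel) \<partial>lborel)"
  by (rule integral_swap_dominated(1)[OF _ integrable_norm[OF W] integrable_norm[OF g]]) (auto simp: norm_mult)
 also have "... = (\<integral> t. g t * (\<integral> y. W y * cis (2 * pi * (y \<bullet> t)) \<partial>lborel) \<partial>lborel)"
  by (simp add: mult.left_commute[of "W _" "g _"])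
 finally show ?thesis .
qed

text \<open>By \<open>inverse_fourier_distr_eq\<close> the functional is integration against the
  bounded inverse transform \<open>A\<close> of W, and the seminorm of order 2 * DIM bounds the
  integral of |g|.\<close>

lemma inverse_fourier_distr_tempered:
 fixes W :: "'a::euclidean_space => complex"
 assumes W: "integrable lborel W"
 shows "inverse_fourier_distr (regular_distr W) \<in> tempered"
proof -
 have [measurable]: "W \<in> borel_measurable borel" using W by auto
 define A where "A t = (\<integral> y. W y * cis (2 * pi * (y \<bullet> t)) \<partial>lborel)" for t
 have [measurable]: "A \<in> borel_measurable borel" unfolding A_def[abs_def] by measurable
 let ?M = "\<integral> y. norm (W y) \<partial>lborel"
 have A: "norm (A t) <= ?M" for t
  unfolding A_def by (rule order_trans[OF integral_norm_bound]) (simp add: norm_mult)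
 note sint = rapid_integrable[OF schwartz_rapid]
 note eq = inverse_fourier_distr_eq[OF W sint, folded A_def]
 have int: "integrable lborel (%t. g t * A t)" if "g \<in> schwartz" for g
 proof (rule Bochner_Integration.integrable_bound)
  show "integrable lborel (%t. norm (g t) * ?M)" using sint[OF that] by auto
  show "AE t in lborel. norm (g t * A t) <= norm (norm (g t) * ?M)"
   using A by (intro AE_I2) (auto simp: norm_mult abs_mult intro!: mult_left_mono order_trans[OF _ abs_ge_self])
  show "(%t. g t * A t) \<in> borel_measurable lborel" using schwartz_measurable[OF that] by measurable
 qed
 show ?thesis
  unfolding tempered_def
 proof (intro CollectI conjI ballI allI)
  fix g h :: "'a => complex" assume gh: "g \<in> schwartz" "h \<in> schwartz"
  show "inverse_fourier_distr (regular_distr W) (%x. g x + h x)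
    = inverse_fourier_distr (regular_distr W) g + inverse_fourier_distr (regular_distr W) h"
   using int[OF gh(1)] int[OF gh(2)] gh schwartz_add[OF gh] by (simp add: eq distrib_right)
 next
  fix c and g :: "'a => complex" assume g: "g \<in> schwartz"
  show "inverse_fourier_distr (regular_distr W) (%x. c * g x) = c * inverse_fourier_distr (regular_distr W) g"
   using g schwartz_cmult[OF g, of c] by (simp add: eq mult.assoc)
 next
  let ?n = "2 * DIM('a)" and ?D = "\<integral> t. decay (2 * DIM('a)) (t :: 'a) \<partial>lborel"
  show "\<exists>n C. \<forall>g\<in>schwartz. ennreal (norm (inverse_fourier_distr (regular_distr W) g)) <= ennreal C * schwartz_seminorm n g"
  proof (intro exI ballI)
   fix g :: "'a => complex" assume g: "g \<in> schwartz"
   obtain S where S: "0 <= S" "schwartz_seminorm ?n g = ennreal S" "!!x. norm (g x) <= S * decay ?n x"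
    using schwartz_seminorm_bound[OF g, of ?n] by blast
   have M: "0 <= ?M" and D: "0 <= ?D" by auto
   have "norm (inverse_fourier_distr (regular_distr W) g) <= (\<integral> t. (S * ?M) * decay ?n (t :: 'a) \<partial>lborel)"
    unfolding eq[OF g]
   proof (rule order_trans[OF integral_norm_bound integral_mono'])
    show "integrable lborel (%t :: 'a. (S * ?M) * decay ?n t)"
     by (intro integrable_mult_right integrable_decay) simp
    fix t
    have "norm (g t * A t) <= (S * decay ?n t) * ?M"
     unfolding norm_mult using S A by (intro mult_mono) auto
    then show "norm (g t * A t) <= (S * ?M) * decay ?n t" by (simp add: mult_ac)
    show "0 <= (S * ?M) * decay ?n t" using S M by (intro mult_nonneg_nonneg) auto
   qed
   also have "... = (?M * ?D) * S" by simp
   finally show "ennreal (norm (inverse_fourier_distr (regular_distr W) g)) <= ennreal (?M * ?D) * schwartz_seminorm ?n g"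
    using S M D by (simp add: ennreal_leI flip: ennreal_mult)
  qed
 qed
qed

lemma stft_inverse_fourier_distr:
 fixes W :: "'a::euclidean_space => complex"
 assumes W: "integrable lborel W" and \<Phi>: "rapid \<Phi>"
 shows "stft \<Phi> (inverse_fourier_distr (regular_distr W)) z \<zeta>
  = stft0 \<Phi> (%t. \<integral> y. W y * cis (2 * pi * (y \<bullet> t)) \<partial>lborel) z \<zeta>"
proof -
 have [measurable]: "\<Phi> \<in> borel_measurable borel" by (rule rapid_measurable[OF \<Phi>])
 have "integrable lborel (%t. cnj (cis (2 * pi * (t \<bullet> \<zeta>)) * \<Phi> (t - z)))"
  by (rule Bochner_Integration.integrable_bound[OF integrable_shift(2)[OF rapid_integrable[OF \<Phi>], of z]])
   (auto simp: norm_mult)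
 from inverse_fourier_distr_eq[OF W this] show ?thesis
  unfolding stft_def pairing_def stft0_def fourier_def by (simp add: cis_cnj mult_ac)
qed

subsection \<open>The ambiguity function\<close>

text \<open>The \<tau>-cross-ambiguity function. The sign in \<open>- u\<close> turns
  \<open>fourier\<close> into an inverse transform; by \<open>inverse_fourier_wigner\<close> this is
  the inverse Fourier transform of \<open>wigner\<close>.\<close>

definition amb :: "real => ('a::euclidean_space => complex) => ('a => complex) => 'a \<times> 'a => complex" where
 "amb \<tau> f g = (%(u, v). fourier (two_point 1 1 (\<tau> *\<^sub>R v) (- ((1 - \<tau>) *\<^sub>R v)) f g) (- u))"

lemma norm_convex_le:
 fixes a c :: "'a::real_normed_vector"
 assumes "0 <= \<tau>" "\<tau> <= 1"
 shows "1 + norm ((1 - \<tau>) *\<^sub>R a + \<tau> *\<^sub>R c) <= (1 + norm a) * (1 + norm c)"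
proof -
 have "norm ((1 - \<tau>) *\<^sub>R a + \<tau> *\<^sub>R c) <= (1 - \<tau>) * norm a + \<tau> * norm c"
  using assms by (intro norm_triangle_le) auto
 also have "... <= 1 * norm a + 1 * norm c" using assms by (intro add_mono mult_right_mono) auto
 finally have "norm ((1 - \<tau>) *\<^sub>R a + \<tau> *\<^sub>R c) <= norm a + norm c" by simp
 moreover have "0 <= norm a * norm c" by simp
 ultimately show ?thesis unfolding distrib_left distrib_right by linarith
qed

text \<open>The convex combination of the two arguments with weights 1 - \<tau> and \<tau> is t, and
  their difference is v. In \<open>spread_wigner\<close> the two roles are exchanged: the convex
  combination is x and the difference is t.\<close>

lemma spread_amb:
 assumes "0 <= \<tau>" "\<tau> <= 1"
 shows "spread 1 1 (\<tau> *\<^sub>R v) (- ((1 - \<tau>) *\<^sub>R v)) v"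
 unfolding spread_def
proof (intro allI conjI)
 fix t :: 'a
 let ?a = "\<tau> *\<^sub>R v + 1 *\<^sub>R t" and ?c = "- ((1 - \<tau>) *\<^sub>R v) + 1 *\<^sub>R t"
 have "(1 - \<tau>) *\<^sub>R ?a + \<tau> *\<^sub>R ?c = t" by (simp add: algebra_simps)
 then show "1 + norm t <= (1 + norm ?a) * (1 + norm ?c)" using norm_convex_le[OF assms, of ?a ?c] by simp
 have "?a + - ?c = v" by (simp add: algebra_simps)
 then show "1 + norm v <= (1 + norm ?a) * (1 + norm ?c)"
  using one_add_norm_mult[of ?a "- ?c"] by (simp only: norm_minus_cancel)
qed

lemma spread_wigner:
 assumes "0 <= \<tau>" "\<tau> <= 1"
 shows "spread \<tau> (- (1 - \<tau>)) x x x"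
 unfolding spread_def
proof (intro allI conjI)
 fix t :: 'a
 let ?a = "x + \<tau> *\<^sub>R t" and ?c = "x + (- (1 - \<tau>)) *\<^sub>R t"
 have "(1 - \<tau>) *\<^sub>R ?a + \<tau> *\<^sub>R ?c = x" by (simp add: algebra_simps)
 then show "1 + norm x <= (1 + norm ?a) * (1 + norm ?c)" using norm_convex_le[OF assms, of ?a ?c] by simp
 have "?a + - ?c = t" by (simp add: algebra_simps)
 then show "1 + norm t <= (1 + norm ?a) * (1 + norm ?c)"
  using one_add_norm_mult[of ?a "- ?c"] by (simp only: norm_minus_cancel)
qed

lemma wigner_eq:
 assumes [measurable]: "f \<in> borel_measurable borel" "g \<in> borel_measurable borel"
 shows "wigner \<tau> f g (x, \<xi>) = fourier (two_point \<tau> (- (1 - \<tau>)) x x f g) \<xi>"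
 unfolding wigner_def fourier_def two_point_def
 by (simp, subst integral_lebesgue) (auto simp: inner_commute algebra_simps)

lemma amb_measurable [measurable]:
 assumes [measurable]: "f \<in> borel_measurable borel" "g \<in> borel_measurable borel"
 shows "amb \<tau> f g \<in> borel_measurable borel"
 unfolding amb_def fourier_def two_point_def borel_prod[symmetric] by measurable

lemma wigner_measurable [measurable]:
 assumes [measurable]: "f \<in> borel_measurable borel" "g \<in> borel_measurable borel"
 shows "wigner \<tau> f g \<in> borel_measurable borel"
proof -
 have "wigner \<tau> f g = (%(x, \<xi>). fourier (two_point \<tau> (- (1 - \<tau>)) x x f g) \<xi>)"
  by (auto simp: wigner_eq)
 also have "... \<in> borel_measurable (borel \<Otimes>\<^sub>M borel)" unfolding fourier_def two_point_def by measurable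
 finally show ?thesis by (simp add: borel_prod)
qed

lemma amb_decay:
 assumes \<tau>: "0 <= \<tau>" "\<tau> <= 1" and fg: "f \<in> schwartz" "g \<in> schwartz"
 shows "\<exists>C. 0 <= C \<and> (\<forall>u v. norm (amb \<tau> f g (u, v)) <= C * (decay n v * decay n u))"
proof -
 obtain C where C: "0 <= C" "!!a c y \<xi>. spread 1 1 a c y ==> norm (fourier (two_point 1 1 a c f g) \<xi>) <= C * (decay n y * decay n \<xi>)"
  using fourier_two_point_decay[of 1 1 f g n n] fg by auto
 have "norm (amb \<tau> f g (u, v)) <= C * (decay n v * decay n u)" for u v
  using C(2)[OF spread_amb[OF \<tau>], of v "- u"] by (simp add: amb_def)
 with C show ?thesis by blast
qed

lemma wigner_decay:
 assumes \<tau>: "0 <= \<tau>" "\<tau> <= 1" and fg: "f \<in> schwartz" "g \<in> schwartz"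
 shows "\<exists>C. 0 <= C \<and> (\<forall>x \<xi>. norm (wigner \<tau> f g (x, \<xi>)) <= C * (decay n x * decay n \<xi>))"
proof -
 obtain C where C: "0 <= C" "!!a c y \<xi>. spread \<tau> (- (1 - \<tau>)) a c y ==>
   norm (fourier (two_point \<tau> (- (1 - \<tau>)) a c f g) \<xi>) <= C * (decay n y * decay n \<xi>)"
  using fourier_two_point_decay[of \<tau> "- (1 - \<tau>)" f g n n] assms by (auto simp: abs_le_iff)
 have "norm (wigner \<tau> f g (x, \<xi>)) <= C * (decay n x * decay n \<xi>)" for x \<xi>
  unfolding wigner_eq[OF schwartz_measurable[OF fg(1)] schwartz_measurable[OF fg(2)]]
  by (rule C(2)[OF spread_wigner[OF \<tau>]])
 with C show ?thesis by blast
qed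

lemma integrable_pair_decay:
 fixes F :: "'a::euclidean_space \<times> 'a => complex"
 assumes [measurable]: "F \<in> borel_measurable borel"
  and C: "!!x y. norm (F (x, y)) <= C * (decay (2 * DIM('a)) x * decay (2 * DIM('a)) y)"
 shows "integrable lborel F"
proof -
 have "integrable (lborel \<Otimes>\<^sub>M lborel) F"
 proof (rule integrable_pair_dominated)
  show "integrable lborel (%x :: 'a. C * decay (2 * DIM('a)) x)" "integrable lborel (decay (2 * DIM('a)) :: 'a => real)"
   by (auto intro!: integrable_mult_right integrable_decay)
 qed (use C in \<open>auto simp: lborel_prod mult.assoc\<close>)
 then show ?thesis by (simp add: lborel_prod)
qed

lemma amb_integrable:
 assumes \<tau>: "0 <= \<tau>" "\<tau> <= 1" and fg: "f \<in> schwartz" "g \<in> schwartz"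
 shows "integrable lborel (amb \<tau> f g)"
proof -
 note [measurable] = fg[THEN schwartz_measurable]
 obtain C where "!!u v. norm (amb \<tau> f g (u, v)) <= C * (decay (2 * DIM('a)) v * decay (2 * DIM('a)) u)"
  using amb_decay[OF assms] by blast
 then show ?thesis
  by (intro integrable_pair_decay[of _ C]) (simp_all add: mult.commute)
qed

lemma wigner_integrable:
 assumes \<tau>: "0 <= \<tau>" "\<tau> <= 1" and fg: "f \<in> schwartz" "g \<in> schwartz"
 shows "integrable lborel (wigner \<tau> f g)"
proof -
 note [measurable] = fg[THEN schwartz_measurable]
 obtain C where "!!x \<xi>. norm (wigner \<tau> f g (x, \<xi>)) <= C * (decay (2 * DIM('a)) x * decay (2 * DIM('a)) \<xi>)"
  using wigner_decay[OF assms] by blast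
 then show ?thesis
  by (intro integrable_pair_decay[of _ C]) simp_all
qed

text \<open>\<open>wigner\<close> is a Fourier transform in its second variable, so inversion there
  returns the product of the two functions at the lag v; the remaining integral over x is
  \<open>amb\<close>.\<close>

lemma inverse_fourier_wigner:
 fixes f g :: "'a::euclidean_space => complex"
 assumes \<tau>: "0 <= \<tau>" "\<tau> <= 1" and fg: "f \<in> schwartz" "g \<in> schwartz"
 shows "(\<integral> y. wigner \<tau> f g y * cis (2 * pi * (y \<bullet> w)) \<partial>lborel) = amb \<tau> f g w"
proof (cases w)
 case (Pair u v)
 note [measurable] = fg[THEN schwartz_measurable]
 note r = fg[THEN schwartz_rapid]
 have int: "integrable (lborel \<Otimes>\<^sub>M lborel) (%(x, \<xi>). wigner \<tau> f g (x, \<xi>) * cis (2 * pi * ((x, \<xi>) \<bullet> w)))"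
 proof -
  have "integrable lborel (%y. wigner \<tau> f g y * cis (2 * pi * (y \<bullet> w)))"
   by (rule Bochner_Integration.integrable_bound[OF wigner_integrable[OF assms]]) (auto simp: norm_mult)
  then show ?thesis by (simp add: lborel_prod split_beta')
 qed
 have inner: "(\<integral> \<xi>. wigner \<tau> f g (x, \<xi>) * cis (2 * pi * (v \<bullet> \<xi>)) \<partial>lborel) = two_point \<tau> (- (1 - \<tau>)) x x f g v" for x
 proof -
  let ?h = "two_point \<tau> (- (1 - \<tau>)) x x f g"
  note sp = spread_wigner[OF \<tau>, of x]
  obtain C where C: "0 <= C" "!!t. norm (?h t) <= C * decay 0 x * decay 0 t"
   using two_point_bound[OF r, of \<tau> "- (1 - \<tau>)" 0 0] sp by blast
  obtain K where K: "0 <= K" "!!\<xi>. norm (fourier ?h \<xi>) <= K * (decay 0 x * decay (2 * DIM('a)) \<xi>)"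
  proof -
   have "\<exists>C. 0 <= C \<and> (\<forall>a c y \<xi>. spread \<tau> (- (1 - \<tau>)) a c y \<longrightarrow>
     norm (fourier (two_point \<tau> (- (1 - \<tau>)) a c f g) \<xi>) <= C * (decay 0 y * decay (2 * DIM('a)) \<xi>))"
    using \<tau> by (intro fourier_two_point_decay fg) (auto simp: abs_le_iff)
   with sp that show thesis by blast
  qed
  show ?thesis
   unfolding wigner_eq[OF schwartz_measurable[OF fg(1)] schwartz_measurable[OF fg(2)]]
  proof (rule fourier_inversion)
   show "integrable lborel ?h" by (rule two_point_integrable[OF r sp])
   show "continuous_on UNIV ?h"
    unfolding two_point_def[abs_def]
    by (intro continuous_intros continuous_on_compose2[OF rapid_continuous[OF r(1)]]
     continuous_on_compose2[OF rapid_continuous[OF r(2)]]) auto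
   show "norm (?h t) <= C" for t using C(2)[of t] by simp
   show "integrable lborel (fourier ?h)"
   proof (rule Bochner_Integration.integrable_bound)
    show "integrable lborel (%\<xi> :: 'a. K * decay (2 * DIM('a)) \<xi>)"
     by (intro integrable_mult_right integrable_decay) simp
    show "AE \<xi> in lborel. norm (fourier ?h \<xi>) <= norm (K * decay (2 * DIM('a)) \<xi>)"
     using K by (intro AE_I2) (auto intro: order_trans[OF _ abs_ge_self])
   qed (use r in measurable)
  qed
 qed
 have "(\<integral> y. wigner \<tau> f g y * cis (2 * pi * (y \<bullet> w)) \<partial>lborel)
   = (\<integral> x. (\<integral> \<xi>. wigner \<tau> f g (x, \<xi>) * cis (2 * pi * ((x, \<xi>) \<bullet> w)) \<partial>lborel) \<partial>lborel)"
  using lborel_pair.integral_fst[OF int] by (simp add: lborel_prod split_beta')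
 also have "... = (\<integral> x. (\<integral> \<xi>. wigner \<tau> f g (x, \<xi>) * cis (2 * pi * (v \<bullet> \<xi>)) * cis (2 * pi * (x \<bullet> u)) \<partial>lborel) \<partial>lborel)"
  by (simp add: Pair inner_Pair distrib_left cis_mult[symmetric] inner_commute[of v] mult_ac)
 also have "... = (\<integral> x. two_point \<tau> (- (1 - \<tau>)) x x f g v * cis (2 * pi * (x \<bullet> u)) \<partial>lborel)"
  by (simp only: integral_mult_left_zero inner)
 also have "... = amb \<tau> f g w"
  unfolding amb_def fourier_def two_point_def Pair by (simp add: algebra_simps)
 finally show ?thesis .
qed

lemma fourier_translate:
 assumes [measurable]: "h \<in> borel_measurable borel"
 shows "fourier (%t. h (t + s)) \<xi> = cis (2 * pi * (s \<bullet> \<xi>)) * fourier h \<xi>"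
proof -
 have "fourier h \<xi> = (\<integral> t. h (t + s) * cis (- 2 * pi * ((t + s) \<bullet> \<xi>)) \<partial>lborel)"
  unfolding fourier_def by (rule integral_shift(1)[symmetric]) measurable
 also have "... = (\<integral> t. cis (- 2 * pi * (s \<bullet> \<xi>)) * (h (t + s) * cis (- 2 * pi * (t \<bullet> \<xi>))) \<partial>lborel)"
 proof (intro Bochner_Integration.integral_cong refl)
  fix t
  have "cis (- 2 * pi * ((t + s) \<bullet> \<xi>)) = cis (- 2 * pi * (s \<bullet> \<xi>)) * cis (- 2 * pi * (t \<bullet> \<xi>))"
   unfolding cis_mult by (rule arg_cong[where f = cis]) (simp add: inner_add_left algebra_simps)
  then show "h (t + s) * cis (- 2 * pi * ((t + s) \<bullet> \<xi>)) = cis (- 2 * pi * (s \<bullet> \<xi>)) * (h (t + s) * cis (- 2 * pi * (t \<bullet> \<xi>)))"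
   by (simp only: mult_ac)
 qed
 also have "... = cis (- 2 * pi * (s \<bullet> \<xi>)) * fourier (%t. h (t + s)) \<xi>"
  unfolding fourier_def by (rule integral_mult_right_zero)
 finally show ?thesis by (simp add: mult.assoc[symmetric] cis_mult)
qed

lemma fourier_modulate: "fourier (%t. h t * cis (- 2 * pi * (t \<bullet> \<eta>))) \<xi> = fourier h (\<eta> + \<xi>)"
 unfolding fourier_def by (intro Bochner_Integration.integral_cong refl)
  (simp add: mult.assoc cis_mult inner_add_right distrib_left)

text \<open>After u is replaced by - u, a translation of h and a modulation of k bring the integral
  into the form of Parseval's identity.\<close>

lemma amb_parseval:
 fixes h k :: "'a::euclidean_space => complex"
 assumes h: "integrable lborel h" and k: "integrable lborel k" "continuous_on UNIV k" "!!t. norm (k t) <= B"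
  and K: "!!\<xi>. norm (fourier k \<xi>) <= K * decay (2 * DIM('a)) \<xi>"
 shows "(\<integral> u. fourier h (- u) * cnj (fourier k (z - u)) * cis (- 2 * pi * (u \<bullet> \<zeta>)) \<partial>lborel)
  = (\<integral> t. h (t + \<zeta>) * cnj (k t) * cis (2 * pi * (t \<bullet> z)) \<partial>lborel)"
proof -
 have [measurable]: "h \<in> borel_measurable borel" "k \<in> borel_measurable borel" using h k by auto
 let ?k = "%t. k t * cis (- 2 * pi * (t \<bullet> z))"
 have "(\<integral> u. fourier h (- u) * cnj (fourier k (z - u)) * cis (- 2 * pi * (u \<bullet> \<zeta>)) \<partial>lborel)
   = (\<integral> u. fourier h (- (0 - u)) * cnj (fourier k (z - (0 - u))) * cis (- 2 * pi * ((0 - u) \<bullet> \<zeta>)) \<partial>lborel)"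
  by (rule integral_shift(3)[symmetric]) measurable
 also have "... = (\<integral> u. fourier (%t. h (t + \<zeta>)) u * cnj (fourier ?k u) \<partial>lborel)"
  unfolding fourier_translate[OF \<open>h \<in> borel_measurable borel\<close>] fourier_modulate
  by (simp add: inner_commute[of \<zeta>] mult_ac)
 also have "... = (\<integral> t. h (t + \<zeta>) * cnj (?k t) \<partial>lborel)"
 proof (rule parseval)
  show "integrable lborel (%t. h (t + \<zeta>))" by (rule integrable_shift(1)[OF h])
  show "integrable lborel ?k"
   by (rule Bochner_Integration.integrable_bound[OF k(1)]) (auto simp: norm_mult)
  show "continuous_on UNIV ?k" by (intro continuous_intros k)
  show "norm (?k t) <= B" for t using k(3) by (simp add: norm_mult)
  show "integrable lborel (fourier ?k)"
  proof (rule Bochner_Integration.integrable_bound)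
   show "integrable lborel (%\<xi> :: 'a. K * decay (2 * DIM('a)) (\<xi> + z))"
    by (intro integrable_mult_right integrable_shift(1) integrable_decay) simp
   show "AE \<xi> in lborel. norm (fourier ?k \<xi>) <= norm (K * decay (2 * DIM('a)) (\<xi> + z))"
    unfolding fourier_modulate using K by (intro AE_I2) (auto simp: add.commute intro: order_trans[OF _ abs_ge_self])
  qed measurable
 qed
 finally show ?thesis by (simp add: cis_cnj mult_ac)
qed

lemma stft0_eq_shift:
 assumes [measurable]: "\<phi> \<in> borel_measurable borel" "u \<in> borel_measurable borel"
 shows "(\<integral> a. u (a + x) * cnj (\<phi> a) * cis (- 2 * pi * (a \<bullet> \<xi>)) \<partial>lborel) = cis (2 * pi * (x \<bullet> \<xi>)) * stft0 \<phi> u x \<xi>"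
 using fourier_translate[of "%t. u t * cnj (\<phi> (t - x))" x \<xi>]
 by (simp add: fourier_def stft0_def)

text \<open>In the variables a = t + \<tau> s and b = t - (1 - \<tau>) s = a - s the integrand
  separates. The substitution has Jacobian 1 and is carried out by translations and a
  reflection.\<close>

lemma integral_convolution_product:
 fixes F1 F2 :: "'a::euclidean_space => complex"
 assumes [measurable]: "F1 \<in> borel_measurable borel" "F2 \<in> borel_measurable borel"
  and C: "0 <= C" "!!a. norm (F1 a) <= C * decay (2 * DIM('a) + 2 * DIM('a)) a" and D: "0 <= D" "!!a. norm (F2 a) <= D * decay (2 * DIM('a)) a"
 shows "(\<integral> s. (\<integral> t. F1 (t + \<tau> *\<^sub>R s) * F2 (t - (1 - \<tau>) *\<^sub>R s) \<partial>lborel) \<partial>lborel) = integral\<^sup>L lborel F1 * integral\<^sup>L lborel F2"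
proof -
 let ?n = "2 * DIM('a)"
 have "(\<integral> t. F1 (t + \<tau> *\<^sub>R s) * F2 (t - (1 - \<tau>) *\<^sub>R s) \<partial>lborel) = (\<integral> a. F1 a * F2 (a - s) \<partial>lborel)" for s
  using integral_shift(1)[of "%a. F1 a * F2 (a - s)" "\<tau> *\<^sub>R s"] by (simp add: algebra_simps)
 then have "(\<integral> s. (\<integral> t. F1 (t + \<tau> *\<^sub>R s) * F2 (t - (1 - \<tau>) *\<^sub>R s) \<partial>lborel) \<partial>lborel)
   = (\<integral> s. (\<integral> a. F1 a * F2 (a - s) \<partial>lborel) \<partial>lborel)" by simp
 also have "... = (\<integral> a. (\<integral> s. F1 a * F2 (a - s) \<partial>lborel) \<partial>lborel)"
 proof (rule integral_swap_dominated(1))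
  show "integrable lborel (%s :: 'a. C * D * decay ?n s)" "integrable lborel (decay ?n :: 'a => real)"
   by (auto intro!: integrable_mult_right integrable_decay)
  fix s a
  have "norm (F1 a * F2 (a - s)) <= (C * decay (?n + ?n) a) * (D * decay ?n (a - s))"
   unfolding norm_mult using C(1) C(2)[of a] D by (intro mult_mono) auto
  \<comment> \<open>Half of the decay of F1 turns decay in a - s into decay in s; the other half
    remains for the integral over a.\<close>
  also have "... = C * D * (decay ?n (s - a) * decay ?n (a - 0)) * decay ?n a"
   unfolding decay_add by (simp add: decay_commute[of _ s a])
  also have "... <= C * D * decay ?n (s - 0) * decay ?n a"
   using C D by (intro mult_right_mono mult_left_mono decay_chain) auto
  finally show "norm (F1 a * F2 (a - s)) <= C * D * decay ?n s * decay ?n a" by simp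
 qed measurable
 also have "... = (\<integral> a. F1 a * integral\<^sup>L lborel F2 \<partial>lborel)"
  by (simp add: integral_shift(3))
 finally show ?thesis by simp
qed

text \<open>At fixed v the integral over u is evaluated by \<open>amb_parseval\<close>. After the
  shift v = s + z2 the integrand is a function of t + \<tau> s times a function of t - (1 - \<tau>)
  s, so that \<open>integral_convolution_product\<close> splits it; all remaining exponentials have
  modulus 1.\<close>

lemma norm_stft0_amb:
 fixes f g \<phi>1 \<phi>2 :: "'a::euclidean_space => complex"
 assumes \<tau>: "0 <= \<tau>" "\<tau> <= 1" and fg: "f \<in> schwartz" "g \<in> schwartz" and \<phi>: "\<phi>1 \<in> schwartz" "\<phi>2 \<in> schwartz"
 shows "norm (stft0 (amb \<tau> \<phi>1 \<phi>2) (amb \<tau> f g) (z1, z2) (\<zeta>1, \<zeta>2))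
  = norm (stft0 \<phi>1 f (\<zeta>1 + \<tau> *\<^sub>R z2) (\<zeta>2 - (1 - \<tau>) *\<^sub>R z1)) * norm (stft0 \<phi>2 g (\<zeta>1 - (1 - \<tau>) *\<^sub>R z2) (\<zeta>2 + \<tau> *\<^sub>R z1))"
proof -
 note [measurable] = fg[THEN schwartz_measurable] \<phi>[THEN schwartz_measurable]
 note rf = fg[THEN schwartz_rapid] and r\<phi> = \<phi>[THEN schwartz_rapid]
 let ?n = "2 * DIM('a)"
 let ?A1 = "\<zeta>1 + \<tau> *\<^sub>R z2" and ?A2 = "\<zeta>2 - (1 - \<tau>) *\<^sub>R z1"
  and ?B1 = "\<zeta>1 - (1 - \<tau>) *\<^sub>R z2" and ?B2 = "\<zeta>2 + \<tau> *\<^sub>R z1"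
 define h where "h v = two_point 1 1 (\<tau> *\<^sub>R v) (- ((1 - \<tau>) *\<^sub>R v)) f g" for v
 define k where "k v = two_point 1 1 (\<tau> *\<^sub>R v) (- ((1 - \<tau>) *\<^sub>R v)) \<phi>1 \<phi>2" for v
 let ?F = "%w. amb \<tau> f g w * cnj (amb \<tau> \<phi>1 \<phi>2 (w - (z1, z2))) * cis (- 2 * pi * (w \<bullet> (\<zeta>1, \<zeta>2)))"
 obtain Ca where Ca: "!!u v. norm (amb \<tau> \<phi>1 \<phi>2 (u, v)) <= Ca * (decay 0 v * decay 0 u)"
  using amb_decay[OF \<tau> \<phi>] by blast
 have "integrable lborel ?F"
 proof (rule Bochner_Integration.integrable_bound)
  show "integrable lborel (%w. norm (amb \<tau> f g w) * Ca)" using amb_integrable[OF \<tau> fg] by auto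
  show "AE w in lborel. norm (?F w) <= norm (norm (amb \<tau> f g w) * Ca)"
  proof (rule AE_I2)
   fix w :: "'a \<times> 'a"
   have "norm (amb \<tau> \<phi>1 \<phi>2 (w - (z1, z2))) <= Ca" using Ca[of "fst w - z1" "snd w - z2"] by (cases w) simp
   then show "norm (?F w) <= norm (norm (amb \<tau> f g w) * Ca)"
    by (auto simp: norm_mult abs_mult intro!: mult_left_mono order_trans[OF _ abs_ge_self])
  qed
 qed measurable
 then have int: "integrable (lborel \<Otimes>\<^sub>M lborel) (%(u, v). ?F (u, v))"
  unfolding lborel_prod by (rule iffD1[OF Bochner_Integration.integrable_cong, rotated -1]) auto
 have "stft0 (amb \<tau> \<phi>1 \<phi>2) (amb \<tau> f g) (z1, z2) (\<zeta>1, \<zeta>2) = (\<integral> v. (\<integral> u. ?F (u, v) \<partial>lborel) \<partial>lborel)"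
 proof -
  have "stft0 (amb \<tau> \<phi>1 \<phi>2) (amb \<tau> f g) (z1, z2) (\<zeta>1, \<zeta>2) = integral\<^sup>L (lborel \<Otimes>\<^sub>M lborel) (%(u, v). ?F (u, v))"
   unfolding stft0_def fourier_def lborel_prod by (rule Bochner_Integration.integral_cong) auto
  also have "... = (\<integral> v. (\<integral> u. ?F (u, v) \<partial>lborel) \<partial>lborel)"
   by (rule lborel_pair.integral_snd[OF int, symmetric])
  finally show ?thesis .
 qed
 also have "... = (\<integral> v. cis (- 2 * pi * (v \<bullet> \<zeta>2)) * (\<integral> t. h v (t + \<zeta>1) * cnj (k (v - z2) t) * cis (2 * pi * (t \<bullet> z1)) \<partial>lborel) \<partial>lborel)"
 proof (intro Bochner_Integration.integral_cong refl)
  fix v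
  obtain B where B: "0 <= B" "!!t. norm (k (v - z2) t) <= B * decay 0 (v - z2) * decay 0 t"
   unfolding k_def using two_point_bound[OF r\<phi>, of 1 1 0 0] spread_amb[OF \<tau>] by blast
  obtain K where K: "0 <= K" "!!\<xi>. norm (fourier (k (v - z2)) \<xi>) <= K * (decay 0 (v - z2) * decay ?n \<xi>)"
  proof -
   have "\<exists>C. 0 <= C \<and> (\<forall>a c y \<xi>. spread 1 1 a c y \<longrightarrow>
     norm (fourier (two_point 1 1 a c \<phi>1 \<phi>2) \<xi>) <= C * (decay 0 y * decay ?n \<xi>))"
    by (intro fourier_two_point_decay \<phi>) auto
   with spread_amb[OF \<tau>] that show thesis unfolding k_def by blast
  qed
  have "(\<integral> u. ?F (u, v) \<partial>lborel)
   = (\<integral> u. cis (- 2 * pi * (v \<bullet> \<zeta>2)) * (fourier (h v) (- u) * cnj (fourier (k (v - z2)) (z1 - u)) * cis (- 2 * pi * (u \<bullet> \<zeta>1))) \<partial>lborel)"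
  proof (intro Bochner_Integration.integral_cong refl)
   fix u
   have c: "cis (- 2 * pi * ((u, v) \<bullet> (\<zeta>1, \<zeta>2))) = cis (- 2 * pi * (v \<bullet> \<zeta>2)) * cis (- 2 * pi * (u \<bullet> \<zeta>1))"
    unfolding cis_mult by (rule arg_cong[where f = cis]) (simp add: inner_Pair algebra_simps)
   have "amb \<tau> f g (u, v) = fourier (h v) (- u)" "amb \<tau> \<phi>1 \<phi>2 ((u, v) - (z1, z2)) = fourier (k (v - z2)) (z1 - u)"
    by (simp_all add: amb_def h_def k_def)
   then show "?F (u, v) = cis (- 2 * pi * (v \<bullet> \<zeta>2)) * (fourier (h v) (- u) * cnj (fourier (k (v - z2)) (z1 - u)) * cis (- 2 * pi * (u \<bullet> \<zeta>1)))"
    unfolding c by (simp only: mult_ac)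
  qed
  also have "... = cis (- 2 * pi * (v \<bullet> \<zeta>2)) * (\<integral> t. h v (t + \<zeta>1) * cnj (k (v - z2) t) * cis (2 * pi * (t \<bullet> z1)) \<partial>lborel)"
  proof (simp only: integral_mult_right_zero, rule arg_cong2[where f = "(*)"], rule refl, rule amb_parseval)
   show "integrable lborel (h v)" unfolding h_def by (rule two_point_integrable[OF rf spread_amb[OF \<tau>]])
   show "integrable lborel (k (v - z2))" unfolding k_def by (rule two_point_integrable[OF r\<phi> spread_amb[OF \<tau>]])
   show "continuous_on UNIV (k (v - z2))"
    unfolding k_def two_point_def[abs_def]
    by (intro continuous_intros continuous_on_compose2[OF rapid_continuous[OF r\<phi>(1)]]
     continuous_on_compose2[OF rapid_continuous[OF r\<phi>(2)]]) auto
   show "!!t. norm (k (v - z2) t) <= B" using B(2) by simp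
   show "!!\<xi>. norm (fourier (k (v - z2)) \<xi>) <= K * decay ?n \<xi>" using K by simp
  qed
  finally show "(\<integral> u. ?F (u, v) \<partial>lborel) = cis (- 2 * pi * (v \<bullet> \<zeta>2)) * (\<integral> t. h v (t + \<zeta>1) * cnj (k (v - z2) t) * cis (2 * pi * (t \<bullet> z1)) \<partial>lborel)" .
 qed
 also have "... = (\<integral> s. cis (- 2 * pi * ((s + z2) \<bullet> \<zeta>2)) * (\<integral> t. h (s + z2) (t + \<zeta>1) * cnj (k ((s + z2) - z2) t) * cis (2 * pi * (t \<bullet> z1)) \<partial>lborel) \<partial>lborel)"
  unfolding h_def k_def two_point_def by (rule integral_shift(1)[symmetric]) measurable
 also have "... = (\<integral> s. cis (- 2 * pi * (z2 \<bullet> \<zeta>2)) * (\<integral> t. (f ((t + \<tau> *\<^sub>R s) + ?A1) * cnj (\<phi>1 (t + \<tau> *\<^sub>R s)) * cis (- 2 * pi * ((t + \<tau> *\<^sub>R s) \<bullet> ?A2))) *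
   cnj (g ((t - (1 - \<tau>) *\<^sub>R s) + ?B1) * cnj (\<phi>2 (t - (1 - \<tau>) *\<^sub>R s)) * cis (- 2 * pi * ((t - (1 - \<tau>) *\<^sub>R s) \<bullet> ?B2))) \<partial>lborel) \<partial>lborel)"
  unfolding integral_mult_right_zero[symmetric]
 proof (intro Bochner_Integration.integral_cong refl)
  fix s t :: 'a
  have c: "cis (- 2 * pi * ((s + z2) \<bullet> \<zeta>2)) * cis (2 * pi * (t \<bullet> z1))
   = cis (- 2 * pi * (z2 \<bullet> \<zeta>2)) * (cis (- 2 * pi * ((t + \<tau> *\<^sub>R s) \<bullet> ?A2)) * cis (2 * pi * ((t - (1 - \<tau>) *\<^sub>R s) \<bullet> ?B2)))"
   unfolding cis_mult by (rule arg_cong[where f = cis]) (simp add: inner_simps algebra_simps)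
  have cc: "cnj (cis (- 2 * pi * ((t - (1 - \<tau>) *\<^sub>R s) \<bullet> ?B2))) = cis (2 * pi * ((t - (1 - \<tau>) *\<^sub>R s) \<bullet> ?B2))"
   by (simp add: cis_cnj)
  have "h (s + z2) (t + \<zeta>1) = f ((t + \<tau> *\<^sub>R s) + ?A1) * cnj (g ((t - (1 - \<tau>) *\<^sub>R s) + ?B1))"
   "k ((s + z2) - z2) t = \<phi>1 (t + \<tau> *\<^sub>R s) * cnj (\<phi>2 (t - (1 - \<tau>) *\<^sub>R s))"
   unfolding h_def k_def two_point_def by (simp_all add: algebra_simps)
  then have "cis (- 2 * pi * ((s + z2) \<bullet> \<zeta>2)) * (h (s + z2) (t + \<zeta>1) * cnj (k ((s + z2) - z2) t) * cis (2 * pi * (t \<bullet> z1)))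
   = f ((t + \<tau> *\<^sub>R s) + ?A1) * cnj (g ((t - (1 - \<tau>) *\<^sub>R s) + ?B1)) * cnj (\<phi>1 (t + \<tau> *\<^sub>R s)) * \<phi>2 (t - (1 - \<tau>) *\<^sub>R s)
    * (cis (- 2 * pi * ((s + z2) \<bullet> \<zeta>2)) * cis (2 * pi * (t \<bullet> z1)))"
   by (simp only: complex_cnj_mult complex_cnj_cnj mult_ac)
  also have "... = cis (- 2 * pi * (z2 \<bullet> \<zeta>2)) * ((f ((t + \<tau> *\<^sub>R s) + ?A1) * cnj (\<phi>1 (t + \<tau> *\<^sub>R s)) * cis (- 2 * pi * ((t + \<tau> *\<^sub>R s) \<bullet> ?A2))) *
   cnj (g ((t - (1 - \<tau>) *\<^sub>R s) + ?B1) * cnj (\<phi>2 (t - (1 - \<tau>) *\<^sub>R s)) * cis (- 2 * pi * ((t - (1 - \<tau>) *\<^sub>R s) \<bullet> ?B2))))"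
   unfolding c cc complex_cnj_mult complex_cnj_cnj by (simp only: mult_ac)
  finally show "cis (- 2 * pi * ((s + z2) \<bullet> \<zeta>2)) * (h (s + z2) (t + \<zeta>1) * cnj (k ((s + z2) - z2) t) * cis (2 * pi * (t \<bullet> z1)))
   = cis (- 2 * pi * (z2 \<bullet> \<zeta>2)) * ((f ((t + \<tau> *\<^sub>R s) + ?A1) * cnj (\<phi>1 (t + \<tau> *\<^sub>R s)) * cis (- 2 * pi * ((t + \<tau> *\<^sub>R s) \<bullet> ?A2))) *
   cnj (g ((t - (1 - \<tau>) *\<^sub>R s) + ?B1) * cnj (\<phi>2 (t - (1 - \<tau>) *\<^sub>R s)) * cis (- 2 * pi * ((t - (1 - \<tau>) *\<^sub>R s) \<bullet> ?B2))))" .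
 qed
 also have "... = cis (- 2 * pi * (z2 \<bullet> \<zeta>2)) * ((\<integral> a. f (a + ?A1) * cnj (\<phi>1 a) * cis (- 2 * pi * (a \<bullet> ?A2)) \<partial>lborel)
   * (\<integral> b. cnj (g (b + ?B1) * cnj (\<phi>2 b) * cis (- 2 * pi * (b \<bullet> ?B2))) \<partial>lborel))"
 proof -
  obtain Bf where Bf: "0 <= Bf" "!!t. norm (f t) <= Bf" using rapid_bounded[OF rf(1)] by blast
  obtain Bg where Bg: "0 <= Bg" "!!t. norm (g t) <= Bg" using rapid_bounded[OF rf(2)] by blast
  obtain C1 where C1: "0 <= C1" "!!t. norm (\<phi>1 t) <= C1 * decay (?n + ?n) t" using rapidE[OF r\<phi>(1)] by blast
  obtain C2 where C2: "0 <= C2" "!!t. norm (\<phi>2 t) <= C2 * decay ?n t" using rapidE[OF r\<phi>(2)] by blast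
  show ?thesis
   unfolding integral_mult_right_zero
  proof (rule arg_cong2[where f = "(*)"], rule refl, rule integral_convolution_product)
   show "norm (f (a + ?A1) * cnj (\<phi>1 a) * cis (- 2 * pi * (a \<bullet> ?A2))) <= (Bf * C1) * decay (?n + ?n) a" for a
    using mult_mono[OF Bf(2) C1(2)] Bf by (simp add: norm_mult mult.assoc)
   show "norm (cnj (g (b + ?B1) * cnj (\<phi>2 b) * cis (- 2 * pi * (b \<bullet> ?B2)))) <= (Bg * C2) * decay ?n b" for b
    using mult_mono[OF Bg(2) C2(2)] Bg by (simp add: norm_mult mult.assoc)
  qed (use Bf Bg C1 C2 in auto)
 qed
 also have "... = cis (- 2 * pi * (z2 \<bullet> \<zeta>2)) * ((cis (2 * pi * (?A1 \<bullet> ?A2)) * stft0 \<phi>1 f ?A1 ?A2) * cnj (cis (2 * pi * (?B1 \<bullet> ?B2)) * stft0 \<phi>2 g ?B1 ?B2))"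
  by (simp only: Bochner_Integration.integral_cnj stft0_eq_shift[OF schwartz_measurable[OF \<phi>(1)] schwartz_measurable[OF fg(1)]]
    stft0_eq_shift[OF schwartz_measurable[OF \<phi>(2)] schwartz_measurable[OF fg(2)]])
 finally show ?thesis by (simp add: norm_mult)
qed

lemma amb_gauss:
 fixes u v :: "'a::euclidean_space"
 shows "amb \<tau> (gauss 0 0) (gauss 0 0) (u, v)
  = exp (of_real (- (pi / 2) * (u \<bullet> u + v \<bullet> v)) + \<i> * of_real (pi * (1 - 2 * \<tau>) * (u \<bullet> v))) / sqrt 2 ^ DIM('a)"
proof -
 \<comment> \<open>Recentring: the two arguments become t + v / 2 and t - v / 2, and the cross term
   of the Gaussians disappears.\<close>
 let ?c = "(1 / 2 - \<tau>) *\<^sub>R v"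
 have "amb \<tau> (gauss 0 0) (gauss 0 0) (u, v)
   = (\<integral> t. two_point 1 1 (\<tau> *\<^sub>R v) (- ((1 - \<tau>) *\<^sub>R v)) (gauss 0 0) (gauss 0 0) (t + ?c) * cis (2 * pi * ((t + ?c) \<bullet> u)) \<partial>lborel)"
 proof -
  have [measurable]: "two_point 1 1 (\<tau> *\<^sub>R v) (- ((1 - \<tau>) *\<^sub>R v)) (gauss 0 0) (gauss 0 0) \<in> borel_measurable borel"
   by (intro two_point_measurable schwartz_rapid gauss_schwartz)
  show ?thesis
   using integral_shift(1)[of "%t. two_point 1 1 (\<tau> *\<^sub>R v) (- ((1 - \<tau>) *\<^sub>R v)) (gauss 0 0) (gauss 0 0) t * cis (2 * pi * (t \<bullet> u))" ?c]
   by (simp add: amb_def fourier_def)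
 qed
 also have "... = (\<integral> t. (of_real (exp (- (pi / 2) * (v \<bullet> v))) * cis (pi * (1 - 2 * \<tau>) * (u \<bullet> v)))
   * (of_real (exp (- pi * 2 * (norm t)\<^sup>2)) * cis (2 * pi * (t \<bullet> u))) \<partial>lborel)"
 proof (intro Bochner_Integration.integral_cong refl)
  fix t
  have e: "- pi * (norm (\<tau> *\<^sub>R v + (t + ?c)))\<^sup>2 + - pi * (norm (- ((1 - \<tau>) *\<^sub>R v) + (t + ?c)))\<^sup>2
    = - (pi / 2) * (v \<bullet> v) + - pi * 2 * (norm t)\<^sup>2"
   unfolding power2_norm_eq_inner by (simp add: inner_simps inner_commute algebra_simps)
  have "two_point 1 1 (\<tau> *\<^sub>R v) (- ((1 - \<tau>) *\<^sub>R v)) (gauss 0 0) (gauss 0 0) (t + ?c)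
   = of_real (exp (- pi * (norm (\<tau> *\<^sub>R v + (t + ?c)))\<^sup>2) * exp (- pi * (norm (- ((1 - \<tau>) *\<^sub>R v) + (t + ?c)))\<^sup>2))"
   by (simp add: two_point_def gauss_def)
  also have "... = of_real (exp (- (pi / 2) * (v \<bullet> v))) * of_real (exp (- pi * 2 * (norm t)\<^sup>2))"
  proof -
   have "exp (- pi * (norm (\<tau> *\<^sub>R v + (t + ?c)))\<^sup>2) * exp (- pi * (norm (- ((1 - \<tau>) *\<^sub>R v) + (t + ?c)))\<^sup>2)
     = exp (- (pi / 2) * (v \<bullet> v)) * exp (- pi * 2 * (norm t)\<^sup>2)"
    unfolding exp_add[symmetric] e by (rule refl)
   then show ?thesis by (simp only: of_real_mult)
  qed
  finally have "two_point 1 1 (\<tau> *\<^sub>R v) (- ((1 - \<tau>) *\<^sub>R v)) (gauss 0 0) (gauss 0 0) (t + ?c)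
   = of_real (exp (- (pi / 2) * (v \<bullet> v))) * of_real (exp (- pi * 2 * (norm t)\<^sup>2))" .
  moreover have "cis (2 * pi * ((t + ?c) \<bullet> u)) = cis (pi * (1 - 2 * \<tau>) * (u \<bullet> v)) * cis (2 * pi * (t \<bullet> u))"
   unfolding cis_mult by (rule arg_cong[where f = cis]) (simp add: inner_simps inner_commute algebra_simps)
  ultimately show "two_point 1 1 (\<tau> *\<^sub>R v) (- ((1 - \<tau>) *\<^sub>R v)) (gauss 0 0) (gauss 0 0) (t + ?c) * cis (2 * pi * ((t + ?c) \<bullet> u))
   = (of_real (exp (- (pi / 2) * (v \<bullet> v))) * cis (pi * (1 - 2 * \<tau>) * (u \<bullet> v)))
   * (of_real (exp (- pi * 2 * (norm t)\<^sup>2)) * cis (2 * pi * (t \<bullet> u)))"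
   by (simp only: mult_ac)
 qed
 also have "... = (of_real (exp (- (pi / 2) * (v \<bullet> v))) * cis (pi * (1 - 2 * \<tau>) * (u \<bullet> v)))
   * of_real (exp (- pi * (norm u)\<^sup>2 / 2) / sqrt 2 ^ DIM('a))"
  using gaussian_fourier(2)[of 2 u] by (simp only: integral_mult_right_zero zero_less_numeral True_implies_equals)
 also have "... = exp (of_real (- (pi / 2) * (u \<bullet> u + v \<bullet> v)) + \<i> * of_real (pi * (1 - 2 * \<tau>) * (u \<bullet> v))) / sqrt 2 ^ DIM('a)"
 proof -
  have "exp (- (pi / 2) * (u \<bullet> u + v \<bullet> v)) = exp (- (pi / 2) * (v \<bullet> v)) * exp (- pi * (norm u)\<^sup>2 / 2)"
   unfolding exp_add[symmetric] power2_norm_eq_inner by (rule arg_cong[where f = exp]) (simp add: algebra_simps)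
  then show ?thesis
   unfolding exp_add exp_of_real cis_conv_exp by simp
 qed
 finally show ?thesis .
qed

lemma amb_gauss_schwartz: "amb \<tau> (gauss 0 0) (gauss 0 (0 :: 'a::euclidean_space)) \<in> schwartz"
proof -
 define q :: "'a \<times> 'a => complex" where
  "q = (%w. of_real (- (pi / 2) * (fst w \<bullet> fst w + snd w \<bullet> snd w)) + \<i> * of_real (pi * (1 - 2 * \<tau>) * (fst w \<bullet> snd w)))"
 have "amb \<tau> (gauss 0 0) (gauss 0 (0 :: 'a)) = (%w. (1 / of_real (sqrt 2 ^ DIM('a))) * exp (q w))"
  by (auto simp: amb_gauss q_def)
 also have "... \<in> schwartz"
 proof (intro schwartz_cmult exp_quadratic_schwartz)
  fix x :: "'a \<times> 'a"
  show "(q has_derivative (%h. of_real (- pi * (fst x \<bullet> fst h + snd x \<bullet> snd h)) + \<i> * of_real (pi * (1 - 2 * \<tau>) * (fst x \<bullet> snd h + snd x \<bullet> fst h)))) (at x)"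
   unfolding q_def by (auto intro!: derivative_eq_intros simp: fun_eq_iff inner_commute algebra_simps)
  show "Re (q x) <= 0 - (pi / 2) * (norm x)\<^sup>2"
   by (cases x) (simp add: q_def power2_norm_eq_inner inner_Pair)
 next
  fix b :: "'a \<times> 'a" assume "b \<in> Basis"
  have l: "bounded_linear (%x :: 'a \<times> 'a. complex_of_real (- pi * (fst x \<bullet> fst b + snd x \<bullet> snd b)) + \<i> * complex_of_real (pi * (1 - 2 * \<tau>) * (fst x \<bullet> snd b + snd x \<bullet> fst b)))"
   by (intro bounded_linear_add bounded_linear_compose[OF bounded_linear_of_real] bounded_linear_const_mult
    bounded_linear_compose[OF bounded_linear_inner_left] bounded_linear_fst bounded_linear_snd)
  show "\<exists>c l. bounded_linear l \<and> (\<forall>x :: 'a \<times> 'a. complex_of_real (- pi * (fst x \<bullet> fst b + snd x \<bullet> snd b)) + \<i> * complex_of_real (pi * (1 - 2 * \<tau>) * (fst x \<bullet> snd b + snd x \<bullet> fst b)) = c + l x)"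
   by (intro exI[of _ 0] exI conjI) (rule l, simp)
 qed auto
 finally show ?thesis .
qed

subsection \<open>Peetre's maximal function\<close>

text \<open>Peetre's maximal function. Being bounded by an average of \<open>|V|\<^sup>r\<close> for every \<open>r > 0\<close>, it
 takes over the role of local averages when the exponents are smaller than one.\<close>

definition peetre :: "nat => ('a::euclidean_space => 'a => complex) => 'a => 'a => real" where
 "peetre N V x \<xi> = (SUP w. norm (V (fst w) (snd w)) * (decay N (x - fst w) * decay N (\<xi> - snd w)))"

context
 fixes V :: "'a::euclidean_space => 'a => complex" and B :: real
 assumes B: "!!x \<xi>. norm (V x \<xi>) <= B"
begin

lemma peetre_bdd: "bdd_above (range (%w. norm (V (fst w) (snd w)) * (decay N (x - fst w) * decay N (\<xi> - snd w))))"
proof (rule bdd_aboveI)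
 fix y assume "y \<in> range (%w. norm (V (fst w) (snd w)) * (decay N (x - fst w) * decay N (\<xi> - snd w)))"
 then obtain w where y: "y = norm (V (fst w) (snd w)) * (decay N (x - fst w) * decay N (\<xi> - snd w))" by auto
 have "y <= B * (1 * 1)" unfolding y using B order_trans[OF norm_ge_zero B] by (intro mult_mono) auto
 then show "y <= B" by simp
qed

lemma peetre_upper: "norm (V y \<eta>) * (decay N (x - y) * decay N (\<xi> - \<eta>)) <= peetre N V x \<xi>"
 unfolding peetre_def by (rule cSUP_upper2[OF peetre_bdd, of "(y, \<eta>)"]) auto

lemma peetre_ge: "norm (V x \<xi>) <= peetre N V x \<xi>"
 using peetre_upper[of x \<xi> N x \<xi>] by simp

lemma peetre_nonneg: "0 <= peetre N V x \<xi>"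
 using peetre_ge norm_ge_zero order_trans by blast

lemma peetre_upper': "norm (V y \<eta>) <= ((1 + norm (x - y)) ^ N * (1 + norm (\<xi> - \<eta>)) ^ N) * peetre N V x \<xi>"
proof -
 have "norm (V y \<eta>) = ((1 + norm (x - y)) ^ N * (1 + norm (\<xi> - \<eta>)) ^ N) * (norm (V y \<eta>) * (decay N (x - y) * decay N (\<xi> - \<eta>)))"
  by (simp add: decay_def field_simps)
 also have "... <= ((1 + norm (x - y)) ^ N * (1 + norm (\<xi> - \<eta>)) ^ N) * peetre N V x \<xi>"
  by (intro mult_left_mono peetre_upper) auto
 finally show ?thesis .
qed

end

lemma peetre_least:
 "(!!y \<eta>. norm (V y \<eta>) * (decay N (x - y) * decay N (\<xi> - \<eta>)) <= c) ==> peetre N V x \<xi> <= c"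
 unfolding peetre_def by (rule cSUP_least) auto

lemma peetre_antimono:
 assumes B: "!!x \<xi>. norm (V x \<xi>) <= B" and "M <= N"
 shows "peetre N V x \<xi> <= peetre M V x \<xi>"
proof (rule peetre_least)
 fix y \<eta>
 have "norm (V y \<eta>) * (decay N (x - y) * decay N (\<xi> - \<eta>)) <= norm (V y \<eta>) * (decay M (x - y) * decay M (\<xi> - \<eta>))"
  using assms(2) by (intro mult_left_mono mult_mono) (auto simp: decay_antimono)
 also have "... <= peetre M V x \<xi>" by (rule peetre_upper[OF B])
 finally show "norm (V y \<eta>) * (decay N (x - y) * decay N (\<xi> - \<eta>)) <= peetre M V x \<xi>" .
qed

lemma peetre_moderate:
 assumes B: "!!x \<xi>. norm (V x \<xi>) <= B"
 shows "peetre N V x' \<xi>' <= ((1 + norm (x - x')) ^ N * (1 + norm (\<xi> - \<xi>')) ^ N) * peetre N V x \<xi>"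
proof (rule peetre_least)
 fix y \<eta>
 have d: "decay N (x' - y) <= (1 + norm (x - x')) ^ N * decay N (x - y)" for x x' y :: 'a
  using moderateD(2)[OF moderate_decay, of N "x' - y" "x - y"] by (simp add: algebra_simps norm_minus_commute)
 have "norm (V y \<eta>) * (decay N (x' - y) * decay N (\<xi>' - \<eta>))
   <= norm (V y \<eta>) * (((1 + norm (x - x')) ^ N * decay N (x - y)) * ((1 + norm (\<xi> - \<xi>')) ^ N * decay N (\<xi> - \<eta>)))"
  by (intro mult_left_mono mult_mono d) auto
 also have "... = ((1 + norm (x - x')) ^ N * (1 + norm (\<xi> - \<xi>')) ^ N) * (norm (V y \<eta>) * (decay N (x - y) * decay N (\<xi> - \<eta>)))"
  by (simp only: mult_ac)
 also have "... <= ((1 + norm (x - x')) ^ N * (1 + norm (\<xi> - \<xi>')) ^ N) * peetre N V x \<xi>"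
  by (intro mult_left_mono peetre_upper[OF B]) auto
 finally show "norm (V y \<eta>) * (decay N (x' - y) * decay N (\<xi>' - \<eta>)) <= ((1 + norm (x - x')) ^ N * (1 + norm (\<xi> - \<xi>')) ^ N) * peetre N V x \<xi>" .
qed

definition bimoderate :: "nat => ('a::real_normed_vector => 'b::real_normed_vector => real) => bool" where
 "bimoderate N H \<longleftrightarrow> (\<forall>x \<xi>. 0 <= H x \<xi>) \<and>
  (\<forall>x \<xi> x' \<xi>'. H x' \<xi>' <= ((1 + norm (x - x')) ^ N * (1 + norm (\<xi> - \<xi>')) ^ N) * H x \<xi>)"

text \<open>Maximal functions are suprema over uncountable families; slow variation makes them
  continuous in both variables jointly, hence Borel measurable.\<close>

lemma bimoderate_measurable:
 fixes H :: "'a::euclidean_space => 'b::euclidean_space => real"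
 assumes H: "bimoderate N H"
 shows "(%(x, \<xi>). H x \<xi>) \<in> borel_measurable (borel \<Otimes>\<^sub>M borel)"
proof -
 have "moderate (N + N) (%z :: 'a \<times> 'b. H (fst z) (snd z))"
  unfolding moderate_def
 proof (intro conjI allI)
  fix z w :: "'a \<times> 'b"
  have H0: "0 <= H (fst z) (snd z)" using H by (simp add: bimoderate_def)
  then show "0 <= H (fst z) (snd z)" .
  have "norm (fst z - fst w) <= norm (z - w)" "norm (snd z - snd w) <= norm (z - w)"
   using norm_fst_le[of "fst (z - w)" "snd (z - w)"] norm_snd_le[of "snd (z - w)" "fst (z - w)"]
   by (cases z; cases w; simp)+
  then have "(1 + norm (fst z - fst w)) ^ N * (1 + norm (snd z - snd w)) ^ N <= (1 + norm (z - w)) ^ (N + N)"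
   unfolding power_add by (intro mult_mono power_mono) auto
  from mult_right_mono[OF this H0] show "H (fst w) (snd w) <= (1 + norm (z - w)) ^ (N + N) * H (fst z) (snd z)"
   using H unfolding bimoderate_def by (meson order_trans)
 qed
 from moderate_measurable[OF this] show ?thesis by (simp add: borel_prod split_beta')
qed

lemma peetre_bimoderate: "(!!x \<xi>. norm (V x \<xi>) <= B) ==> bimoderate N (peetre N V)"
 unfolding bimoderate_def using peetre_nonneg[of V B] peetre_moderate[of V B] by blast

lemmas peetre_measurable = bimoderate_measurable[OF peetre_bimoderate]

section \<open>Change of window\<close>

lemma window_norm_pos:
 fixes \<psi> :: "'a::euclidean_space => complex"
 assumes \<psi>: "rapid \<psi>" "\<psi> \<noteq> (%_. 0)"
 shows "0 < (\<integral> t. (norm (\<psi> t))\<^sup>2 \<partial>lborel)"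
proof -
 note [measurable] = rapid_measurable[OF \<psi>(1)]
 have int: "integrable lborel (%t. (norm (\<psi> t))\<^sup>2)"
 proof -
  obtain B where B: "0 <= B" "!!t. norm (\<psi> t) <= B" using rapid_bounded[OF \<psi>(1)] by blast
  show ?thesis
  proof (rule Bochner_Integration.integrable_bound)
   show "integrable lborel (%t. norm (\<psi> t) * B)" using rapid_integrable[OF \<psi>(1)] by auto
   show "AE t in lborel. norm ((norm (\<psi> t))\<^sup>2) <= norm (norm (\<psi> t) * B)"
    using B by (intro AE_I2) (auto simp: power2_eq_square abs_mult intro!: mult_left_mono)
  qed measurable
 qed
 have "(\<integral> t. (norm (\<psi> t))\<^sup>2 \<partial>lborel) \<noteq> 0"
 proof
  assume "(\<integral> t. (norm (\<psi> t))\<^sup>2 \<partial>lborel) = 0"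
  then have "AE t in lborel. (norm (\<psi> t))\<^sup>2 = 0"
   using integral_nonneg_eq_0_iff_AE[OF int] by simp
  then have ae: "AE t in lborel. t \<notin> {t. \<psi> t \<noteq> 0}" by simp
  \<comment> \<open>A continuous nonzero function is nonzero on a nonempty open set, and such a set
    is not negligible.\<close>
  have op: "open {t. \<psi> t \<noteq> 0}"
   using open_Collect_neq[OF rapid_continuous[OF \<psi>(1)] continuous_on_const[of UNIV 0]] by simp
  have "{t. \<psi> t \<noteq> 0} \<in> null_sets lborel"
   using ae op by (subst (asm) AE_iff_null_sets[symmetric]) auto
  then have "negligible {t. \<psi> t \<noteq> 0}"
   using negligible_iff_null_sets null_sets_completionI by blast
  with op have "{t. \<psi> t \<noteq> 0} = {}" using open_not_negligible by blast
  with \<psi>(2) show False by auto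
 qed
 moreover have "0 <= (\<integral> t. (norm (\<psi> t))\<^sup>2 \<partial>lborel)" by simp
 ultimately show ?thesis by linarith
qed

lemma stft0_bdd:
 assumes "integrable lborel u" "rapid \<phi>"
 obtains B where "!!x \<xi>. norm (stft0 \<phi> u x \<xi>) <= B"
proof -
 obtain B where "!!t. norm (\<phi> t) <= B" using rapid_bounded[OF assms(2)] by blast
 from stft0_bounded[OF assms(1) this] show thesis by (rule that)
qed

lemma nn_integral_decay:
 fixes y :: "'a::euclidean_space"
 assumes "2 * DIM('a) <= n"
 shows "(\<integral>\<^sup>+ x. ennreal (decay n (x - y)) \<partial>lborel) = ennreal (\<integral> x. decay n (x :: 'a) \<partial>lborel)"
proof -
 have "(\<integral>\<^sup>+ x. ennreal (decay n (x - y)) \<partial>lborel) = (\<integral>\<^sup>+ x. ennreal (decay n (x :: 'a)) \<partial>lborel)"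
  using nn_integral_shift(2)[of "%x. ennreal (decay n x)" y] by simp
 then show ?thesis using integrable_decay[OF assms] by (simp add: nn_integral_eq_integral)
qed

lemma nn_integral_decay_pair:
 fixes y \<eta> :: "'a::euclidean_space"
 assumes "2 * DIM('a) <= n"
 shows "(\<integral>\<^sup>+ x. \<integral>\<^sup>+ \<xi>. ennreal (decay n (x - y) * decay n (\<xi> - \<eta>)) \<partial>lborel \<partial>lborel)
  = ennreal ((\<integral> x. decay n (x :: 'a) \<partial>lborel)\<^sup>2)"
proof -
 have [measurable]: "(%\<xi>. ennreal (decay n (\<xi> - \<eta>))) \<in> borel_measurable borel" for \<eta> :: 'a by measurable
 have "(\<integral>\<^sup>+ x. \<integral>\<^sup>+ \<xi>. ennreal (decay n (x - y) * decay n (\<xi> - \<eta>)) \<partial>lborel \<partial>lborel)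
   = (\<integral>\<^sup>+ x. ennreal (decay n (x - y)) * (\<integral>\<^sup>+ \<xi>. ennreal (decay n (\<xi> - \<eta>)) \<partial>lborel) \<partial>lborel)"
  by (simp add: ennreal_mult nn_integral_cmult)
 then show ?thesis
  by (simp add: nn_integral_decay[OF assms] nn_integral_multc power2_eq_square ennreal_mult)
qed

text \<open>The reproducing formula with the cross term of the two windows replaced by polynomial
  decay of arbitrary order.\<close>

lemma stft0_window_change:
 fixes \<phi> \<psi> :: "'a::euclidean_space => complex"
 assumes \<phi>: "\<phi> \<in> schwartz" and \<psi>: "\<psi> \<in> schwartz" "\<psi> \<noteq> (%_. 0)" and n: "2 * DIM('a) <= n"
 obtains K where "0 < K" "!!u y \<eta>. integrable lborel u ==> ennreal (norm (stft0 \<phi> u y \<eta>))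
  <= (\<integral>\<^sup>+ x. \<integral>\<^sup>+ \<xi>. ennreal (K * (norm (stft0 \<psi> u x \<xi>) * (decay n (x - y) * decay n (\<xi> - \<eta>)))) \<partial>lborel \<partial>lborel)"
proof -
 obtain K where K: "0 <= K" "!!x \<xi>. norm (stft0 \<psi> \<phi> x \<xi>) <= K * (decay n x * decay n \<xi>)"
  using stft0_decay[OF \<phi> \<psi>(1)] by blast
 note r\<psi> = schwartz_rapid[OF \<psi>(1)]
 define c where "c = (\<integral> t. (norm (\<psi> t))\<^sup>2 \<partial>lborel)"
 have c: "0 < c" unfolding c_def by (rule window_norm_pos[OF r\<psi> \<psi>(2)])
 show thesis
 proof
  show "0 < (K + 1) / c" using K c by simp
  fix u :: "'a => complex" and y \<eta> assume u: "integrable lborel u"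
  then have [measurable]: "u \<in> borel_measurable borel" by auto
  note [measurable] = \<phi>[THEN schwartz_measurable] \<psi>(1)[THEN schwartz_measurable]
  have "ennreal (norm (stft0 \<phi> u y \<eta>)) = ennreal (1 / c) * ennreal (c * norm (stft0 \<phi> u y \<eta>))"
   using c by (simp flip: ennreal_mult)
  also have "... <= ennreal (1 / c) * (\<integral>\<^sup>+ x. \<integral>\<^sup>+ \<xi>. ennreal (norm (stft0 \<psi> u x \<xi>) * norm (stft0 \<psi> \<phi> (x - y) (\<xi> - \<eta>))) \<partial>lborel \<partial>lborel)"
   unfolding c_def by (intro mult_left_mono stft0_reproducing[OF u schwartz_rapid[OF \<phi>] r\<psi> n K(2)]) auto
  also have "... = (\<integral>\<^sup>+ x. \<integral>\<^sup>+ \<xi>. ennreal (1 / c) * ennreal (norm (stft0 \<psi> u x \<xi>) * norm (stft0 \<psi> \<phi> (x - y) (\<xi> - \<eta>))) \<partial>lborel \<partial>lborel)"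
   by (simp add: nn_integral_cmult)
  also have "... <= (\<integral>\<^sup>+ x. \<integral>\<^sup>+ \<xi>. ennreal ((K + 1) / c * (norm (stft0 \<psi> u x \<xi>) * (decay n (x - y) * decay n (\<xi> - \<eta>)))) \<partial>lborel \<partial>lborel)"
  proof (intro nn_integral_mono)
   fix x \<xi>
   have "norm (stft0 \<psi> \<phi> (x - y) (\<xi> - \<eta>)) <= (K + 1) * (decay n (x - y) * decay n (\<xi> - \<eta>))"
    by (rule order_trans[OF K(2)]) (simp add: mult_right_mono)
   then have "1 / c * (norm (stft0 \<psi> u x \<xi>) * norm (stft0 \<psi> \<phi> (x - y) (\<xi> - \<eta>)))
     <= 1 / c * (norm (stft0 \<psi> u x \<xi>) * ((K + 1) * (decay n (x - y) * decay n (\<xi> - \<eta>))))"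
    using c by (intro mult_left_mono) auto
   then show "ennreal (1 / c) * ennreal (norm (stft0 \<psi> u x \<xi>) * norm (stft0 \<psi> \<phi> (x - y) (\<xi> - \<eta>)))
     <= ennreal ((K + 1) / c * (norm (stft0 \<psi> u x \<xi>) * (decay n (x - y) * decay n (\<xi> - \<eta>))))"
    using c by (simp add: ennreal_leI mult_ac flip: ennreal_mult)
  qed
  finally show "ennreal (norm (stft0 \<phi> u y \<eta>))
   <= (\<integral>\<^sup>+ x. \<integral>\<^sup>+ \<xi>. ennreal ((K + 1) / c * (norm (stft0 \<psi> u x \<xi>) * (decay n (x - y) * decay n (\<xi> - \<eta>)))) \<partial>lborel \<partial>lborel)" .
 qed
qed

text \<open>In the formula above the transform at (x, \<xi>) is bounded by the maximal function at
  (x0, \<xi>0). The resulting growth splits into a part in x0 - y, which the decay in the definition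
  of the maximal function cancels, and a part in x - y, which uses N of the N + 2 * DIM orders of
  decay of the kernel.\<close>

lemma peetre_window_change:
 fixes \<phi> \<psi> :: "'a::euclidean_space => complex"
 assumes \<phi>: "\<phi> \<in> schwartz" and \<psi>: "\<psi> \<in> schwartz" "\<psi> \<noteq> (%_. 0)"
 obtains C where "0 < C" "!!u x \<xi>. integrable lborel u ==> peetre N (stft0 \<phi> u) x \<xi> <= C * peetre N (stft0 \<psi> u) x \<xi>"
proof -
 let ?n = "2 * DIM('a)"
 obtain K where K: "0 < K" "!!u y \<eta>. integrable lborel u ==> ennreal (norm (stft0 \<phi> u y \<eta>))
  <= (\<integral>\<^sup>+ x. \<integral>\<^sup>+ \<xi>. ennreal (K * (norm (stft0 \<psi> u x \<xi>) * (decay (N + ?n) (x - y) * decay (N + ?n) (\<xi> - \<eta>)))) \<partial>lborel \<partial>lborel)"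
  using stft0_window_change[OF \<phi> \<psi>, of "N + ?n"] by auto
 define D where "D = (\<integral> x. decay ?n (x :: 'a) \<partial>lborel)"
 have D: "0 <= D" unfolding D_def by simp
 show thesis
 proof
  show "0 < K * D\<^sup>2 + 1" using K D by (auto intro!: add_nonneg_pos mult_nonneg_nonneg)
  fix u :: "'a => complex" and x0 \<xi>0 assume u: "integrable lborel u"
  obtain B where B: "!!x \<xi>. norm (stft0 \<psi> u x \<xi>) <= B" using stft0_bdd[OF u schwartz_rapid[OF \<psi>(1)]] by blast
  let ?P = "peetre N (stft0 \<psi> u) x0 \<xi>0"
  have P0: "0 <= ?P" by (rule peetre_nonneg[OF B])
  show "peetre N (stft0 \<phi> u) x0 \<xi>0 <= (K * D\<^sup>2 + 1) * ?P"
  proof (rule peetre_least)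
   fix y \<eta>
   let ?a = "(1 + norm (x0 - y)) ^ N * (1 + norm (\<xi>0 - \<eta>)) ^ N"
   have "ennreal (norm (stft0 \<phi> u y \<eta>))
    <= (\<integral>\<^sup>+ x. \<integral>\<^sup>+ \<xi>. ennreal (K * (norm (stft0 \<psi> u x \<xi>) * (decay (N + ?n) (x - y) * decay (N + ?n) (\<xi> - \<eta>)))) \<partial>lborel \<partial>lborel)"
    by (rule K(2)[OF u])
   also have "... <= (\<integral>\<^sup>+ x. \<integral>\<^sup>+ \<xi>. ennreal (K * (?a * ?P)) * ennreal (decay ?n (x - y) * decay ?n (\<xi> - \<eta>)) \<partial>lborel \<partial>lborel)"
   proof (intro nn_integral_mono)
    fix x \<xi>
    have pw: "(1 + norm (x0 - x)) ^ N <= (1 + norm (x0 - y)) ^ N * (1 + norm (x - y)) ^ N" for x0 x y :: 'a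
     using power_mono[OF one_add_norm_diff[of x0 x y], of N] by (simp add: power_mult_distrib norm_minus_commute)
    have "norm (stft0 \<psi> u x \<xi>) <= ((1 + norm (x0 - x)) ^ N * (1 + norm (\<xi>0 - \<xi>)) ^ N) * ?P"
     by (rule peetre_upper'[OF B])
    also have "... <= (((1 + norm (x0 - y)) ^ N * (1 + norm (x - y)) ^ N) * ((1 + norm (\<xi>0 - \<eta>)) ^ N * (1 + norm (\<xi> - \<eta>)) ^ N)) * ?P"
     by (intro mult_right_mono mult_mono pw P0) auto
    finally have "norm (stft0 \<psi> u x \<xi>) * (decay (N + ?n) (x - y) * decay (N + ?n) (\<xi> - \<eta>))
     <= (((1 + norm (x0 - y)) ^ N * (1 + norm (x - y)) ^ N) * ((1 + norm (\<xi>0 - \<eta>)) ^ N * (1 + norm (\<xi> - \<eta>)) ^ N)) * ?P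
      * (decay (N + ?n) (x - y) * decay (N + ?n) (\<xi> - \<eta>))"
     by (intro mult_right_mono) auto
    also have "... = (?a * ?P) * (decay ?n (x - y) * decay ?n (\<xi> - \<eta>))
      * (((1 + norm (x - y)) ^ N * decay N (x - y)) * ((1 + norm (\<xi> - \<eta>)) ^ N * decay N (\<xi> - \<eta>)))"
     unfolding decay_add by (simp only: mult_ac)
    also have "... = (?a * ?P) * (decay ?n (x - y) * decay ?n (\<xi> - \<eta>))" by simp
    finally have "K * (norm (stft0 \<psi> u x \<xi>) * (decay (N + ?n) (x - y) * decay (N + ?n) (\<xi> - \<eta>)))
      <= K * ((?a * ?P) * (decay ?n (x - y) * decay ?n (\<xi> - \<eta>)))"
     using K by (intro mult_left_mono) auto
    then show "ennreal (K * (norm (stft0 \<psi> u x \<xi>) * (decay (N + ?n) (x - y) * decay (N + ?n) (\<xi> - \<eta>))))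
      <= ennreal (K * (?a * ?P)) * ennreal (decay ?n (x - y) * decay ?n (\<xi> - \<eta>))"
     using K P0 by (simp add: ennreal_leI mult.assoc flip: ennreal_mult)
   qed
   also have "... = ennreal (K * (?a * ?P)) * ennreal (D\<^sup>2)"
    by (simp add: nn_integral_cmult nn_integral_decay_pair D_def)
   also have "... = ennreal (?a * (K * D\<^sup>2 * ?P))"
    using K P0 D by (simp add: mult_ac flip: ennreal_mult)
   finally have "norm (stft0 \<phi> u y \<eta>) <= ?a * (K * D\<^sup>2 * ?P)"
    using K P0 by (subst (asm) ennreal_le_iff) (auto intro!: mult_nonneg_nonneg)
   then have "norm (stft0 \<phi> u y \<eta>) * (decay N (x0 - y) * decay N (\<xi>0 - \<eta>)) <= ?a * (K * D\<^sup>2 * ?P) * (decay N (x0 - y) * decay N (\<xi>0 - \<eta>))"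
    by (intro mult_right_mono) auto
   also have "... = (K * D\<^sup>2 * ?P) * (((1 + norm (x0 - y)) ^ N * decay N (x0 - y)) * ((1 + norm (\<xi>0 - \<eta>)) ^ N * decay N (\<xi>0 - \<eta>)))"
    by (simp only: mult_ac)
   also have "... <= (K * D\<^sup>2 + 1) * ?P" using P0 by (simp add: distrib_right)
   finally show "norm (stft0 \<phi> u y \<eta>) * (decay N (x0 - y) * decay N (\<xi>0 - \<eta>)) <= (K * D\<^sup>2 + 1) * ?P" .
  qed
 qed
qed

lemma decay_powr: "0 < R ==> decay (R * M) x powr (1 / real R) = decay M x"
proof -
 assume R: "0 < R"
 have "decay (R * M) x = decay M x powr real R"
  by (simp add: decay_def powr_realpow power_mult[symmetric] mult.commute power_inverse flip: power_inverse)
 then show ?thesis using R by (simp add: powr_powr)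
qed


text \<open>Splitting \<open>|V| = |V|\<^sup>r |V|\<^sup>1\<^sup>-\<^sup>r\<close> with \<open>r = 1/R\<close> and bounding the second factor by the maximal function.\<close>

lemma peetre_inequality:
 fixes \<phi> :: "'a::euclidean_space => complex"
 assumes \<phi>: "\<phi> \<in> schwartz" "\<phi> \<noteq> (%_. 0)" and R: "0 < R"
 obtains K where "0 < K" "!!u x \<xi>. integrable lborel u ==>
  ennreal (peetre (R * M) (stft0 \<phi> u) x \<xi> powr (1 / R))
  <= (\<integral>\<^sup>+ y. \<integral>\<^sup>+ \<eta>. ennreal (K * (norm (stft0 \<phi> u y \<eta>) powr (1 / R) * (decay M (x - y) * decay M (\<xi> - \<eta>)))) \<partial>lborel \<partial>lborel)"
proof -
 define r where "r = 1 / real R"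
 have r: "0 < r" "r <= 1" using R by (auto simp: r_def)
 define N where "N = R * M"
 define n where "n = N + 2 * DIM('a)"
 obtain K where K: "0 < K" "!!u y \<eta>. integrable lborel u ==> ennreal (norm (stft0 \<phi> u y \<eta>))
  <= (\<integral>\<^sup>+ x. \<integral>\<^sup>+ \<xi>. ennreal (K * (norm (stft0 \<phi> u x \<xi>) * (decay n (x - y) * decay n (\<xi> - \<eta>)))) \<partial>lborel \<partial>lborel)"
  using stft0_window_change[OF \<phi>(1) \<phi>, of n] by (auto simp: n_def)
 show thesis
 proof (rule that[OF K(1)])
  fix u :: "'a => complex" and x \<xi> assume u: "integrable lborel u"
  let ?V = "stft0 \<phi> u"
  note [measurable] = schwartz_measurable[OF \<phi>(1)]
  have [measurable]: "u \<in> borel_measurable borel" using u by auto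
  obtain B where B: "!!x \<xi>. norm (?V x \<xi>) <= B" using stft0_bdd[OF u schwartz_rapid[OF \<phi>(1)]] by blast
  define P where "P = peetre N ?V x \<xi>"
  have P0: "0 <= P" unfolding P_def by (rule peetre_nonneg[OF B])
  define I where "I = (\<integral>\<^sup>+ y. \<integral>\<^sup>+ \<eta>. ennreal (K * (norm (?V y \<eta>) powr r * (decay M (x - y) * decay M (\<xi> - \<eta>)))) \<partial>lborel \<partial>lborel)"
  have "ennreal (P powr r) <= I"
  proof (cases "P = 0 \<or> I = top")
   case True
   then show ?thesis by auto
  next
   case False
   then have P: "0 < P" using P0 by simp
   obtain i where i: "I = ennreal i" "0 <= i" using False by (cases I) auto
   \<comment> \<open>\<open>P\<close> is a real number because the transform is bounded; as it is
     positive here, division by P powr (1 - r) yields P powr r <= i.\<close>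
   have "P <= P powr (1 - r) * i"
    unfolding P_def
   proof (rule peetre_least)
    fix w1 w2
    let ?d = "decay N (x - w1) * decay N (\<xi> - w2)"
    \<comment> \<open>With N = R * M and r = 1 / R, growth of order N (1 - r) from the maximal
      function leaves decay of order N r = M.\<close>
    have pt: "decay N (x - w) * ((1 + norm (x - y)) ^ N) powr (1 - r) * decay n (y - w) <= decay M (x - y)" for x w y :: 'a
    proof -
     have "decay N (x - w) * decay n (y - w) <= decay N (x - w) * decay N (w - y)"
      unfolding decay_commute[of n y w] by (intro mult_left_mono decay_antimono) (auto simp: n_def)
     also have "... <= decay N (x - y)" by (rule decay_chain)
     finally have "(decay N (x - w) * decay n (y - w)) * ((1 + norm (x - y)) ^ N) powr (1 - r) <= decay N (x - y) * ((1 + norm (x - y)) ^ N) powr (1 - r)"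
      by (rule mult_right_mono) simp
     also have "... = decay M (x - y)"
     proof -
      have "((1 + norm (x - y)) ^ N) powr (1 - r) = decay N (x - y) powr (r - 1)"
       by (simp add: decay_def powr_minus[symmetric] powr_powr powr_realpow[symmetric] inverse_powr)
        (simp add: powr_minus[symmetric] powr_powr algebra_simps)
      then have "decay N (x - y) * ((1 + norm (x - y)) ^ N) powr (1 - r) = decay N (x - y) powr r"
       by (simp add: powr_mult_base)
      also have "... = decay M (x - y)" unfolding N_def r_def by (rule decay_powr[OF R])
      finally show ?thesis .
     qed
     finally show ?thesis by (simp add: mult_ac)
    qed
    have "ennreal (norm (?V w1 w2) * ?d) = ennreal (norm (?V w1 w2)) * ennreal ?d" by (simp add: ennreal_mult)
    also have "... <= (\<integral>\<^sup>+ y. \<integral>\<^sup>+ \<eta>. ennreal (K * (norm (?V y \<eta>) * (decay n (y - w1) * decay n (\<eta> - w2)))) \<partial>lborel \<partial>lborel) * ennreal ?d"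
     by (intro mult_right_mono K(2)[OF u]) auto
    also have "... = (\<integral>\<^sup>+ y. \<integral>\<^sup>+ \<eta>. ennreal (K * (norm (?V y \<eta>) * (decay n (y - w1) * decay n (\<eta> - w2)))) * ennreal ?d \<partial>lborel \<partial>lborel)"
     by (simp add: nn_integral_multc)
    also have "... <= (\<integral>\<^sup>+ y. \<integral>\<^sup>+ \<eta>. ennreal (P powr (1 - r)) * ennreal (K * (norm (?V y \<eta>) powr r * (decay M (x - y) * decay M (\<xi> - \<eta>)))) \<partial>lborel \<partial>lborel)"
    proof (intro nn_integral_mono)
     fix y \<eta>
     let ?v = "norm (?V y \<eta>)"
     let ?a = "(1 + norm (x - y)) ^ N" and ?b = "(1 + norm (\<xi> - \<eta>)) ^ N"
     have vP: "?v <= (?a * ?b) * P" unfolding P_def by (rule peetre_upper'[OF B])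
     have "?v = ?v powr r * ?v powr (1 - r)" by (simp flip: powr_add)
     also have "... <= ?v powr r * ((?a * ?b) * P) powr (1 - r)"
      using r vP by (intro mult_left_mono powr_mono2) auto
     also have "... = ?v powr r * (?a powr (1 - r) * ?b powr (1 - r) * P powr (1 - r))"
      using P0 by (simp add: powr_mult)
     finally have "?v * (decay n (y - w1) * decay n (\<eta> - w2)) * ?d
      <= ?v powr r * (?a powr (1 - r) * ?b powr (1 - r) * P powr (1 - r)) * (decay n (y - w1) * decay n (\<eta> - w2)) * ?d"
      by (intro mult_right_mono) auto
     also have "... = (?v powr r * P powr (1 - r)) * ((decay N (x - w1) * ?a powr (1 - r) * decay n (y - w1)) * (decay N (\<xi> - w2) * ?b powr (1 - r) * decay n (\<eta> - w2)))"
      by (simp only: mult_ac)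
     also have "... <= (?v powr r * P powr (1 - r)) * (decay M (x - y) * decay M (\<xi> - \<eta>))"
      by (intro mult_left_mono mult_mono pt) auto
     finally have "K * (?v * (decay n (y - w1) * decay n (\<eta> - w2)) * ?d) <= K * ((?v powr r * P powr (1 - r)) * (decay M (x - y) * decay M (\<xi> - \<eta>)))"
      using K by (intro mult_left_mono) auto
     then show "ennreal (K * (?v * (decay n (y - w1) * decay n (\<eta> - w2)))) * ennreal ?d
      <= ennreal (P powr (1 - r)) * ennreal (K * (?v powr r * (decay M (x - y) * decay M (\<xi> - \<eta>))))"
      using K by (simp add: ennreal_leI mult_ac flip: ennreal_mult)
    qed
    also have "... = ennreal (P powr (1 - r)) * I"
     by (simp add: nn_integral_cmult I_def)
    also have "... = ennreal (P powr (1 - r) * i)" using i by (simp add: ennreal_mult)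
    finally show "norm (?V w1 w2) * ?d <= peetre N ?V x \<xi> powr (1 - r) * i"
     using i by (simp add: P_def[symmetric])
   qed
   then have "P powr (1 - r) * P powr r <= P powr (1 - r) * i" using P by (simp flip: powr_add)
   then have "P powr r <= i" using P by simp
   then show ?thesis using i by (simp add: ennreal_leI)
  qed
  then show "ennreal (peetre (R * M) ?V x \<xi> powr (1 / R))
   <= (\<integral>\<^sup>+ y. \<integral>\<^sup>+ \<eta>. ennreal (K * (norm (?V y \<eta>) powr (1 / R) * (decay M (x - y) * decay M (\<xi> - \<eta>)))) \<partial>lborel \<partial>lborel)"
   by (simp only: P_def I_def N_def r_def)
 qed
qed

section \<open>Norms of the transform and of its maximal function\<close>

lemma Lp_norm_shift:
 fixes f :: "'a::euclidean_space => ennreal"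
 assumes [measurable]: "f \<in> borel_measurable borel" and p: "0 < p"
 shows "Lp_norm p lborel (%x. f (x - s)) = Lp_norm p lborel f"
 using p
proof (cases rule: exponent_cases)
 case (1 P)
 have "(\<integral>\<^sup>+ x. epowr (f (x - s)) P \<partial>lborel) = (\<integral>\<^sup>+ x. epowr (f x) P \<partial>lborel)"
  by (rule nn_integral_shift(2)) measurable
 then show ?thesis unfolding 1 Lp_norm_ennreal[OF 1(1)] by simp
next
 case 2
 have "(AE x in lborel. f (x - s) <= c) \<longleftrightarrow> (AE x in lborel. f x <= c)" for c
 proof -
  have *: "(AE x in lborel. g x <= c) \<longleftrightarrow> (\<integral>\<^sup>+ x. indicator {c<..} (g x) \<partial>lborel) = 0"
   if [measurable]: "g \<in> borel_measurable borel" for g :: "'a => ennreal"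
   by (subst nn_integral_0_iff_AE) (auto intro!: AE_cong simp: indicator_def)
  have "(\<integral>\<^sup>+ x. indicator {c<..} (f (x - s)) \<partial>lborel) = (\<integral>\<^sup>+ x. indicator {c<..} (f x) \<partial>lborel :: ennreal)"
   by (rule nn_integral_shift(2)) measurable
  then show ?thesis by (simp add: *)
 qed
 then show ?thesis unfolding 2 Lp_norm_top by (simp add: esssup_eq_AE)
qed

lemma mixed_norm_shift:
 fixes f :: "'a::euclidean_space => 'b::euclidean_space => ennreal"
 assumes f[measurable]: "(%(x, y). f x y) \<in> borel_measurable (borel \<Otimes>\<^sub>M borel)" and p: "0 < p" and q: "0 < q"
 shows "mixed_norm p q lborel lborel (%x y. f (x - s) (y - t)) = mixed_norm p q lborel lborel f"
proof -
 define H where "H y = Lp_norm p lborel (%x. f x y)" for y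
 have [measurable]: "H \<in> borel_measurable borel"
  using measurable_Lp_norm[of lborel p f borel] p by (simp add: H_def[abs_def])
 have "Lp_norm p lborel (%x. f (x - s) (y - t)) = H (y - t)" for y
  unfolding H_def by (rule Lp_norm_shift[OF _ p]) measurable
 then have "mixed_norm p q lborel lborel (%x y. f (x - s) (y - t)) = Lp_norm q lborel (%y. H (y - t))"
  by (simp add: mixed_norm_def)
 also have "... = Lp_norm q lborel H" by (rule Lp_norm_shift[OF _ q]) measurable
 finally show ?thesis by (simp add: mixed_norm_def H_def[abs_def])
qed

text \<open>Powers r = 1 / R with natural R keep the orders of decay natural numbers: the r-th power
  of \<open>decay (R * M)\<close> is \<open>decay M\<close>.\<close>

lemma exponent_reciprocal:
 assumes "0 < (p::ennreal)" obtains R where "0 < (R::nat)" "!!R'. R <= R' ==> ennreal (1 / real R') <= p"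
proof (cases p)
 case (real x)
 then have x: "0 < x" using assms by simp
 obtain n where "inverse (real (Suc n)) < x" using reals_Archimedean[OF x] by blast
 then obtain R :: nat where R: "0 < R" "1 / real R < x" by (metis inverse_eq_divide zero_less_Suc)
 have "ennreal (1 / real R') <= p" if "R <= R'" for R'
 proof -
  have "1 / real R' <= 1 / real R" using R that by (intro divide_left_mono) auto
  then show ?thesis using R real by (simp add: ennreal_leI)
 qed
 with R that show thesis by blast
next
 case top
 then show thesis using that[of 1] by simp
qed

text \<open>The r-th power of the maximal function is dominated by an average of r-th powers of
  translates of the transform. With r at most 1, p and q, \<open>mixed_Minkowski_epowr\<close> and
  translation invariance of the mixed norm apply.\<close>

lemma peetre_mixed_norm:
 fixes \<phi> :: "'a::euclidean_space => complex"
 assumes \<phi>: "\<phi> \<in> schwartz" "\<phi> \<noteq> (%_. 0)" and p: "0 < p" and q: "0 < q"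
  and \<omega>: "moderate L \<omega>" and \<mu>: "moderate L' \<mu>"
 obtains N0 C where "0 < C" "!!u N. integrable lborel u ==> N0 <= N ==>
  mixed_norm p q lborel lborel (%x \<xi>. ennreal (peetre N (stft0 \<phi> u) x \<xi> * (\<omega> x * \<mu> \<xi>)))
  <= ennreal C * mixed_norm p q lborel lborel (%x \<xi>. ennreal (norm (stft0 \<phi> u x \<xi>) * (\<omega> x * \<mu> \<xi>)))"
proof -
 obtain R1 where R1: "0 < (R1::nat)" "!!R'. R1 <= R' ==> ennreal (1 / real R') <= p" using exponent_reciprocal[OF p] by blast
 obtain R2 where R2: "0 < (R2::nat)" "!!R'. R2 <= R' ==> ennreal (1 / real R') <= q" using exponent_reciprocal[OF q] by blast
 define R where "R = max R1 R2"
 define r where "r = 1 / real R"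
 have R: "0 < R" and r: "0 < r" "r <= 1" "ennreal r <= p" "ennreal r <= q"
  using R1 R2 by (auto simp: R_def r_def)
 define n where "n = 2 * DIM('a)"
 \<comment> \<open>The part \<open>max L L'\<close> pays for moving the weights, the part
   \<open>n\<close> keeps the kernel integrable.\<close>
 define M where "M = max L L' + n"
 obtain K where K: "0 < K" "!!u x \<xi>. integrable lborel u ==>
  ennreal (peetre (R * M) (stft0 \<phi> u) x \<xi> powr (1 / R))
  <= (\<integral>\<^sup>+ y. \<integral>\<^sup>+ \<eta>. ennreal (K * (norm (stft0 \<phi> u y \<eta>) powr (1 / R) * (decay M (x - y) * decay M (\<xi> - \<eta>)))) \<partial>lborel \<partial>lborel)"
  using peetre_inequality[OF \<phi> R, of M] by blast
 define D where "D = (\<integral> x. decay n (x :: 'a) \<partial>lborel)"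
 define C where "C = (K * D\<^sup>2 + 1) powr R"
 have KD: "0 <= K * D\<^sup>2" using K by simp
 show thesis
 proof
  show "0 < C" using KD by (simp add: C_def add_nonneg_pos)
  fix u :: "'a => complex" and N assume u: "integrable lborel u" and N: "R * M <= N"
  let ?V = "stft0 \<phi> u"
  note [measurable] = schwartz_measurable[OF \<phi>(1)] moderate_measurable[OF \<omega>] moderate_measurable[OF \<mu>]
  have [measurable]: "u \<in> borel_measurable borel" using u by auto
  obtain B where B: "!!x \<xi>. norm (?V x \<xi>) <= B" using stft0_bdd[OF u schwartz_rapid[OF \<phi>(1)]] by blast
  note [measurable] = peetre_measurable[OF B]
  have pnn: "0 <= peetre N ?V x \<xi>" for N x \<xi> by (rule peetre_nonneg[OF B])
  note \<omega>0 = moderateD(1)[OF \<omega>] and \<mu>0 = moderateD(1)[OF \<mu>]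
  let ?F = "%x \<xi>. ennreal (norm (?V x \<xi>) * (\<omega> x * \<mu> \<xi>))"
  let ?P = "%x \<xi>. ennreal (peetre (R * M) ?V x \<xi> * (\<omega> x * \<mu> \<xi>))"
  let ?k = "%w :: 'a \<times> 'a. ennreal (K * (decay n (fst w) * decay n (snd w)))"
  have F_meas: "(%(x, \<xi>). ?F x \<xi>) \<in> borel_measurable (borel \<Otimes>\<^sub>M borel)" by measurable
  \<comment> \<open>The weight is moved from x to x - t at the cost of a power of 1 + norm t, which
    r <= 1 keeps within the reserved decay.\<close>
  have wt: "(decay M t * \<omega> x powr r) <= decay n t * \<omega> (x - t) powr r" if "moderate l \<omega>" "l <= max L L'" for \<omega> l and x t :: 'a
  proof -
   note \<omega>0 = moderateD(1)[OF that(1)]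
   have "\<omega> x <= (1 + norm t) ^ l * \<omega> (x - t)" using moderateD(2)[OF that(1), of x "x - t"] by simp
   then have "\<omega> x powr r <= ((1 + norm t) ^ l * \<omega> (x - t)) powr r" using r \<omega>0 by (intro powr_mono2) auto
   also have "... = ((1 + norm t) ^ l) powr r * \<omega> (x - t) powr r" using \<omega>0 by (simp add: powr_mult)
   also have "... <= (1 + norm t) ^ max L L' * \<omega> (x - t) powr r"
   proof (intro mult_right_mono)
    have "((1 + norm t) ^ l) powr r <= ((1 + norm t) ^ l) powr 1"
     using r by (intro powr_mono) (auto simp: one_le_power)
    also have "... <= (1 + norm t) ^ max L L'" using that(2) by (simp add: power_increasing)
    finally show "((1 + norm t) ^ l) powr r <= (1 + norm t) ^ max L L'" .
   qed simp
   finally have "decay M t * \<omega> x powr r <= decay M t * ((1 + norm t) ^ max L L' * \<omega> (x - t) powr r)"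
    by (rule mult_left_mono) simp
   also have "... = (decay (max L L') t * (1 + norm t) ^ max L L') * (decay n t * \<omega> (x - t) powr r)"
    unfolding M_def decay_add by (simp only: mult_ac)
   finally show ?thesis by simp
  qed
  have main: "epowr (mixed_norm p q lborel lborel ?P) r
    <= (\<integral>\<^sup>+ w. epowr (mixed_norm p q lborel lborel (%x \<xi>. ?F (x - fst w) (\<xi> - snd w))) r * ?k w \<partial>(lborel \<Otimes>\<^sub>M lborel))"
  proof (rule mixed_Minkowski_epowr[OF _ _ _ r(1,3,4)])
   show "sigma_finite_measure (lborel \<Otimes>\<^sub>M lborel :: ('a \<times> 'a) measure)" by (simp add: lborel_prod)
   show "(%(x, y). ?P x y) \<in> borel_measurable (lborel \<Otimes>\<^sub>M lborel)" by measurable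
   show "(%(x, y, w). ?F (x - fst w) (y - snd w)) \<in> borel_measurable (lborel \<Otimes>\<^sub>M lborel \<Otimes>\<^sub>M lborel \<Otimes>\<^sub>M lborel)"
    by measurable
   show "?k \<in> borel_measurable (lborel \<Otimes>\<^sub>M lborel)" by measurable
   fix x \<xi>
   have "epowr (?P x \<xi>) r = ennreal (peetre (R * M) ?V x \<xi> powr (1 / R)) * ennreal (\<omega> x powr r * \<mu> \<xi> powr r)"
    using pnn \<omega>0 \<mu>0 by (simp add: epowr_ennreal powr_mult r_def flip: ennreal_mult)
   also have "... <= (\<integral>\<^sup>+ y. \<integral>\<^sup>+ \<eta>. ennreal (K * (norm (?V y \<eta>) powr (1 / R) * (decay M (x - y) * decay M (\<xi> - \<eta>)))) \<partial>lborel \<partial>lborel)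
     * ennreal (\<omega> x powr r * \<mu> \<xi> powr r)"
    by (intro mult_right_mono K(2)[OF u]) auto
   also have "... = (\<integral>\<^sup>+ y. \<integral>\<^sup>+ \<eta>. ennreal (K * (norm (?V y \<eta>) powr (1 / R) * (decay M (x - y) * decay M (\<xi> - \<eta>)))) * ennreal (\<omega> x powr r * \<mu> \<xi> powr r) \<partial>lborel \<partial>lborel)"
    by (simp add: nn_integral_multc)
   also have "... <= (\<integral>\<^sup>+ y. \<integral>\<^sup>+ \<eta>. epowr (?F (x - (x - y)) (\<xi> - (\<xi> - \<eta>))) r * ?k (x - y, \<xi> - \<eta>) \<partial>lborel \<partial>lborel)"
   proof (intro nn_integral_mono)
    fix y \<eta>
    have "(decay M (x - y) * \<omega> x powr r) * (decay M (\<xi> - \<eta>) * \<mu> \<xi> powr r)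
      <= (decay n (x - y) * \<omega> (x - (x - y)) powr r) * (decay n (\<xi> - \<eta>) * \<mu> (\<xi> - (\<xi> - \<eta>)) powr r)"
     by (intro mult_mono wt[OF \<omega>] wt[OF \<mu>]) auto
    then have "(K * norm (?V y \<eta>) powr r) * ((decay M (x - y) * \<omega> x powr r) * (decay M (\<xi> - \<eta>) * \<mu> \<xi> powr r))
      <= (K * norm (?V y \<eta>) powr r) * ((decay n (x - y) * \<omega> y powr r) * (decay n (\<xi> - \<eta>) * \<mu> \<eta> powr r))"
     using K by (intro mult_left_mono) auto
    then show "ennreal (K * (norm (?V y \<eta>) powr (1 / R) * (decay M (x - y) * decay M (\<xi> - \<eta>)))) * ennreal (\<omega> x powr r * \<mu> \<xi> powr r)
     <= epowr (?F (x - (x - y)) (\<xi> - (\<xi> - \<eta>))) r * ?k (x - y, \<xi> - \<eta>)"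
     using K \<omega>0 \<mu>0 by (simp add: epowr_ennreal powr_mult r_def[symmetric] ennreal_leI mult_ac flip: ennreal_mult)
   qed
   also have "... = (\<integral>\<^sup>+ y. \<integral>\<^sup>+ \<eta>. epowr (?F (x - y) (\<xi> - \<eta>)) r * ?k (y, \<eta>) \<partial>lborel \<partial>lborel)"
   proof -
    have shift1: "(\<integral>\<^sup>+ \<eta>. epowr (?F (x - y) (\<xi> - (\<xi> - \<eta>))) r * ?k (y, \<xi> - \<eta>) \<partial>lborel)
      = (\<integral>\<^sup>+ \<eta>. epowr (?F (x - y) (\<xi> - \<eta>)) r * ?k (y, \<eta>) \<partial>lborel)" for y
     by (rule nn_integral_shift(3)[of "%\<eta>. epowr (?F (x - y) (\<xi> - \<eta>)) r * ?k (y, \<eta>)"])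
      (simp only: fst_conv snd_conv, measurable)
    have "(\<integral>\<^sup>+ y. \<integral>\<^sup>+ \<eta>. epowr (?F (x - (x - y)) (\<xi> - (\<xi> - \<eta>))) r * ?k (x - y, \<xi> - \<eta>) \<partial>lborel \<partial>lborel)
     = (\<integral>\<^sup>+ y. \<integral>\<^sup>+ \<eta>. epowr (?F (x - (x - y)) (\<xi> - \<eta>)) r * ?k (x - y, \<eta>) \<partial>lborel \<partial>lborel)"
     by (intro nn_integral_cong shift1)
    also have "... = (\<integral>\<^sup>+ y. \<integral>\<^sup>+ \<eta>. epowr (?F (x - y) (\<xi> - \<eta>)) r * ?k (y, \<eta>) \<partial>lborel \<partial>lborel)"
    proof (rule nn_integral_shift(3)[of "%y. \<integral>\<^sup>+ \<eta>. epowr (?F (x - y) (\<xi> - \<eta>)) r * ?k (y, \<eta>) \<partial>lborel"])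
     show "(%y. \<integral>\<^sup>+ \<eta>. epowr (?F (x - y) (\<xi> - \<eta>)) r * ?k (y, \<eta>) \<partial>lborel) \<in> borel_measurable borel"
      by (rule lborel.borel_measurable_nn_integral) measurable
    qed
    finally show ?thesis .
   qed
   also have "... = (\<integral>\<^sup>+ w. epowr (?F (x - fst w) (\<xi> - snd w)) r * ?k w \<partial>(lborel \<Otimes>\<^sub>M lborel))"
    by (subst lborel.nn_integral_fst[symmetric]) auto
   finally show "epowr (?P x \<xi>) r <= (\<integral>\<^sup>+ w. epowr (?F (x - fst w) (\<xi> - snd w)) r * ?k w \<partial>(lborel \<Otimes>\<^sub>M lborel))" .
  qed auto
  have ksum: "(\<integral>\<^sup>+ w. ?k w \<partial>(lborel \<Otimes>\<^sub>M lborel)) = ennreal (K * D\<^sup>2)"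
  proof -
   have "(\<integral>\<^sup>+ w. ?k w \<partial>(lborel \<Otimes>\<^sub>M lborel)) = (\<integral>\<^sup>+ x. \<integral>\<^sup>+ y. ennreal K * ennreal (decay n (x - 0 :: 'a) * decay n (y - 0 :: 'a)) \<partial>lborel \<partial>lborel)"
    using K by (subst lborel.nn_integral_fst[symmetric]) (auto simp: ennreal_mult)
   also have "... = ennreal K * (\<integral>\<^sup>+ x. \<integral>\<^sup>+ y. ennreal (decay n (x - 0 :: 'a) * decay n (y - 0 :: 'a)) \<partial>lborel \<partial>lborel)"
    by (simp add: nn_integral_cmult del: diff_zero)
   also have "... = ennreal K * ennreal (D\<^sup>2)"
    unfolding D_def by (subst nn_integral_decay_pair) (auto simp: n_def)
   finally show ?thesis using K by (simp add: ennreal_mult)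
  qed
  have "epowr (mixed_norm p q lborel lborel ?P) r
    <= (\<integral>\<^sup>+ w. epowr (mixed_norm p q lborel lborel ?F) r * ?k w \<partial>(lborel \<Otimes>\<^sub>M lborel))"
   using main by (simp only: mixed_norm_shift[OF F_meas p q])
  also have "... = epowr (mixed_norm p q lborel lborel ?F) r * ennreal (K * D\<^sup>2)"
   unfolding ksum[symmetric] by (rule nn_integral_cmult) measurable
  also have "... <= ennreal (K * D\<^sup>2 + 1) * epowr (mixed_norm p q lborel lborel ?F) r"
   by (subst mult.commute) (intro mult_right_mono ennreal_leI, auto)
  also have "ennreal (K * D\<^sup>2 + 1) = epowr (ennreal C) r"
   using KD R by (simp add: C_def epowr_ennreal powr_powr r_def)
  also have "epowr (ennreal C) r * epowr (mixed_norm p q lborel lborel ?F) r = epowr (ennreal C * mixed_norm p q lborel lborel ?F) r"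
   using r by (simp add: epowr_mult)
  finally have "mixed_norm p q lborel lborel ?P <= ennreal C * mixed_norm p q lborel lborel ?F"
   using r by (simp add: epowr_le_iff)
  moreover have "mixed_norm p q lborel lborel (%x \<xi>. ennreal (peetre N ?V x \<xi> * (\<omega> x * \<mu> \<xi>))) <= mixed_norm p q lborel lborel ?P"
   by (rule mixed_norm_mono[OF _ p q]) (auto intro!: ennreal_leI mult_right_mono peetre_antimono[OF B N] mult_nonneg_nonneg \<omega>0 \<mu>0)
  ultimately show "mixed_norm p q lborel lborel (%x \<xi>. ennreal (peetre N ?V x \<xi> * (\<omega> x * \<mu> \<xi>))) <= ennreal C * mixed_norm p q lborel lborel ?F"
   by order
 qed
qed

abbreviation stft_norm :: "ennreal => ennreal => ('a::euclidean_space => real) => ('a => real) =>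
  ('a => 'a => complex) => ennreal" where
 "stft_norm p q \<omega> \<mu> V \<equiv> mixed_norm p q lebesgue lebesgue (%x \<xi>. ennreal (norm (V x \<xi>) * (\<omega> x * \<mu> \<xi>)))"

text \<open>A given weight together with its continuous regularization: estimates are proved for the
  second, while the spaces are defined by the first.\<close>

definition weight_equiv :: "('a::euclidean_space => real) => ('a => real) => bool" where
 "weight_equiv \<omega> \<omega>' \<longleftrightarrow> \<omega> \<in> borel_measurable lebesgue \<and> (\<forall>x. 0 <= \<omega> x) \<and> (\<exists>L. moderate L \<omega>') \<and>
  (\<exists>C>0. \<forall>x. \<omega> x <= \<omega>' x \<and> \<omega>' x <= C * \<omega> x)"

lemma poly_weight_equiv: "poly_weight \<omega> ==> \<exists>\<omega>'. weight_equiv \<omega> \<omega>'"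
 unfolding weight_equiv_def using poly_weight_moderate by (metis poly_weight_def)

lemma weight_equiv_1: "weight_equiv (%_. 1) (%_. 1)"
 unfolding weight_equiv_def by (auto simp: moderate_def intro!: exI[of _ 0] exI[of _ 1])

definition peetre_norm :: "nat => ennreal => ennreal => ('a::euclidean_space => real) => ('a => real) =>
  ('a => 'a => complex) => ennreal" where
 "peetre_norm N p q \<omega> \<mu> V = mixed_norm p q lborel lborel (%x \<xi>. ennreal (peetre N V x \<xi> * (\<omega> x * \<mu> \<xi>)))"

text \<open>Maximal functions for different windows are pointwise comparable, so the maximal
  inequality is needed for the window \<phi> alone. Taking the same maximal function for two windows
  \<phi> shows that the quasi-norm does not depend on the window.\<close>

lemma stft_norm_equiv:
 fixes \<phi> \<psi> :: "'a::euclidean_space => complex"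
 assumes \<phi>: "\<phi> \<in> schwartz" "\<phi> \<noteq> (%_. 0)" and \<psi>: "\<psi> \<in> schwartz" "\<psi> \<noteq> (%_. 0)" and p: "0 < p" and q: "0 < q"
  and \<omega>: "weight_equiv \<omega> \<omega>'" and \<mu>: "weight_equiv \<mu> \<mu>'"
 obtains N0 where "!!N. N0 <= N ==> \<exists>C>0. \<forall>u. integrable lborel u \<longrightarrow>
  stft_norm p q \<omega> \<mu> (stft0 \<phi> u)
   <= ennreal C * peetre_norm N p q \<omega>' \<mu>' (stft0 \<psi> u) \<and>
  peetre_norm N p q \<omega>' \<mu>' (stft0 \<psi> u)
   <= ennreal C * stft_norm p q \<omega> \<mu> (stft0 \<phi> u)"
proof -
 obtain L C1 where L: "moderate L \<omega>'" and C1: "0 < C1" "!!x. \<omega> x <= \<omega>' x" "!!x. \<omega>' x <= C1 * \<omega> x"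
  and mo: "\<omega> \<in> borel_measurable lebesgue" "!!x. 0 <= \<omega> x"
  using \<omega> unfolding weight_equiv_def by blast
 obtain L' C2 where L': "moderate L' \<mu>'" and C2: "0 < C2" "!!x. \<mu> x <= \<mu>' x" "!!x. \<mu>' x <= C2 * \<mu> x"
  and mm: "\<mu> \<in> borel_measurable lebesgue" "!!x. 0 <= \<mu> x"
  using \<mu> unfolding weight_equiv_def by blast
 obtain N0 C3 where C3: "0 < C3" "!!u N. integrable lborel u ==> N0 <= N ==>
   peetre_norm N p q \<omega>' \<mu>' (stft0 \<phi> u)
   <= ennreal C3 * mixed_norm p q lborel lborel (%x \<xi>. ennreal (norm (stft0 \<phi> u x \<xi>) * (\<omega>' x * \<mu>' \<xi>)))"
  by (rule peetre_mixed_norm[OF \<phi> p q L L', folded peetre_norm_def]) (rule that; assumption)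
 show thesis
 proof (rule that)
  fix N assume N: "N0 <= N"
  obtain K1 where K1: "0 < K1" "!!u x \<xi>. integrable lborel u ==> peetre N (stft0 \<phi> u) x \<xi> <= K1 * peetre N (stft0 \<psi> u) x \<xi>"
   by (rule peetre_window_change[OF \<phi>(1) \<psi>, of N]) (rule that; assumption)
  obtain K2 where K2: "0 < K2" "!!u x \<xi>. integrable lborel u ==> peetre N (stft0 \<psi> u) x \<xi> <= K2 * peetre N (stft0 \<phi> u) x \<xi>"
   by (rule peetre_window_change[OF \<psi>(1) \<phi>, of N]) (rule that; assumption)
  define C where "C = max K1 (K2 * (C3 * (C1 * C2)))"
  have *: "stft_norm p q \<omega> \<mu> (stft0 \<phi> u)
   <= ennreal C * peetre_norm N p q \<omega>' \<mu>' (stft0 \<psi> u) \<and>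
  peetre_norm N p q \<omega>' \<mu>' (stft0 \<psi> u)
   <= ennreal C * stft_norm p q \<omega> \<mu> (stft0 \<phi> u)"
   if u: "integrable lborel u" for u
  proof
   note [measurable] = schwartz_measurable[OF \<phi>(1)] schwartz_measurable[OF \<psi>(1)] moderate_measurable[OF L] moderate_measurable[OF L']
   have [measurable]: "u \<in> borel_measurable borel" using u by auto
   obtain B where B: "!!x \<xi>. norm (stft0 \<phi> u x \<xi>) <= B" using stft0_bdd[OF u schwartz_rapid[OF \<phi>(1)]] by blast
   obtain B' where B': "!!x \<xi>. norm (stft0 \<psi> u x \<xi>) <= B'" using stft0_bdd[OF u schwartz_rapid[OF \<psi>(1)]] by blast
   note [measurable] = peetre_measurable[of "stft0 \<phi> u", OF B] peetre_measurable[of "stft0 \<psi> u", OF B']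
   have pnn: "0 <= peetre N (stft0 \<phi> u) x \<xi>" "0 <= peetre N (stft0 \<psi> u) x \<xi>" for x \<xi>
    by (rule peetre_nonneg[OF B] peetre_nonneg[OF B'])+
   have \<omega>\<mu>: "0 <= \<omega>' x * \<mu>' \<xi>" for x \<xi> using moderateD(1)[OF L] moderateD(1)[OF L'] by simp
   have V: "(%(x, \<xi>). norm (stft0 \<phi> u x \<xi>)) \<in> borel_measurable (borel \<Otimes>\<^sub>M borel)" by measurable
   note leb = mixed_norm_lebesgue[OF V norm_ge_zero mo(1) mm(1) mo(2) mm(2) moderate_measurable[OF L] moderate_measurable[OF L'] C1(2) C2(2) C1(3) C2(3) C1(1) C2(1) p q]
   have "mixed_norm p q lborel lborel (%x \<xi>. ennreal (norm (stft0 \<phi> u x \<xi>) * (\<omega>' x * \<mu>' \<xi>)))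
     <= mixed_norm p q lborel lborel (%x \<xi>. ennreal K1 * ennreal (peetre N (stft0 \<psi> u) x \<xi> * (\<omega>' x * \<mu>' \<xi>)))"
   proof (rule mixed_norm_mono[OF _ p q])
    fix x \<xi>
    have "norm (stft0 \<phi> u x \<xi>) <= K1 * peetre N (stft0 \<psi> u) x \<xi>"
     by (rule order_trans[OF peetre_ge[of "stft0 \<phi> u", OF B] K1(2)[OF u]])
    from mult_right_mono[OF this \<omega>\<mu>[of x \<xi>]]
    show "ennreal (norm (stft0 \<phi> u x \<xi>) * (\<omega>' x * \<mu>' \<xi>)) <= ennreal K1 * ennreal (peetre N (stft0 \<psi> u) x \<xi> * (\<omega>' x * \<mu>' \<xi>))"
     using K1 \<omega>\<mu>[of x \<xi>] pnn(2)[of x \<xi>] by (simp add: ennreal_leI mult.assoc flip: ennreal_mult)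
   qed (auto, measurable)
   also have "... = ennreal K1 * peetre_norm N p q \<omega>' \<mu>' (stft0 \<psi> u)"
    unfolding peetre_norm_def by (rule mixed_norm_cmult[OF _ p q]) (auto, measurable)
   also have "... <= ennreal C * peetre_norm N p q \<omega>' \<mu>' (stft0 \<psi> u)"
    by (intro mult_right_mono ennreal_leI) (auto simp: C_def)
   finally show "stft_norm p q \<omega> \<mu> (stft0 \<phi> u)
     <= ennreal C * peetre_norm N p q \<omega>' \<mu>' (stft0 \<psi> u)"
    using leb(1) by (rule order_trans[rotated])
   have "peetre_norm N p q \<omega>' \<mu>' (stft0 \<psi> u)
     <= mixed_norm p q lborel lborel (%x \<xi>. ennreal K2 * ennreal (peetre N (stft0 \<phi> u) x \<xi> * (\<omega>' x * \<mu>' \<xi>)))"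
    unfolding peetre_norm_def
   proof (rule mixed_norm_mono[OF _ p q])
    fix x \<xi>
    from mult_right_mono[OF K2(2)[OF u, of x \<xi>] \<omega>\<mu>[of x \<xi>]]
    show "ennreal (peetre N (stft0 \<psi> u) x \<xi> * (\<omega>' x * \<mu>' \<xi>)) <= ennreal K2 * ennreal (peetre N (stft0 \<phi> u) x \<xi> * (\<omega>' x * \<mu>' \<xi>))"
     using K2 \<omega>\<mu>[of x \<xi>] pnn(1)[of x \<xi>] by (simp add: ennreal_leI mult.assoc flip: ennreal_mult)
   qed (auto, measurable)
   also have "... = ennreal K2 * peetre_norm N p q \<omega>' \<mu>' (stft0 \<phi> u)"
    unfolding peetre_norm_def by (rule mixed_norm_cmult[OF _ p q]) (auto, measurable)
   also have "... <= ennreal K2 * (ennreal C3 * (ennreal (C1 * C2) * stft_norm p q \<omega> \<mu> (stft0 \<phi> u)))"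
    using order_trans[OF C3(2)[OF u N] mult_left_mono[OF leb(2)]] by (intro mult_left_mono) auto
   also have "... = ennreal (K2 * (C3 * (C1 * C2))) * stft_norm p q \<omega> \<mu> (stft0 \<phi> u)"
    using K2 C3 C1 C2 by (simp add: ennreal_mult mult.assoc)
   also have "... <= ennreal C * stft_norm p q \<omega> \<mu> (stft0 \<phi> u)"
    by (intro mult_right_mono ennreal_leI) (auto simp: C_def)
   finally show "peetre_norm N p q \<omega>' \<mu>' (stft0 \<psi> u)
     <= ennreal C * stft_norm p q \<omega> \<mu> (stft0 \<phi> u)" .
  qed
  have "0 < C" using K1 by (simp add: C_def)
  with * show "\<exists>C>0. \<forall>u. integrable lborel u \<longrightarrow>
  stft_norm p q \<omega> \<mu> (stft0 \<phi> u)
   <= ennreal C * peetre_norm N p q \<omega>' \<mu>' (stft0 \<psi> u) \<and>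
  peetre_norm N p q \<omega>' \<mu>' (stft0 \<psi> u)
   <= ennreal C * stft_norm p q \<omega> \<mu> (stft0 \<phi> u)" by blast
 qed
qed

section \<open>Modulation and amalgam norms in terms of maximal functions\<close>

lemma modulation_norm_schwartz:
 assumes "f \<in> schwartz" "\<phi> \<in> schwartz"
 shows "modulation_norm \<phi> p q (tensor \<omega> \<mu>) (regular_distr f)
  = mixed_norm p q lebesgue lebesgue (%x \<xi>. ennreal (norm (stft0 \<phi> f x \<xi>) * (\<omega> x * \<mu> \<xi>)))"
 using regular_distr_tempered[OF rapid_integrable[OF schwartz_rapid[OF assms(1)]]]
  stft_regular_distr[OF schwartz_measurable[OF assms(1)] schwartz_measurable[OF assms(2)]]
 by (simp add: modulation_norm_def tensor_def)

lemma wiener_norm_wigner: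
 assumes "f \<in> schwartz" "g \<in> schwartz" "\<Phi> \<in> schwartz" "0 <= \<tau>" "\<tau> <= 1"
 shows "wiener_norm \<Phi> p q m (regular_distr (wigner \<tau> f g))
  = mixed_norm p q lebesgue lebesgue (%z \<zeta>. ennreal (norm (stft0 \<Phi> (amb \<tau> f g) z \<zeta>) * (1 * m \<zeta>)))"
proof -
 note int = wigner_integrable[OF assms(4,5,1,2)]
 have "stft \<Phi> (inverse_fourier_distr (regular_distr (wigner \<tau> f g))) z \<zeta> = stft0 \<Phi> (amb \<tau> f g) z \<zeta>" for z \<zeta>
  unfolding stft_inverse_fourier_distr[OF int schwartz_rapid[OF assms(3)]] inverse_fourier_wigner[OF assms(4,5,1,2)] ..
 then show ?thesis
  using inverse_fourier_distr_tempered[OF int] by (simp add: wiener_norm_def modulation_norm_def tensor_def)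
qed

text \<open>The two maximal functions at the points occurring in \<open>norm_stft0_amb\<close>, with
  z and \<zeta> split into their two components.\<close>

definition peetre_pair :: "real => nat => ('a::euclidean_space => 'a => complex) => ('a => 'a => complex) => 'a \<times> 'a => 'a \<times> 'a => real" where
 "peetre_pair \<tau> N V W z \<zeta> = peetre N V (fst \<zeta> + \<tau> *\<^sub>R snd z) (snd \<zeta> - (1 - \<tau>) *\<^sub>R fst z)
  * peetre N W (fst \<zeta> - (1 - \<tau>) *\<^sub>R snd z) (snd \<zeta> + \<tau> *\<^sub>R fst z)"

text \<open>Takes the supremum in one factor of a product while the other is fixed;
  \<open>peetre_pair_le\<close> uses it once for each factor.\<close>

lemma peetre_mult_least:
 assumes "0 <= X" "0 <= c" "!!y \<eta>. norm (V y \<eta>) * (decay N (x - y) * decay N (\<xi> - \<eta>)) * X <= c"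
 shows "peetre N V x \<xi> * X <= c"
proof (cases "X = 0")
 case False
 then have "peetre N V x \<xi> <= c / X" using assms by (intro peetre_least) (simp add: pos_le_divide_eq)
 then show ?thesis using False assms by (simp add: pos_le_divide_eq)
qed (use assms in simp)

lemma one_add_norm_lincomb:
 fixes x y :: "'a::real_normed_vector"
 assumes "\<bar>a\<bar> <= 1" "\<bar>b\<bar> <= 1" "norm x <= s" "norm y <= t"
 shows "1 + norm (a *\<^sub>R x + b *\<^sub>R y) <= (1 + s) * (1 + t)"
proof -
 have "norm (a *\<^sub>R x + b *\<^sub>R y) <= \<bar>a\<bar> * norm x + \<bar>b\<bar> * norm y" by (intro norm_triangle_le) simp
 also have "... <= 1 * s + 1 * t" using assms by (intro add_mono mult_mono) auto
 finally have "norm (a *\<^sub>R x + b *\<^sub>R y) <= s + t" by simp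
 moreover have "0 <= s * t" using assms norm_ge_zero order_trans by (metis mult_nonneg_nonneg)
 ultimately show ?thesis unfolding distrib_left distrib_right by linarith
qed

text \<open>Moving (z, \<zeta>) changes each of the four coordinates by a combination of both
  displacements with coefficients at most 1, at the cost of (s t)^N each time; four coordinates
  account for 4 * N.\<close>

lemma peetre_pair_ge:
 fixes V W :: "'a::euclidean_space => 'a => complex"
 assumes \<tau>: "0 <= \<tau>" "\<tau> <= 1" and V: "!!x \<xi>. norm (V x \<xi>) <= B" and W: "!!x \<xi>. norm (W x \<xi>) <= B'"
  and U: "!!z \<zeta>. norm (U z \<zeta>) = norm (V (fst \<zeta> + \<tau> *\<^sub>R snd z) (snd \<zeta> - (1 - \<tau>) *\<^sub>R fst z))
   * norm (W (fst \<zeta> - (1 - \<tau>) *\<^sub>R snd z) (snd \<zeta> + \<tau> *\<^sub>R fst z))"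
 shows "peetre (4 * N) U z \<zeta> <= peetre_pair \<tau> N V W z \<zeta>"
proof (rule peetre_least)
 fix z' \<zeta>' :: "'a \<times> 'a"
 let ?s = "1 + norm (\<zeta> - \<zeta>')" and ?t = "1 + norm (z - z')"
 let ?P = "peetre N V (fst \<zeta> + \<tau> *\<^sub>R snd z) (snd \<zeta> - (1 - \<tau>) *\<^sub>R fst z)"
 let ?Q = "peetre N W (fst \<zeta> - (1 - \<tau>) *\<^sub>R snd z) (snd \<zeta> + \<tau> *\<^sub>R fst z)"
 have fs: "norm (fst w) <= norm w" "norm (snd w) <= norm w" for w :: "'a \<times> 'a"
  by (metis norm_fst_le prod.collapse) (metis norm_snd_le prod.collapse)
 have pw: "(1 + norm (1 *\<^sub>R x + b *\<^sub>R y)) ^ N <= (?s * ?t) ^ N"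
  if "\<bar>b\<bar> <= 1" "norm x <= norm (\<zeta> - \<zeta>')" "norm y <= norm (z - z')" for x y :: 'a and b
  using that by (intro power_mono one_add_norm_lincomb) auto
 have bnd: "(1 + norm ((fst \<zeta> + \<tau> *\<^sub>R snd z) - (fst \<zeta>' + \<tau> *\<^sub>R snd z'))) ^ N <= (?s * ?t) ^ N"
  "(1 + norm ((snd \<zeta> - (1 - \<tau>) *\<^sub>R fst z) - (snd \<zeta>' - (1 - \<tau>) *\<^sub>R fst z'))) ^ N <= (?s * ?t) ^ N"
  "(1 + norm ((fst \<zeta> - (1 - \<tau>) *\<^sub>R snd z) - (fst \<zeta>' - (1 - \<tau>) *\<^sub>R snd z'))) ^ N <= (?s * ?t) ^ N"
  "(1 + norm ((snd \<zeta> + \<tau> *\<^sub>R fst z) - (snd \<zeta>' + \<tau> *\<^sub>R fst z'))) ^ N <= (?s * ?t) ^ N"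
  using pw[of \<tau> "fst (\<zeta> - \<zeta>')" "snd (z - z')"] pw[of "- (1 - \<tau>)" "snd (\<zeta> - \<zeta>')" "fst (z - z')"]
   pw[of "- (1 - \<tau>)" "fst (\<zeta> - \<zeta>')" "snd (z - z')"] pw[of \<tau> "snd (\<zeta> - \<zeta>')" "fst (z - z')"] \<tau>
   fs[of "\<zeta> - \<zeta>'"] fs[of "z - z'"]
  by (simp_all add: algebra_simps)
 have nn: "0 <= ?P" "0 <= ?Q" by (rule peetre_nonneg[OF V] peetre_nonneg[OF W])+
 have v: "norm (V (fst \<zeta>' + \<tau> *\<^sub>R snd z') (snd \<zeta>' - (1 - \<tau>) *\<^sub>R fst z')) <= ((?s * ?t) ^ N * (?s * ?t) ^ N) * ?P"
  by (rule order_trans[OF peetre_upper'[OF V, where x = "fst \<zeta> + \<tau> *\<^sub>R snd z" and \<xi> = "snd \<zeta> - (1 - \<tau>) *\<^sub>R fst z"]]) (intro mult_right_mono mult_mono; (rule bnd | rule nn | simp))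
 have w: "norm (W (fst \<zeta>' - (1 - \<tau>) *\<^sub>R snd z') (snd \<zeta>' + \<tau> *\<^sub>R fst z')) <= ((?s * ?t) ^ N * (?s * ?t) ^ N) * ?Q"
  by (rule order_trans[OF peetre_upper'[OF W, where x = "fst \<zeta> - (1 - \<tau>) *\<^sub>R snd z" and \<xi> = "snd \<zeta> + \<tau> *\<^sub>R fst z"]]) (intro mult_right_mono mult_mono; (rule bnd | rule nn | simp))
 have "norm (U z' \<zeta>') * (decay (4 * N) (z - z') * decay (4 * N) (\<zeta> - \<zeta>'))
   <= ((((?s * ?t) ^ N * (?s * ?t) ^ N) * ?P) * (((?s * ?t) ^ N * (?s * ?t) ^ N) * ?Q)) * (decay (4 * N) (z - z') * decay (4 * N) (\<zeta> - \<zeta>'))"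
  unfolding U by (intro mult_right_mono mult_mono v w) (auto intro!: mult_nonneg_nonneg nn)
 also have "... = (?P * ?Q) * ((?s * ?t) ^ (4 * N) * (decay (4 * N) (z - z') * decay (4 * N) (\<zeta> - \<zeta>')))"
 proof -
  have "(?s * ?t) ^ (4 * N) = ((?s * ?t) ^ N * (?s * ?t) ^ N) * ((?s * ?t) ^ N * (?s * ?t) ^ N)"
   unfolding power_add[symmetric] by (rule arg_cong[where f = "%n. (?s * ?t) ^ n"]) simp
  then show ?thesis by (simp only: mult_ac)
 qed
 also have "(?s * ?t) ^ (4 * N) * (decay (4 * N) (z - z') * decay (4 * N) (\<zeta> - \<zeta>'))
   = (?s ^ (4 * N) * decay (4 * N) (\<zeta> - \<zeta>')) * (?t ^ (4 * N) * decay (4 * N) (z - z'))"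
  by (simp only: power_mult_distrib mult_ac)
 finally show "norm (U z' \<zeta>') * (decay (4 * N) (z - z') * decay (4 * N) (\<zeta> - \<zeta>')) <= peetre_pair \<tau> N V W z \<zeta>"
  by (simp add: peetre_pair_def)
qed

text \<open>The map from (z, \<zeta>) to the two points is invertible, and its inverse also has
  coefficients at most 1. Points chosen independently for the two factors therefore come from a
  single (z', \<zeta>') at controlled distance. The decay of order 2 * N is shared between z and
  \<zeta>.\<close>

lemma peetre_pair_le:
 fixes V W :: "'a::euclidean_space => 'a => complex"
 assumes \<tau>: "0 <= \<tau>" "\<tau> <= 1" and V: "!!x \<xi>. norm (V x \<xi>) <= B" and W: "!!x \<xi>. norm (W x \<xi>) <= B'"
  and U: "!!z \<zeta>. norm (U z \<zeta>) = norm (V (fst \<zeta> + \<tau> *\<^sub>R snd z) (snd \<zeta> - (1 - \<tau>) *\<^sub>R fst z))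
   * norm (W (fst \<zeta> - (1 - \<tau>) *\<^sub>R snd z) (snd \<zeta> + \<tau> *\<^sub>R fst z))"
 shows "peetre_pair \<tau> (2 * N) V W z \<zeta> <= peetre N U z \<zeta>"
proof -
 have "norm (U z \<zeta>) <= B * B'" for z \<zeta>
  unfolding U by (intro mult_mono V W) (auto intro: order_trans[OF norm_ge_zero V])
 note Ub = this
 have Unn: "0 <= peetre N U z \<zeta>" by (rule peetre_nonneg[OF Ub])
 let ?a1 = "fst \<zeta> + \<tau> *\<^sub>R snd z" and ?a2 = "snd \<zeta> - (1 - \<tau>) *\<^sub>R fst z"
  and ?b1 = "fst \<zeta> - (1 - \<tau>) *\<^sub>R snd z" and ?b2 = "snd \<zeta> + \<tau> *\<^sub>R fst z"
 have key: "norm (W y' \<eta>') * (decay (2 * N) (?b1 - y') * decay (2 * N) (?b2 - \<eta>'))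
   * (norm (V y \<eta>) * (decay (2 * N) (?a1 - y) * decay (2 * N) (?a2 - \<eta>))) <= peetre N U z \<zeta>" for y \<eta> y' \<eta>'
 proof -
  \<comment> \<open>(z', \<zeta>') is the preimage of the pair of points (y, \<eta>) and (y',
    \<eta>').\<close>
  define z' where "z' = (\<eta>' - \<eta>, y - y')"
  define \<zeta>' where "\<zeta>' = ((1 - \<tau>) *\<^sub>R y + \<tau> *\<^sub>R y', \<tau> *\<^sub>R \<eta> + (1 - \<tau>) *\<^sub>R \<eta>')"
  have inv: "fst \<zeta>' + \<tau> *\<^sub>R snd z' = y" "snd \<zeta>' - (1 - \<tau>) *\<^sub>R fst z' = \<eta>"
   "fst \<zeta>' - (1 - \<tau>) *\<^sub>R snd z' = y'" "snd \<zeta>' + \<tau> *\<^sub>R fst z' = \<eta>'"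
   by (simp_all add: z'_def \<zeta>'_def algebra_simps)
  define \<Delta>1 where "\<Delta>1 = ?a1 - y" define \<Delta>2 where "\<Delta>2 = ?a2 - \<eta>"
  define \<Delta>3 where "\<Delta>3 = ?b1 - y'" define \<Delta>4 where "\<Delta>4 = ?b2 - \<eta>'"
  let ?D = "(1 + norm \<Delta>1) * (1 + norm \<Delta>2) * ((1 + norm \<Delta>3) * (1 + norm \<Delta>4))"
  have pr: "1 + norm (x, y) <= (1 + norm x) * (1 + norm y)" for x y :: 'a
   using norm_Pair_le[of x y] mult_nonneg_nonneg[of "norm x" "norm y"] unfolding distrib_left distrib_right by (simp del: mult_nonneg_nonneg)
  have "z - z' = (1 *\<^sub>R \<Delta>4 + (- 1) *\<^sub>R \<Delta>2, 1 *\<^sub>R \<Delta>1 + (- 1) *\<^sub>R \<Delta>3)"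
   by (cases z) (simp add: z'_def \<Delta>1_def \<Delta>2_def \<Delta>3_def \<Delta>4_def algebra_simps)
  then have "1 + norm (z - z') <= ((1 + norm \<Delta>4) * (1 + norm \<Delta>2)) * ((1 + norm \<Delta>1) * (1 + norm \<Delta>3))"
   by (simp only:) (intro order_trans[OF pr] mult_mono one_add_norm_lincomb, auto)
  then have nz: "1 + norm (z - z') <= ?D" by (simp only: mult_ac)
  have "\<zeta> - \<zeta>' = ((1 - \<tau>) *\<^sub>R \<Delta>1 + \<tau> *\<^sub>R \<Delta>3, \<tau> *\<^sub>R \<Delta>2 + (1 - \<tau>) *\<^sub>R \<Delta>4)"
   by (cases \<zeta>) (simp add: \<zeta>'_def \<Delta>1_def \<Delta>2_def \<Delta>3_def \<Delta>4_def algebra_simps)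
  then have "1 + norm (\<zeta> - \<zeta>') <= ((1 + norm \<Delta>1) * (1 + norm \<Delta>3)) * ((1 + norm \<Delta>2) * (1 + norm \<Delta>4))"
   using \<tau> by (simp only:) (intro order_trans[OF pr] mult_mono one_add_norm_lincomb, auto)
  then have n\<zeta>: "1 + norm (\<zeta> - \<zeta>') <= ?D" by (simp only: mult_ac)
  have dec: "decay N \<Delta>1 * decay N \<Delta>2 * (decay N \<Delta>3 * decay N \<Delta>4) <= decay N w" if "1 + norm w <= ?D" for w :: "'a \<times> 'a"
  proof -
   have "(1 + norm w) ^ N <= ?D ^ N" using that by (intro power_mono) auto
   then have "inverse (?D ^ N) <= inverse ((1 + norm w) ^ N)" by (intro le_imp_inverse_le) auto
   then show ?thesis by (simp add: decay_def power_mult_distrib inverse_mult_distrib mult_ac)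
  qed
  have "norm (W y' \<eta>') * (decay (2 * N) \<Delta>3 * decay (2 * N) \<Delta>4) * (norm (V y \<eta>) * (decay (2 * N) \<Delta>1 * decay (2 * N) \<Delta>2))
   = norm (U z' \<zeta>') * ((decay N \<Delta>1 * decay N \<Delta>2 * (decay N \<Delta>3 * decay N \<Delta>4)) * (decay N \<Delta>1 * decay N \<Delta>2 * (decay N \<Delta>3 * decay N \<Delta>4)))"
   unfolding U inv mult_2 decay_add by (simp only: mult_ac)
  also have "... <= norm (U z' \<zeta>') * (decay N (z - z') * decay N (\<zeta> - \<zeta>'))"
   by (intro mult_left_mono mult_mono dec nz n\<zeta>) auto
  also have "... <= peetre N U z \<zeta>" by (rule peetre_upper[OF Ub])
  finally show ?thesis by (simp only: \<Delta>1_def \<Delta>2_def \<Delta>3_def \<Delta>4_def)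
 qed
 have "peetre (2 * N) W ?b1 ?b2 * (norm (V y \<eta>) * (decay (2 * N) (?a1 - y) * decay (2 * N) (?a2 - \<eta>))) <= peetre N U z \<zeta>" for y \<eta>
  by (rule peetre_mult_least[OF _ Unn key]) simp
 then have "peetre (2 * N) V ?a1 ?a2 * peetre (2 * N) W ?b1 ?b2 <= peetre N U z \<zeta>"
  by (intro peetre_mult_least Unn peetre_nonneg[OF W]) (simp only: mult.commute)
 then show ?thesis by (simp only: peetre_pair_def)
qed

abbreviation VG :: "('a::euclidean_space => complex) => 'a => 'a => complex" where
 "VG \<equiv> stft0 (gauss 0 0)"

lemma VG_bdd:
 assumes "f \<in> schwartz" obtains B where "!!x \<xi>. norm (VG f x \<xi>) <= B"
 by (rule stft0_bdd[OF rapid_integrable[OF schwartz_rapid[OF assms]] schwartz_rapid[OF gauss_schwartz]]) (rule that)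

lemma gauss_nonzero: "gauss 0 0 \<noteq> (%_. 0)"
proof
 assume "gauss 0 0 = (%_ :: 'a. 0)"
 then have "gauss 0 0 (0::'a) = 0" by simp
 then show False by (simp add: gauss_def)
qed

lemma amb_gauss_nonzero: "amb \<tau> (gauss 0 0) (gauss 0 0) \<noteq> (%_. 0)"
proof
 assume "amb \<tau> (gauss 0 0) (gauss 0 0) = (%_ :: 'a \<times> 'a. 0)"
 then have "amb \<tau> (gauss 0 0) (gauss 0 0) (0 :: 'a, 0) = 0" by simp
 then show False by (simp add: amb_gauss)
qed

lemma peetre_pair_measurable:
 fixes V W :: "'a::euclidean_space => 'a => complex"
 assumes V: "!!x \<xi>. norm (V x \<xi>) <= B" and W: "!!x \<xi>. norm (W x \<xi>) <= B'"
 shows "(%(z, \<zeta>). peetre_pair \<tau> N V W z \<zeta>) \<in> borel_measurable (borel \<Otimes>\<^sub>M borel)"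
proof -
 have m: "(%x. peetre N U (g x) (h x)) \<in> borel_measurable M"
  if "!!x \<xi>. norm (U x \<xi>) <= B" "g \<in> borel_measurable M" "h \<in> borel_measurable M"
  for U :: "'a => 'a => complex" and g h B and M :: "'c measure"
  using measurable_compose[OF measurable_Pair[OF that(2,3)] peetre_measurable[of U, OF that(1)]] by simp
 show ?thesis
  unfolding peetre_pair_def split_beta' borel_prod
  by (intro borel_measurable_times m[OF V] m[OF W] borel_measurable_continuous_onI continuous_intros)
qed

definition pair_norm :: "real => nat => ennreal => ennreal => ('a \<times> 'a => real) =>
  ('a::euclidean_space => complex) => ('a => complex) => ennreal" where
 "pair_norm \<tau> N p q m f g = mixed_norm p q lborel lborel (%z \<zeta>. ennreal (peetre_pair \<tau> N (VG f) (VG g) z \<zeta> * m \<zeta>))"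

lemma wiener_norm_equiv:
 fixes \<Phi> :: "'a::euclidean_space \<times> 'a => complex"
 assumes \<Phi>: "\<Phi> \<in> schwartz" "\<Phi> \<noteq> (%_. 0)" and p: "0 < p" and q: "0 < q" and \<tau>: "0 <= \<tau>" "\<tau> <= 1"
  and m: "weight_equiv m m'"
 obtains N0 where "!!K. N0 <= K ==> \<exists>C>0. \<forall>f\<in>schwartz. \<forall>g\<in>schwartz.
  wiener_norm \<Phi> p q m (regular_distr (wigner \<tau> f g)) <= ennreal C * pair_norm \<tau> (2 * K) p q m' f g \<and>
  pair_norm \<tau> (2 * K) p q m' f g <= ennreal C * wiener_norm \<Phi> p q m (regular_distr (wigner \<tau> f g))"
proof -
 let ?\<Psi> = "amb \<tau> (gauss 0 0) (gauss 0 0) :: 'a \<times> 'a => complex"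
 obtain N0 where N0: "!!N. N0 <= N ==> \<exists>C>0. \<forall>u. integrable lborel u \<longrightarrow>
  stft_norm p q (%_. 1) m (stft0 \<Phi> u)
   <= ennreal C * peetre_norm N p q (%_. 1) m' (stft0 ?\<Psi> u) \<and>
  peetre_norm N p q (%_. 1) m' (stft0 ?\<Psi> u)
   <= ennreal C * stft_norm p q (%_. 1) m (stft0 \<Phi> u)"
  by (rule stft_norm_equiv[OF \<Phi> amb_gauss_schwartz amb_gauss_nonzero p q weight_equiv_1 m]) (rule that)
 obtain L where L: "moderate L m'" using m unfolding weight_equiv_def by blast
 show thesis
 proof (rule that)
  fix K assume K: "N0 <= K"
  \<comment> \<open>Passing to the pair costs a factor 4 in the index in one direction and a factor
    2 in the other; the indices are arranged so that both estimates meet at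
    \<open>2 * K\<close>.\<close>
  obtain C1 where C1: "0 < C1" "!!u. integrable lborel u ==>
    stft_norm p q (%_. 1) m (stft0 \<Phi> u)
     <= ennreal C1 * peetre_norm (4 * (2 * K)) p q (%_. 1) m' (stft0 ?\<Psi> u)"
   using N0[of "4 * (2 * K)"] K by auto
  obtain C2 where C2: "0 < C2" "!!u. integrable lborel u ==> peetre_norm K p q (%_. 1) m' (stft0 ?\<Psi> u)
   <= ennreal C2 * stft_norm p q (%_. 1) m (stft0 \<Phi> u)"
   using N0[OF K] by auto
  show "\<exists>C>0. \<forall>f\<in>schwartz. \<forall>g\<in>schwartz.
   wiener_norm \<Phi> p q m (regular_distr (wigner \<tau> f g)) <= ennreal C * pair_norm \<tau> (2 * K) p q m' f g \<and>
   pair_norm \<tau> (2 * K) p q m' f g <= ennreal C * wiener_norm \<Phi> p q m (regular_distr (wigner \<tau> f g))"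
  proof (intro exI[of _ "max C1 C2"] conjI ballI)
   show "0 < max C1 C2" using C1 by simp
   fix f g :: "'a => complex" assume fg: "f \<in> schwartz" "g \<in> schwartz"
   obtain B where B: "!!x \<xi>. norm (VG f x \<xi>) <= B" using VG_bdd[OF fg(1)] by blast
   obtain B' where B': "!!x \<xi>. norm (VG g x \<xi>) <= B'" using VG_bdd[OF fg(2)] by blast
   note int = amb_integrable[OF \<tau> fg]
   obtain B3 where B3: "!!z \<zeta>. norm (stft0 ?\<Psi> (amb \<tau> f g) z \<zeta>) <= B3"
    using stft0_bdd[OF int schwartz_rapid[OF amb_gauss_schwartz]] by blast
   have U: "norm (stft0 ?\<Psi> (amb \<tau> f g) z \<zeta>) = norm (VG f (fst \<zeta> + \<tau> *\<^sub>R snd z) (snd \<zeta> - (1 - \<tau>) *\<^sub>R fst z))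
    * norm (VG g (fst \<zeta> - (1 - \<tau>) *\<^sub>R snd z) (snd \<zeta> + \<tau> *\<^sub>R fst z))" for z \<zeta>
    using norm_stft0_amb[OF \<tau> fg gauss_schwartz gauss_schwartz, of 0 0 0 0 "fst z" "snd z" "fst \<zeta>" "snd \<zeta>"] by simp
   note [measurable] = moderate_measurable[OF L] peetre_pair_measurable[of "VG f" B "VG g", OF B B']
    peetre_measurable[of "stft0 ?\<Psi> (amb \<tau> f g)", OF B3]
   have m0: "0 <= m' \<zeta>" for \<zeta> by (rule moderateD(1)[OF L])
   have "peetre_norm (4 * (2 * K)) p q (%_. 1) m' (stft0 ?\<Psi> (amb \<tau> f g)) <= pair_norm \<tau> (2 * K) p q m' f g"
    unfolding peetre_norm_def pair_norm_def
   proof (rule mixed_norm_mono[OF _ p q])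
    fix z \<zeta>
    show "ennreal (peetre (4 * (2 * K)) (stft0 ?\<Psi> (amb \<tau> f g)) z \<zeta> * (1 * m' \<zeta>)) <= ennreal (peetre_pair \<tau> (2 * K) (VG f) (VG g) z \<zeta> * m' \<zeta>)"
     using peetre_pair_ge[of \<tau> "VG f" B "VG g" B' "stft0 ?\<Psi> (amb \<tau> f g)" "2 * K" z \<zeta>, OF \<tau> B B' U] m0[of \<zeta>]
     by (intro ennreal_leI) (simp add: mult_right_mono)
   qed (auto, measurable)
   with C1(2)[OF int] have "wiener_norm \<Phi> p q m (regular_distr (wigner \<tau> f g)) <= ennreal C1 * pair_norm \<tau> (2 * K) p q m' f g"
    unfolding wiener_norm_wigner[OF fg \<Phi>(1) \<tau>] by (meson mult_left_mono order_trans zero_le)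
   also have "... <= ennreal (max C1 C2) * pair_norm \<tau> (2 * K) p q m' f g"
    by (intro mult_right_mono ennreal_leI) auto
   finally show "wiener_norm \<Phi> p q m (regular_distr (wigner \<tau> f g)) <= ennreal (max C1 C2) * pair_norm \<tau> (2 * K) p q m' f g" .
   have "pair_norm \<tau> (2 * K) p q m' f g <= peetre_norm K p q (%_. 1) m' (stft0 ?\<Psi> (amb \<tau> f g))"
    unfolding peetre_norm_def pair_norm_def
   proof (rule mixed_norm_mono[OF _ p q])
    fix z \<zeta>
    show "ennreal (peetre_pair \<tau> (2 * K) (VG f) (VG g) z \<zeta> * m' \<zeta>) <= ennreal (peetre K (stft0 ?\<Psi> (amb \<tau> f g)) z \<zeta> * (1 * m' \<zeta>))"
     using peetre_pair_le[of \<tau> "VG f" B "VG g" B' "stft0 ?\<Psi> (amb \<tau> f g)" K z \<zeta>, OF \<tau> B B' U] m0[of \<zeta>]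
     by (intro ennreal_leI) (simp add: mult_right_mono)
   qed (auto, measurable)
   also have "... <= ennreal C2 * wiener_norm \<Phi> p q m (regular_distr (wigner \<tau> f g))"
    unfolding wiener_norm_wigner[OF fg \<Phi>(1) \<tau>] by (rule C2(2)[OF int])
   also have "... <= ennreal (max C1 C2) * wiener_norm \<Phi> p q m (regular_distr (wigner \<tau> f g))"
    by (intro mult_right_mono ennreal_leI) auto
   finally show "pair_norm \<tau> (2 * K) p q m' f g <= ennreal (max C1 C2) * wiener_norm \<Phi> p q m (regular_distr (wigner \<tau> f g))" .
  qed
 qed
qed

lemma modulation_norm_equiv:
 fixes \<phi> :: "'a::euclidean_space => complex"
 assumes \<phi>: "\<phi> \<in> schwartz" "\<phi> \<noteq> (%_. 0)" and p: "0 < p" and q: "0 < q"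
  and \<omega>: "weight_equiv \<omega> \<omega>'" and \<mu>: "weight_equiv \<mu> \<mu>'"
 obtains N0 where "!!N. N0 <= N ==> \<exists>C>0. \<forall>f\<in>schwartz.
  modulation_norm \<phi> p q (tensor \<omega> \<mu>) (regular_distr f) <= ennreal C * peetre_norm N p q \<omega>' \<mu>' (VG f) \<and>
  peetre_norm N p q \<omega>' \<mu>' (VG f) <= ennreal C * modulation_norm \<phi> p q (tensor \<omega> \<mu>) (regular_distr f)"
proof -
 obtain N0 where N0: "!!N. N0 <= N ==> \<exists>C>0. \<forall>u. integrable lborel u \<longrightarrow>
  stft_norm p q \<omega> \<mu> (stft0 \<phi> u)
   <= ennreal C * peetre_norm N p q \<omega>' \<mu>' (VG u) \<and>
  peetre_norm N p q \<omega>' \<mu>' (VG u)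
   <= ennreal C * stft_norm p q \<omega> \<mu> (stft0 \<phi> u)"
  by (rule stft_norm_equiv[OF \<phi> gauss_schwartz gauss_nonzero p q \<omega> \<mu>]) (rule that)
 show thesis
 proof (rule that)
  fix N assume "N0 <= N"
  from N0[OF this] obtain C where C: "0 < C" "!!u. integrable lborel u ==>
   stft_norm p q \<omega> \<mu> (stft0 \<phi> u)
    <= ennreal C * peetre_norm N p q \<omega>' \<mu>' (VG u) \<and>
   peetre_norm N p q \<omega>' \<mu>' (VG u)
    <= ennreal C * stft_norm p q \<omega> \<mu> (stft0 \<phi> u)" by auto
  show "\<exists>C>0. \<forall>f\<in>schwartz.
   modulation_norm \<phi> p q (tensor \<omega> \<mu>) (regular_distr f) <= ennreal C * peetre_norm N p q \<omega>' \<mu>' (VG f) \<and>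
   peetre_norm N p q \<omega>' \<mu>' (VG f) <= ennreal C * modulation_norm \<phi> p q (tensor \<omega> \<mu>) (regular_distr f)"
   using C(1) by (intro exI[of _ C] conjI ballI) (auto simp only: modulation_norm_schwartz[OF _ \<phi>(1)] C(2)[OF rapid_integrable[OF schwartz_rapid]])
 qed
qed

lemma bilinear_bound_transfer:
 fixes X Y Z X' Y' Z' :: "'f => ennreal"
 assumes "\<exists>C>0. \<forall>f\<in>S. \<forall>g\<in>S. W f g <= ennreal C * X f * Y g"
  and W: "\<exists>C>0. \<forall>f\<in>S. \<forall>g\<in>S. W' f g <= ennreal C * W f g"
  and X: "\<exists>C>0. \<forall>f\<in>S. X f <= ennreal C * X' f" and Y: "\<exists>C>0. \<forall>f\<in>S. Y f <= ennreal C * Y' f"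
 shows "\<exists>C>0. \<forall>f\<in>S. \<forall>g\<in>S. W' f g <= ennreal C * X' f * Y' g"
proof -
 obtain C1 where C1: "0 < C1" and le1: "!!f g. f \<in> S ==> g \<in> S ==> W f g <= ennreal C1 * X f * Y g" using assms(1) by blast
 obtain C2 where C2: "0 < C2" and le2: "!!f g. f \<in> S ==> g \<in> S ==> W' f g <= ennreal C2 * W f g" using W by blast
 obtain C3 where C3: "0 < C3" and le3: "!!f. f \<in> S ==> X f <= ennreal C3 * X' f" using X by blast
 obtain C4 where C4: "0 < C4" and le4: "!!f. f \<in> S ==> Y f <= ennreal C4 * Y' f" using Y by blast
 have "W' f g <= ennreal (C2 * C1 * C3 * C4) * X' f * Y' g" if "f \<in> S" "g \<in> S" for f g
 proof -
  have "W' f g <= ennreal C2 * (ennreal C1 * (ennreal C3 * X' f) * (ennreal C4 * Y' g))"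
   by (intro order_trans[OF le2[OF that]] mult_left_mono order_trans[OF le1[OF that]] mult_mono le3[OF that(1)] le4[OF that(2)]) auto
  also have "... = ennreal (C2 * C1 * C3 * C4) * X' f * Y' g"
   using C1 C2 C3 C4 by (simp add: ennreal_mult mult_ac)
  finally show ?thesis .
 qed
 then show ?thesis using C1 C2 C3 C4 by (intro exI[of _ "C2 * C1 * C3 * C4"]) simp
qed

lemma wigner_bounded_iff_peetre:
 fixes \<phi> :: "'a::euclidean_space => complex" and \<Phi> :: "'a \<times> 'a => complex"
 assumes \<phi>: "\<phi> \<in> schwartz" "\<phi> \<noteq> (%_. 0)" and \<Phi>: "\<Phi> \<in> schwartz" "\<Phi> \<noteq> (%_. 0)"
  and p: "0 < p1" "0 < q1" "0 < p2" "0 < q2" "0 < p" "0 < q" and \<tau>: "0 <= \<tau>" "\<tau> <= 1"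
  and w: "weight_equiv \<omega>1 \<omega>1'" "weight_equiv \<mu>1 \<mu>1'" "weight_equiv \<omega>2 \<omega>2'" "weight_equiv \<mu>2 \<mu>2'" "weight_equiv m m'"
 obtains N0 where "!!K. N0 <= K ==>
  wigner_bounded \<phi> \<Phi> \<tau> p1 q1 (tensor \<omega>1 \<mu>1) p2 q2 (tensor \<omega>2 \<mu>2) p q m \<longleftrightarrow>
  (\<exists>C>0. \<forall>f\<in>schwartz. \<forall>g\<in>schwartz. pair_norm \<tau> (2 * K) p q m' f g
   <= ennreal C * peetre_norm (2 * K) p1 q1 \<omega>1' \<mu>1' (VG f) * peetre_norm (2 * K) p2 q2 \<omega>2' \<mu>2' (VG g))"
proof -
 obtain N1 where N1: "!!N. N1 <= N ==> \<exists>C>0. \<forall>f\<in>schwartz.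
  modulation_norm \<phi> p1 q1 (tensor \<omega>1 \<mu>1) (regular_distr f) <= ennreal C * peetre_norm N p1 q1 \<omega>1' \<mu>1' (VG f) \<and>
  peetre_norm N p1 q1 \<omega>1' \<mu>1' (VG f) <= ennreal C * modulation_norm \<phi> p1 q1 (tensor \<omega>1 \<mu>1) (regular_distr f)"
  by (rule modulation_norm_equiv[OF \<phi> p(1,2) w(1,2)]) (rule that)
 obtain N2 where N2: "!!N. N2 <= N ==> \<exists>C>0. \<forall>f\<in>schwartz.
  modulation_norm \<phi> p2 q2 (tensor \<omega>2 \<mu>2) (regular_distr f) <= ennreal C * peetre_norm N p2 q2 \<omega>2' \<mu>2' (VG f) \<and>
  peetre_norm N p2 q2 \<omega>2' \<mu>2' (VG f) <= ennreal C * modulation_norm \<phi> p2 q2 (tensor \<omega>2 \<mu>2) (regular_distr f)"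
  by (rule modulation_norm_equiv[OF \<phi> p(3,4) w(3,4)]) (rule that)
 obtain N3 where N3: "!!K. N3 <= K ==> \<exists>C>0. \<forall>f\<in>schwartz. \<forall>g\<in>schwartz.
  wiener_norm \<Phi> p q m (regular_distr (wigner \<tau> f g)) <= ennreal C * pair_norm \<tau> (2 * K) p q m' f g \<and>
  pair_norm \<tau> (2 * K) p q m' f g <= ennreal C * wiener_norm \<Phi> p q m (regular_distr (wigner \<tau> f g))"
  by (rule wiener_norm_equiv[OF \<Phi> p(5,6) \<tau> w(5)]) (rule that)
 show thesis
 proof (rule that)
  fix K assume K: "max N1 (max N2 N3) <= K"
  have le: "N1 <= 2 * K" "N2 <= 2 * K" "N3 <= K" using K by auto
  note n1 = N1[OF le(1)] and n2 = N2[OF le(2)] and n3 = N3[OF le(3)]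
  show "wigner_bounded \<phi> \<Phi> \<tau> p1 q1 (tensor \<omega>1 \<mu>1) p2 q2 (tensor \<omega>2 \<mu>2) p q m \<longleftrightarrow>
   (\<exists>C>0. \<forall>f\<in>schwartz. \<forall>g\<in>schwartz. pair_norm \<tau> (2 * K) p q m' f g
    <= ennreal C * peetre_norm (2 * K) p1 q1 \<omega>1' \<mu>1' (VG f) * peetre_norm (2 * K) p2 q2 \<omega>2' \<mu>2' (VG g))"
   unfolding wigner_bounded_def
  proof
   assume "\<exists>C>0. \<forall>f\<in>schwartz. \<forall>g\<in>schwartz. wiener_norm \<Phi> p q m (regular_distr (wigner \<tau> f g))
    <= ennreal C * modulation_norm \<phi> p1 q1 (tensor \<omega>1 \<mu>1) (regular_distr f) * modulation_norm \<phi> p2 q2 (tensor \<omega>2 \<mu>2) (regular_distr g)"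
   then show "\<exists>C>0. \<forall>f\<in>schwartz. \<forall>g\<in>schwartz. pair_norm \<tau> (2 * K) p q m' f g
    <= ennreal C * peetre_norm (2 * K) p1 q1 \<omega>1' \<mu>1' (VG f) * peetre_norm (2 * K) p2 q2 \<omega>2' \<mu>2' (VG g)"
    by (rule bilinear_bound_transfer) (use n1 n2 n3 in blast)+
  next
   assume "\<exists>C>0. \<forall>f\<in>schwartz. \<forall>g\<in>schwartz. pair_norm \<tau> (2 * K) p q m' f g
    <= ennreal C * peetre_norm (2 * K) p1 q1 \<omega>1' \<mu>1' (VG f) * peetre_norm (2 * K) p2 q2 \<omega>2' \<mu>2' (VG g)"
   then show "\<exists>C>0. \<forall>f\<in>schwartz. \<forall>g\<in>schwartz. wiener_norm \<Phi> p q m (regular_distr (wigner \<tau> f g))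
    <= ennreal C * modulation_norm \<phi> p1 q1 (tensor \<omega>1 \<mu>1) (regular_distr f) * modulation_norm \<phi> p2 q2 (tensor \<omega>2 \<mu>2) (regular_distr g)"
    by (rule bilinear_bound_transfer) (use n1 n2 n3 in blast)+
  qed
 qed
qed

subsection \<open>Lattices of Gabor atoms\<close>

abbreviation lpt :: "real => int^'d => real^'d" where
 "lpt c k \<equiv> c *\<^sub>R lattice_pt k"

text \<open>Sampling at exponent 1 compares the sum with the integral of \<open>decay M\<close>;
  translation invariance makes the bound uniform in y.\<close>

lemma lattice_decay_sum:
 assumes c: "0 < c" and M: "2 * CARD('d) <= M"
 obtains T where "0 < T"
  "!!S (y :: real^'d). finite S ==> (\<Sum>k\<in>S. decay M (y - lpt c k)) <= T"
proof -
 define D where "D = c * real CARD('d)"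
 define J where "J = (\<integral> x. decay M (x :: real^'d) \<partial>lborel)"
 define v where "v = c ^ CARD('d)"
 have v: "0 < v" and D: "0 <= D" and J: "0 <= J" using c by (auto simp: v_def D_def J_def)
 have le: "(\<Sum>k\<in>S. decay M (y - lpt c k)) <= (1 + D) ^ M * J / v"
  if S: "finite S" for S :: "(int^'d) set" and y :: "real^'d"
 proof -
  define F :: "real^'d => ennreal" where "F = (%x. ennreal (decay M (x - y)))"
  have [measurable]: "F \<in> borel_measurable borel" unfolding F_def by measurable
  have osc: "F x <= ennreal ((1 + D) ^ M) * F x'" if "norm (x - x') <= D" for x x'
  proof -
   have "decay M (x - y) <= (1 + norm (x' - y - (x - y))) ^ M * decay M (x' - y)"
    by (rule moderateD(2)[OF moderate_decay])
   also have "... <= (1 + D) ^ M * decay M (x' - y)"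
    using that by (intro mult_right_mono power_mono) (auto simp: norm_minus_commute)
   finally show ?thesis using D by (simp add: F_def ennreal_mult'[symmetric])
  qed
  have L1: "Lp_norm 1 A f = (\<integral>\<^sup>+ x. f x \<partial>A)" for A :: "'b measure" and f
   using Lp_norm_ennreal[of 1 A f] by simp
  have "cell_const 1 v * lp 1 (%k :: int^'d. F (lpt c k)) <= ennreal ((1 + D) ^ M) * Lp_norm 1 lborel F"
   unfolding v_def by (rule sampling_Lp_norm_ge[OF sampling_lattice[OF c]]) (use osc in \<open>auto simp: D_def\<close>)
  also have "Lp_norm 1 lborel F = ennreal J"
   using nn_integral_decay[of M y] M by (simp add: L1 F_def J_def)
  also have "cell_const 1 v = ennreal v" using v by (simp add: cell_const_def)
  finally have *: "ennreal v * lp 1 (%k :: int^'d. F (lpt c k)) <= ennreal ((1 + D) ^ M * J)"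
   using D J by (simp add: ennreal_mult')
  have "ennreal (\<Sum>k\<in>S. decay M (y - lpt c k)) = (\<Sum>k\<in>S. F (lpt c k))"
   by (simp add: F_def decay_commute[of M y] sum_ennreal)
  also have "... = (\<integral>\<^sup>+k. F (lpt c k) * indicator S k \<partial>count_space UNIV)"
   using S by (simp add: nn_integral_count_space_indicator[symmetric] nn_integral_count_space_finite)
  also have "... <= lp 1 (%k :: int^'d. F (lpt c k))"
   unfolding L1 by (intro nn_integral_mono) (auto simp: indicator_def)
  finally have "ennreal v * ennreal (\<Sum>k\<in>S. decay M (y - lpt c k)) <= ennreal ((1 + D) ^ M * J)"
   using * by (meson dual_order.trans mult_left_mono zero_le)
  then have "v * (\<Sum>k\<in>S. decay M (y - lpt c k)) <= (1 + D) ^ M * J"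
   using v D J by (simp add: ennreal_mult'[symmetric] ennreal_le_iff)
  then show ?thesis using v by (simp add: field_simps)
 qed
 show thesis
 proof (rule that[of "(1 + D) ^ M * J / v + 1"])
  show "0 < (1 + D) ^ M * J / v + 1" using v D J by (intro add_nonneg_pos) auto
  fix S :: "(int^'d) set" and y :: "real^'d" assume "finite S"
  from le[OF this, of y] show "(\<Sum>k\<in>S. decay M (y - lpt c k)) <= (1 + D) ^ M * J / v + 1" by linarith
 qed
qed

lemma lattice_decay_sum_pair:
 assumes c: "0 < c" "0 < c'" and M: "2 * CARD('d) <= M"
 obtains T where "0 < T"
  "!!S (y :: real^'d) (\<eta> :: real^'d). finite S ==>
   (\<Sum>w\<in>S. decay M (y - lpt c (fst w)) * decay M (\<eta> - c' *\<^sub>R lattice_pt (snd w))) <= T"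
proof -
 obtain T1 where T1: "0 < T1"
  "!!S (y :: real^'d). finite S ==> (\<Sum>k\<in>S. decay M (y - lpt c k)) <= T1"
  by (rule lattice_decay_sum[OF c(1) M]) (rule that; assumption)
 obtain T2 where T2: "0 < T2"
  "!!S (y :: real^'d). finite S ==> (\<Sum>k\<in>S. decay M (y - c' *\<^sub>R lattice_pt k)) <= T2"
  by (rule lattice_decay_sum[OF c(2) M]) (rule that; assumption)
 show thesis
 proof (rule that[of "T1 * T2"])
  show "0 < T1 * T2" using T1 T2 by simp
  fix S :: "((int^'d) \<times> (int^'d)) set" and y \<eta> :: "real^'d" assume S: "finite S"
  \<comment> \<open>The set is enlarged to the product of its projections, where the sum
    factorizes.\<close>
  have "(\<Sum>w\<in>S. decay M (y - lpt c (fst w)) * decay M (\<eta> - c' *\<^sub>R lattice_pt (snd w)))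
   <= (\<Sum>w\<in>fst ` S \<times> snd ` S. decay M (y - lpt c (fst w)) * decay M (\<eta> - c' *\<^sub>R lattice_pt (snd w)))"
   using S by (intro sum_mono2) (auto simp: rev_image_eqI)
  also have "... = (\<Sum>k\<in>fst ` S. decay M (y - lpt c k)) * (\<Sum>n\<in>snd ` S. decay M (\<eta> - c' *\<^sub>R lattice_pt n))"
   by (simp add: sum_product sum.cartesian_product split_beta)
  also have "... <= T1 * T2" using T1 T2 S by (intro mult_mono) (auto intro!: sum_nonneg)
  finally show "(\<Sum>w\<in>S. decay M (y - lpt c (fst w)) * decay M (\<eta> - c' *\<^sub>R lattice_pt (snd w))) <= T1 * T2" .
 qed
qed

definition lat_norm :: "real => real => ennreal => ennreal => (real^'d => real) => (real^'d => real) =>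
  ((int^'d) \<times> (int^'d) => ennreal) => ennreal" where
 "lat_norm \<alpha> \<beta> p q \<omega> \<mu> a =
  lp q (%n. lp p (%k. a (k, n) * ennreal (\<omega> (lpt \<alpha> k) * \<mu> (lpt \<beta> n))))"

lemma bimoderate_osc:
 assumes "bimoderate N H" "moderate L \<omega>" "moderate L' \<mu>" "norm (x - x') <= D" "norm (y - y') <= D'"
 shows "ennreal (H x y * (\<omega> x * \<mu> y))
  <= ennreal (((1 + D) ^ N * (1 + D') ^ N) * ((1 + D) ^ L * (1 + D') ^ L')) * ennreal (H x' y' * (\<omega> x' * \<mu> y'))"
proof -
 have D: "0 <= D" "0 <= D'" using assms(4,5) norm_ge_zero order_trans by blast+
 have nn: "0 <= H x y" "0 <= H x' y'" "0 <= \<omega> x" "0 <= \<omega> x'" "0 <= \<mu> y" "0 <= \<mu> y'" for x y x' y'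
  using assms(1-3) by (auto simp: bimoderate_def moderate_def)
 have pw: "(1 + norm (x' - x)) ^ K <= (1 + D) ^ K" "(1 + norm (y' - y)) ^ K <= (1 + D') ^ K" for K
  using assms(4,5) by (auto intro!: power_mono simp: norm_minus_commute)
 have "H x y <= ((1 + norm (x' - x)) ^ N * (1 + norm (y' - y)) ^ N) * H x' y'"
  using assms(1) by (auto simp: bimoderate_def)
 also have "... <= ((1 + D) ^ N * (1 + D') ^ N) * H x' y'"
  using D nn by (intro mult_mono pw) auto
 finally have H: "H x y <= ((1 + D) ^ N * (1 + D') ^ N) * H x' y'" .
 have w: "\<omega> x <= (1 + D) ^ L * \<omega> x'"
  using moderateD(2)[OF assms(2), of x x'] mult_right_mono[OF pw(1)[of L] nn(4)[of x']] by linarith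
 have u: "\<mu> y <= (1 + D') ^ L' * \<mu> y'"
  using moderateD(2)[OF assms(3), of y y'] mult_right_mono[OF pw(2)[of L'] nn(6)[of y']] by linarith
 have "H x y * (\<omega> x * \<mu> y) <= (((1 + D) ^ N * (1 + D') ^ N) * H x' y') * (((1 + D) ^ L * \<omega> x') * ((1 + D') ^ L' * \<mu> y'))"
  using D nn by (intro mult_mono H w u) auto
 also have "... = (((1 + D) ^ N * (1 + D') ^ N) * ((1 + D) ^ L * (1 + D') ^ L')) * (H x' y' * (\<omega> x' * \<mu> y'))"
  by algebra
 finally show ?thesis using D nn by (subst ennreal_mult'[symmetric]) (auto intro!: ennreal_leI)
qed

lemma sampled_norm:
 fixes \<omega> \<mu> :: "real^'d => real"
 assumes s: "0 < \<alpha>" "0 < \<beta>" and p: "0 < p" "0 < q" and w: "moderate L \<omega>" "moderate L' \<mu>"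
 obtains C where "0 < C"
  "!!H. bimoderate N H ==> mixed_norm p q lborel lborel (%x y. ennreal (H x y * (\<omega> x * \<mu> y)))
   <= ennreal C * lat_norm \<alpha> \<beta> p q \<omega> \<mu> (%w. ennreal (H (lpt \<alpha> (fst w)) (lpt \<beta> (snd w))))"
  "!!H. bimoderate N H ==> lat_norm \<alpha> \<beta> p q \<omega> \<mu> (%w. ennreal (H (lpt \<alpha> (fst w)) (lpt \<beta> (snd w))))
   <= ennreal C * mixed_norm p q lborel lborel (%x y. ennreal (H x y * (\<omega> x * \<mu> y)))"
proof -
 define D where "D = \<alpha> * real CARD('d)"
 define D' where "D' = \<beta> * real CARD('d)"
 define c where "c = ((1 + D) ^ N * (1 + D') ^ N) * ((1 + D) ^ L * (1 + D') ^ L')"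
 define v1 where "v1 = \<alpha> ^ CARD('d)"
 define v2 where "v2 = \<beta> ^ CARD('d)"
 have v: "0 < v1" "0 < v2" and c: "0 < c" using s by (auto simp: v1_def v2_def c_def D_def D'_def intro!: mult_pos_pos zero_less_power add_pos_nonneg)
 define \<kappa> where "\<kappa> = cell_const p v1 * cell_const q v2"
 have \<kappa>: "0 < \<kappa>" "\<kappa> < top" using v by (auto simp: \<kappa>_def cell_const_pos cell_const_finite ennreal_mult_less_top ennreal_zero_less_mult_iff)
 then obtain k where k: "\<kappa> = ennreal k" "0 < k" by (cases \<kappa>) auto
 have sm: "sampling v1 D (%k :: int^'d. lpt \<alpha> k)" "sampling v2 D' (%k :: int^'d. lpt \<beta> k)"
  unfolding v1_def v2_def D_def D'_def by (intro sampling_lattice s)+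
 have eq: "lat_norm \<alpha> \<beta> p q \<omega> \<mu> (%w. ennreal (H (lpt \<alpha> (fst w)) (lpt \<beta> (snd w))))
  = lp q (%j. lp p (%i. ennreal (H (lpt \<alpha> i) (lpt \<beta> j) * (\<omega> (lpt \<alpha> i) * \<mu> (lpt \<beta> j)))))"
  if "bimoderate N H" for H
  using that by (simp add: lat_norm_def ennreal_mult' bimoderate_def)
 have m: "(%(x, y). ennreal (H x y * (\<omega> x * \<mu> y))) \<in> borel_measurable (borel \<Otimes>\<^sub>M borel)" if "bimoderate N H" for H
 proof -
  note [measurable] = bimoderate_measurable[OF that] moderate_measurable[OF w(1)] moderate_measurable[OF w(2)]
  show ?thesis by measurable
 qed
 show thesis
 proof (rule that[of "max (k * c\<^sup>2) (c\<^sup>2 / k)"])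
  show "0 < max (k * c\<^sup>2) (c\<^sup>2 / k)" using k c by (simp add: less_max_iff_disj)
  fix H assume H: "bimoderate N (H :: real^'d => real^'d => real)"
  note A = sampling_mixed_norm[OF sm p m[OF H] bimoderate_osc[OF H w, where D = D and D' = D', folded c_def], folded \<kappa>_def eq[OF H]]
  have *: "\<kappa> * ennreal c ^ 2 <= ennreal (max (k * c\<^sup>2) (c\<^sup>2 / k))"
   using k c by (simp add: ennreal_power ennreal_mult'[symmetric] ennreal_leI)
  show "mixed_norm p q lborel lborel (%x y. ennreal (H x y * (\<omega> x * \<mu> y)))
   <= ennreal (max (k * c\<^sup>2) (c\<^sup>2 / k)) * lat_norm \<alpha> \<beta> p q \<omega> \<mu> (%w. ennreal (H (lpt \<alpha> (fst w)) (lpt \<beta> (snd w))))"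
   by (rule order_trans[OF A(1) mult_right_mono[OF *]]) (assumption | rule zero_le)+
  let ?X = "lat_norm \<alpha> \<beta> p q \<omega> \<mu> (%w. ennreal (H (lpt \<alpha> (fst w)) (lpt \<beta> (snd w))))"
  let ?Y = "mixed_norm p q lborel lborel (%x y. ennreal (H x y * (\<omega> x * \<mu> y)))"
  have "?X = ennreal (1 / k) * (\<kappa> * ?X)" using k by (simp add: mult.assoc[symmetric] ennreal_mult'[symmetric])
  also have "... <= ennreal (1 / k) * (ennreal c ^ 2 * ?Y)" by (intro mult_left_mono A(2)) (assumption | rule zero_le)+
  also have "... = ennreal (c\<^sup>2 / k) * ?Y" using k c by (simp add: ennreal_power mult.assoc[symmetric] ennreal_mult'[symmetric])
  also have "... <= ennreal (max (k * c\<^sup>2) (c\<^sup>2 / k)) * ?Y" by (intro mult_right_mono ennreal_leI) auto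
  finally show "?X <= ennreal (max (k * c\<^sup>2) (c\<^sup>2 / k)) * ?Y" .
 qed
qed

text \<open>Convolution with a sufficiently decaying kernel; the decay needed depends on the exponents
 because a quasi-norm is only \<open>r\<close>-subadditive.\<close>

lemma lat_norm_smear:
 fixes \<omega> \<mu> :: "real^'d => real"
 assumes s: "0 < \<alpha>" "0 < \<beta>" and p: "0 < p" "0 < q" and w: "moderate L \<omega>" "moderate L' \<mu>"
 obtains N0 C where "0 < C" "!!N a h. N0 <= N ==>
  (\<forall>k n. h (k, n) <= (\<integral>\<^sup>+v. a (k - fst v, n - snd v) *
   ennreal (decay N (lpt \<alpha> (fst v)) * decay N (lpt \<beta> (snd v))) \<partial>count_space UNIV)) ==>
  lat_norm \<alpha> \<beta> p q \<omega> \<mu> h <= ennreal C * lat_norm \<alpha> \<beta> p q \<omega> \<mu> a"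
proof -
 obtain R1 where R1: "0 < (R1::nat)" "!!R'. R1 <= R' ==> ennreal (1 / real R') <= p"
  using exponent_reciprocal[OF p(1)] by blast
 obtain R2 where R2: "0 < (R2::nat)" "!!R'. R2 <= R' ==> ennreal (1 / real R') <= q"
  using exponent_reciprocal[OF p(2)] by blast
 define R where "R = max R1 R2"
 define r where "r = 1 / real R"
 have R: "0 < R" and r: "0 < r" "r <= 1" "ennreal r <= p" "ennreal r <= q"
  using R1 R2 by (auto simp: R_def r_def)
 define M where "M = 2 * CARD('d)"
 obtain T where T: "0 < T" "!!S (y :: real^'d) (\<eta> :: real^'d). finite S ==>
   (\<Sum>w\<in>S. decay M (y - lpt \<alpha> (fst w)) * decay M (\<eta> - lpt \<beta> (snd w))) <= T"
  by (rule lattice_decay_sum_pair[OF s, where M = M and 'd = 'd]) (auto simp: M_def intro: that)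
 define k :: "(int^'d) \<times> (int^'d) => ennreal" where
  "k = (%v. ennreal (decay M (lpt \<alpha> (fst v)) * decay M (lpt \<beta> (snd v))))"
 have kT: "(\<integral>\<^sup>+v. k v \<partial>count_space UNIV) <= ennreal T"
  unfolding sums_exhaust
 proof (rule SUP_least)
  fix n
  have "(\<Sum>v\<in>exhaust n. k v) = ennreal (\<Sum>w\<in>(exhaust n :: ((int^'d) \<times> (int^'d)) set). decay M (0 - lpt \<alpha> (fst w)) * decay M (0 - lpt \<beta> (snd w)))"
   by (simp add: k_def sum_ennreal)
  also have "... <= ennreal T" by (intro ennreal_leI T) simp
  finally show "(\<Sum>v\<in>exhaust n. k v) <= ennreal T" .
 qed
 define \<nu> where "\<nu> = (%k n :: int^'d. ennreal (\<omega> (lpt \<alpha> k) * \<mu> (lpt \<beta> n)))"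
 have lat: "lattice_pt (k - l) = lattice_pt k - lattice_pt l" for k l :: "int^'d"
  by (simp add: lattice_pt_def vec_eq_iff)
 have nn: "0 <= \<omega> x" "0 <= \<mu> x" for x using w by (auto simp: moderate_def)
 have \<nu>: "\<nu> k n <= ennreal ((1 + norm (lpt \<alpha> i)) ^ L * (1 + norm (lpt \<beta> j)) ^ L') * \<nu> (k - i) (n - j)" for k n i j
 proof -
  have "\<omega> (lpt \<alpha> k) * \<mu> (lpt \<beta> n) <= ((1 + norm (lpt \<alpha> i)) ^ L * \<omega> (lpt \<alpha> (k - i)))
   * ((1 + norm (lpt \<beta> j)) ^ L' * \<mu> (lpt \<beta> (n - j)))"
   using moderate_add_le[OF w(1), of "lpt \<alpha> i" "lpt \<alpha> (k - i)"]
    moderate_add_le[OF w(2), of "lpt \<beta> j" "lpt \<beta> (n - j)"] nn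
   by (intro mult_mono) (auto simp: lat scaleR_diff_right)
  also have "... = ((1 + norm (lpt \<alpha> i)) ^ L * (1 + norm (lpt \<beta> j)) ^ L') * (\<omega> (lpt \<alpha> (k - i)) * \<mu> (lpt \<beta> (n - j)))"
   by algebra
  finally show ?thesis unfolding \<nu>_def using nn by (subst ennreal_mult'[symmetric]) (auto intro!: ennreal_leI)
 qed
 define C where "C = T powr (1 / r)"
 \<comment> \<open>In this threshold \<open>max L L'\<close> pays for moving the weights, and R * M
   leaves decay of order M after r-th powers.\<close>
 show thesis
 proof (rule that[of C "max L L' + R * M"])
  show "0 < C" using T by (simp add: C_def)
  fix N and a h :: "(int^'d) \<times> (int^'d) => ennreal"
  assume N: "max L L' + R * M <= N" and h0: "\<forall>k n. h (k, n) <= (\<integral>\<^sup>+v. a (k - fst v, n - snd v) *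
   ennreal (decay N (lpt \<alpha> (fst v)) * decay N (lpt \<beta> (snd v))) \<partial>count_space UNIV)"
  note h = h0[rule_format]
  let ?g = "%v :: (int^'d) \<times> (int^'d). ennreal ((1 + norm (lpt \<alpha> (fst v))) ^ L * decay N (lpt \<alpha> (fst v))) * ennreal ((1 + norm (lpt \<beta> (snd v))) ^ L' * decay N (lpt \<beta> (snd v)))"
  define b where "b = (%k n. a (k, n) * \<nu> k n)"
  have dec: "epowr (ennreal ((1 + norm x) ^ K * decay N x)) r <= ennreal (decay M x)"
   if "K <= max L L'" for K and x :: "real^'d"
  proof -
   have "(1 + norm x) ^ K * decay N x <= (1 + norm x) ^ K * decay (K + R * M) x"
    using N that by (intro mult_left_mono decay_antimono) auto
   also have "... = decay (R * M) x" by (simp add: decay_add mult.assoc[symmetric])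
   finally have "((1 + norm x) ^ K * decay N x) powr r <= decay (R * M) x powr r"
    using r by (intro powr_mono2) auto
   then show ?thesis using decay_powr[OF R, of M x] by (simp add: epowr_ennreal r_def ennreal_leI)
  qed
  have le: "epowr (h (k', n) * \<nu> k' n) r <= (\<integral>\<^sup>+v. epowr (b (k' - fst v) (n - snd v)) r * k v \<partial>count_space UNIV)" for k' n
  proof -
   have "h (k', n) * \<nu> k' n <= (\<integral>\<^sup>+v. a (k' - fst v, n - snd v) *
    ennreal (decay N (lpt \<alpha> (fst v)) * decay N (lpt \<beta> (snd v))) * \<nu> k' n \<partial>count_space UNIV)"
    using mult_right_mono[OF h] by (simp add: nn_integral_multc[symmetric])
   also have "... <= (\<integral>\<^sup>+v. b (k' - fst v) (n - snd v) * ?g v \<partial>count_space UNIV)"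
   proof (rule nn_integral_mono)
    fix v :: "(int^'d) \<times> (int^'d)"
    show "a (k' - fst v, n - snd v) * ennreal (decay N (lpt \<alpha> (fst v)) * decay N (lpt \<beta> (snd v))) * \<nu> k' n
     <= b (k' - fst v) (n - snd v) * ?g v"
     using mult_left_mono[OF \<nu>[of k' n "fst v" "snd v"], of "a (k' - fst v, n - snd v) * ennreal (decay N (lpt \<alpha> (fst v)) * decay N (lpt \<beta> (snd v)))"]
     by (simp add: b_def ennreal_mult' mult_ac)
   qed
   finally have "epowr (h (k', n) * \<nu> k' n) r <= epowr (\<integral>\<^sup>+v. b (k' - fst v) (n - snd v) * ?g v \<partial>count_space UNIV) r"
    by (rule epowr_mono[OF r(1)])
   also note epowr_nn_integral_count_le[OF r(1,2)]
   also have "(\<integral>\<^sup>+v. epowr (b (k' - fst v) (n - snd v) * ?g v) r \<partial>count_space UNIV)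
    <= (\<integral>\<^sup>+v. epowr (b (k' - fst v) (n - snd v)) r * k v \<partial>count_space UNIV)"
    unfolding epowr_mult[OF r(1)] k_def
    by (intro nn_integral_mono mult_left_mono order_trans[OF mult_mono[OF dec dec]]) (simp_all add: ennreal_mult')
   finally show ?thesis .
  qed
  have meas: "g \<in> borel_measurable (count_space UNIV \<Otimes>\<^sub>M count_space UNIV)" for g :: "(int^'d) \<times> (int^'d) => ennreal"
   by (simp add: pair_measure_countable)
  have meas3: "g \<in> borel_measurable (count_space UNIV \<Otimes>\<^sub>M count_space UNIV \<Otimes>\<^sub>M count_space UNIV)"
   for g :: "(int^'d) \<times> (int^'d) \<times> (int^'d) \<times> (int^'d) => ennreal"
   by (simp add: pair_measure_countable)
  have lat_eq: "lat_norm \<alpha> \<beta> p q \<omega> \<mu> g = mixed_norm p q (count_space UNIV) (count_space UNIV) (%k n. g (k, n) * \<nu> k n)" for g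
   by (simp add: lat_norm_def mixed_norm_def \<nu>_def)
  have shift: "mixed_norm p q (count_space UNIV) (count_space UNIV) (%k n. b (k - fst v) (n - snd v))
   = mixed_norm p q (count_space UNIV) (count_space UNIV) b" for v
  proof -
   have bij: "bij (%x :: int^'d. x - s)" for s
    by (rule bij_betw_byWitness[where f' = "%x. x + s"]) auto
   have "mixed_norm p q (count_space UNIV) (count_space UNIV) (%k n. b (k - fst v) (n - snd v))
    = lp q (%n. lp p (%k. b k (n - snd v)))"
    unfolding mixed_norm_def by (subst lp_bij[OF bij p(1), of "%k. b k _"]) simp
   also have "... = mixed_norm p q (count_space UNIV) (count_space UNIV) b"
    unfolding mixed_norm_def by (rule lp_bij[OF bij p(2), of "%n. lp p (%k. b k n)"])
   finally show ?thesis .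
  qed
  have "epowr (lat_norm \<alpha> \<beta> p q \<omega> \<mu> h) r <= (\<integral>\<^sup>+v. epowr (mixed_norm p q (count_space UNIV) (count_space UNIV) (%k n. b (k - fst v) (n - snd v))) r * k v \<partial>count_space UNIV)"
   unfolding lat_eq
   by (rule mixed_Minkowski_epowr[where h = "%x y u. b (x - fst u) (y - snd u)" and r = r and k = k])
    (use r le in \<open>auto simp: meas meas3\<close>)
  also have "... = epowr (lat_norm \<alpha> \<beta> p q \<omega> \<mu> a) r * (\<integral>\<^sup>+v. k v \<partial>count_space UNIV)"
   unfolding shift by (simp add: nn_integral_cmult lat_eq b_def)
  also have "... <= epowr (lat_norm \<alpha> \<beta> p q \<omega> \<mu> a) r * epowr (ennreal C) r"
   using kT T r by (intro mult_left_mono) (auto simp: epowr_ennreal C_def powr_powr)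
  also have "... = epowr (ennreal C * lat_norm \<alpha> \<beta> p q \<omega> \<mu> a) r" by (simp add: epowr_mult[OF r(1)] mult.commute)
  finally show "lat_norm \<alpha> \<beta> p q \<omega> \<mu> h <= ennreal C * lat_norm \<alpha> \<beta> p q \<omega> \<mu> a" using epowr_le_iff[OF r(1)] by blast
 qed
qed

lemma stft0_sum:
 fixes u :: "'i => 'a::euclidean_space => complex"
 assumes "finite S" "!!v. v \<in> S ==> integrable lborel (u v)" "rapid \<phi>"
 shows "stft0 \<phi> (%t. \<Sum>v\<in>S. c v * u v t) x \<xi> = (\<Sum>v\<in>S. c v * stft0 \<phi> (u v) x \<xi>)"
proof -
 obtain B where B: "!!t. norm (\<phi> t) <= B" using rapid_bounded[OF assms(3)] by blast
 have [measurable]: "\<phi> \<in> borel_measurable borel" by (rule rapid_measurable[OF assms(3)])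
 have int: "integrable lborel (%t. u v t * cnj (\<phi> (t - x)) * cis (- 2 * pi * (t \<bullet> \<xi>)))" if "v \<in> S" for v
 proof (rule Bochner_Integration.integrable_bound)
  show "integrable lborel (%t. B * norm (u v t))" using assms(2)[OF that] by simp
  have [measurable]: "u v \<in> borel_measurable lborel" using assms(2)[OF that] by auto
  show "(%t. u v t * cnj (\<phi> (t - x)) * cis (- 2 * pi * (t \<bullet> \<xi>))) \<in> borel_measurable lborel" by measurable
  show "AE t in lborel. norm (u v t * cnj (\<phi> (t - x)) * cis (- 2 * pi * (t \<bullet> \<xi>))) <= norm (B * norm (u v t))"
  proof (rule AE_I2)
   fix t
   have "norm (u v t) * norm (\<phi> (t - x)) <= norm (u v t) * B" by (intro mult_left_mono B) simp
   also have "... <= norm (B * norm (u v t))" by (simp add: mult.commute)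
   finally show "norm (u v t * cnj (\<phi> (t - x)) * cis (- 2 * pi * (t \<bullet> \<xi>))) <= norm (B * norm (u v t))"
    by (simp add: norm_mult)
  qed
 qed
 show ?thesis
  unfolding stft0_def fourier_def sum_distrib_right mult.assoc
  by (subst Bochner_Integration.integral_sum) (use int in \<open>auto simp: mult.assoc\<close>)
qed

lemma lattice_pt_diff: "lattice_pt (k - l) = lattice_pt k - lattice_pt l"
 by (simp add: lattice_pt_def vec_eq_iff)

lemma norm_lattice_pt_ge: "k \<noteq> 0 ==> 1 <= norm (lattice_pt k)"
proof -
 assume "k \<noteq> 0"
 then obtain i where "k $ i \<noteq> 0" by (auto simp: vec_eq_iff)
 then have "1 <= \<bar>lattice_pt k $ i\<bar>" by (simp add: lattice_pt_def)
 then show ?thesis using component_le_norm_cart[of "lattice_pt k" i] by linarith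
qed

text \<open>A lattice of Gabor atoms with coefficients \<open>H\<close>. Since \<open>H\<close> varies moderately while the
 correlations of the atoms decay rapidly, the diagonal term dominates once the lattice is sparse.\<close>

lemma gabor_sum:
 obtains \<Lambda> c where "1 <= (\<Lambda> :: real)" "0 < c"
  "!!(H :: real^'d => real^'d => real) S. bimoderate N H ==> finite S ==>
   \<exists>f\<in>schwartz. (\<forall>v\<in>S. c * H (lpt \<Lambda> (fst v)) (lpt \<Lambda> (snd v))
     <= norm (VG f (lpt \<Lambda> (fst v)) (lpt \<Lambda> (snd v)))) \<and>
    (\<forall>y \<eta>. c * norm (VG f y \<eta>) <= H y \<eta>)"
proof -
 define M where "M = 2 * CARD('d)"
 \<comment> \<open>N orders of decay cancel the variation of H, M make the sums converge, and the
   extra one supplies the factor 1 / (1 + \<Lambda>) between distinct lattice points.\<close>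
 obtain V where V: "0 <= V" "!!x \<xi> :: real^'d. norm (VG (gauss 0 0) x \<xi>) <= V * (decay (N + (M + 1)) x * decay (N + (M + 1)) \<xi>)"
  using stft0_decay[OF gauss_schwartz gauss_schwartz, of 0 0 0 0 "N + (M + 1)"] by blast
 define c0 where "c0 = 1 / sqrt 2 ^ CARD('d)"
 have c0: "0 < c0" by (simp add: c0_def)
 obtain T where T: "0 < T" "!!S (y :: real^'d) (\<eta> :: real^'d). finite S ==>
   (\<Sum>w\<in>S. decay M (y - lpt 1 (fst w)) * decay M (\<eta> - lpt 1 (snd w))) <= T"
  by (rule lattice_decay_sum_pair[where c = 1 and c' = 1 and M = M and 'd = 'd]) (auto simp: M_def intro: that)
 \<comment> \<open>Chosen so that the off-diagonal sum, at most V * T / (1 + \<Lambda>) times the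
   coefficient, is at most half of the diagonal term \<open>c0\<close>.\<close>
 define \<Lambda> where "\<Lambda> = max 1 (2 * V * T / c0)"
 have \<Lambda>: "1 <= \<Lambda>" by (simp add: \<Lambda>_def)
 have "2 * V * T / c0 <= 1 + \<Lambda>" by (simp add: \<Lambda>_def)
 then have VT: "V * T / (1 + \<Lambda>) <= c0 / 2" using c0 \<Lambda> by (simp add: field_simps)
 obtain T' where T': "0 < T'" "!!S (y :: real^'d) (\<eta> :: real^'d). finite S ==>
   (\<Sum>w\<in>S. decay M (y - lpt \<Lambda> (fst w)) * decay M (\<eta> - lpt \<Lambda> (snd w))) <= T'"
  by (rule lattice_decay_sum_pair[where c = \<Lambda> and c' = \<Lambda> and M = M and 'd = 'd])
   (use \<Lambda> in \<open>auto simp: M_def intro: that\<close>)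
 \<comment> \<open>The first entry serves the lower bound at the lattice points, the second the
   upper bound by H.\<close>
 define c where "c = min (c0 / 2) (inverse (V * T' + 1))"
 have VT': "0 < V * T' + 1" using V T' by (intro add_nonneg_pos) auto
 have c: "0 < c" "c <= c0 / 2" "c * (V * T') <= 1"
 proof -
  show "0 < c" "c <= c0 / 2" using c0 VT' by (auto simp: c_def)
  have "c * (V * T') <= inverse (V * T' + 1) * (V * T')" using V T' by (intro mult_right_mono) (auto simp: c_def)
  also have "... <= 1" using VT' by (simp add: field_simps)
  finally show "c * (V * T') <= 1" .
 qed
 show thesis
 proof (rule that[OF \<Lambda> c(1)])
  fix H :: "real^'d => real^'d => real" and S :: "((int^'d) \<times> (int^'d)) set"
  assume H: "bimoderate N H" and S: "finite S"
  define P :: "int^'d => real^'d" where "P = (%k. lpt \<Lambda> k)"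
  define g where "g = (%v. gauss (P (fst v)) (P (snd v)))"
  define h where "h = (%v. H (P (fst v)) (P (snd v)))"
  define f where "f = (%t. \<Sum>v\<in>S. of_real (h v) * g v t)"
  have nn: "0 <= H y \<eta>" "0 <= h v" for y \<eta> v using H by (auto simp: bimoderate_def h_def)
  have g: "g v \<in> schwartz" for v by (simp add: g_def gauss_schwartz)
  have VGf: "VG f y \<eta> = (\<Sum>v\<in>S. of_real (h v) * VG (g v) y \<eta>)" for y \<eta>
   unfolding f_def using g S by (intro stft0_sum) (auto intro: rapid_integrable schwartz_rapid schwartz_rapid[OF gauss_schwartz])
  have tm: "h v * norm (VG (g v) y \<eta>) <= V * H y \<eta> * (decay (M + 1) (y - P (fst v)) * decay (M + 1) (\<eta> - P (snd v)))"
   for v y \<eta>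
  proof -
   let ?a = "y - P (fst v)" and ?b = "\<eta> - P (snd v)"
   have "h v <= ((1 + norm ?a) ^ N * (1 + norm ?b) ^ N) * H y \<eta>"
    using H by (auto simp: bimoderate_def h_def)
   moreover have "norm (VG (g v) y \<eta>) <= V * (decay (N + (M + 1)) ?a * decay (N + (M + 1)) ?b)"
    unfolding g_def by (subst norm_stft0_gauss) (rule V)
   ultimately have "h v * norm (VG (g v) y \<eta>) <= (((1 + norm ?a) ^ N * (1 + norm ?b) ^ N) * H y \<eta>) * (V * (decay (N + (M + 1)) ?a * decay (N + (M + 1)) ?b))"
    using nn by (intro mult_mono) auto
   also have "... = V * H y \<eta> * (((1 + norm ?a) ^ N * decay N ?a) * decay (M + 1) ?a * (((1 + norm ?b) ^ N * decay N ?b) * decay (M + 1) ?b))"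
    unfolding decay_add[of N "M + 1"] by algebra
   also have "... = V * H y \<eta> * (decay (M + 1) ?a * decay (M + 1) ?b)" by simp
   finally show ?thesis .
  qed
  show "\<exists>f\<in>schwartz. (\<forall>v\<in>S. c * H (lpt \<Lambda> (fst v)) (lpt \<Lambda> (snd v))
     <= norm (VG f (lpt \<Lambda> (fst v)) (lpt \<Lambda> (snd v)))) \<and> (\<forall>y \<eta>. c * norm (VG f y \<eta>) <= H y \<eta>)"
  proof (intro bexI[of _ f] conjI ballI allI)
   show "f \<in> schwartz" unfolding f_def by (intro schwartz_sum schwartz_cmult g S)
  next
   fix y \<eta>
   have "norm (VG f y \<eta>) <= (\<Sum>v\<in>S. h v * norm (VG (g v) y \<eta>))"
    unfolding VGf using nn by (intro order_trans[OF norm_sum] sum_mono) (simp add: norm_mult)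
   also have "... <= (\<Sum>v\<in>S. V * H y \<eta> * (decay M (y - P (fst v)) * decay M (\<eta> - P (snd v))))"
    using nn V by (intro sum_mono order_trans[OF tm] mult_left_mono mult_mono decay_antimono) auto
   also have "... = V * H y \<eta> * (\<Sum>v\<in>S. decay M (y - P (fst v)) * decay M (\<eta> - P (snd v)))"
    by (rule sum_distrib_left[symmetric])
   also have "... <= V * H y \<eta> * T'"
    using nn V unfolding P_def by (intro mult_left_mono T' S) auto
   finally have "c * norm (VG f y \<eta>) <= c * (V * H y \<eta> * T')" using c by (intro mult_left_mono) auto
   also have "... = (c * (V * T')) * H y \<eta>" by algebra
   also have "... <= 1 * H y \<eta>" using nn c by (intro mult_right_mono) auto
   finally show "c * norm (VG f y \<eta>) <= H y \<eta>" by simp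
  next
   fix v0 assume v0: "v0 \<in> S"
   let ?y = "P (fst v0)" and ?\<eta> = "P (snd v0)"
   \<comment> \<open>Distinct indices differ in some component, where the points have distance at
     least \<Lambda>. As \<Lambda> >= 1, the remaining decay is compared with the unit lattice, so
     that \<open>T\<close> does not depend on \<Lambda> and the choice of \<Lambda> is not
     circular.\<close>
   have off: "decay (M + 1) (?y - P (fst v)) * decay (M + 1) (?\<eta> - P (snd v))
    <= (decay M (lattice_pt (fst v0) - lpt 1 (fst v)) * decay M (lattice_pt (snd v0) - lpt 1 (snd v))) / (1 + \<Lambda>)"
    if "v \<noteq> v0" for v
   proof -
    have eq: "P k - P l = lpt \<Lambda> (k - l)" for k l
     by (simp add: P_def lattice_pt_diff scaleR_diff_right)
    have le: "decay M (P k - P l) <= decay M (lattice_pt k - lpt 1 l)" for k l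
    proof -
     have "norm (lattice_pt (k - l)) <= norm (P k - P l)"
      unfolding eq using \<Lambda> mult_right_mono[of 1 \<Lambda> "norm (lattice_pt (k - l))"] by simp
     then show ?thesis unfolding decay_def lattice_pt_diff
      by (intro le_imp_inverse_le power_mono zero_less_power) (auto simp: add_pos_nonneg)
    qed
    have d1: "decay 1 (P k - P l) <= 1 / (1 + \<Lambda>)" if "k \<noteq> l" for k l
    proof -
     have "1 <= norm (lattice_pt (k - l))" using that by (intro norm_lattice_pt_ge) simp
     then have "\<Lambda> <= norm (P k - P l)" unfolding eq using \<Lambda> mult_left_mono[of 1 "norm (lattice_pt (k - l))" \<Lambda>] by simp
     then show ?thesis using \<Lambda> by (simp add: decay_def inverse_eq_divide frac_le)
    qed
    have "decay 1 (?y - P (fst v)) * decay 1 (?\<eta> - P (snd v)) <= 1 / (1 + \<Lambda>)"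
    proof (cases "fst v0 = fst v")
     case True
     then have "snd v0 \<noteq> snd v" using that by (metis prod_eqI)
     from mult_mono[OF decay_le_1 d1[OF this]] show ?thesis by simp
    next
     case False
     from mult_mono[OF d1[OF this] decay_le_1] show ?thesis using \<Lambda> by simp
    qed
    then have "(decay M (?y - P (fst v)) * decay M (?\<eta> - P (snd v))) * (decay 1 (?y - P (fst v)) * decay 1 (?\<eta> - P (snd v)))
     <= (decay M (lattice_pt (fst v0) - lpt 1 (fst v)) * decay M (lattice_pt (snd v0) - lpt 1 (snd v))) * (1 / (1 + \<Lambda>))"
     by (intro mult_mono le) auto
    then show ?thesis unfolding decay_add[of M 1] by (simp add: mult_ac)
   qed
   have "(\<Sum>v\<in>S - {v0}. h v * norm (VG (g v) ?y ?\<eta>)) <= (\<Sum>v\<in>S - {v0}. V * h v0 *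
    ((decay M (lattice_pt (fst v0) - lpt 1 (fst v)) * decay M (lattice_pt (snd v0) - lpt 1 (snd v))) / (1 + \<Lambda>)))"
   proof (rule sum_mono)
    fix v assume "v \<in> S - {v0}"
    then have v: "v \<noteq> v0" by blast
    have h0: "h v0 = H ?y ?\<eta>" by (simp add: h_def)
    show "h v * norm (VG (g v) ?y ?\<eta>) <= V * h v0 *
    ((decay M (lattice_pt (fst v0) - lpt 1 (fst v)) * decay M (lattice_pt (snd v0) - lpt 1 (snd v))) / (1 + \<Lambda>))"
     unfolding h0 by (rule order_trans[OF tm mult_left_mono[OF off[OF v]]]) (use nn V in simp)
   qed
   also have "... = V * h v0 * ((\<Sum>v\<in>S - {v0}. decay M (lattice_pt (fst v0) - lpt 1 (fst v)) * decay M (lattice_pt (snd v0) - lpt 1 (snd v))) / (1 + \<Lambda>))"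
    by (simp add: sum_distrib_left sum_divide_distrib)
   also have "... <= V * h v0 * (T / (1 + \<Lambda>))"
    using nn V \<Lambda> S by (intro mult_left_mono divide_right_mono T) auto
   also have "... = h v0 * (V * T / (1 + \<Lambda>))" by simp
   also have "... <= h v0 * (c0 / 2)" by (rule mult_left_mono[OF VT nn(2)])
   finally have offsum: "(\<Sum>v\<in>S - {v0}. h v * norm (VG (g v) ?y ?\<eta>)) <= h v0 * (c0 / 2)" .
   have diag: "norm (VG (g v0) ?y ?\<eta>) = c0"
    unfolding g_def by (subst norm_stft0_gauss) (simp add: stft0_gauss_0 c0_def norm_divide norm_power)
   have eqf: "VG f ?y ?\<eta> = of_real (h v0) * VG (g v0) ?y ?\<eta> + (\<Sum>v\<in>S - {v0}. of_real (h v) * VG (g v) ?y ?\<eta>)"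
    unfolding VGf using S v0 by (simp add: sum.remove)
   have "norm (of_real (h v0) * VG (g v0) ?y ?\<eta>) - norm (\<Sum>v\<in>S - {v0}. of_real (h v) * VG (g v) ?y ?\<eta>) <= norm (VG f ?y ?\<eta>)"
    unfolding eqf by (rule norm_diff_ineq)
   moreover have "norm (\<Sum>v\<in>S - {v0}. of_real (h v) * VG (g v) ?y ?\<eta>) <= (\<Sum>v\<in>S - {v0}. h v * norm (VG (g v) ?y ?\<eta>))"
    using nn by (intro order_trans[OF norm_sum] sum_mono) (simp add: norm_mult)
   moreover have "norm (of_real (h v0) * VG (g v0) ?y ?\<eta>) = h v0 * c0" using nn by (simp add: norm_mult diag)
   moreover have "c * h v0 <= h v0 * c0 - h v0 * (c0 / 2)" using mult_right_mono[OF c(2) nn(2)[of v0]] by (simp add: algebra_simps)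
   ultimately have "c * h v0 <= norm (VG f ?y ?\<eta>)" using offsum by linarith
   then show "c * H (lpt \<Lambda> (fst v0)) (lpt \<Lambda> (snd v0)) <= norm (VG f (lpt \<Lambda> (fst v0)) (lpt \<Lambda> (snd v0)))"
    by (simp add: h_def P_def)
  qed
 qed
qed

lemma lat_norm_mono:
 assumes "0 < p" "0 < q" "!!w. a w <= b w"
 shows "lat_norm \<alpha> \<beta> p q \<omega> \<mu> a <= lat_norm \<alpha> \<beta> p q \<omega> \<mu> b"
 unfolding lat_norm_def by (intro lp_mono mult_right_mono assms) auto

lemma lat_norm_cmult:
 assumes "0 < p" "0 < q"
 shows "lat_norm \<alpha> \<beta> p q \<omega> \<mu> (%w. c * a w) = c * lat_norm \<alpha> \<beta> p q \<omega> \<mu> a"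
 unfolding lat_norm_def by (simp add: lp_cmult assms mult.assoc)

lemma bimoderate_mono:
 "bimoderate N H ==> norm (x - x') <= D ==> norm (\<xi> - \<xi>') <= D' ==> H x' \<xi>' <= ((1 + D) ^ N * (1 + D') ^ N) * H x \<xi>"
 unfolding bimoderate_def
 by (rule order_trans[of _ "((1 + norm (x - x')) ^ N * (1 + norm (\<xi> - \<xi>')) ^ N) * H x \<xi>"])
  (auto intro!: mult_mono power_mono simp: add_nonneg_nonneg order_trans[OF norm_ge_zero])

lemma bimoderate_cmult: "bimoderate N H ==> 0 <= c ==> bimoderate N (%x \<xi>. c * H x \<xi>)"
 unfolding bimoderate_def
proof (elim conjE, intro conjI allI)
 fix x x' \<xi> \<xi>'
 assume "0 <= c" "\<forall>x \<xi> x' \<xi>'. H x' \<xi>' <= ((1 + norm (x - x')) ^ N * (1 + norm (\<xi> - \<xi>')) ^ N) * H x \<xi>"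
 then have "c * H x' \<xi>' <= c * (((1 + norm (x - x')) ^ N * (1 + norm (\<xi> - \<xi>')) ^ N) * H x \<xi>)"
  by (intro mult_left_mono) auto
 then show "c * H x' \<xi>' <= ((1 + norm (x - x')) ^ N * (1 + norm (\<xi> - \<xi>')) ^ N) * (c * H x \<xi>)"
  by (simp only: mult.left_commute[of c])
qed simp

lemma bimoderate_sum:
 assumes "!!w. w \<in> A ==> bimoderate N (H w)"
 shows "bimoderate N (%x \<xi>. \<Sum>w\<in>A. H w x \<xi>)"
 using assms unfolding bimoderate_def sum_distrib_left by (auto intro!: sum_nonneg sum_mono)

lemma bimoderate_decay: "bimoderate N (%x \<xi>. decay N (x - s) * decay N (\<xi> - t))"
 unfolding bimoderate_def
proof (intro conjI allI)
 fix x x' :: 'a and \<xi> \<xi>' :: 'b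
 have "decay N (x' - s) * decay N (\<xi>' - t) <= ((1 + norm (x - x')) ^ N * decay N (x - s)) * ((1 + norm (\<xi> - \<xi>')) ^ N * decay N (\<xi> - t))"
  using moderateD(2)[OF moderate_decay, of _ "x' - s" "x - s"] moderateD(2)[OF moderate_decay, of _ "\<xi>' - t" "\<xi> - t"]
  by (intro mult_mono) auto
 then show "decay N (x' - s) * decay N (\<xi>' - t) <= ((1 + norm (x - x')) ^ N * (1 + norm (\<xi> - \<xi>')) ^ N) * (decay N (x - s) * decay N (\<xi> - t))"
  by (simp add: mult_ac)
qed simp

text \<open>The sequence is smeared into a slowly varying H, whose values on a sparse lattice are
  the coefficients of Gabor atoms. Every point of the original lattice is close to a sparse one, so
  the maximal function dominates the sequence there; the upper bound by H and
  \<open>lat_norm_smear\<close> control the norm.\<close>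

lemma test_function:
 fixes \<omega> \<mu> :: "real^'d => real"
 assumes s: "0 < \<alpha>" "0 < \<beta>" and p: "0 < p" "0 < q" and w: "moderate L \<omega>" "moderate L' \<mu>"
 obtains N0 where "!!N. N0 <= N ==> \<exists>C>0. \<forall>a :: (int^'d) \<times> (int^'d) => real. finite {w. a w \<noteq> 0} \<longrightarrow> (\<forall>w. 0 <= a w) \<longrightarrow>
  (\<exists>f\<in>schwartz. (\<forall>w. a w <= peetre N (VG f) (lpt \<alpha> (fst w)) (lpt \<beta> (snd w))) \<and>
   peetre_norm N p q \<omega> \<mu> (VG f) <= ennreal C * lat_norm \<alpha> \<beta> p q \<omega> \<mu> (%w. ennreal (a w)))"
proof -
 obtain N0 C1 where C1: "0 < C1" and smear: "!!N a h. N0 <= N ==>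
  (\<forall>k n. h (k, n) <= (\<integral>\<^sup>+v. a (k - fst v, n - snd v) *
   ennreal (decay N (lpt \<alpha> (fst v)) * decay N (lpt \<beta> (snd v))) \<partial>count_space UNIV)) ==>
  lat_norm \<alpha> \<beta> p q \<omega> \<mu> h <= ennreal C1 * lat_norm \<alpha> \<beta> p q \<omega> \<mu> a"
  by (rule lat_norm_smear[OF s p w]) (rule that; assumption)
 show thesis
 proof (rule that)
  fix N assume N: "N0 <= N"
  obtain \<Lambda> c where \<Lambda>: "1 <= (\<Lambda> :: real)" and c: "0 < c" and gabor:
   "!!(H :: real^'d => real^'d => real) S. bimoderate N H ==> finite S ==>
   \<exists>f\<in>schwartz. (\<forall>v\<in>S. c * H (lpt \<Lambda> (fst v)) (lpt \<Lambda> (snd v))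
     <= norm (VG f (lpt \<Lambda> (fst v)) (lpt \<Lambda> (snd v)))) \<and>
    (\<forall>y \<eta>. c * norm (VG f y \<eta>) <= H y \<eta>)"
   by (rule gabor_sum) (rule that; assumption)
  obtain C2 where C2: "0 < C2" and samp: "!!H. bimoderate N H ==>
   mixed_norm p q lborel lborel (%x y. ennreal (H x y * (\<omega> x * \<mu> y)))
   <= ennreal C2 * lat_norm \<alpha> \<beta> p q \<omega> \<mu> (%w. ennreal (H (lpt \<alpha> (fst w)) (lpt \<beta> (snd w))))"
   by (rule sampled_norm[OF s p w]) (rule that; assumption)
  define D where "D = \<Lambda> * real CARD('d)"
  define J where "J = (1 + D) ^ N * (1 + D) ^ N"
  have J: "0 < J" "0 <= D" using \<Lambda> by (auto simp: J_def D_def add_pos_nonneg)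
  obtain cell where cell: "!!x :: real^'d. norm (x - lpt \<Lambda> (cell x)) <= D"
   using sampling_lattice[of \<Lambda>, where 'd = 'd] \<Lambda> unfolding sampling_def D_def by auto
  \<comment> \<open>One J is lost in moving H to a nearby sparse point, another in moving the
    maximal function back; c is the constant of the Gabor sum.\<close>
  define \<kappa> where "\<kappa> = J * J / c"
  have \<kappa>: "0 < \<kappa>" using J c by (simp add: \<kappa>_def)
  show "\<exists>C>0. \<forall>a :: (int^'d) \<times> (int^'d) => real. finite {w. a w \<noteq> 0} \<longrightarrow> (\<forall>w. 0 <= a w) \<longrightarrow>
   (\<exists>f\<in>schwartz. (\<forall>w. a w <= peetre N (VG f) (lpt \<alpha> (fst w)) (lpt \<beta> (snd w))) \<and>
    peetre_norm N p q \<omega> \<mu> (VG f) <= ennreal C * lat_norm \<alpha> \<beta> p q \<omega> \<mu> (%w. ennreal (a w)))"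
  proof (intro exI[of _ "C2 * (\<kappa> / c) * C1"] conjI allI impI)
   show "0 < C2 * (\<kappa> / c) * C1" using C1 C2 \<kappa> c by simp
   fix a :: "(int^'d) \<times> (int^'d) => real" assume fin: "finite {w. a w \<noteq> 0}" and "\<forall>w. 0 <= a w"
   then have a: "0 <= a w" for w by blast
   define A where "A = {w. a w \<noteq> 0}"
   define x where "x = (%w :: (int^'d) \<times> (int^'d). lpt \<alpha> (fst w))"
   define \<xi> where "\<xi> = (%w :: (int^'d) \<times> (int^'d). lpt \<beta> (snd w))"
   define H where "H = (%y \<eta>. \<Sum>w\<in>A. a w * (decay N (y - x w) * decay N (\<eta> - \<xi> w)))"
   have H: "bimoderate N H" unfolding H_def using a by (intro bimoderate_sum bimoderate_cmult bimoderate_decay)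
   have aH: "a w <= H (x w) (\<xi> w)" for w
   proof (cases "w \<in> A")
    case True
    have "a w * (decay N (x w - x w) * decay N (\<xi> w - \<xi> w)) <= H (x w) (\<xi> w)"
     unfolding H_def using True fin a
     by (intro member_le_sum[of w A "%v. a v * (decay N (x w - x v) * decay N (\<xi> w - \<xi> v))"]) (auto simp: A_def)
    then show ?thesis by simp
   next
    case False
    then show ?thesis using H by (simp add: A_def bimoderate_def)
   qed
   define v where "v = (%w. (cell (x w), cell (\<xi> w)))"
   obtain f where f: "f \<in> schwartz" and lower: "!!u. u \<in> v ` A ==> c * (\<kappa> * H (lpt \<Lambda> (fst u)) (lpt \<Lambda> (snd u)))
     <= norm (VG f (lpt \<Lambda> (fst u)) (lpt \<Lambda> (snd u)))"
    and upper: "!!y \<eta>. c * norm (VG f y \<eta>) <= \<kappa> * H y \<eta>"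
    using gabor[OF bimoderate_cmult[OF H less_imp_le[OF \<kappa>]] finite_imageI[OF fin[folded A_def]], of v] by blast
   obtain B where B: "!!x \<xi>. norm (VG f x \<xi>) <= B" using VG_bdd[OF f] by blast
   have "a w <= peetre N (VG f) (x w) (\<xi> w)" for w
   proof (cases "w \<in> A")
    case True
    let ?y = "lpt \<Lambda> (cell (x w))" and ?\<eta> = "lpt \<Lambda> (cell (\<xi> w))"
    have "norm (?y - x w) <= D" "norm (?\<eta> - \<xi> w) <= D" using cell by (auto simp: norm_minus_commute)
    from bimoderate_mono[OF H this] have "a w <= J * H ?y ?\<eta>" using aH[of w] unfolding J_def by linarith
    then have "J * a w <= J * (J * H ?y ?\<eta>)" using J by (intro mult_left_mono) auto
    also have "... = c * (\<kappa> * H ?y ?\<eta>)" using c by (simp add: \<kappa>_def)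
    also have "... <= norm (VG f ?y ?\<eta>)" using lower[of "v w"] True by (simp add: v_def)
    also have "... <= J * peetre N (VG f) (x w) (\<xi> w)"
     unfolding J_def by (rule bimoderate_mono[OF peetre_bimoderate[of "VG f", OF B] cell cell, THEN order_trans[rotated], THEN order_trans[rotated]])
      (use peetre_ge[of "VG f", OF B] in auto)
    finally show ?thesis using J by simp
   next
    case False
    then show ?thesis using peetre_nonneg[of "VG f", OF B] by (simp add: A_def)
   qed
   moreover have "peetre_norm N p q \<omega> \<mu> (VG f) <= ennreal (C2 * (\<kappa> / c) * C1) * lat_norm \<alpha> \<beta> p q \<omega> \<mu> (%w. ennreal (a w))"
   proof -
    have nn: "0 <= \<omega> x" "0 <= \<mu> x" for x using w by (auto simp: moderate_def)
    note [measurable] = peetre_measurable[of "VG f" B N] moderate_measurable[OF w(1)] moderate_measurable[OF w(2)]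
    have bm: "bimoderate N (%y \<eta>. (\<kappa> / c) * H y \<eta>)" using \<kappa> c by (intro bimoderate_cmult H) auto
    \<comment> \<open>H varies slowly with the same index N, so the bound of the transform by H
      passes to the maximal function without loss.\<close>
    have "peetre N (VG f) y \<eta> <= (\<kappa> / c) * H y \<eta>" for y \<eta>
    proof (rule peetre_least)
     fix y' \<eta>'
     have "norm (VG f y' \<eta>') <= (\<kappa> / c) * H y' \<eta>'" using upper[of y' \<eta>'] c by (simp add: field_simps)
     also have "... <= ((1 + norm (y - y')) ^ N * (1 + norm (\<eta> - \<eta>')) ^ N) * ((\<kappa> / c) * H y \<eta>)"
      using bm unfolding bimoderate_def by blast
     finally have "norm (VG f y' \<eta>') * (decay N (y - y') * decay N (\<eta> - \<eta>'))
      <= ((1 + norm (y - y')) ^ N * (1 + norm (\<eta> - \<eta>')) ^ N) * ((\<kappa> / c) * H y \<eta>) * (decay N (y - y') * decay N (\<eta> - \<eta>'))"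
      by (rule mult_right_mono) simp
     also have "... = (\<kappa> / c) * H y \<eta> * ((1 + norm (y - y')) ^ N * decay N (y - y')) * ((1 + norm (\<eta> - \<eta>')) ^ N * decay N (\<eta> - \<eta>'))"
      by algebra
     finally show "norm (VG f y' \<eta>') * (decay N (y - y') * decay N (\<eta> - \<eta>')) <= (\<kappa> / c) * H y \<eta>" by simp
    qed
    then have "peetre_norm N p q \<omega> \<mu> (VG f) <= mixed_norm p q lborel lborel (%y \<eta>. ennreal ((\<kappa> / c) * H y \<eta> * (\<omega> y * \<mu> \<eta>)))"
     unfolding peetre_norm_def using p nn B
     by (intro mixed_norm_mono ennreal_leI mult_right_mono mult_nonneg_nonneg) auto
    also have "... <= ennreal C2 * lat_norm \<alpha> \<beta> p q \<omega> \<mu> (%w. ennreal ((\<kappa> / c) * H (x w) (\<xi> w)))"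
     unfolding x_def \<xi>_def by (rule samp[OF bm])
    also have "(%w. ennreal ((\<kappa> / c) * H (x w) (\<xi> w))) = (%w. ennreal (\<kappa> / c) * ennreal (H (x w) (\<xi> w)))"
     using \<kappa> c by (intro ext ennreal_mult') simp
    also have "lat_norm \<alpha> \<beta> p q \<omega> \<mu> ... = ennreal (\<kappa> / c) * lat_norm \<alpha> \<beta> p q \<omega> \<mu> (%w. ennreal (H (x w) (\<xi> w)))"
     by (rule lat_norm_cmult[OF p])
    \<comment> \<open>On the original lattice H is a discrete convolution of the sequence with the
      decaying kernel.\<close>
    also have "lat_norm \<alpha> \<beta> p q \<omega> \<mu> (%w. ennreal (H (x w) (\<xi> w))) <= ennreal C1 * lat_norm \<alpha> \<beta> p q \<omega> \<mu> (%w. ennreal (a w))"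
    proof (rule smear[OF N], intro allI)
     fix k n
     define G where "G = (%w. ennreal (a w * (decay N (lpt \<alpha> (k - fst w)) * decay N (lpt \<beta> (n - snd w)))))"
     have "ennreal (H (x (k, n)) (\<xi> (k, n))) = (\<Sum>w\<in>A. G w)"
      unfolding H_def G_def x_def \<xi>_def using a by (subst sum_ennreal) (auto simp: lattice_pt_diff scaleR_diff_right)
     also have "... = (\<integral>\<^sup>+w. G w * indicator A w \<partial>count_space UNIV)"
      using fin by (simp add: A_def nn_integral_count_space_indicator[symmetric] nn_integral_count_space_finite)
     also have "... <= (\<integral>\<^sup>+w. G w \<partial>count_space UNIV)" by (intro nn_integral_mono) (auto simp: indicator_def)
     also have "... = (\<integral>\<^sup>+v. G (k - fst v, n - snd v) \<partial>count_space UNIV)"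
      by (rule nn_integral_bij_count_space[symmetric])
       (rule bij_betw_byWitness[where f' = "%v. (k - fst v, n - snd v)"], auto)
     also have "... = (\<integral>\<^sup>+v. ennreal (a (k - fst v, n - snd v)) *
       ennreal (decay N (lpt \<alpha> (fst v)) * decay N (lpt \<beta> (snd v))) \<partial>count_space UNIV)"
      using a by (simp add: G_def ennreal_mult')
     finally show "ennreal (H (x (k, n)) (\<xi> (k, n))) <= ..." .
    qed
    finally have "peetre_norm N p q \<omega> \<mu> (VG f) <= ennreal C2 * (ennreal (\<kappa> / c) * (ennreal C1 * lat_norm \<alpha> \<beta> p q \<omega> \<mu> (%w. ennreal (a w))))"
     by (simp add: mult_left_mono)
    moreover have "ennreal (C2 * (\<kappa> / c) * C1) = ennreal C2 * ennreal (\<kappa> / c) * ennreal C1"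
     using C1 C2 \<kappa> c by (simp only: ennreal_mult divide_nonneg_nonneg less_imp_le mult_nonneg_nonneg)
    ultimately show ?thesis by (simp only: mult.assoc)
   qed
   ultimately show "\<exists>f\<in>schwartz. (\<forall>w. a w <= peetre N (VG f) (lpt \<alpha> (fst w)) (lpt \<beta> (snd w))) \<and>
    peetre_norm N p q \<omega> \<mu> (VG f) <= ennreal (C2 * (\<kappa> / c) * C1) * lat_norm \<alpha> \<beta> p q \<omega> \<mu> (%w. ennreal (a w))"
    using f unfolding x_def \<xi>_def by blast
  qed
 qed
qed

text \<open>The index maps A and B tell which entries of a and b meet at the output w and the inner
  index v. With \<open>v\<close> and \<open>w - v\<close> this is a convolution; at \<tau> = 0 the
  maps are \<open>(fst w, snd v)\<close> and \<open>(fst v, snd w)\<close>.\<close>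

definition bilin_norm :: "ennreal => ennreal => ('w => 'v => 'i) => ('w => 'v => 'j) => ('w => real) =>
  ('i => ennreal) => ('j => ennreal) => ennreal" where
 "bilin_norm p q A B \<kappa> a b = lp q (%w. lp p (%v. a (A w v) * b (B w v)) * ennreal (\<kappa> w))"

lemma bilin_norm_mono:
 assumes "0 < p" "0 < q" "!!i. a i <= a' i" "!!j. b j <= b' j"
 shows "bilin_norm p q A B \<kappa> a b <= bilin_norm p q A B \<kappa> a' b'"
 unfolding bilin_norm_def by (intro lp_mono mult_mono assms) auto

lemma bilin_norm_SUP:
 fixes a :: "nat => 'i => ennreal" and b :: "nat => 'j => ennreal"
 assumes p: "0 < p" "0 < q"
 shows "(!!i. incseq (%n. a n i)) ==> bilin_norm p q A B \<kappa> (%i. SUP n. a n i) b' = (SUP n. bilin_norm p q A B \<kappa> (a n) b')"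
  and "(!!j. incseq (%n. b n j)) ==> bilin_norm p q A B \<kappa> a' (%j. SUP n. b n j) = (SUP n. bilin_norm p q A B \<kappa> a' (b n))"
proof -
 have *: "lp q (%w. lp p (%v. SUP n. f n w v) * c w) = (SUP n. lp q (%w. lp p (f n w) * c w))"
  if "!!w v. incseq (%n. f n w v)" for f :: "nat => 'a => 'b => ennreal" and c
 proof -
  have inc: "incseq (%n. lp p (f n w) * c w)" for w
   using that p by (auto simp: incseq_def intro!: mult_right_mono lp_mono)
  show ?thesis
   by (subst lp_SUP[OF p(1) that], subst SUP_mult_right_ennreal, subst lp_SUP[OF p(2) inc]) (rule refl)
 qed
 show "bilin_norm p q A B \<kappa> (%i. SUP n. a n i) b' = (SUP n. bilin_norm p q A B \<kappa> (a n) b')" if "!!i. incseq (%n. a n i)"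
  unfolding bilin_norm_def SUP_mult_right_ennreal using that
  by (intro *) (auto simp: incseq_def intro!: mult_right_mono)
 show "bilin_norm p q A B \<kappa> a' (%j. SUP n. b n j) = (SUP n. bilin_norm p q A B \<kappa> a' (b n))" if "!!j. incseq (%n. b n j)"
  unfolding bilin_norm_def SUP_mult_left_ennreal using that
  by (intro *) (auto simp: incseq_def intro!: mult_left_mono)
qed

text \<open>Values are cut off at n as well as the support, so the approximants are real even where
  the sequence is \<open>top\<close>.\<close>

lemma finite_approx:
 fixes a :: "'i::countable => ennreal"
 obtains s :: "nat => 'i => real" where "!!n i. 0 <= s n i" "!!n. finite {i. s n i \<noteq> 0}"
  "!!i. incseq (%n. ennreal (s n i))" "!!i. (SUP n. ennreal (s n i)) = a i"
proof (rule that)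
 define s where "s = (%n i. enn2real (min (a i) (of_nat n)) * indicator (exhaust n) i)"
 have s: "ennreal (s n i) = min (a i) (of_nat n) * indicator (exhaust n) i" for n i
  by (auto simp: s_def indicator_def min_def intro!: ennreal_enn2real) (simp_all add: ennreal_of_nat_eq_real_of_nat le_less_trans)
 show "0 <= s n i" for n i by (simp add: s_def)
 show "finite {i. s n i \<noteq> 0}" for n
  by (rule finite_subset[of _ "exhaust n"]) (auto simp: s_def indicator_def)
 show inc: "incseq (%n. ennreal (s n i))" for i
  unfolding s incseq_def
  by (intro allI impI mult_mono min.mono) (use exhaust_mono in \<open>auto simp: indicator_def\<close>)
 show "(SUP n. ennreal (s n i)) = a i" for i
 proof (rule antisym)
  show "(SUP n. ennreal (s n i)) <= a i" unfolding s by (intro SUP_least) (auto simp: indicator_def)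
  obtain n0 where n0: "i \<in> exhaust n0" using in_exhaust[of i] by blast
  have "(SUP n. min (a i) (of_nat n)) = a i"
  proof -
   have "(SUP n. min (a i) (of_nat n)) = min (a i) (SUP n. of_nat n)" unfolding inf_min[symmetric] by (rule inf_SUP[symmetric])
   then show ?thesis by (simp add: ennreal_SUP_of_nat_eq_top)
  qed
  then have "a i = (SUP n. min (a i) (of_nat n))" by simp
  also have "... <= (SUP n. ennreal (s n i))"
  proof (rule SUP_mono)
   fix n
   have "min (a i) (of_nat n) <= ennreal (s (max n n0) i)"
    unfolding s using exhaust_mono[of n0 "max n n0"] n0 min.mono[OF order_refl of_nat_mono[of n "max n n0"], of "a i"]
    by (auto simp: indicator_def)
   then show "\<exists>m\<in>UNIV. min (a i) (of_nat n) <= ennreal (s m i)" by blast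
  qed
  finally show "a i <= (SUP n. ennreal (s n i))" .
 qed
qed

text \<open>Monotone convergence in each argument separately. The right-hand side is evaluated on
  minorants of a and b, so X and Y need only be monotone.\<close>

lemma bilin_norm_finite_approx:
 fixes a :: "'i::countable => ennreal" and b :: "'j::countable => ennreal"
 assumes p: "0 < p" "0 < q"
  and X: "!!a a'. (!!i. a i <= a' i) ==> X a <= X a'" and Y: "!!b b'. (!!j. b j <= b' j) ==> Y b <= (Y b' :: ennreal)"
  and fin: "!!a b. finite {i. a i \<noteq> 0} ==> finite {j. b j \<noteq> 0} ==> (!!i. 0 <= a i) ==> (!!j. 0 <= b j) ==>
   bilin_norm p q A B \<kappa> (%i. ennreal (a i)) (%j. ennreal (b j)) <= C * X (%i. ennreal (a i)) * Y (%j. ennreal (b j))"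
 shows "bilin_norm p q A B \<kappa> a b <= C * X a * Y b"
proof -
 obtain s where s: "!!n i. 0 <= s n i" "!!n. finite {i. s n i \<noteq> 0}"
  "!!i. incseq (%n. ennreal (s n i))" "!!i. (SUP n. ennreal (s n i)) = a i"
  by (rule finite_approx[of a]) (rule that; assumption)
 obtain t where t: "!!n i. 0 <= t n i" "!!n. finite {i. t n i \<noteq> 0}"
  "!!i. incseq (%n. ennreal (t n i))" "!!i. (SUP n. ennreal (t n i)) = b i"
  by (rule finite_approx[of b]) (rule that; assumption)
 have sa: "ennreal (s n i) <= a i" for n i unfolding s(4)[symmetric] by (rule SUP_upper) simp
 have tb: "ennreal (t n j) <= b j" for n j unfolding t(4)[symmetric] by (rule SUP_upper) simp
 have "bilin_norm p q A B \<kappa> a b = (SUP n. SUP l. bilin_norm p q A B \<kappa> (%i. ennreal (s n i)) (%j. ennreal (t l j)))"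
  using bilin_norm_SUP(1)[OF p s(3), where A = A and B = B and \<kappa> = \<kappa> and b' = b]
   bilin_norm_SUP(2)[OF p t(3), where A = A and B = B and \<kappa> = \<kappa>] by (simp add: s(4) t(4))
 also have "... <= C * X a * Y b"
  by (intro SUP_least order_trans[OF fin] s t mult_mono X Y sa tb) auto
 finally show ?thesis .
qed

lemma peetre_pair_osc:
 fixes V W :: "'a::euclidean_space => 'a => complex"
 assumes \<tau>: "0 <= \<tau>" "\<tau> <= 1" and V: "!!x \<xi>. norm (V x \<xi>) <= B" and W: "!!x \<xi>. norm (W x \<xi>) <= B'"
  and z: "norm (z - z') <= D1" and \<zeta>: "norm (\<zeta> - \<zeta>') <= D2"
 shows "peetre_pair \<tau> N V W z \<zeta> <= ((1 + (D1 + D2)) ^ N * (1 + (D1 + D2)) ^ N) ^ 2 * peetre_pair \<tau> N V W z' \<zeta>'"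
proof -
 have D: "0 <= D1" "0 <= D2" using z \<zeta> norm_ge_zero order_trans by blast+
 have d: "norm (fst z' - fst z) <= D1" "norm (snd z' - snd z) <= D1" "norm (fst \<zeta>' - fst \<zeta>) <= D2" "norm (snd \<zeta>' - snd \<zeta>) <= D2"
 proof -
  have "norm (fst u - fst v) <= norm (u - v)" "norm (snd u - snd v) <= norm (u - v)" for u v :: "'a \<times> 'a"
   using norm_fst_le[of "fst u - fst v" "snd u - snd v"] norm_snd_le[of "snd u - snd v" "fst u - fst v"]
   by (simp_all add: minus_prod_def)
  moreover have "norm (z' - z) <= D1" "norm (\<zeta>' - \<zeta>) <= D2" using z \<zeta> by (simp_all add: norm_minus_commute)
  ultimately show "norm (fst z' - fst z) <= D1" "norm (snd z' - snd z) <= D1" "norm (fst \<zeta>' - fst \<zeta>) <= D2" "norm (snd \<zeta>' - snd \<zeta>) <= D2"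
   by (meson order_trans)+
 qed
 have lin: "norm ((s' + c *\<^sub>R t') - (s + c *\<^sub>R t)) <= D1 + D2" if "norm (s' - s) <= D2" "norm (t' - t) <= D1" "\<bar>c\<bar> <= 1" for s s' t t' :: 'a and c
 proof -
  have eq: "(s' + c *\<^sub>R t') - (s + c *\<^sub>R t) = (s' - s) + c *\<^sub>R (t' - t)" by (simp add: algebra_simps)
  have "\<bar>c\<bar> * norm (t' - t) <= 1 * D1" using that D by (intro mult_mono) auto
  then show ?thesis unfolding eq using norm_triangle_ineq[of "s' - s" "c *\<^sub>R (t' - t)"] that by simp
 qed
 have lin': "norm ((s' - c *\<^sub>R t') - (s - c *\<^sub>R t)) <= D1 + D2" if "norm (s' - s) <= D2" "norm (t' - t) <= D1" "\<bar>c\<bar> <= 1" for s s' t t' :: 'a and c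
  using lin[of s' s t' t "- c"] that by simp
 have c: "\<bar>\<tau>\<bar> <= 1" "\<bar>1 - \<tau>\<bar> <= 1" using \<tau> by auto
 note bV = bimoderate_mono[OF peetre_bimoderate[of V, OF V] lin[OF d(3,2) c(1)] lin'[OF d(4,1) c(2)]]
 note bW = bimoderate_mono[OF peetre_bimoderate[of W, OF W] lin'[OF d(3,2) c(2)] lin[OF d(4,1) c(1)]]
 have "peetre_pair \<tau> N V W z \<zeta> <= ((1 + (D1 + D2)) ^ N * (1 + (D1 + D2)) ^ N * peetre N V (fst \<zeta>' + \<tau> *\<^sub>R snd z') (snd \<zeta>' - (1 - \<tau>) *\<^sub>R fst z'))
  * ((1 + (D1 + D2)) ^ N * (1 + (D1 + D2)) ^ N * peetre N W (fst \<zeta>' - (1 - \<tau>) *\<^sub>R snd z') (snd \<zeta>' + \<tau> *\<^sub>R fst z'))"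
  unfolding peetre_pair_def
  using D peetre_nonneg[of V, OF V] peetre_nonneg[of W, OF W] by (intro mult_mono bV bW) auto
 then show ?thesis by (simp add: peetre_pair_def power2_eq_square mult_ac)
qed

subsection \<open>Inequalities for sequences\<close>

lemma lp_inj:
 fixes f :: "'j::countable => ennreal" and g :: "'i::countable => 'j"
 assumes "0 < p" "inj g"
 shows "lp p (%x. f (g x)) <= lp p f"
 using assms(1)
proof (cases p rule: exponent_cases)
 case (1 P)
 have "(\<integral>\<^sup>+x. epowr (f (g x)) P \<partial>count_space UNIV) = (\<integral>\<^sup>+y. epowr (f y) P \<partial>count_space (range g))"
  using assms(2) by (intro nn_integral_bij_count_space) (auto simp: bij_betw_def)
 also have "... <= (\<integral>\<^sup>+y. epowr (f y) P \<partial>count_space UNIV)"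
  by (subst nn_integral_count_space_indicator) (auto intro!: nn_integral_mono simp: indicator_def)
 finally show ?thesis using 1 by (simp add: Lp_norm_ennreal epowr_mono)
next
 case 2
 then show ?thesis by (auto simp: lp_top intro!: SUP_least SUP_upper)
qed

text \<open>Minkowski's integral inequality for the exponent q / p >= 1, applied to p-th
  powers.\<close>

lemma lp_Minkowski:
 fixes G :: "'i::countable => 'j::countable => ennreal"
 assumes "0 < p" "p <= q"
 shows "lp q (%i. lp p (%n. G i n)) <= lp p (%n. lp q (%i. G i n))"
 using assms(1)
proof (cases p rule: exponent_cases)
 case (1 P)
 have q: "0 < q" using assms by auto
 have q1: "1 <= q / ennreal P"
  using assms(2) 1 divide_right_mono_ennreal[of "ennreal P" q "ennreal P"] by (auto simp: ennreal_divide_self)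
 have e: "lp (q / ennreal P) (%i. epowr (f i) P) = epowr (lp q f) P" for f :: "'i => ennreal"
  using Lp_norm_epowr[of q P f "count_space UNIV"] q 1 by simp
 have "epowr (lp q (%i. lp p (%n. G i n))) P = lp (q / ennreal P) (%i. \<integral>\<^sup>+ n. epowr (G i n) P \<partial>count_space UNIV)"
  unfolding e[symmetric] 1(2) epowr_Lp_norm[OF 1(1)] ..
 also have "... <= (\<integral>\<^sup>+ n. lp (q / ennreal P) (%i. epowr (G i n) P) \<partial>count_space UNIV)"
  by (rule Minkowski_integral) (auto simp: q1 pair_measure_countable)
 also have "... = epowr (lp p (%n. lp q (%i. G i n))) P"
  unfolding e 1(2) epowr_Lp_norm[OF 1(1)] ..
 finally show ?thesis using epowr_le_iff[OF 1(1)] by blast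
next
 case 2
 then have "q = top" using assms(2) by (simp add: top_unique)
 with 2 show ?thesis by (simp add: lp_top) (subst SUP_commute, simp)
qed

definition wlp :: "ennreal => ('i => real) => ('i => ennreal) => ennreal" where
 "wlp p u a = lp p (%k. a k * ennreal (u k))"

definition seq_norm :: "ennreal => ennreal => ('i => real) => ('j => real) => ('i \<times> 'j => ennreal) => ennreal" where
 "seq_norm p q u v a = wlp q v (%n. wlp p u (%k. a (k, n)))"

lemma wlp_mono: "0 < p ==> (!!k. a k <= b k) ==> wlp p u a <= wlp p u b"
 unfolding wlp_def by (intro lp_mono mult_right_mono) auto

lemma wlp_cmult: "0 < p ==> wlp p u (%k. c * a k) = c * wlp p u a"
 by (simp add: wlp_def mult.assoc lp_cmult)

lemma wlp_multc: "0 < p ==> wlp p u (%k. a k * c) = wlp p u a * c"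
 using wlp_cmult[of p u c a] by (simp add: mult.commute)

lemma seq_norm_tensor:
 "0 < p ==> 0 < q ==> seq_norm p q u v (%w. a (fst w) * b (snd w)) = wlp p u a * wlp q v b"
 by (simp add: seq_norm_def wlp_multc wlp_cmult)

lemma wlp_delta: "0 < p ==> wlp p u (%k. indicator {k0} k) = ennreal (u k0)"
 unfolding wlp_def by (subst lp_single[where k = k0]) auto

text \<open>Inclusions for sequences in [0, top], without restriction to finite norm. The complex
  sequence spaces are reached through \<open>embeds_iff_emb\<close> and
  \<open>conv_embeds_iff_bemb\<close>.\<close>

definition emb :: "('a => ennreal) => ('a => ennreal) => bool" where
 "emb X Z \<longleftrightarrow> (\<exists>C>0. \<forall>a. Z a <= ennreal C * X a)"

definition bemb :: "('a => ennreal) => ('b => ennreal) => ('a => 'b => ennreal) => bool" where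
 "bemb X Y Z \<longleftrightarrow> (\<exists>C>0. \<forall>a b. Z a b <= ennreal C * X a * Y b)"

lemma embI: "c < top ==> (!!a. Z a <= c * X a) ==> emb X Z"
 unfolding emb_def
proof (intro exI[of _ "enn2real c + 1"] conjI allI)
 fix a assume c: "c < top" and "!!a. Z a <= c * X a"
 then have "Z a <= c * X a" by blast
 also have "c <= ennreal (enn2real c + 1)" using c by (cases c) (auto simp: ennreal_leI)
 finally show "Z a <= ennreal (enn2real c + 1) * X a" by (simp add: mult_right_mono)
qed (simp add: add_nonneg_pos)

lemma bembI: "c < top ==> (!!a b. Z a b <= c * X a * Y b) ==> bemb X Y Z"
 unfolding bemb_def
proof (intro exI[of _ "enn2real c + 1"] conjI allI)
 fix a b assume c: "c < top" and "!!a b. Z a b <= c * X a * Y b"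
 then have "Z a b <= c * X a * Y b" by blast
 also have "c <= ennreal (enn2real c + 1)" using c by (cases c) (auto simp: ennreal_leI)
 finally show "Z a b <= ennreal (enn2real c + 1) * X a * Y b" by (simp add: mult_right_mono)
qed (simp add: add_nonneg_pos)

text \<open>Restricting the output index and the inner index to injective images only drops terms.
  This evaluates the form on sequences supported on coordinate axes.\<close>

lemma bilin_restrict:
 fixes A :: "'w::countable => 'v::countable => 'i" and gw :: "'w0::countable => 'w" and gv :: "'v0::countable => 'v"
 assumes p: "0 < p" "0 < q" and inj: "inj gw" "inj gv"
 shows "lp q (%w. lp p (%v. a (A (gw w) (gv v)) * b (B (gw w) (gv v))) * ennreal (\<kappa> (gw w))) <= bilin_norm p q A B \<kappa> a b"
 unfolding bilin_norm_def
 by (rule order_trans[OF lp_mono[OF p(2) mult_right_mono[OF lp_inj[OF p(1) inj(2), of "%v. a (A _ v) * b (B _ v)"]]]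
    lp_inj[OF p(2) inj(1), of "%w. lp p (%v. a (A w v) * b (B w v)) * ennreal (\<kappa> w)"]]) simp

abbreviation (input) conv_norm :: "ennreal => ennreal => ('i => real) => ('i::ab_group_add => ennreal) => ('i => ennreal) => ennreal" where
 "conv_norm p q \<kappa> \<equiv> bilin_norm p q (%w v. v) (%w v. w - v) \<kappa>"

text \<open>The test sequences are tensor products with a delta, supported on one axis, where the
  convolution is one-dimensional.\<close>

lemma conv_norm_restrict:
 fixes \<kappa> :: "'i::{countable, ab_group_add} \<times> 'j::{countable, ab_group_add} => real"
 assumes p: "0 < p1" "0 < q1" "0 < p2" "0 < q2" "0 < p" "0 < q"
  and D: "bemb (seq_norm p1 q1 u1 v1) (seq_norm p2 q2 u2 v2) (conv_norm p q \<kappa>)"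
 shows "bemb (wlp p1 u1) (wlp p2 u2) (conv_norm p q (%i. \<kappa> (i, 0)))"
  and "bemb (wlp q1 v1) (wlp q2 v2) (conv_norm p q (%j. \<kappa> (0, j)))"
proof -
 obtain C where C: "!!a b. conv_norm p q \<kappa> a b <= ennreal C * seq_norm p1 q1 u1 v1 a * seq_norm p2 q2 u2 v2 b"
  using D unfolding bemb_def by blast
 show "bemb (wlp p1 u1) (wlp p2 u2) (conv_norm p q (%i. \<kappa> (i, 0)))"
 proof (rule bembI)
  fix a b :: "'i => ennreal"
  let ?a = "%w :: 'i \<times> 'j. a (fst w) * indicator {0} (snd w)" and ?b = "%w :: 'i \<times> 'j. b (fst w) * indicator {0} (snd w)"
  have "conv_norm p q (%i. \<kappa> (i, 0)) a b <= conv_norm p q \<kappa> ?a ?b"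
   using bilin_restrict[OF p(5,6), of "%i. (i, 0)" "%i. (i, 0)" ?a "%w v. v" ?b "%w v. w - v" \<kappa>]
   by (simp add: inj_on_def bilin_norm_def)
  also have "... <= ennreal C * seq_norm p1 q1 u1 v1 ?a * seq_norm p2 q2 u2 v2 ?b" by (rule C)
  also have "... = (ennreal C * ennreal (v1 0) * ennreal (v2 0)) * wlp p1 u1 a * wlp p2 u2 b"
   unfolding seq_norm_tensor[OF p(1,2)] seq_norm_tensor[OF p(3,4)] wlp_delta[OF p(1)] wlp_delta[OF p(2)] wlp_delta[OF p(3)] wlp_delta[OF p(4)]
   by (simp only: mult_ac)
  finally show "conv_norm p q (%i. \<kappa> (i, 0)) a b <= (ennreal C * ennreal (v1 0) * ennreal (v2 0)) * wlp p1 u1 a * wlp p2 u2 b" .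
 qed (simp add: ennreal_mult_less_top)
 show "bemb (wlp q1 v1) (wlp q2 v2) (conv_norm p q (%j. \<kappa> (0, j)))"
 proof (rule bembI)
  fix a b :: "'j => ennreal"
  let ?a = "%w :: 'i \<times> 'j. indicator {0} (fst w) * a (snd w)" and ?b = "%w :: 'i \<times> 'j. indicator {0} (fst w) * b (snd w)"
  have "conv_norm p q (%j. \<kappa> (0, j)) a b <= conv_norm p q \<kappa> ?a ?b"
   using bilin_restrict[OF p(5,6), of "%i. (0, i)" "%i. (0, i)" ?a "%w v. v" ?b "%w v. w - v" \<kappa>]
   by (simp add: inj_on_def bilin_norm_def)
  also have "... <= ennreal C * seq_norm p1 q1 u1 v1 ?a * seq_norm p2 q2 u2 v2 ?b" by (rule C)
  also have "... = (ennreal C * ennreal (u1 0) * ennreal (u2 0)) * wlp q1 v1 a * wlp q2 v2 b"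
   unfolding seq_norm_tensor[OF p(1,2)] seq_norm_tensor[OF p(3,4)] wlp_delta[OF p(1)] wlp_delta[OF p(2)] wlp_delta[OF p(3)] wlp_delta[OF p(4)]
   by (simp only: mult_ac)
  finally show "conv_norm p q (%j. \<kappa> (0, j)) a b <= (ennreal C * ennreal (u1 0) * ennreal (u2 0)) * wlp q1 v1 a * wlp q2 v2 b" .
 qed (simp add: ennreal_mult_less_top)
qed

text \<open>At fixed j the q-norm over i and the p-norm over n are exchanged by
  \<open>lp_Minkowski\<close>, which requires p <= q. Then the first inequality applies at each n,
  and the second to the resulting sequences of norms \<open>A\<close> and \<open>B\<close>.\<close>

lemma conv_norm_tensor:
 fixes \<kappa> :: "'i::{countable, ab_group_add} \<times> 'j::{countable, ab_group_add} => real"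
 assumes p: "0 < p1" "0 < q1" "0 < p2" "0 < q2" "0 < p" "p <= q"
  and \<kappa>: "!!i j. \<kappa> (i, j) <= K * (\<kappa>1 i * \<kappa>2 j)" "0 <= K" "!!i. 0 <= \<kappa>1 i" "!!j. 0 <= \<kappa>2 j"
  and D1: "bemb (wlp p1 u1) (wlp p2 u2) (conv_norm p q \<kappa>1)"
  and D2: "bemb (wlp q1 v1) (wlp q2 v2) (conv_norm p q \<kappa>2)"
 shows "bemb (seq_norm p1 q1 u1 v1) (seq_norm p2 q2 u2 v2) (conv_norm p q \<kappa>)"
proof -
 obtain C1 where C1: "!!a b. conv_norm p q \<kappa>1 a b <= ennreal C1 * wlp p1 u1 a * wlp p2 u2 b"
  using D1 unfolding bemb_def by blast
 obtain C2 where C2: "!!a b. conv_norm p q \<kappa>2 a b <= ennreal C2 * wlp q1 v1 a * wlp q2 v2 b"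
  using D2 unfolding bemb_def by blast
 have q: "0 < q" using p by auto
 show ?thesis
 proof (rule bembI)
  fix a b :: "'i \<times> 'j => ennreal"
  define A where "A = (%n. wlp p1 u1 (%k. a (k, n)))"
  define B where "B = (%n. wlp p2 u2 (%k. b (k, n)))"
  have inner: "lp q (%i. lp p (%v. a v * b ((i, j) - v)) * ennreal (\<kappa>1 i)) <= ennreal C1 * lp p (%n. A n * B (j - n))" for j
  proof -
   have "lp q (%i. lp p (%v. a v * b ((i, j) - v)) * ennreal (\<kappa>1 i))
    = lp q (%i. lp p (%n. lp p (%k. a (k, n) * b (i - k, j - n)) * ennreal (\<kappa>1 i)))"
    using p by (simp add: lp_pair lp_multc)
   also have "... <= lp p (%n. lp q (%i. lp p (%k. a (k, n) * b (i - k, j - n)) * ennreal (\<kappa>1 i)))"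
    by (rule lp_Minkowski[OF p(5,6)])
   also have "... <= lp p (%n. ennreal C1 * (A n * B (j - n)))"
    using C1[of "%k. a (k, n)" "%k. b (k, j - n)" for n] p
    by (intro lp_mono) (auto simp: bilin_norm_def A_def B_def mult.assoc)
   also have "... = ennreal C1 * lp p (%n. A n * B (j - n))" using p by (simp add: lp_cmult)
   finally show ?thesis .
  qed
  have "conv_norm p q \<kappa> a b <= lp q (%w. lp p (%v. a v * b (w - v)) * ennreal (\<kappa>1 (fst w)) * (ennreal K * ennreal (\<kappa>2 (snd w))))"
   unfolding bilin_norm_def
  proof (rule lp_mono[OF q])
   fix w :: "'i \<times> 'j"
   have "ennreal (\<kappa> w) <= ennreal (K * (\<kappa>1 (fst w) * \<kappa>2 (snd w)))" using \<kappa>(1)[of "fst w" "snd w"] by (intro ennreal_leI) simp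
   also have "... = ennreal (\<kappa>1 (fst w)) * (ennreal K * ennreal (\<kappa>2 (snd w)))" using \<kappa> by (simp add: ennreal_mult' mult_ac)
   finally show "lp p (%v. a v * b (w - v)) * ennreal (\<kappa> w)
    <= lp p (%v. a v * b (w - v)) * ennreal (\<kappa>1 (fst w)) * (ennreal K * ennreal (\<kappa>2 (snd w)))"
    unfolding mult.assoc by (rule mult_left_mono) simp
  qed
  also have "... = lp q (%j. lp q (%i. lp p (%v. a v * b ((i, j) - v)) * ennreal (\<kappa>1 i)) * (ennreal K * ennreal (\<kappa>2 j)))"
   using q by (simp add: lp_pair[OF q] lp_multc)
  also have "... <= lp q (%j. (ennreal C1 * ennreal K) * (lp p (%n. A n * B (j - n)) * ennreal (\<kappa>2 j)))"
  proof (rule lp_mono[OF q])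
   fix j
   show "lp q (%i. lp p (%v. a v * b ((i, j) - v)) * ennreal (\<kappa>1 i)) * (ennreal K * ennreal (\<kappa>2 j))
    <= (ennreal C1 * ennreal K) * (lp p (%n. A n * B (j - n)) * ennreal (\<kappa>2 j))"
    using mult_right_mono[OF inner[of j], of "ennreal K * ennreal (\<kappa>2 j)"] by (simp add: mult_ac)
  qed
  also have "... = (ennreal C1 * ennreal K) * conv_norm p q \<kappa>2 A B"
   using q by (simp add: lp_cmult bilin_norm_def)
  also have "... <= (ennreal C1 * ennreal K) * (ennreal C2 * wlp q1 v1 A * wlp q2 v2 B)"
   by (intro mult_left_mono C2) simp
  also have "... = (ennreal C1 * ennreal K * ennreal C2) * seq_norm p1 q1 u1 v1 a * seq_norm p2 q2 u2 v2 b"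
   by (simp add: seq_norm_def A_def B_def mult_ac)
  finally show "conv_norm p q \<kappa> a b <= (ennreal C1 * ennreal K * ennreal C2) * seq_norm p1 q1 u1 v1 a * seq_norm p2 q2 u2 v2 b" .
 qed (simp add: ennreal_mult_less_top)
qed

text \<open>Convolution with the delta at 0 reproduces the other sequence.\<close>

lemma conv_norm_delta:
 fixes \<kappa> :: "'i::{countable, ab_group_add} => real"
 assumes p: "0 < p1" "0 < p2" "0 < p" "0 < q" and D: "bemb (wlp p1 u1) (wlp p2 u2) (conv_norm p q \<kappa>)"
 shows "emb (wlp p1 u1) (wlp q \<kappa>)" "emb (wlp p2 u2) (wlp q \<kappa>)"
proof -
 obtain C where C: "!!a b. conv_norm p q \<kappa> a b <= ennreal C * wlp p1 u1 a * wlp p2 u2 b"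
  using D unfolding bemb_def by blast
 show "emb (wlp p1 u1) (wlp q \<kappa>)"
 proof (rule embI)
  fix a :: "'i => ennreal"
  have "wlp q \<kappa> a <= conv_norm p q \<kappa> a (indicator {0})"
   unfolding wlp_def bilin_norm_def using lp_ge[OF p(3), of "%v. a v * indicator {0} (w - v)" w for w]
   by (intro lp_mono p mult_right_mono) auto
  also have "... <= ennreal C * wlp p1 u1 a * wlp p2 u2 (%k. indicator {0} k)" by (rule C)
  finally show "wlp q \<kappa> a <= (ennreal C * ennreal (u2 0)) * wlp p1 u1 a" using p by (simp add: wlp_delta mult_ac)
 qed (simp add: ennreal_mult_less_top)
 show "emb (wlp p2 u2) (wlp q \<kappa>)"
 proof (rule embI)
  fix b :: "'i => ennreal"
  have "wlp q \<kappa> b <= conv_norm p q \<kappa> (indicator {0}) b"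
   unfolding wlp_def bilin_norm_def using lp_ge[OF p(3), of "%v. indicator {0} v * b (w - v)" 0 for w]
   by (intro lp_mono p mult_right_mono) auto
  also have "... <= ennreal C * wlp p1 u1 (%k. indicator {0} k) * wlp p2 u2 b" by (rule C)
  finally show "wlp q \<kappa> b <= (ennreal C * ennreal (u1 0)) * wlp p2 u2 b" using p by (simp add: wlp_delta mult_ac)
 qed (simp add: ennreal_mult_less_top)
qed

lemma seq_norm_emb:
 assumes p: "0 < p" "0 < q" "0 < r" and E: "emb (wlp p u) (wlp r \<kappa>1)" "emb (wlp q v) (wlp r \<kappa>2)"
 shows "emb (seq_norm p q u v) (seq_norm r r \<kappa>1 \<kappa>2)"
proof -
 obtain C1 where C1: "!!a. wlp r \<kappa>1 a <= ennreal C1 * wlp p u a" using E(1) unfolding emb_def by blast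
 obtain C2 where C2: "!!a. wlp r \<kappa>2 a <= ennreal C2 * wlp q v a" using E(2) unfolding emb_def by blast
 show ?thesis
 proof (rule embI)
  fix a
  have "seq_norm r r \<kappa>1 \<kappa>2 a <= wlp r \<kappa>2 (%n. ennreal C1 * wlp p u (%k. a (k, n)))"
   unfolding seq_norm_def by (intro wlp_mono p C1)
  also have "... <= ennreal C1 * (ennreal C2 * seq_norm p q u v a)"
   using p by (simp add: wlp_cmult seq_norm_def C2 mult_left_mono)
  finally show "seq_norm r r \<kappa>1 \<kappa>2 a <= (ennreal C1 * ennreal C2) * seq_norm p q u v a" by (simp add: mult.assoc)
 qed (simp add: ennreal_mult_less_top)
qed

text \<open>For q <= p the inner exponent may be lowered to q. The double q-sum of a v * b (w - v),
  with the weight distributed over v and w - v, factorizes by translation invariance.\<close>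

lemma conv_norm_emb:
 fixes \<kappa> :: "'i::{countable, ab_group_add} \<times> 'j::{countable, ab_group_add} => real"
 assumes p: "0 < p1" "0 < q1" "0 < p2" "0 < q2" "0 < q" "q <= p"
  and \<kappa>: "!!w v. \<kappa> w <= K * ((\<kappa>1 (fst v) * \<kappa>2 (snd v)) * (\<kappa>1 (fst (w - v)) * \<kappa>2 (snd (w - v))))"
   "0 <= K" "!!i. 0 <= \<kappa>1 i" "!!j. 0 <= \<kappa>2 j"
  and E: "emb (wlp p1 u1) (wlp q \<kappa>1)" "emb (wlp q1 v1) (wlp q \<kappa>2)" "emb (wlp p2 u2) (wlp q \<kappa>1)" "emb (wlp q2 v2) (wlp q \<kappa>2)"
 shows "bemb (seq_norm p1 q1 u1 v1) (seq_norm p2 q2 u2 v2) (conv_norm p q \<kappa>)"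
proof -
 obtain C1 where C1: "!!a. seq_norm q q \<kappa>1 \<kappa>2 a <= ennreal C1 * seq_norm p1 q1 u1 v1 a"
  using seq_norm_emb[OF p(1,2,5) E(1,2)] unfolding emb_def by blast
 obtain C2 where C2: "!!a. seq_norm q q \<kappa>1 \<kappa>2 a <= ennreal C2 * seq_norm p2 q2 u2 v2 a"
  using seq_norm_emb[OF p(3,4,5) E(3,4)] unfolding emb_def by blast
 have q: "0 < q" "0 < p" using p by auto
 show ?thesis
 proof (rule bembI)
  fix a b :: "'i \<times> 'j => ennreal"
  define k where "k = (%w :: 'i \<times> 'j. ennreal (\<kappa>1 (fst w)) * ennreal (\<kappa>2 (snd w)))"
  have sn: "seq_norm q q \<kappa>1 \<kappa>2 c = lp q (%w. c w * k w)" for c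
   using q by (simp add: seq_norm_def wlp_def lp_pair[OF q(1)] k_def lp_multc mult.assoc[symmetric])
  have "conv_norm p q \<kappa> a b <= lp q (%w. lp q (%v. a v * b (w - v)) * ennreal (\<kappa> w))"
   unfolding bilin_norm_def by (intro lp_mono mult_right_mono lp_antimono q p) auto
  also have "... = lp q (%w. lp q (%v. a v * b (w - v) * ennreal (\<kappa> w)))" using q by (simp add: lp_multc)
  also have "... <= lp q (%w. lp q (%v. (ennreal K * (a v * k v)) * (b (w - v) * k (w - v))))"
  proof (intro lp_mono q)
   fix w v :: "'i \<times> 'j"
   have "ennreal (\<kappa> w) <= ennreal (K * ((\<kappa>1 (fst v) * \<kappa>2 (snd v)) * (\<kappa>1 (fst (w - v)) * \<kappa>2 (snd (w - v)))))"
    by (intro ennreal_leI \<kappa>)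
   also have "... = ennreal K * (k v * k (w - v))" using \<kappa>(2-4) by (simp add: k_def ennreal_mult')
   finally have "a v * b (w - v) * ennreal (\<kappa> w) <= a v * b (w - v) * (ennreal K * (k v * k (w - v)))"
    by (rule mult_left_mono) simp
   then show "a v * b (w - v) * ennreal (\<kappa> w) <= (ennreal K * (a v * k v)) * (b (w - v) * k (w - v))"
    by (simp add: mult_ac)
  qed
  also have "... = lp q (%v. lp q (%w. (ennreal K * (a v * k v)) * (b (w - v) * k (w - v))))"
   using lp_pair[OF q(1), of "%(v, w). (ennreal K * (a v * k v)) * (b (w - v) * k (w - v))"]
    lp_pair_swap[OF q(1), of "%(v, w). (ennreal K * (a v * k v)) * (b (w - v) * k (w - v))"] by simp
  also have "... = lp q (%v. (ennreal K * (a v * k v)) * lp q (%w. b w * k w))"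
  proof -
   have bij: "bij (%w. w - v)" for v :: "'i \<times> 'j" by (rule bij_betw_byWitness[where f' = "%w. w + v"]) auto
   have "lp q (%w. b (w - v) * k (w - v)) = lp q (%w. b w * k w)" for v by (rule lp_bij[OF bij q(1)])
   then show ?thesis using q by (simp add: lp_cmult)
  qed
  also have "... = ennreal K * lp q (%v. a v * k v) * lp q (%w. b w * k w)"
   using q by (simp add: lp_multc lp_cmult)
  also have "... <= ennreal K * (ennreal C1 * seq_norm p1 q1 u1 v1 a) * (ennreal C2 * seq_norm p2 q2 u2 v2 b)"
   unfolding sn[symmetric] by (intro mult_mono C1 C2) auto
  finally show "conv_norm p q \<kappa> a b <= (ennreal K * ennreal C1 * ennreal C2) * seq_norm p1 q1 u1 v1 a * seq_norm p2 q2 u2 v2 b"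
   by (simp add: mult_ac)
 qed (simp add: ennreal_mult_less_top)
qed

text \<open>The inner norm over v = (k, n) is the product of the p-norm of a in its second variable
  and the p-norm of b in its first, and the weight splits up to K. So the form is bounded by a
  product of two norms; conversely, each condition is seen by putting deltas in the other
  places.\<close>

lemma bilin_norm_endpoint:
 fixes \<kappa> :: "'i::{countable, zero} \<times> 'j::{countable, zero} => real" and u1 u2 :: "'i => real" and v1 v2 :: "'j => real"
 assumes p: "0 < p1" "0 < q1" "0 < p2" "0 < q2" "0 < p" "0 < q"
  and \<kappa>: "!!i j. \<kappa> (i, j) <= K * (\<kappa> (i, 0) * \<kappa> (0, j))" "0 <= K" "!!w. 0 <= \<kappa> w" "0 < \<kappa> (0, 0)"
 shows "bemb (seq_norm p1 q1 u1 v1) (seq_norm p2 q2 u2 v2) (bilin_norm p q (%w v. (fst w, snd v)) (%w v. (fst v, snd w)) \<kappa>) \<longleftrightarrow>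
  emb (seq_norm p1 q1 u1 v1) (%a. lp q (%i. lp p (%n. a (i, n)) * ennreal (\<kappa> (i, 0)))) \<and>
  emb (wlp p2 u2) (wlp p (%_. 1)) \<and> emb (wlp q2 v2) (wlp q (%j. \<kappa> (0, j)))" (is "bemb ?X ?Y ?Z \<longleftrightarrow> ?E1 \<and> ?E2 \<and> ?E3")
proof (intro iffI conjI)
 assume "bemb ?X ?Y ?Z"
 then obtain C where C: "!!a b. ?Z a b <= ennreal C * ?X a * ?Y b" unfolding bemb_def by blast
 let ?\<delta>i = "%k :: 'i. indicator {0} k :: ennreal" and ?\<delta>j = "%n :: 'j. indicator {0} n :: ennreal"
 define \<delta> where "\<delta> = (%w. ?\<delta>i (fst w) * ?\<delta>j (snd w))"
 have X\<delta>: "?X \<delta> = ennreal (u1 0) * ennreal (v1 0)" and Y\<delta>: "?Y \<delta> = ennreal (u2 0) * ennreal (v2 0)"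
  unfolding \<delta>_def seq_norm_tensor[OF p(1,2)] seq_norm_tensor[OF p(3,4)] by (simp_all only: wlp_delta p)
 show ?E1
 proof (rule embI)
  fix a :: "'i \<times> 'j => ennreal"
  have "lp q (%i. lp p (%n. a (i, n)) * ennreal (\<kappa> (i, 0))) <= ?Z a \<delta>"
   using bilin_restrict[OF p(5,6), of "%i :: 'i. (i, 0 :: 'j)" "%n :: 'j. (0 :: 'i, n)" a "%w v. (fst w, snd v)" \<delta> "%w v. (fst v, snd w)" \<kappa>]
   by (simp add: inj_on_def \<delta>_def)
  also have "... <= ennreal C * ?X a * ?Y \<delta>" by (rule C)
  finally show "lp q (%i. lp p (%n. a (i, n)) * ennreal (\<kappa> (i, 0))) <= (ennreal C * ?Y \<delta>) * ?X a" by (simp add: mult_ac)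
 qed (simp add: Y\<delta> ennreal_mult_less_top)
 show ?E2
 proof (rule embI)
  fix b :: "'i => ennreal"
  let ?b = "%w :: 'i \<times> 'j. b (fst w) * ?\<delta>j (snd w)"
  \<comment> \<open>The unit type restricts the output to (0, 0), where the positive weight can be
    divided out.\<close>
  have "lp q (%_ :: unit. lp p b * ennreal (\<kappa> (0, 0))) <= ?Z \<delta> ?b"
   using bilin_restrict[OF p(5,6), of "%_ :: unit. (0 :: 'i, 0 :: 'j)" "%k :: 'i. (k, 0 :: 'j)" \<delta> "%w v. (fst w, snd v)" ?b "%w v. (fst v, snd w)" \<kappa>]
   by (simp add: inj_on_def \<delta>_def)
  also have "lp q (%_ :: unit. lp p b * ennreal (\<kappa> (0, 0))) = lp p b * ennreal (\<kappa> (0, 0))"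
   by (rule lp_single[OF p(6), of "()"]) simp
  finally have "lp p b * ennreal (\<kappa> (0, 0)) * ennreal (1 / \<kappa> (0, 0)) <= ennreal C * ?X \<delta> * ?Y ?b * ennreal (1 / \<kappa> (0, 0))"
   using C by (intro mult_right_mono) (auto intro: order_trans)
  moreover have "ennreal (\<kappa> (0, 0)) * ennreal (1 / \<kappa> (0, 0)) = 1" using \<kappa>(4) by (simp add: ennreal_mult'[symmetric])
  moreover have "?Y ?b = wlp p2 u2 b * ennreal (v2 0)" unfolding seq_norm_tensor[OF p(3,4)] wlp_delta[OF p(4)] ..
  ultimately show "wlp p (%_. 1) b <= (ennreal C * ?X \<delta> * ennreal (v2 0) * ennreal (1 / \<kappa> (0, 0))) * wlp p2 u2 b"
   by (simp add: wlp_def mult.assoc) (simp add: mult_ac)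
 qed (simp add: X\<delta> ennreal_mult_less_top)
 show ?E3
 proof (rule embI)
  fix b :: "'j => ennreal"
  let ?b = "%w :: 'i \<times> 'j. ?\<delta>i (fst w) * b (snd w)"
  have "lp p (%_ :: unit. c) = c" for c by (rule lp_single[OF p(5), of "()"]) simp
  then have "wlp q (%j. \<kappa> (0, j)) b = lp q (%j. lp p (%_ :: unit. b j) * ennreal (\<kappa> (0, j)))"
   by (simp add: wlp_def)
  also have "... <= ?Z \<delta> ?b"
   using bilin_restrict[OF p(5,6), of "%j :: 'j. (0 :: 'i, j)" "%_ :: unit. (0 :: 'i, 0 :: 'j)" \<delta> "%w v. (fst w, snd v)" ?b "%w v. (fst v, snd w)" \<kappa>]
   by (simp add: inj_on_def \<delta>_def)
  also have "... <= ennreal C * ?X \<delta> * ?Y ?b" by (rule C)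
  also have "?Y ?b = ennreal (u2 0) * wlp q2 v2 b" unfolding seq_norm_tensor[OF p(3,4)] wlp_delta[OF p(3)] ..
  finally show "wlp q (%j. \<kappa> (0, j)) b <= (ennreal C * ?X \<delta> * ennreal (u2 0)) * wlp q2 v2 b"
   by (simp only: mult.assoc)
 qed (simp add: X\<delta> ennreal_mult_less_top)
next
 assume E: "?E1 \<and> ?E2 \<and> ?E3"
 obtain C1 where C1: "!!a. lp q (%i. lp p (%n. a (i, n)) * ennreal (\<kappa> (i, 0))) <= ennreal C1 * ?X a" using E unfolding emb_def by blast
 obtain C2 where C2: "!!a. wlp p (%_. 1) a <= ennreal C2 * wlp p2 u2 a" using E unfolding emb_def by blast
 obtain C3 where C3: "!!a. wlp q (%j. \<kappa> (0, j)) a <= ennreal C3 * wlp q2 v2 a" using E unfolding emb_def by blast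
 show "bemb ?X ?Y ?Z"
 proof (rule bembI)
  fix a :: "'i \<times> 'j => ennreal" and b :: "'i \<times> 'j => ennreal"
  let ?F = "%i. lp p (%n. a (i, n)) * ennreal (\<kappa> (i, 0))" and ?G = "%j. lp p (%k. b (k, j)) * ennreal (\<kappa> (0, j))"
  have "?Z a b = lp q (%w. (lp p (%n. a (fst w, n)) * lp p (%k. b (k, snd w))) * ennreal (\<kappa> w))"
   using p by (simp add: bilin_norm_def lp_pair[OF p(5)] lp_multc lp_cmult)
  also have "... <= lp q (%w. ennreal K * (?F (fst w) * ?G (snd w)))"
  proof (rule lp_mono[OF p(6)])
   fix w :: "'i \<times> 'j"
   have "ennreal (\<kappa> w) <= ennreal (K * (\<kappa> (fst w, 0) * \<kappa> (0, snd w)))" using \<kappa>(1)[of "fst w" "snd w"] by (intro ennreal_leI) simp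
   also have "... = ennreal K * (ennreal (\<kappa> (fst w, 0)) * ennreal (\<kappa> (0, snd w)))" using \<kappa> by (simp add: ennreal_mult')
   finally have "(lp p (%n. a (fst w, n)) * lp p (%k. b (k, snd w))) * ennreal (\<kappa> w)
    <= (lp p (%n. a (fst w, n)) * lp p (%k. b (k, snd w))) * (ennreal K * (ennreal (\<kappa> (fst w, 0)) * ennreal (\<kappa> (0, snd w))))"
    by (rule mult_left_mono) simp
   then show "(lp p (%n. a (fst w, n)) * lp p (%k. b (k, snd w))) * ennreal (\<kappa> w) <= ennreal K * (?F (fst w) * ?G (snd w))"
    by (simp add: mult_ac)
  qed
  also have "... = ennreal K * (lp q ?F * lp q ?G)"
  proof -
   have "lp q (%w. ?F (fst w) * ?G (snd w)) = lp q ?F * lp q ?G"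
    unfolding lp_pair[OF p(6), of "%w. ?F (fst w) * ?G (snd w)"] fst_conv snd_conv
    by (subst lp_multc[OF p(6)]) (rule lp_cmult[OF p(6)])
   then show ?thesis by (subst lp_cmult[OF p(6)]) simp
  qed
  also have "... <= ennreal K * ((ennreal C1 * ?X a) * (ennreal C3 * (ennreal C2 * ?Y b)))"
  proof (intro mult_left_mono mult_mono C1)
   have "lp q ?G <= ennreal C3 * wlp q2 v2 (%j. lp p (%k. b (k, j)))"
    using C3[of "%j. lp p (%k. b (k, j))"] by (simp add: wlp_def)
   also have "... <= ennreal C3 * wlp q2 v2 (%j. ennreal C2 * wlp p2 u2 (%k. b (k, j)))"
    using C2 by (intro mult_left_mono wlp_mono p) (auto simp: wlp_def)
   also have "... = ennreal C3 * (ennreal C2 * ?Y b)" using p by (simp add: wlp_cmult seq_norm_def)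
   finally show "lp q ?G <= ..." .
  qed auto
  finally show "?Z a b <= (ennreal K * ennreal C1 * ennreal C2 * ennreal C3) * ?X a * ?Y b" by (simp add: mult_ac)
 qed (simp add: ennreal_mult_less_top)
qed

section \<open>From sequences in [0, top] to complex sequences\<close>

lemma ennreal_factor_finite:
 fixes a x y :: ennreal
 assumes "a * x <= y" "y < top" "x \<noteq> 0" shows "a < top"
proof -
 have "a * x \<noteq> top" using assms(1,2) by (metis less_le_not_le top_greatest)
 then show ?thesis using assms(3) by (auto simp: ennreal_mult_eq_top_iff less_top)
qed

text \<open>If a weight x i vanished, the delta at i would have norm 0 and a nonzero image. So the
  inclusion makes these weights positive, and finite norm then forces finite entries, which are
  moduli of complex numbers.\<close>

lemma embeds_iff_emb:
 assumes x: "!!a i. a i * x i <= X a" "!!i. X (indicator {i}) = x i" and z: "!!i. 0 < Z (indicator {i})"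
 shows "embeds (%a. X (%i. ennreal (norm (a i)))) (%a. Z (%i. ennreal (norm (a i)))) \<longleftrightarrow> emb X Z"
proof
 assume "embeds (%a. X (%i. ennreal (norm (a i)))) (%a. Z (%i. ennreal (norm (a i))))"
 then obtain C where C': "C > 0 \<and> (\<forall>a :: _ => complex. X (%i. ennreal (norm (a i))) < \<infinity> \<longrightarrow> Z (%i. ennreal (norm (a i))) <= ennreal C * X (%i. ennreal (norm (a i))))"
  unfolding embeds_def by (rule exE)
 note C = conjunct1[OF C'] conjunct2[OF C', rule_format]
 have pos: "x i \<noteq> 0" for i
 proof
  assume "x i = 0"
  have eq: "(%j. ennreal (norm (if j = i then 1 else 0 :: complex))) = indicator {i}" by (auto simp: fun_eq_iff)
  from C(2)[of "%j. if j = i then 1 else 0", unfolded eq] show False using z[of i] \<open>x i = 0\<close> x(2)[of i] by simp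
 qed
 show "emb X Z" unfolding emb_def
 proof (intro exI conjI allI)
  show "0 < C" by fact
  fix a
  show "Z a <= ennreal C * X a"
  proof (cases "X a = top")
   case True
   then show ?thesis using C(1) by (simp add: ennreal_mult_top)
  next
   case False
   have fin: "a i < top" for i using x(1)[of a i] False pos[of i] by (intro ennreal_factor_finite[of "a i" "x i"]) (auto simp: less_top)
   then have "(%i. ennreal (norm (complex_of_real (enn2real (a i))))) = a" by (simp add: fun_eq_iff)
   with C(2)[of "%i. complex_of_real (enn2real (a i))"] False show ?thesis by (simp add: less_top)
  qed
 qed
next
 assume "emb X Z"
 then obtain C where "C > 0 \<and> (\<forall>a. Z a <= ennreal C * X a)" unfolding emb_def by (rule exE)
 then show "embeds (%a. X (%i. ennreal (norm (a i)))) (%a. Z (%i. ennreal (norm (a i))))"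
  unfolding embeds_def by (intro exI[of _ C]) simp
qed

lemma lp_1: "lp 1 f = (\<integral>\<^sup>+ x. f x \<partial>count_space UNIV)"
 using Lp_norm_ennreal[of 1] by simp

text \<open>Raising everything to the power P turns the l^P sum of products into an ordinary
  convolution sum and divides the exponents by P; the P-th power is a bijection of [0, top].\<close>

lemma bemb_conv_norm_powr:
 fixes \<kappa> :: "'i::{countable, ab_group_add} => real"
 assumes P: "0 < P" and p: "0 < p1" "0 < p2" "0 < q" and nn: "!!k. 0 <= u k" "!!k. 0 <= w k" "!!k. 0 <= \<kappa> k"
 shows "bemb (wlp p1 u) (wlp p2 w) (conv_norm (ennreal P) q \<kappa>) \<longleftrightarrow>
  bemb (wlp (p1 / ennreal P) (%k. u k powr P)) (wlp (p2 / ennreal P) (%k. w k powr P)) (conv_norm 1 (q / ennreal P) (%k. \<kappa> k powr P))"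
  (is "bemb ?X ?Y ?Z \<longleftrightarrow> bemb ?X' ?Y' ?Z'")
proof -
 have ew: "wlp (r / ennreal P) (%k. v k powr P) (%k. epowr (a k) P) = epowr (wlp r v a) P"
  if "0 < r" "!!k. 0 <= v k" for r and v :: "'i => real" and a
 proof -
  have "(%k. epowr (a k) P * ennreal (v k powr P)) = (%k. epowr (a k * ennreal (v k)) P)"
   using that P by (simp add: epowr_mult epowr_ennreal)
  then show ?thesis using Lp_norm_epowr[OF that(1) P, of "%k. a k * ennreal (v k)" "count_space UNIV"] by (simp add: wlp_def)
 qed
 have X: "?X' (%k. epowr (a k) P) = epowr (?X a) P" for a by (rule ew[OF p(1) nn(1)])
 have Y: "?Y' (%k. epowr (b k) P) = epowr (?Y b) P" for b by (rule ew[OF p(2) nn(2)])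
 have Z: "?Z' (%k. epowr (a k) P) (%k. epowr (b k) P) = epowr (?Z a b) P" for a b
 proof -
  have "lp 1 (%k. epowr (a k) P * epowr (b (i - k)) P) = epowr (lp (ennreal P) (%k. a k * b (i - k))) P" for i
   using P by (simp add: lp_1 epowr_Lp_norm epowr_mult)
  then show ?thesis
   using ew[OF p(3) nn(3), where a = "%i. lp (ennreal P) (%k. a k * b (i - k))"] by (simp add: bilin_norm_def wlp_def)
 qed
 show ?thesis
 proof
  assume "bemb ?X ?Y ?Z"
  then obtain C where C: "!!a b. ?Z a b <= ennreal C * ?X a * ?Y b" unfolding bemb_def by blast
  show "bemb ?X' ?Y' ?Z'"
  proof (rule bembI)
   show "epowr (ennreal C) P < top" by (simp add: less_top[symmetric] epowr_eq_top_iff)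
   fix a b :: "'i => ennreal"
   define a' where "a' = (%k. epowr (a k) (1 / P))"
   define b' where "b' = (%k. epowr (b k) (1 / P))"
   have ab: "a = (%k. epowr (a' k) P)" "b = (%k. epowr (b' k) P)" using P by (simp_all add: a'_def b'_def epowr_epowr)
   have "?Z' a b = epowr (?Z a' b') P" unfolding ab by (rule Z)
   also have "... <= epowr (ennreal C * ?X a' * ?Y b') P" by (rule epowr_mono[OF P C])
   also have "... = epowr (ennreal C) P * ?X' a * ?Y' b" unfolding ab X Y epowr_mult[OF P] ..
   finally show "?Z' a b <= epowr (ennreal C) P * ?X' a * ?Y' b" .
  qed
 next
  assume "bemb ?X' ?Y' ?Z'"
  then obtain C where C: "!!a b. ?Z' a b <= ennreal C * ?X' a * ?Y' b" unfolding bemb_def by blast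
  show "bemb ?X ?Y ?Z"
  proof (rule bembI)
   show "epowr (ennreal C) (1 / P) < top" by (simp add: less_top[symmetric] epowr_eq_top_iff)
   fix a b :: "'i => ennreal"
   have "epowr (?Z a b) P <= ennreal C * epowr (?X a) P * epowr (?Y b) P" unfolding X[symmetric] Y[symmetric] Z[symmetric] by (rule C)
   also have "... = epowr (epowr (ennreal C) (1 / P) * ?X a * ?Y b) P" using P by (simp add: epowr_mult epowr_epowr)
   finally show "?Z a b <= epowr (ennreal C) (1 / P) * ?X a * ?Y b" using epowr_le_iff[OF P] by blast
  qed
 qed
qed

text \<open>For nonnegative sequences the complex convolution is the sum \<open>F\<close> itself. In
  the other direction absolute convergence is automatic: a finite norm of \<open>F\<close> with a
  positive weight makes \<open>F\<close> finite everywhere.\<close>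

lemma conv_embeds_iff_bemb:
 fixes \<kappa> u w :: "'i::{countable, ab_group_add} => real"
 assumes r: "0 < r1" "0 < r2" "0 < r" and \<kappa>: "!!k. 0 < \<kappa> k"
 shows "conv_embeds (%a. wlp r1 u (%i. ennreal (norm (a i)))) (%a. wlp r2 w (%i. ennreal (norm (a i))))
   (%a. wlp r \<kappa> (%i. ennreal (norm (a i)))) \<longleftrightarrow> bemb (wlp r1 u) (wlp r2 w) (conv_norm 1 r \<kappa>)"
proof -
 define F where "F = (%a b (i :: 'i). \<integral>\<^sup>+ k. a k * b (i - k) \<partial>count_space UNIV)"
 have cn: "conv_norm 1 r \<kappa> a b = wlp r \<kappa> (F a b)" for a b by (simp add: bilin_norm_def wlp_def F_def lp_1)
 have summ: "(%k. norm (a k * b (n - k))) summable_on UNIV \<longleftrightarrow> F (%i. ennreal (norm (a i))) (%i. ennreal (norm (b i))) n < top"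
  and infs: "F (%i. ennreal (norm (a i))) (%i. ennreal (norm (b i))) n < top ==>
   ennreal (infsum (%k. norm (a k * b (n - k))) UNIV) = F (%i. ennreal (norm (a i))) (%i. ennreal (norm (b i))) n"
  for a b :: "'i => complex" and n
 proof -
  have FF: "F (%i. ennreal (norm (a i))) (%i. ennreal (norm (b i))) n = (\<integral>\<^sup>+ k. ennreal (norm (a k * b (n - k))) \<partial>count_space UNIV)"
   by (simp add: F_def norm_mult ennreal_mult')
  have iff: "(%k. norm (a k * b (n - k))) summable_on UNIV \<longleftrightarrow> integrable (count_space UNIV) (%k. a k * b (n - k))"
   using abs_summable_equivalent[of "%k. a k * b (n - k)" UNIV] unfolding abs_summable_on_def .
  show "(%k. norm (a k * b (n - k))) summable_on UNIV \<longleftrightarrow> F (%i. ennreal (norm (a i))) (%i. ennreal (norm (b i))) n < top"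
   unfolding iff FF by (simp add: integrable_iff_bounded)
  assume "F (%i. ennreal (norm (a i))) (%i. ennreal (norm (b i))) n < top"
  then have int': "integrable (count_space UNIV) (%k. a k * b (n - k))" unfolding FF by (simp add: integrable_iff_bounded)
  note int = integrable_norm[OF int']
  have "infsum (%k. norm (a k * b (n - k))) UNIV = (\<integral> k. norm (a k * b (n - k)) \<partial>count_space UNIV)"
   using infsetsum_infsum[of "%k. norm (a k * b (n - k))" UNIV] int unfolding abs_summable_on_def infsetsum_def by simp
  then show "ennreal (infsum (%k. norm (a k * b (n - k))) UNIV) = F (%i. ennreal (norm (a i))) (%i. ennreal (norm (b i))) n"
   unfolding FF using nn_integral_eq_integral[OF int] by simp
 qed
 let ?n = "%(a :: 'i => complex) i. ennreal (norm (a i))"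
 show ?thesis
 proof
  assume "bemb (wlp r1 u) (wlp r2 w) (conv_norm 1 r \<kappa>)"
  then obtain C where C: "0 < C" "!!a b. wlp r \<kappa> (F a b) <= ennreal C * wlp r1 u a * wlp r2 w b" unfolding bemb_def cn by blast
  show "conv_embeds (%a. wlp r1 u (?n a)) (%a. wlp r2 w (?n a)) (%a. wlp r \<kappa> (?n a))"
   unfolding conv_embeds_def
  proof (intro exI[of _ C] conjI allI impI C(1))
   fix a b :: "'i => complex"
   assume fin: "wlp r1 u (?n a) < \<infinity>" "wlp r2 w (?n b) < \<infinity>"
   have "wlp r \<kappa> (F (?n a) (?n b)) < top"
    using C(2)[of "?n a" "?n b"] fin by (auto intro: le_less_trans simp: ennreal_mult_less_top)
   then have lt: "F (?n a) (?n b) n < top" for n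
    by (rule ennreal_factor_finite[OF lp_ge[OF r(3), of "%k. F (?n a) (?n b) k * ennreal (\<kappa> k)" n, folded wlp_def]])
     (use \<kappa>[of n] in \<open>simp add: ennreal_eq_0_iff\<close>)
   then show "(%k. norm (a k * b (n - k))) summable_on UNIV" for n unfolding summ by blast
   have "ennreal (norm (Defs.convolution a b n)) <= F (?n a) (?n b) n" for n
    unfolding Defs.convolution_def infs[OF lt, symmetric] using lt[of n] by (intro ennreal_leI norm_infsum_bound) (simp add: summ)
   then have "wlp r \<kappa> (?n (Defs.convolution a b)) <= wlp r \<kappa> (F (?n a) (?n b))" by (intro wlp_mono r)
   also have "... <= ennreal C * wlp r1 u (?n a) * wlp r2 w (?n b)" by (rule C)
   finally show "wlp r \<kappa> (?n (Defs.convolution a b)) <= ennreal C * wlp r1 u (?n a) * wlp r2 w (?n b)" .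
  qed
 next
  assume "conv_embeds (%a. wlp r1 u (?n a)) (%a. wlp r2 w (?n a)) (%a. wlp r \<kappa> (?n a))"
  then obtain C where C: "0 < C" "!!a b. wlp r1 u (?n a) < \<infinity> ==> wlp r2 w (?n b) < \<infinity> ==>
   (\<forall>n. F (?n a) (?n b) n < top) \<and> wlp r \<kappa> (?n (Defs.convolution a b)) <= ennreal C * wlp r1 u (?n a) * wlp r2 w (?n b)"
   unfolding conv_embeds_def summ by blast
  define \<delta> where "\<delta> = (%i j :: 'i. if j = i then 1 else 0 :: complex)"
  have n\<delta>: "?n (\<delta> i) = indicator {i}" for i by (auto simp: fun_eq_iff \<delta>_def)
  have W\<delta>: "wlp s v (?n (\<delta> i)) = ennreal (v i)" if "0 < s" for s v i unfolding n\<delta> by (rule wlp_delta[OF that])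
  \<comment> \<open>Deltas convolve to deltas, so positivity of \<kappa> (i + j) forces u i and w j
    to be positive.\<close>
  have "Defs.convolution (\<delta> i) (\<delta> j) = \<delta> (i + j)" for i j
  proof
   fix n
   have "Defs.convolution (\<delta> i) (\<delta> j) n = infsum (%k. \<delta> i k * \<delta> j (n - k)) {i}"
    unfolding Defs.convolution_def by (rule infsum_cong_neutral) (auto simp: \<delta>_def)
   then show "Defs.convolution (\<delta> i) (\<delta> j) n = \<delta> (i + j) n" by (auto simp: \<delta>_def algebra_simps)
  qed
  then have "ennreal (\<kappa> (i + j)) <= ennreal C * ennreal (u i) * ennreal (w j)" for i j
   using C(2)[of "\<delta> i" "\<delta> j"] by (simp add: W\<delta> r)
  then have "0 < ennreal C * ennreal (u i) * ennreal (w j)" for i j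
   using \<kappa>[of "i + j"] by (metis ennreal_less_zero_iff less_le_trans)
  then have "0 < ennreal (u i)" "0 < ennreal (w i)" for i by (auto simp: ennreal_zero_less_mult_iff)
  then have pos: "0 < u i" "0 < w i" for i by (simp_all add: ennreal_less_zero_iff)
  \<comment> \<open>A zero norm has to force the zero sequence, since the right-hand side is then 0
    even if the other norm is \<open>top\<close>.\<close>
  have zero: "a = (%_. 0)" if "wlp s v a = 0" "0 < s" "!!i. 0 < v i" for s a and v :: "'i => real"
  proof
   fix i
   have "a i * ennreal (v i) <= 0" using lp_ge[OF that(2), of "%i. a i * ennreal (v i)" i] that(1) by (simp add: wlp_def)
   then show "a i = 0" using that(3)[of i] by (simp add: not_le[symmetric])
  qed
  show "bemb (wlp r1 u) (wlp r2 w) (conv_norm 1 r \<kappa>)"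
   unfolding bemb_def cn
  proof (intro exI[of _ C] conjI allI C(1))
   fix a b :: "'i => ennreal"
   show "wlp r \<kappa> (F a b) <= ennreal C * wlp r1 u a * wlp r2 w b"
   proof (cases "wlp r1 u a = 0 \<or> wlp r2 w b = 0")
    case True
    then have "a = (%_. 0) \<or> b = (%_. 0)" using zero r pos by blast
    then have "F a b = (%_. 0)" by (auto simp: F_def)
    then show ?thesis using r by (simp add: wlp_def)
   next
    case nz: False
    show ?thesis
    proof (cases "wlp r1 u a = top \<or> wlp r2 w b = top")
     case True
     then have "ennreal C * wlp r1 u a * wlp r2 w b = top" using nz C(1) by (auto simp: ennreal_mult_eq_top_iff)
     then show ?thesis by simp
    next
     case False
     have fin: "c i < top" if "wlp s v c \<noteq> top" "0 < s" "!!i. 0 < v i" for s c i and v :: "'i => real"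
      by (rule ennreal_factor_finite[OF lp_ge[OF that(2), of "%i. c i * ennreal (v i)" i, folded wlp_def]])
       (use that(1) that(3)[of i] in \<open>auto simp: ennreal_eq_0_iff less_top[symmetric]\<close>)
     define a' where "a' = (%i. complex_of_real (enn2real (a i)))"
     define b' where "b' = (%i. complex_of_real (enn2real (b i)))"
     have eq: "?n a' = a" "?n b' = b"
      using fin[of r1 u a, OF _ r(1) pos(1)] fin[of r2 w b, OF _ r(2) pos(2)] False by (auto simp: a'_def b'_def fun_eq_iff)
     note C' = C(2)[of a' b', unfolded eq]
     have lt: "F a b n < top" for n using C' False by (simp add: less_top)
     have "Defs.convolution a' b' n = complex_of_real (infsum (%k. norm (a' k * b' (n - k))) UNIV)" for n
     proof -
      have "((%k. complex_of_real (norm (a' k * b' (n - k)))) has_sum complex_of_real (infsum (%k. norm (a' k * b' (n - k))) UNIV)) UNIV"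
       using summ[of a' b' n, unfolded eq] lt[of n] by (intro has_sum_of_real has_sum_infsum) simp
      from infsumI[OF this] show ?thesis unfolding Defs.convolution_def by (simp add: a'_def b'_def norm_mult)
     qed
     then have "?n (Defs.convolution a' b') = F a b"
      using infs[of a' b', unfolded eq, OF lt] by (auto simp: fun_eq_iff infsum_nonneg)
     then show ?thesis using C' False by (simp add: less_top)
    qed
   qed
  qed
 qed
qed

section \<open>Discretization of the boundedness\<close>

definition wdom :: "('i => real) => ('i => real) => bool" where
 "wdom u v \<longleftrightarrow> (\<exists>C>0. \<forall>k. u k <= C * v k)"

lemma weight_equiv_wdom: "weight_equiv \<omega> \<omega>' ==> wdom (%k. \<omega> (x k)) (%k. \<omega>' (x k)) \<and> wdom (%k. \<omega>' (x k)) (%k. \<omega> (x k))"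
 unfolding weight_equiv_def wdom_def by (metis mult_1 zero_less_one)

lemma wdomE:
 assumes "wdom u v" obtains c where "c < top" "!!k. ennreal (u k) <= c * ennreal (v k)"
proof -
 obtain C where C: "0 < C" "!!k. u k <= C * v k" using assms unfolding wdom_def by blast
 show thesis
 proof (rule that[of "ennreal C"])
  show "ennreal (u k) <= ennreal C * ennreal (v k)" for k
   using C ennreal_leI[OF C(2)] by (simp add: ennreal_mult')
 qed simp
qed

lemma seq_norm_wdom:
 assumes p: "0 < p" "0 < q" and "wdom u u'" "wdom v v'"
 obtains c where "c < top" "!!a. seq_norm p q u v a <= c * seq_norm p q u' v' a"
proof -
 obtain c1 where c1: "c1 < top" "!!k. ennreal (u k) <= c1 * ennreal (u' k)" by (rule wdomE[OF assms(3)]) (rule that; assumption)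
 obtain c2 where c2: "c2 < top" "!!k. ennreal (v k) <= c2 * ennreal (v' k)" by (rule wdomE[OF assms(4)]) (rule that; assumption)
 have le: "wlp r w a <= c * wlp r w' a" if "0 < r" "!!k. ennreal (w k) <= c * ennreal (w' k)" for r w w' c and a :: "'x => ennreal"
 proof -
  have "wlp r w a <= lp r (%k. c * (a k * ennreal (w' k)))"
   unfolding wlp_def using that(2) by (intro lp_mono that(1)) (metis mult.left_commute mult_left_mono zero_le)
  then show ?thesis using that(1) by (simp add: lp_cmult wlp_def)
 qed
 show thesis
 proof (rule that[of "c2 * c1"])
  fix a
  have "seq_norm p q u v a <= c2 * wlp q v' (%n. c1 * wlp p u' (%k. a (k, n)))"
   unfolding seq_norm_def
   by (rule order_trans[OF le[OF p(2) c2(2)] mult_left_mono[OF wlp_mono[OF p(2) le[OF p(1) c1(2)]]]]) simp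
  then show "seq_norm p q u v a <= c2 * c1 * seq_norm p q u' v' a"
   using p by (simp add: wlp_cmult seq_norm_def mult.assoc)
 qed (use c1 c2 in \<open>simp add: ennreal_mult_less_top\<close>)
qed

lemma bemb_wdom:
 assumes p: "0 < p1" "0 < q1" "0 < p2" "0 < q2" "0 < p" "0 < q"
  and w: "wdom u1 u1'" "wdom v1 v1'" "wdom u2 u2'" "wdom v2 v2'" "wdom \<kappa>' \<kappa>"
  and D: "bemb (seq_norm p1 q1 u1 v1) (seq_norm p2 q2 u2 v2) (bilin_norm p q A B \<kappa>)"
 shows "bemb (seq_norm p1 q1 u1' v1') (seq_norm p2 q2 u2' v2') (bilin_norm p q A B \<kappa>')"
proof -
 obtain C where C: "!!a b. bilin_norm p q A B \<kappa> a b <= ennreal C * seq_norm p1 q1 u1 v1 a * seq_norm p2 q2 u2 v2 b"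
  using D unfolding bemb_def by blast
 obtain c1 where c1: "c1 < top" "!!a. seq_norm p1 q1 u1 v1 a <= c1 * seq_norm p1 q1 u1' v1' a"
  by (rule seq_norm_wdom[OF p(1,2) w(1,2)]) (rule that; assumption)
 obtain c2 where c2: "c2 < top" "!!a. seq_norm p2 q2 u2 v2 a <= c2 * seq_norm p2 q2 u2' v2' a"
  by (rule seq_norm_wdom[OF p(3,4) w(3,4)]) (rule that; assumption)
 obtain c where c: "c < top" "!!k. ennreal (\<kappa>' k) <= c * ennreal (\<kappa> k)" by (rule wdomE[OF w(5)]) (rule that; assumption)
 show ?thesis
 proof (rule bembI)
  fix a b
  have "bilin_norm p q A B \<kappa>' a b <= lp q (%w. c * (lp p (%v. a (A w v) * b (B w v)) * ennreal (\<kappa> w)))"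
   unfolding bilin_norm_def using c(2) by (intro lp_mono p) (metis mult.left_commute mult_left_mono zero_le)
  also have "... = c * bilin_norm p q A B \<kappa> a b" using p by (simp add: lp_cmult bilin_norm_def)
  also have "... <= c * (ennreal C * (c1 * seq_norm p1 q1 u1' v1' a) * (c2 * seq_norm p2 q2 u2' v2' b))"
   by (intro mult_left_mono order_trans[OF C] mult_mono c1 c2) auto
  finally show "bilin_norm p q A B \<kappa>' a b <= (c * ennreal C * c1 * c2) * seq_norm p1 q1 u1' v1' a * seq_norm p2 q2 u2' v2' b"
   by (simp add: mult_ac)
 qed (use c1 c2 c in \<open>simp add: ennreal_mult_less_top\<close>)
qed

lemma lat_norm_eq_seq_norm:
 assumes "0 < p" "0 < q" "!!x. 0 <= \<omega> x"
 shows "lat_norm \<alpha> \<beta> p q \<omega> \<mu> = seq_norm p q (%k. \<omega> (lpt \<alpha> k)) (%n. \<mu> (lpt \<beta> n))"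
 using assms by (simp add: fun_eq_iff lat_norm_def seq_norm_def wlp_def ennreal_mult' lp_multc mult.assoc[symmetric])

text \<open>The nodes in z may depend on the node in \<zeta>, so that by the hypotheses AB all
  transformed points fall on lattices. Sampling turns the inequality between maximal functions into
  one for their samples; the test functions make it hold for all finitely supported sequences, and
  monotone convergence for all others.\<close>

lemma wigner_bounded_iff_bemb:
 fixes \<phi> :: "real^'d => complex" and \<Phi> :: "(real^'d) \<times> (real^'d) => complex"
  and A B :: "(int^'d) \<times> (int^'d) => (int^'d) \<times> (int^'d) => (int^'d) \<times> (int^'d)"
  and \<nu>1 :: "(int^'d) \<times> (int^'d) => (int^'d) \<times> (int^'d) => (real^'d) \<times> (real^'d)"
 assumes \<phi>: "\<phi> \<in> schwartz" "\<phi> \<noteq> (%_. 0)" and \<Phi>: "\<Phi> \<in> schwartz" "\<Phi> \<noteq> (%_. 0)"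
  and p: "0 < p1" "0 < q1" "0 < p2" "0 < q2" "0 < p" "0 < q" and \<tau>: "0 <= \<tau>" "\<tau> <= 1"
  and pw: "poly_weight \<omega>1" "poly_weight \<mu>1" "poly_weight \<omega>2" "poly_weight \<mu>2" "poly_weight m"
  and s: "0 < \<alpha>1" "0 < \<beta>1" "0 < \<alpha>2" "0 < \<beta>2"
  and \<nu>: "!!w. sampling v1 D1 (\<nu>1 w)" "sampling v2 D2 \<nu>2"
  and AB: "!!w v. fst (\<nu>2 w) + \<tau> *\<^sub>R snd (\<nu>1 w v) = lpt \<alpha>1 (fst (A w v))"
   "!!w v. snd (\<nu>2 w) - (1 - \<tau>) *\<^sub>R fst (\<nu>1 w v) = lpt \<beta>1 (snd (A w v))"
   "!!w v. fst (\<nu>2 w) - (1 - \<tau>) *\<^sub>R snd (\<nu>1 w v) = lpt \<alpha>2 (fst (B w v))"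
   "!!w v. snd (\<nu>2 w) + \<tau> *\<^sub>R fst (\<nu>1 w v) = lpt \<beta>2 (snd (B w v))"
 shows "wigner_bounded \<phi> \<Phi> \<tau> p1 q1 (tensor \<omega>1 \<mu>1) p2 q2 (tensor \<omega>2 \<mu>2) p q m \<longleftrightarrow>
  bemb (seq_norm p1 q1 (%k. \<omega>1 (lpt \<alpha>1 k)) (%n. \<mu>1 (lpt \<beta>1 n)))
   (seq_norm p2 q2 (%k. \<omega>2 (lpt \<alpha>2 k)) (%n. \<mu>2 (lpt \<beta>2 n)))
   (bilin_norm p q A B (%w. m (\<nu>2 w)))" (is "?L \<longleftrightarrow> _")
proof -
 obtain \<omega>1' \<mu>1' \<omega>2' \<mu>2' m' where w: "weight_equiv \<omega>1 \<omega>1'" "weight_equiv \<mu>1 \<mu>1'" "weight_equiv \<omega>2 \<omega>2'"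
  "weight_equiv \<mu>2 \<mu>2'" "weight_equiv m m'" using pw[THEN poly_weight_equiv] by blast
 obtain L1 where w1: "moderate L1 \<omega>1'" using w by (auto simp: weight_equiv_def)
 obtain L2 where w2: "moderate L2 \<mu>1'" using w by (auto simp: weight_equiv_def)
 obtain L3 where w3: "moderate L3 \<omega>2'" using w by (auto simp: weight_equiv_def)
 obtain L4 where w4: "moderate L4 \<mu>2'" using w by (auto simp: weight_equiv_def)
 obtain L where m: "moderate L m'" using w by (auto simp: weight_equiv_def)
 obtain N0 where wig: "!!K. N0 <= K ==> ?L \<longleftrightarrow> (\<exists>C>0. \<forall>f\<in>schwartz. \<forall>g\<in>schwartz. pair_norm \<tau> (2 * K) p q m' f g
   <= ennreal C * peetre_norm (2 * K) p1 q1 \<omega>1' \<mu>1' (VG f) * peetre_norm (2 * K) p2 q2 \<omega>2' \<mu>2' (VG g))"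
  by (rule wigner_bounded_iff_peetre[OF \<phi> \<Phi> p \<tau> w]) (rule that; assumption)
 obtain N1 where test1: "!!N. N1 <= N ==> \<exists>C>0. \<forall>a :: (int^'d) \<times> (int^'d) => real. finite {w. a w \<noteq> 0} \<longrightarrow> (\<forall>w. 0 <= a w) \<longrightarrow>
  (\<exists>f\<in>schwartz. (\<forall>w. a w <= peetre N (VG f) (lpt \<alpha>1 (fst w)) (lpt \<beta>1 (snd w))) \<and>
   peetre_norm N p1 q1 \<omega>1' \<mu>1' (VG f) <= ennreal C * lat_norm \<alpha>1 \<beta>1 p1 q1 \<omega>1' \<mu>1' (%w. ennreal (a w)))"
  by (rule test_function[OF s(1,2) p(1,2) w1 w2]) (rule that; assumption)
 obtain N2 where test2: "!!N. N2 <= N ==> \<exists>C>0. \<forall>a :: (int^'d) \<times> (int^'d) => real. finite {w. a w \<noteq> 0} \<longrightarrow> (\<forall>w. 0 <= a w) \<longrightarrow>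
  (\<exists>f\<in>schwartz. (\<forall>w. a w <= peetre N (VG f) (lpt \<alpha>2 (fst w)) (lpt \<beta>2 (snd w))) \<and>
   peetre_norm N p2 q2 \<omega>2' \<mu>2' (VG f) <= ennreal C * lat_norm \<alpha>2 \<beta>2 p2 q2 \<omega>2' \<mu>2' (%w. ennreal (a w)))"
  by (rule test_function[OF s(3,4) p(3,4) w3 w4]) (rule that; assumption)
 \<comment> \<open>One index for the norm equivalences and for both families of test
   functions.\<close>
 define K where "K = max N0 (max N1 N2)"
 define N where "N = 2 * K"
 have N: "N0 <= K" "N1 <= N" "N2 <= N" by (auto simp: K_def N_def)
 define S1 :: "(real^'d => complex) => (int^'d) \<times> (int^'d) => real"
  where "S1 = (%f w. peetre N (VG f) (lpt \<alpha>1 (fst w)) (lpt \<beta>1 (snd w)))"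
 define S2 :: "(real^'d => complex) => (int^'d) \<times> (int^'d) => real"
  where "S2 = (%f w. peetre N (VG f) (lpt \<alpha>2 (fst w)) (lpt \<beta>2 (snd w)))"
 define X1 where "X1 = (%f. peetre_norm N p1 q1 \<omega>1' \<mu>1' (VG f))"
 define X2 where "X2 = (%f. peetre_norm N p2 q2 \<omega>2' \<mu>2' (VG f))"
 define Y1 where "Y1 = lat_norm \<alpha>1 \<beta>1 p1 q1 \<omega>1' \<mu>1'"
 define Y2 where "Y2 = lat_norm \<alpha>2 \<beta>2 p2 q2 \<omega>2' \<mu>2'"
 define Q where "Q = bilin_norm p q A B (%w. m' (\<nu>2 w))"
 define P where "P = pair_norm \<tau> N p q m'"
 have bm: "bimoderate N (peetre N (VG f))" if f: "f \<in> schwartz" for f :: "real^'d => complex"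
 proof -
  obtain B where B: "!!x \<xi>. norm (VG f x \<xi>) <= B" using VG_bdd[OF f] by blast
  show ?thesis by (rule peetre_bimoderate[of "VG f", OF B])
 qed
 have samp: "\<exists>C>0. \<forall>f\<in>schwartz. lat_norm \<alpha> \<beta> r t \<omega> \<mu> (%w. ennreal (peetre N (VG f) (lpt \<alpha> (fst w)) (lpt \<beta> (snd w))))
  <= ennreal C * peetre_norm N r t \<omega> \<mu> (VG f)"
  if h: "0 < \<alpha>" "0 < \<beta>" "0 < r" "0 < t" "moderate M \<omega>" "moderate M' \<mu>" for \<alpha> \<beta> r t M M' and \<omega> \<mu> :: "real^'d => real"
  by (rule sampled_norm[OF h, where N = N]) (use bm in \<open>unfold peetre_norm_def, blast\<close>)
 have s1: "\<exists>C>0. \<forall>f\<in>schwartz. Y1 (%w. ennreal (S1 f w)) <= ennreal C * X1 f"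
  unfolding Y1_def S1_def X1_def by (rule samp[OF s(1,2) p(1,2) w1 w2])
 have s2: "\<exists>C>0. \<forall>f\<in>schwartz. Y2 (%w. ennreal (S2 f w)) <= ennreal C * X2 f"
  unfolding Y2_def S2_def X2_def by (rule samp[OF s(3,4) p(3,4) w3 w4])
 define D where "D = D1 + D2"
 define c where "c = ((1 + D) ^ N * (1 + D) ^ N) ^ 2 * (1 + D2) ^ L"
 have D: "0 <= D1" "0 <= D2" "0 < v1" "0 < v2" using \<nu> by (auto simp: sampling_def)
 have c: "0 < c" using D by (auto simp: c_def D_def intro!: mult_pos_pos zero_less_power add_pos_nonneg)
 define \<kappa> where "\<kappa> = cell_const p v1 * cell_const q v2"
 have "0 < \<kappa>" "\<kappa> < top" using D by (auto simp: \<kappa>_def cell_const_pos cell_const_finite ennreal_mult_less_top ennreal_zero_less_mult_iff)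
 then obtain k where k: "\<kappa> = ennreal k" "0 < k" by (cases \<kappa>) auto
 have PQ: "P f g <= ennreal (k * c\<^sup>2) * Q (%w. ennreal (S1 f w)) (%w. ennreal (S2 g w))"
  "Q (%w. ennreal (S1 f w)) (%w. ennreal (S2 g w)) <= ennreal (c\<^sup>2 / k) * P f g"
  if f: "f \<in> schwartz" and g: "g \<in> schwartz" for f g
 proof -
  obtain Bf where Bf: "!!x \<xi>. norm (VG f x \<xi>) <= Bf" using VG_bdd[OF f] by blast
  obtain Bg where Bg: "!!x \<xi>. norm (VG g x \<xi>) <= Bg" using VG_bdd[OF g] by blast
  have nn: "0 <= peetre_pair \<tau> N (VG f) (VG g) z \<zeta>" for z \<zeta>
   using peetre_nonneg[of "VG f", OF Bf] peetre_nonneg[of "VG g", OF Bg] by (simp add: peetre_pair_def)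
  have m0: "0 <= m' \<zeta>" for \<zeta> by (rule moderateD(1)[OF m])
  define F where "F = (%z \<zeta>. ennreal (peetre_pair \<tau> N (VG f) (VG g) z \<zeta> * m' \<zeta>))"
  note [measurable] = peetre_pair_measurable[of "VG f" Bf "VG g" Bg, OF Bf Bg] moderate_measurable[OF m]
  have F: "(%(x, y). F x y) \<in> borel_measurable (borel \<Otimes>\<^sub>M borel)" unfolding F_def by measurable
  have osc: "F z \<zeta> <= ennreal c * F z' \<zeta>'" if d: "norm (z - z') <= D1" "norm (\<zeta> - \<zeta>') <= D2" for z z' \<zeta> \<zeta>'
  proof -
   have "m' \<zeta> <= (1 + norm (\<zeta>' - \<zeta>)) ^ L * m' \<zeta>'" by (rule moderateD(2)[OF m])
   also have "... <= (1 + D2) ^ L * m' \<zeta>'" using d m0 by (intro mult_right_mono power_mono) (auto simp: norm_minus_commute)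
   finally have "peetre_pair \<tau> N (VG f) (VG g) z \<zeta> * m' \<zeta> <=
    (((1 + D) ^ N * (1 + D) ^ N) ^ 2 * peetre_pair \<tau> N (VG f) (VG g) z' \<zeta>') * ((1 + D2) ^ L * m' \<zeta>')"
    using peetre_pair_osc[of \<tau> "VG f" Bf "VG g" Bg, OF \<tau> Bf Bg d] nn m0 unfolding D_def by (intro mult_mono) auto
   also have "... = c * (peetre_pair \<tau> N (VG f) (VG g) z' \<zeta>' * m' \<zeta>')" by (simp add: c_def)
   finally show ?thesis unfolding F_def using c nn m0 by (subst ennreal_mult'[symmetric]) (auto intro!: ennreal_leI)
  qed
  have Qeq: "Q (%w. ennreal (S1 f w)) (%w. ennreal (S2 g w)) = lp q (%j. lp p (%i. F (\<nu>1 j i) (\<nu>2 j)))"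
   unfolding Q_def bilin_norm_def S1_def S2_def F_def peetre_pair_def AB
   using peetre_nonneg[of "VG f", OF Bf] peetre_nonneg[of "VG g", OF Bg] m0 p
   by (simp add: ennreal_mult' lp_multc[symmetric])
  have Peq: "P f g = mixed_norm p q lborel lborel F" by (simp add: P_def pair_norm_def F_def)
  have E: "P f g <= \<kappa> * (ennreal c)\<^sup>2 * Q (%w. ennreal (S1 f w)) (%w. ennreal (S2 g w))"
   "\<kappa> * Q (%w. ennreal (S1 f w)) (%w. ennreal (S2 g w)) <= (ennreal c)\<^sup>2 * P f g"
   unfolding Qeq Peq \<kappa>_def by (rule sampling_mixed_norm[OF \<nu> p(5,6) F osc]; assumption)+
  have kc: "\<kappa> * ennreal c ^ 2 = ennreal (k * c\<^sup>2)" using k c by (simp add: ennreal_power ennreal_mult'[symmetric])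
  show "P f g <= ennreal (k * c\<^sup>2) * Q (%w. ennreal (S1 f w)) (%w. ennreal (S2 g w))" unfolding kc[symmetric] by (rule E(1))
  let ?Q = "Q (%w. ennreal (S1 f w)) (%w. ennreal (S2 g w))"
  have "?Q = ennreal (1 / k) * (\<kappa> * ?Q)" using k by (simp add: mult.assoc[symmetric] ennreal_mult'[symmetric])
  also have "... <= ennreal (1 / k) * (ennreal c ^ 2 * P f g)" by (rule mult_left_mono[OF E(2)]) (assumption | rule zero_le)+
  also have "... = ennreal (c\<^sup>2 / k) * P f g" using k c by (simp add: ennreal_power mult.assoc[symmetric] ennreal_mult'[symmetric])
  finally show "?Q <= ennreal (c\<^sup>2 / k) * P f g" .
 qed
 have pos: "0 < k * c\<^sup>2" "0 < c\<^sup>2 / k" using k c by auto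
 have cont: "?L \<longleftrightarrow> (\<exists>C>0. \<forall>f\<in>schwartz. \<forall>g\<in>schwartz. P f g <= ennreal C * X1 f * X2 g)"
  unfolding P_def X1_def X2_def N_def by (rule wig[OF N(1)])
 have id: "\<exists>C>0. \<forall>f\<in>schwartz. X f <= ennreal C * X f" for X :: "(real^'d => complex) => ennreal"
  by (intro exI[of _ 1]) auto
 have nn: "0 <= \<omega>1' x" "0 <= \<omega>2' x" for x using w(1,3) moderateD(1) unfolding weight_equiv_def by blast+
 note d = w[THEN weight_equiv_wdom, THEN conjunct1] and d' = w[THEN weight_equiv_wdom, THEN conjunct2]
 have "?L \<longleftrightarrow> (\<exists>C>0. \<forall>a\<in>UNIV. \<forall>b\<in>UNIV. Q a b <= ennreal C * Y1 a * Y2 b)"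
 proof
  assume "\<exists>C>0. \<forall>a\<in>UNIV. \<forall>b\<in>UNIV. Q a b <= ennreal C * Y1 a * Y2 b"
  then have "\<exists>C>0. \<forall>f\<in>schwartz. \<forall>g\<in>schwartz. Q (%w. ennreal (S1 f w)) (%w. ennreal (S2 g w))
   <= ennreal C * Y1 (%w. ennreal (S1 f w)) * Y2 (%w. ennreal (S2 g w))" by blast
  moreover have "\<exists>C>0. \<forall>f\<in>schwartz. \<forall>g\<in>schwartz. P f g <= ennreal C * Q (%w. ennreal (S1 f w)) (%w. ennreal (S2 g w))"
   using PQ(1) pos by blast
  ultimately show ?L unfolding cont by (rule bilinear_bound_transfer[OF _ _ s1 s2])
 next
  assume ?L
  moreover have "\<exists>C>0. \<forall>f\<in>schwartz. \<forall>g\<in>schwartz. Q (%w. ennreal (S1 f w)) (%w. ennreal (S2 g w)) <= ennreal C * P f g"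
   using PQ(2) pos by blast
  ultimately have "\<exists>C>0. \<forall>f\<in>schwartz. \<forall>g\<in>schwartz. Q (%w. ennreal (S1 f w)) (%w. ennreal (S2 g w)) <= ennreal C * X1 f * X2 g"
   unfolding cont by (rule bilinear_bound_transfer[OF _ _ id id])
  then obtain C where C: "0 < C" "!!f g. f \<in> schwartz ==> g \<in> schwartz ==>
   Q (%w. ennreal (S1 f w)) (%w. ennreal (S2 g w)) <= ennreal C * X1 f * X2 g" by blast
  obtain C1 where C1: "0 < C1" "!!a :: (int^'d) \<times> (int^'d) => real. finite {w. a w \<noteq> 0} ==> \<forall>w. 0 <= a w ==>
   \<exists>f\<in>schwartz. (\<forall>w. a w <= S1 f w) \<and> X1 f <= ennreal C1 * Y1 (%w. ennreal (a w))"
   using test1[OF N(2)] unfolding S1_def X1_def Y1_def by blast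
  obtain C2 where C2: "0 < C2" "!!a :: (int^'d) \<times> (int^'d) => real. finite {w. a w \<noteq> 0} ==> \<forall>w. 0 <= a w ==>
   \<exists>f\<in>schwartz. (\<forall>w. a w <= S2 f w) \<and> X2 f <= ennreal C2 * Y2 (%w. ennreal (a w))"
   using test2[OF N(3)] unfolding S2_def X2_def Y2_def by blast
  have "Q a b <= ennreal (C * C1 * C2) * Y1 a * Y2 b" for a b
   unfolding Q_def
  proof (rule bilin_norm_finite_approx[OF p(5,6)])
   show "Y1 a <= Y1 a'" if "!!i. a i <= a' i" for a a' unfolding Y1_def by (intro lat_norm_mono p that)
   show "Y2 a <= Y2 a'" if "!!i. a i <= a' i" for a a' unfolding Y2_def by (intro lat_norm_mono p that)
   fix a b :: "(int^'d) \<times> (int^'d) => real"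
   assume fin: "finite {i. a i \<noteq> 0}" "finite {i. b i \<noteq> 0}" and nn: "!!i. 0 <= a i" "!!j. 0 <= b j"
   obtain f where f: "f \<in> schwartz" "!!w. a w <= S1 f w" "X1 f <= ennreal C1 * Y1 (%w. ennreal (a w))" using C1(2)[of a] fin nn by blast
   obtain g where g: "g \<in> schwartz" "!!w. b w <= S2 g w" "X2 g <= ennreal C2 * Y2 (%w. ennreal (b w))" using C2(2)[of b] fin nn by blast
   have "bilin_norm p q A B (%w. m' (\<nu>2 w)) (%i. ennreal (a i)) (%j. ennreal (b j)) <= Q (%w. ennreal (S1 f w)) (%w. ennreal (S2 g w))"
    unfolding Q_def by (intro bilin_norm_mono p ennreal_leI f g)
   also have "... <= ennreal C * X1 f * X2 g" by (rule C(2)[OF f(1) g(1)])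
   also have "... <= ennreal C * (ennreal C1 * Y1 (%w. ennreal (a w))) * (ennreal C2 * Y2 (%w. ennreal (b w)))"
    by (intro mult_mono f g) auto
   also have "... = ennreal (C * C1 * C2) * Y1 (%w. ennreal (a w)) * Y2 (%w. ennreal (b w))"
    using C(1) C1(1) C2(1) by (simp add: ennreal_mult mult_ac)
   finally show "bilin_norm p q A B (%w. m' (\<nu>2 w)) (%i. ennreal (a i)) (%j. ennreal (b j))
    <= ennreal (C * C1 * C2) * Y1 (%i. ennreal (a i)) * Y2 (%j. ennreal (b j))" .
  qed
  moreover have "0 < C * C1 * C2" using C(1) C1(1) C2(1) by simp
  ultimately show "\<exists>C>0. \<forall>a\<in>UNIV. \<forall>b\<in>UNIV. Q a b <= ennreal C * Y1 a * Y2 b" by blast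
 qed
 then have "?L \<longleftrightarrow> bemb (seq_norm p1 q1 (%k. \<omega>1' (lpt \<alpha>1 k)) (%n. \<mu>1' (lpt \<beta>1 n)))
   (seq_norm p2 q2 (%k. \<omega>2' (lpt \<alpha>2 k)) (%n. \<mu>2' (lpt \<beta>2 n)))
   (bilin_norm p q A B (%w. m' (\<nu>2 w)))"
  unfolding bemb_def lat_norm_eq_seq_norm[where \<omega> = \<omega>1', OF p(1,2) nn(1), symmetric] lat_norm_eq_seq_norm[where \<omega> = \<omega>2', OF p(3,4) nn(2), symmetric]
  unfolding Q_def Y1_def Y2_def by simp
 \<comment> \<open>The regularized weights are exchanged for the given ones at the lattice
   points.\<close>
 also have "... \<longleftrightarrow> bemb (seq_norm p1 q1 (%k. \<omega>1 (lpt \<alpha>1 k)) (%n. \<mu>1 (lpt \<beta>1 n)))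
   (seq_norm p2 q2 (%k. \<omega>2 (lpt \<alpha>2 k)) (%n. \<mu>2 (lpt \<beta>2 n)))
   (bilin_norm p q A B (%w. m (\<nu>2 w)))"
  by (rule iffI) (erule bemb_wdom[OF p d'(1-4) d(5)] bemb_wdom[OF p d(1-4) d'(5)])+
 finally show ?thesis .
qed

lemma sampling_lattice_shift:
 assumes "0 < c"
 shows "sampling (c ^ CARD('d)) (c * CARD('d)) (%k :: int^'d. lpt c k + s)"
  and "sampling (c ^ CARD('d)) (c * CARD('d)) (%k :: int^'d. s - lpt c k)"
proof -
 show "sampling (c ^ CARD('d)) (c * CARD('d)) (%k :: int^'d. lpt c k + s)" for s
  by (rule sampling_shift[OF sampling_lattice[OF assms]])
 have "lattice_pt (- k) = - lattice_pt k" for k :: "int^'d" by (simp add: lattice_pt_def vec_eq_iff)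
 with sampling_bij[OF \<open>!!s. sampling (c ^ CARD('d)) (c * CARD('d)) (%k :: int^'d. lpt c k + s)\<close>, of uminus s] show "sampling (c ^ CARD('d)) (c * CARD('d)) (%k :: int^'d. s - lpt c k)"
  by (simp add: bij_uminus)
qed

text \<open>The first component of z is added to frequencies and the second to times, hence the
  exchanged indices.\<close>

lemma sampling_pair_swap:
 assumes "sampling v1 D1 f" "sampling v2 D2 g"
 shows "sampling (v1 * v2) (D1 + D2) (%v. (f (snd v), g (fst v)))"
 using sampling_bij[OF sampling_pair[OF assms] bij_swap] by (simp add: split_beta)

lemma lattice_pt_0 [simp]: "lattice_pt 0 = 0"
 by (simp add: lattice_pt_def vec_eq_iff)

lemma lp_norm_eq_wlp: "lp_norm p \<omega> = (%a. wlp p (%k. \<omega> (lattice_pt k)) (%i. ennreal (norm (a i))))"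
 by (simp add: fun_eq_iff lp_norm_def wlp_def ennreal_mult')

lemma embeds_lp_norm:
 fixes \<omega> \<kappa> :: "real^'d => real"
 assumes "0 < p" "0 < q" "!!k :: int^'d. 0 < \<kappa> (lattice_pt k)"
 shows "embeds (lp_norm p \<omega>) (lp_norm q \<kappa>) \<longleftrightarrow> emb (wlp p (%k. \<omega> (lattice_pt k))) (wlp q (%k. \<kappa> (lattice_pt k)))"
 unfolding lp_norm_eq_wlp
proof (rule embeds_iff_emb)
 show "a i * ennreal (\<omega> (lattice_pt i)) <= wlp p (%k. \<omega> (lattice_pt k)) a" for a i
  unfolding wlp_def by (rule lp_ge[OF assms(1), of "%i. a i * ennreal (\<omega> (lattice_pt i))"])
 show "wlp p (%k. \<omega> (lattice_pt k)) (indicator {i}) = ennreal (\<omega> (lattice_pt i))" for i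
  by (rule wlp_delta[OF assms(1)])
 show "0 < wlp q (%k. \<kappa> (lattice_pt k)) (indicator {i})" for i
  unfolding wlp_delta[OF assms(2)] using assms(3) by simp
qed

lemma embeds_lpq_norm:
 fixes \<omega> \<mu> \<kappa> :: "real^'d => real"
 assumes p: "0 < p1" "0 < q1" "0 < p" "0 < q" and \<kappa>: "!!k :: int^'d. 0 < \<kappa> (lattice_pt k)" and nn: "!!x. 0 <= \<omega> x"
 shows "embeds (lpq_norm p1 q1 (tensor \<omega> \<mu>)) (lpq_norm_rev q p (tensor \<kappa> (%_. 1))) \<longleftrightarrow>
  emb (seq_norm p1 q1 (%k. \<omega> (lattice_pt k)) (%n. \<mu> (lattice_pt n)))
   (%a. lp q (%i. lp p (%n. a (i, n)) * ennreal (\<kappa> (lattice_pt i))))"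
proof -
 have X: "lpq_norm p1 q1 (tensor \<omega> \<mu>) = (%a. seq_norm p1 q1 (%k. \<omega> (lattice_pt k)) (%n. \<mu> (lattice_pt n)) (%i. ennreal (norm (a i))))"
  using p nn by (simp add: fun_eq_iff lpq_norm_def tensor_def mixed_norm_def seq_norm_def wlp_def ennreal_mult' lp_multc mult.assoc[symmetric])
 have Z: "lpq_norm_rev q p (tensor \<kappa> (%_. 1)) = (%a. (%a. lp q (%i. lp p (%n. a (i, n)) * ennreal (\<kappa> (lattice_pt i)))) (%i. ennreal (norm (a i))))"
  using p by (simp add: fun_eq_iff lpq_norm_rev_def tensor_def mixed_norm_def ennreal_mult' lp_multc)
 show ?thesis
  unfolding X Z
 proof (rule embeds_iff_emb)
  let ?u = "%k :: int^'d. ennreal (\<omega> (lattice_pt k))" and ?v = "%n :: int^'d. ennreal (\<mu> (lattice_pt n))"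
  fix a and w :: "(int^'d) \<times> (int^'d)"
  have "a (fst w, snd w) * ?u (fst w) * ?v (snd w) <= wlp p1 (%k. \<omega> (lattice_pt k)) (%k. a (k, snd w)) * ?v (snd w)"
   unfolding wlp_def using lp_ge[OF p(1), of "%k. a (k, snd w) * ?u k" "fst w"] by (intro mult_right_mono) auto
  also have "... <= seq_norm p1 q1 (%k. \<omega> (lattice_pt k)) (%n. \<mu> (lattice_pt n)) a"
   unfolding seq_norm_def wlp_def[of q1] by (rule lp_ge[OF p(2), of "%n. wlp p1 (%k. \<omega> (lattice_pt k)) (%k. a (k, n)) * ?v n"])
  finally show "a w * (?u (fst w) * ?v (snd w)) <= seq_norm p1 q1 (%k. \<omega> (lattice_pt k)) (%n. \<mu> (lattice_pt n)) a"
   by (simp add: mult.assoc)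
  have ind: "(indicator {w} :: _ => ennreal) = (%v. indicator {fst w} (fst v) * indicator {snd w} (snd v))"
   by (auto simp: fun_eq_iff indicator_def prod_eq_iff)
  show "seq_norm p1 q1 (%k. \<omega> (lattice_pt k)) (%n. \<mu> (lattice_pt n)) (indicator {w}) = ?u (fst w) * ?v (snd w)"
   unfolding ind seq_norm_tensor[OF p(1,2)] wlp_delta[OF p(1)] wlp_delta[OF p(2)] ..
  have "0 < indicator {w} (fst w, snd w) * ennreal (\<kappa> (lattice_pt (fst w)))" using \<kappa> by simp
  also have "... <= lp p (%n. indicator {w} (fst w, n)) * ennreal (\<kappa> (lattice_pt (fst w)))"
   by (rule mult_right_mono[OF lp_ge[OF p(3), of "%n. indicator {w} (fst w, n)" "snd w"]]) simp
  also have "... <= lp q (%i. lp p (%n. indicator {w} (i, n)) * ennreal (\<kappa> (lattice_pt i)))"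
   by (rule lp_ge[OF p(4), of "%i. lp p (%n. indicator {w} (i, n)) * ennreal (\<kappa> (lattice_pt i))"])
  finally show "0 < lp q (%i. lp p (%n. indicator {w} (i, n)) * ennreal (\<kappa> (lattice_pt i)))" .
 qed
qed

text \<open>Powers of weights and divided exponents are returned to the form
  \<open>conv_norm p q\<close>, whose inner norm has exponent p.\<close>

lemma conv_embeds_lp_norm:
 fixes \<omega> \<omega>' \<kappa> :: "real^'d => real"
 assumes p: "0 < p1" "0 < p2" "0 < p" "0 < q" "p < \<infinity>" and \<kappa>: "!!k :: int^'d. 0 < \<kappa> (lattice_pt k)"
  and nn: "!!x. 0 <= \<omega> x" "!!x. 0 <= \<omega>' x"
 shows "conv_embeds (lp_norm (p1 / p) (weight_pow \<omega> p)) (lp_norm (p2 / p) (weight_pow \<omega>' p)) (lp_norm (q / p) (weight_pow \<kappa> p)) \<longleftrightarrow>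
  bemb (wlp p1 (%k. \<omega> (lattice_pt k))) (wlp p2 (%k. \<omega>' (lattice_pt k))) (conv_norm p q (%k. \<kappa> (lattice_pt k)))"
proof -
 obtain P where P: "p = ennreal P" "0 < P" using p by (cases p) auto
 have pos: "0 < r / p" if "0 < r" for r :: ennreal using that p(5) by (simp add: ennreal_zero_less_divide less_top)
 have weq: "weight_pow w p x = w x powr P" for w :: "real^'d => real" and x using P by (simp add: weight_pow_def)
 have c: "0 < weight_pow \<kappa> p (lattice_pt k)" for k :: "int^'d" using \<kappa>[of k] by (simp add: weight_pow_def)
 show ?thesis
  unfolding lp_norm_eq_wlp
  by (rule trans[OF conv_embeds_iff_bemb[OF pos[OF p(1)] pos[OF p(2)] pos[OF p(4)] c]], unfold weq, unfold P(1),
    rule bemb_conv_norm_powr[OF P(2) p(1,2,4) nn(1) nn(2) less_imp_le[OF \<kappa>], symmetric])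
qed

lemma bilin_norm_commute: "bilin_norm p q A B \<kappa> a b = bilin_norm p q B A \<kappa> b a"
 by (simp add: bilin_norm_def mult.commute)

lemma bemb_commute: "bemb X Y Z \<longleftrightarrow> bemb Y X (%b a. Z a b)"
proof -
 have "ennreal C * X a * Y b = ennreal C * Y b * X a" for C a b by (simp only: mult_ac)
 then show ?thesis unfolding bemb_def by metis
qed

text \<open>The moderate inequality bounds m y by a multiple of m x for all x and y, so a single
  zero would make the weight vanish identically.\<close>

lemma poly_weight_pos:
 assumes "poly_weight m" "m \<noteq> (%_. 0)" shows "0 < m x"
proof -
 obtain m' L C where m': "moderate L m'" "0 < C" "!!x. m x <= m' x" "!!x. m' x <= C * m x"
  by (rule poly_weight_moderate[OF assms(1)]) (rule that; assumption)
 have nn: "0 <= m x" for x using assms(1) by (simp add: poly_weight_def)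
 obtain y where "m y \<noteq> 0" using assms(2) by auto
 then have "0 < m' y" using nn[of y] m'(3)[of y] by linarith
 also have "m' y <= (1 + norm (x - y)) ^ L * m' x" by (rule moderateD(2)[OF m'(1)])
 also have "... <= (1 + norm (x - y)) ^ L * (C * m x)" by (intro mult_left_mono m') simp
 finally have "m x \<noteq> 0" by auto
 with nn[of x] show ?thesis by simp
qed

theorem theorem1p5:
  fixes p1 p2 q1 q2 p q :: ennreal
    and \<tau> :: real
    and m m' :: "(real^'d) \<times> (real^'d) \<Rightarrow> real"
    and \<omega>1 \<omega>2 \<mu>1 \<mu>2 \<omega>2' \<mu>2' m\<^sub>\<alpha> m\<^sub>\<beta> m'\<^sub>\<alpha> m'\<^sub>\<beta> :: "real^'d \<Rightarrow> real"
    and \<phi> :: "real^'d \<Rightarrow> complex"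
    and \<Phi> :: "(real^'d) \<times> (real^'d) \<Rightarrow> complex"
  assumes "\<phi> \<in> schwartz" "\<phi> \<noteq> (\<lambda>_. 0)" "\<Phi> \<in> schwartz" "\<Phi> \<noteq> (\<lambda>_. 0)"
    and "0 < p1" "0 < p2" "0 < q1" "0 < q2" "0 < p" "0 < q"
    and "0 \<le> \<tau>" "\<tau> \<le> 1"
    and "poly_weight m" "submultiplicative m" "m \<noteq> (\<lambda>_. 0)"
    and "poly_weight \<omega>1" "poly_weight \<omega>2" "poly_weight \<mu>1" "poly_weight \<mu>2"
    and "m' = (\<lambda>(z1, z2). m ((1 - \<tau>) *\<^sub>R z1, \<tau> *\<^sub>R z2))"
    and "\<omega>2' = (\<lambda>z. \<omega>2 (((1 - \<tau>) / \<tau>) *\<^sub>R z))"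
    and "\<mu>2' = (\<lambda>z. \<mu>2 ((\<tau> / (1 - \<tau>)) *\<^sub>R z))"
    and "m\<^sub>\<alpha> = (\<lambda>z. m (z, 0))" "m\<^sub>\<beta> = (\<lambda>z. m (0, z))"
    and "m'\<^sub>\<alpha> = (\<lambda>z. m' (z, 0))" "m'\<^sub>\<beta> = (\<lambda>z. m' (0, z))"
  shows
    "(0 < \<tau> \<and> \<tau> < 1 \<and> p < \<infinity> \<longrightarrow>
        (wigner_bounded \<phi> \<Phi> \<tau> p1 q1 (tensor \<omega>1 \<mu>1) p2 q2 (tensor \<omega>2 \<mu>2) p q m \<longleftrightarrow>
           conv_embeds (lp_norm (p1 / p) (weight_pow \<omega>1 p)) (lp_norm (p2 / p) (weight_pow \<omega>2' p))
             (lp_norm (q / p) (weight_pow m'\<^sub>\<alpha> p)) \<and>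
           conv_embeds (lp_norm (q1 / p) (weight_pow \<mu>1 p)) (lp_norm (q2 / p) (weight_pow \<mu>2' p))
             (lp_norm (q / p) (weight_pow m'\<^sub>\<beta> p)))) \<and>
     (0 < \<tau> \<and> \<tau> < 1 \<and> p \<ge> q \<longrightarrow>
        (wigner_bounded \<phi> \<Phi> \<tau> p1 q1 (tensor \<omega>1 \<mu>1) p2 q2 (tensor \<omega>2 \<mu>2) p q m \<longleftrightarrow>
           embeds (lp_norm p1 \<omega>1) (lp_norm q m'\<^sub>\<alpha>) \<and> embeds (lp_norm p2 \<omega>2') (lp_norm q m'\<^sub>\<alpha>) \<and>
           embeds (lp_norm q1 \<mu>1) (lp_norm q m'\<^sub>\<beta>) \<and> embeds (lp_norm q2 \<mu>2') (lp_norm q m'\<^sub>\<beta>))) \<and>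
     (\<tau> = 0 \<longrightarrow>
        (wigner_bounded \<phi> \<Phi> \<tau> p1 q1 (tensor \<omega>1 \<mu>1) p2 q2 (tensor \<omega>2 \<mu>2) p q m \<longleftrightarrow>
           embeds (lpq_norm p1 q1 (tensor \<omega>1 \<mu>1)) (lpq_norm_rev q p (tensor m\<^sub>\<alpha> (\<lambda>_. 1))) \<and>
           embeds (lp_norm p2 \<omega>2) (lp_norm p (\<lambda>_. 1)) \<and>
           embeds (lp_norm q2 \<mu>2) (lp_norm q m\<^sub>\<beta>))) \<and>
     (\<tau> = 1 \<longrightarrow>
        (wigner_bounded \<phi> \<Phi> \<tau> p1 q1 (tensor \<omega>1 \<mu>1) p2 q2 (tensor \<omega>2 \<mu>2) p q m \<longleftrightarrow>
           embeds (lpq_norm p2 q2 (tensor \<omega>2 \<mu>2)) (lpq_norm_rev q p (tensor m\<^sub>\<alpha> (\<lambda>_. 1))) \<and>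
           embeds (lp_norm p1 \<omega>1) (lp_norm p (\<lambda>_. 1)) \<and>
           embeds (lp_norm q1 \<mu>1) (lp_norm q m\<^sub>\<beta>)))"
proof -
 let ?W = "wigner_bounded \<phi> \<Phi> \<tau> p1 q1 (tensor \<omega>1 \<mu>1) p2 q2 (tensor \<omega>2 \<mu>2) p q m"
 note p = assms(5,7,6,8,9,10)
 note pw = assms(16,18,17,19,13)
 have nn: "0 <= \<omega>1 x" "0 <= \<omega>2 x" "0 <= \<mu>1 x" "0 <= \<mu>2 x" for x
  using assms(16-19) by (auto simp: poly_weight_def)
 have m: "0 < m z" for z by (rule poly_weight_pos[OF assms(13,15)])
 note m0 = less_imp_le[OF m]
 obtain K where sub: "!!z w. m (z + w) <= K * m z * m w" using assms(14) unfolding submultiplicative_def by blast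
 have "0 < K * m 0 * m 0" using sub[of 0 0] m[of 0] by simp
 then have K: "0 < K" using m[of 0] by (simp add: zero_less_mult_iff)
 have split: "m (x, y) <= K * (m (x, 0) * m (0, y))" for x y using sub[of "(x, 0)" "(0, y)"] by (simp add: mult.assoc)
 define D where "D = real CARD('d)"
 let ?pt = "lattice_pt :: int^'d => real^'d"
 note wb = wigner_bounded_iff_bemb[OF assms(1-4) p assms(11,12) pw]
 have wlp1: "embeds (lp_norm r \<omega>) (lp_norm p (%_. 1)) \<longleftrightarrow> emb (wlp r (%k. \<omega> (?pt k))) (wlp p (%_. 1))"
  if "0 < r" for r and \<omega> :: "real^'d => real"
  using embeds_lp_norm[OF that p(5), of "%_. 1" \<omega>] by simp
 have tau0: "?W \<longleftrightarrow>
     embeds (lpq_norm p1 q1 (tensor \<omega>1 \<mu>1)) (lpq_norm_rev q p (tensor m\<^sub>\<alpha> (%_. 1))) \<and>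
     embeds (lp_norm p2 \<omega>2) (lp_norm p (%_. 1)) \<and> embeds (lp_norm q2 \<mu>2) (lp_norm q m\<^sub>\<beta>)" if "\<tau> = 0"
 proof -
  \<comment> \<open>For \<tau> = 0 the points are (\<zeta>1, \<zeta>2 - z1) and (\<zeta>1 - z2,
    \<zeta>2); z is sampled so that the coordinates containing it run through the lattice
    independently of \<zeta>.\<close>
  let ?\<nu>1 = "%w v :: (int^'d) \<times> (int^'d). (?pt (snd w) - 1 *\<^sub>R ?pt (snd v), ?pt (fst w) - 1 *\<^sub>R ?pt (fst v))"
  let ?\<nu>2 = "%(i, j). (1 *\<^sub>R ?pt i, 1 *\<^sub>R ?pt j)"
  have "?W \<longleftrightarrow>
   bemb (seq_norm p1 q1 (%k. \<omega>1 (1 *\<^sub>R ?pt k)) (%n. \<mu>1 (1 *\<^sub>R ?pt n))) (seq_norm p2 q2 (%k. \<omega>2 (1 *\<^sub>R ?pt k)) (%n. \<mu>2 (1 *\<^sub>R ?pt n)))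
    (bilin_norm p q (%w v. (fst w, snd v)) (%w v. (fst v, snd w)) (%w. m (?\<nu>2 w)))"
   by (rule wb[where ?\<nu>1.0 = ?\<nu>1, OF _ _ _ _ sampling_pair_swap[OF sampling_lattice_shift(2) sampling_lattice_shift(2)] sampling_pair[OF sampling_lattice sampling_lattice]])
    (auto simp: that)
  also have "... \<longleftrightarrow> emb (seq_norm p1 q1 (%k. \<omega>1 (?pt k)) (%n. \<mu>1 (?pt n))) (%a. lp q (%i. lp p (%n. a (i, n)) * ennreal (m (?pt i, 0)))) \<and>
   emb (wlp p2 (%k. \<omega>2 (?pt k))) (wlp p (%_. 1)) \<and> emb (wlp q2 (%n. \<mu>2 (?pt n))) (wlp q (%j. m (0, ?pt j)))"
   by (subst bilin_norm_endpoint[OF p, where K = K]) (use split K m m0 in auto)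
  finally show ?thesis
   unfolding assms(23,24) by (simp add: wlp1 p embeds_lpq_norm embeds_lp_norm m nn)
 qed
 have tau1: "?W \<longleftrightarrow>
     embeds (lpq_norm p2 q2 (tensor \<omega>2 \<mu>2)) (lpq_norm_rev q p (tensor m\<^sub>\<alpha> (%_. 1))) \<and>
     embeds (lp_norm p1 \<omega>1) (lp_norm p (%_. 1)) \<and> embeds (lp_norm q1 \<mu>1) (lp_norm q m\<^sub>\<beta>)" if "\<tau> = 1"
 proof -
  \<comment> \<open>For \<tau> = 1 the points are (\<zeta>1 + z2, \<zeta>2) and (\<zeta>1, \<zeta>2
    + z1); f and g exchange their roles, which \<open>bemb_commute\<close> undoes.\<close>
  let ?\<nu>1 = "%w v :: (int^'d) \<times> (int^'d). (1 *\<^sub>R ?pt (snd v) + - ?pt (snd w), 1 *\<^sub>R ?pt (fst v) + - ?pt (fst w))"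
  let ?\<nu>2 = "%(i, j). (1 *\<^sub>R ?pt i, 1 *\<^sub>R ?pt j)"
  have "?W \<longleftrightarrow>
   bemb (seq_norm p1 q1 (%k. \<omega>1 (1 *\<^sub>R ?pt k)) (%n. \<mu>1 (1 *\<^sub>R ?pt n))) (seq_norm p2 q2 (%k. \<omega>2 (1 *\<^sub>R ?pt k)) (%n. \<mu>2 (1 *\<^sub>R ?pt n)))
    (bilin_norm p q (%w v. (fst v, snd w)) (%w v. (fst w, snd v)) (%w. m (?\<nu>2 w)))"
   by (rule wb[where ?\<nu>1.0 = ?\<nu>1, OF _ _ _ _ sampling_pair_swap[OF sampling_lattice_shift(1) sampling_lattice_shift(1)] sampling_pair[OF sampling_lattice sampling_lattice]])
    (auto simp: that)
  also have "... \<longleftrightarrow> bemb (seq_norm p2 q2 (%k. \<omega>2 (?pt k)) (%n. \<mu>2 (?pt n))) (seq_norm p1 q1 (%k. \<omega>1 (?pt k)) (%n. \<mu>1 (?pt n)))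
    (bilin_norm p q (%w v. (fst w, snd v)) (%w v. (fst v, snd w)) (%w. m (?\<nu>2 w)))"
   by (subst bemb_commute, subst bilin_norm_commute) simp
  also have "... \<longleftrightarrow> emb (seq_norm p2 q2 (%k. \<omega>2 (?pt k)) (%n. \<mu>2 (?pt n))) (%a. lp q (%i. lp p (%n. a (i, n)) * ennreal (m (?pt i, 0)))) \<and>
   emb (wlp p1 (%k. \<omega>1 (?pt k))) (wlp p (%_. 1)) \<and> emb (wlp q1 (%n. \<mu>1 (?pt n))) (wlp q (%j. m (0, ?pt j)))"
   by (subst bilin_norm_endpoint[OF p(3,4,1,2,5,6), where K = K]) (use split K m m0 in auto)
  finally show ?thesis
   unfolding assms(23,24) by (simp add: wlp1 p embeds_lpq_norm embeds_lp_norm m nn)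
 qed
 have tau: "?W \<longleftrightarrow>
   bemb (wlp p1 (%k. \<omega>1 (?pt k))) (wlp p2 (%k. \<omega>2' (?pt k))) (conv_norm p q (%k. m'\<^sub>\<alpha> (?pt k))) \<and>
   bemb (wlp q1 (%k. \<mu>1 (?pt k))) (wlp q2 (%k. \<mu>2' (?pt k))) (conv_norm p q (%k. m'\<^sub>\<beta> (?pt k)))" (is "?L \<longleftrightarrow> ?D1 \<and> ?D2")
  and tau': "q <= p ==> ?W \<longleftrightarrow>
   emb (wlp p1 (%k. \<omega>1 (?pt k))) (wlp q (%k. m'\<^sub>\<alpha> (?pt k))) \<and> emb (wlp p2 (%k. \<omega>2' (?pt k))) (wlp q (%k. m'\<^sub>\<alpha> (?pt k))) \<and>
   emb (wlp q1 (%k. \<mu>1 (?pt k))) (wlp q (%k. m'\<^sub>\<beta> (?pt k))) \<and> emb (wlp q2 (%k. \<mu>2' (?pt k))) (wlp q (%k. m'\<^sub>\<beta> (?pt k)))"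
   (is "_ ==> _ \<longleftrightarrow> ?E")
  if \<tau>: "0 < \<tau>" "\<tau> < 1"
 proof -
  \<comment> \<open>Chosen so that the point belonging to f is the integer point v. The one
    belonging to g is then w - v with components scaled by (1 - \<tau>) / \<tau> and \<tau> / (1 -
    \<tau>), and \<zeta> is sampled where \<open>m\<close> takes the values of \<open>m'\<close> at
    w.\<close>
  let ?\<nu>1 = "%w v :: (int^'d) \<times> (int^'d). ((\<tau> / (1 - \<tau>)) *\<^sub>R ?pt (snd w) - (1 / (1 - \<tau>)) *\<^sub>R ?pt (snd v),
   (1 / \<tau>) *\<^sub>R ?pt (fst v) + (- ((1 - \<tau>) / \<tau>) *\<^sub>R ?pt (fst w)))"
  let ?\<nu>2 = "%(i, j). ((1 - \<tau>) *\<^sub>R ?pt i, \<tau> *\<^sub>R ?pt j)"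
  let ?\<kappa> = "%w. m ((1 - \<tau>) *\<^sub>R ?pt (fst w), \<tau> *\<^sub>R ?pt (snd w))"
  let ?S = "bemb (seq_norm p1 q1 (%k. \<omega>1 (?pt k)) (%n. \<mu>1 (?pt n))) (seq_norm p2 q2 (%k. \<omega>2' (?pt k)) (%n. \<mu>2' (?pt n))) (conv_norm p q ?\<kappa>)"
  have "?L \<longleftrightarrow> bemb (seq_norm p1 q1 (%k. \<omega>1 (1 *\<^sub>R ?pt k)) (%n. \<mu>1 (1 *\<^sub>R ?pt n)))
   (seq_norm p2 q2 (%k. \<omega>2 (((1 - \<tau>) / \<tau>) *\<^sub>R ?pt k)) (%n. \<mu>2 ((\<tau> / (1 - \<tau>)) *\<^sub>R ?pt n)))
    (bilin_norm p q (%w v. v) (%w v. w - v) (%w. m (?\<nu>2 w)))"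
   by (rule wb[where ?\<nu>1.0 = ?\<nu>1, OF _ _ _ _ sampling_pair_swap[OF sampling_lattice_shift(2) sampling_lattice_shift(1)] sampling_pair[OF sampling_lattice sampling_lattice]])
    (use \<tau> in \<open>auto simp: vec_eq_iff lattice_pt_diff field_simps\<close>)
  also have "... \<longleftrightarrow> ?S" by (simp add: assms(21,22) split_beta)
  finally have LS: "?L \<longleftrightarrow> ?S" .
  have \<alpha>: "?\<kappa> (i, 0) = m'\<^sub>\<alpha> (?pt i)" and \<beta>: "?\<kappa> (0, j) = m'\<^sub>\<beta> (?pt j)" for i j by (simp_all add: assms(20,25,26))
  have S1: "?D1 \<and> ?D2" if ?S using conv_norm_restrict[OF p that] unfolding \<alpha> \<beta> by blast
  have mpos: "0 <= m'\<^sub>\<alpha> x" "0 <= m'\<^sub>\<beta> x" for x using m0 by (auto simp: assms(20,25,26))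
  have spl: "?\<kappa> (i, j) <= K * (m'\<^sub>\<alpha> (?pt i) * m'\<^sub>\<beta> (?pt j))" for i j using split by (simp add: assms(20,25,26))
  have D_E: ?E if "?D1 \<and> ?D2"
   using conv_norm_delta[OF p(1,3,5,6) conjunct1[OF that]] conv_norm_delta[OF p(2,4,5,6) conjunct2[OF that]] by blast
  \<comment> \<open>One factor K comes from submultiplicativity at v and w - v, two more from
    splitting each of these weights into its components.\<close>
  have E_S: "?S" if "q <= p" ?E
  proof (rule conv_norm_emb[OF p(1-4,6) that(1), where K = "K * K * K" and ?\<kappa>1.0 = "%k. m'\<^sub>\<alpha> (?pt k)" and ?\<kappa>2.0 = "%k. m'\<^sub>\<beta> (?pt k)"])
   fix w v :: "(int^'d) \<times> (int^'d)"
   have "?\<kappa> w <= K * ?\<kappa> v * ?\<kappa> (w - v)"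
    using sub[of "((1 - \<tau>) *\<^sub>R ?pt (fst v), \<tau> *\<^sub>R ?pt (snd v))" "((1 - \<tau>) *\<^sub>R ?pt (fst (w - v)), \<tau> *\<^sub>R ?pt (snd (w - v)))"]
    by (simp add: lattice_pt_diff algebra_simps)
   also have "... <= K * (K * (m'\<^sub>\<alpha> (?pt (fst v)) * m'\<^sub>\<beta> (?pt (snd v)))) * (K * (m'\<^sub>\<alpha> (?pt (fst (w - v))) * m'\<^sub>\<beta> (?pt (snd (w - v)))))"
    using spl[of "fst v" "snd v"] spl[of "fst (w - v)" "snd (w - v)"] K m0 mpos by (intro mult_mono mult_left_mono) auto
   finally show "?\<kappa> w <= K * K * K * (m'\<^sub>\<alpha> (?pt (fst v)) * m'\<^sub>\<beta> (?pt (snd v)) * (m'\<^sub>\<alpha> (?pt (fst (w - v))) * m'\<^sub>\<beta> (?pt (snd (w - v)))))"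
    by (simp only: mult_ac)
  qed (use that K mpos in auto)
  \<comment> \<open>If p <= q, Minkowski's inequality recombines the two convolution inequalities.
    Otherwise deltas reduce them to the inclusions, which suffice because q <= p.\<close>
  show "?L \<longleftrightarrow> ?D1 \<and> ?D2"
  proof (cases "p <= q")
   case True
   have "?S" if "?D1" "?D2"
    by (rule conv_norm_tensor[OF p(1-5) True spl _ _ _ that]) (use K mpos in auto)
   then show ?thesis using LS S1 by blast
  next
   case False
   then show ?thesis using LS S1 D_E E_S by (meson nle_le)
  qed
  show "?L \<longleftrightarrow> ?E" if "q <= p" using LS S1 D_E E_S[OF that] by blast
 qed
 have m'pos: "0 < m'\<^sub>\<alpha> x" "0 < m'\<^sub>\<beta> x" for x using m by (auto simp: assms(20,25,26))
 have nn': "0 <= \<omega>2' x" "0 <= \<mu>2' x" for x using nn by (auto simp: assms(21,22))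
 show ?thesis
  using tau0 tau1 tau tau' by (simp add: conv_embeds_lp_norm embeds_lp_norm p nn nn' m'pos)
qed

end
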